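(* There exist subgroups of diagram groups that are not diagram groups themselves. For instance, the one-relator group $$\langle x,y\mid xy^2x=yx^2y\rangle$$ is isomorphic to a subgroup of a diagram group, but it is not a diagram group itself.
   Context: Diagram groups. A semigroup presentation $\mathcal{P}=\langle\Sigma\mid\mathcal{R}\rangle$ consists of an alphabet $\Sigma$ and a set $\mathcal{R}$ of pairs $(u,v)$ of non-empty words over $\Sigma$, written $u=v$; presentations are assumed anti-symmetric: if $(u=v)\in\mathcal{R}$ then $(v=u)\notin\mathcal{R}$. $\Sigma^+$ and $\Sigma^*$ are the free semigroup and free monoid on $\Sigma$. The graph $\Gamma(\mathcal{P})$ has vertex set $\Sigma^+$ and an edge $(p,u\to v,q)$ from $puq$ to $pvq$ for all $p,q\in\Sigma^*$ and all $u,v$ with $(u=v)\in\mathcal{R}$ or $(v=u)\in\mathcal{R}$; the inverse edge is $(p,v\to u,q)$. The Squier complex $\mathcal{K}(\mathcal{P})$ is the 2-complex obtained from $\Gamma(\mathcal{P})$ by attaching, for all $p,z,q\in\Sigma^*$ and $(\ell_1=r_1),(\ell_2=r_2)\in\mathcal{R}$, a 2-cell along the closed path $p_1p_2^{-1}$, where $p_1=(p,\ell_1\to r_1,z\ell_2q)(pr_1z,\ell_2\to r_2,q)$ and $p_2=(p\ell_1z,\ell_2\to r_2,q)(p,\ell_1\to r_1,zr_2q)$. For $w\in\Sigma^+$ the diagram group $\mathcal{D}(\mathcal{P},w)$ is (up to isomorphism, by Kilibarda's theorem; this may be taken as the definition) the fundamental group $\pi_1(\mathcal{K}(\mathcal{P}),w)$.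 A group is a diagram group if it is isomorphic to some $\mathcal{D}(\mathcal{P},w)$. *)

theory Defs
  imports "HOL-Algebra.Group"
begin

section \<open>Quotients of sets of words\<close>

text \<open>
  Both presented groups and edge-path groups are quotients of a set \<open>W\<close> of words, closed under
  concatenation, by the equivalence relation generated by replacing a factor \<open>l\<close> by \<open>r\<close> for
  \<open>(l, r)\<close> in a set \<open>S\<close> of rules. Every word along a chain of replacements has to lie in \<open>W\<close>;
  for edge paths this means that only closed edge paths at the base point occur.
\<close>

definition replace_step :: "'e list set \<Rightarrow> 'e list rel \<Rightarrow> 'e list \<Rightarrow> 'e list \<Rightarrow> bool" where
  "replace_step W S s t \<longleftrightarrow> s \<in> W \<and> t \<in> W \<and>
     (\<exists>a l r b. (l, r) \<in> S \<and> s = a @ l @ b \<and> t = a @ r @ b)"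

definition word_cong :: "'e list set \<Rightarrow> 'e list rel \<Rightarrow> 'e list rel" where
  "word_cong W S = {(s, t). s \<in> W \<and> t \<in> W \<and> equivclp (replace_step W S) s t}"

definition word_group :: "'e list set \<Rightarrow> 'e list rel \<Rightarrow> 'e list set monoid" where
  "word_group W S =
    \<lparr>carrier = W // word_cong W S,
     mult = (\<lambda>A B. \<Union>s\<in>A. \<Union>t\<in>B. word_cong W S `` {s @ t}),
     one = word_cong W S `` {[]}\<rparr>"

lemma equiv_word_cong: "equiv W (word_cong W S)"
  by (rule equivI)
    (auto simp: word_cong_def refl_on_def sym_def trans_def
      intro: equivclp_sym equivclp_trans)

lemma replace_step_word_cong:
  assumes "(l, r) \<in> S" "a @ l @ b \<in> W" "(a @ r @ b, u) \<in> word_cong W S"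
  shows "(a @ l @ b, u) \<in> word_cong W S"
proof -
  have "replace_step W S (a @ l @ b) (a @ r @ b)"
    using assms unfolding replace_step_def word_cong_def by blast
  then have "equivclp (replace_step W S) (a @ l @ b) (a @ r @ b)"
    by (rule r_into_equivclp)
  moreover have "equivclp (replace_step W S) (a @ r @ b) u" "u \<in> W"
    using assms(3) by (simp_all add: word_cong_def)
  ultimately show ?thesis
    using assms(2) equivclp_trans by (auto simp: word_cong_def)
qed

lemma replace_step_context:
  assumes W: "\<And>s t. s \<in> W \<Longrightarrow> t \<in> W \<Longrightarrow> s @ t \<in> W"
    and "replace_step W S s t" "x \<in> W" "y \<in> W"
  shows "replace_step W S (x @ s @ y) (x @ t @ y)"
proof -
  obtain a l r b where "(l, r) \<in> S" "s = a @ l @ b" "t = a @ r @ b" "s \<in> W" "t \<in> W"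
    using assms(2) by (auto simp: replace_step_def)
  then have "(l, r) \<in> S \<and> x @ s @ y = (x @ a) @ l @ (b @ y) \<and> x @ t @ y = (x @ a) @ r @ (b @ y)"
    by simp
  moreover have "x @ s @ y \<in> W" "x @ t @ y \<in> W"
    using assms(3,4) \<open>s \<in> W\<close> \<open>t \<in> W\<close> W by blast+
  ultimately show ?thesis
    unfolding replace_step_def by blast
qed

lemma word_cong_context:
  assumes W: "\<And>s t. s \<in> W \<Longrightarrow> t \<in> W \<Longrightarrow> s @ t \<in> W"
    and st: "(s, t) \<in> word_cong W S" and xy: "x \<in> W" "y \<in> W"
  shows "(x @ s @ y, x @ t @ y) \<in> word_cong W S"
proof -
  have "equivclp (replace_step W S) s t" using st by (simp add: word_cong_def)
  then have "equivclp (replace_step W S) (x @ s @ y) (x @ t @ y)"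
  proof (induction rule: equivclp_induct)
    case base
    show ?case by simp
  next
    case (step u v)
    then have "equivclp (replace_step W S) (x @ u @ y) (x @ v @ y)"
      using replace_step_context[OF W _ xy] by blast
    with step.IH show ?case by (rule equivclp_trans)
  qed
  then show ?thesis using st xy W by (simp add: word_cong_def)
qed

lemma congruent2_word_cong:
  assumes W: "\<And>s t. s \<in> W \<Longrightarrow> t \<in> W \<Longrightarrow> s @ t \<in> W" and nil: "[] \<in> W"
  shows "congruent2 (word_cong W S) (word_cong W S) (\<lambda>s t. word_cong W S `` {s @ t})"
proof (rule congruent2I')
  fix s s' t t'
  assume s: "(s, s') \<in> word_cong W S" and t: "(t, t') \<in> word_cong W S"
  then have "(s @ t, s' @ t) \<in> word_cong W S" "(s' @ t, s' @ t') \<in> word_cong W S"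
    using word_cong_context[OF W s nil, of t] word_cong_context[OF W t _ nil, of s']
    by (auto simp: word_cong_def)
  then have "(s @ t, s' @ t') \<in> word_cong W S"
    using equiv_word_cong[of W S] by (meson equivE transE)
  then show "word_cong W S `` {s @ t} = word_cong W S `` {s' @ t'}"
    by (rule equiv_class_eq[OF equiv_word_cong])
qed

lemma word_group_mult:
  assumes W: "\<And>s t. s \<in> W \<Longrightarrow> t \<in> W \<Longrightarrow> s @ t \<in> W" and nil: "[] \<in> W"
    and "s \<in> W" "t \<in> W"
  shows "(word_cong W S `` {s}) \<otimes>\<^bsub>word_group W S\<^esub> (word_cong W S `` {t}) = word_cong W S `` {s @ t}"
  using UN_equiv_class2[OF equiv_word_cong equiv_word_cong congruent2_word_cong[OF W nil]] assms(3,4)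
  by (simp add: word_group_def)

lemma group_word_group:
  assumes W: "\<And>s t. s \<in> W \<Longrightarrow> t \<in> W \<Longrightarrow> s @ t \<in> W" and nil: "[] \<in> W"
    and inverse: "\<And>s. s \<in> W \<Longrightarrow> \<exists>t\<in>W. (t @ s, []) \<in> word_cong W S"
  shows "group (word_group W S)"
proof (rule groupI)
  note mult = word_group_mult[OF W nil]
  have carrier: "carrier (word_group W S) = W // word_cong W S"
    and one: "\<one>\<^bsub>word_group W S\<^esub> = word_cong W S `` {[]}"
    by (simp_all add: word_group_def)
  fix A B C
  show "\<one>\<^bsub>word_group W S\<^esub> \<in> carrier (word_group W S)"
    unfolding carrier one by (rule quotientI[OF nil])
  assume "A \<in> carrier (word_group W S)"
  then obtain a where a: "a \<in> W" "A = word_cong W S `` {a}"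
    unfolding carrier by (rule quotientE)
  show "\<one>\<^bsub>word_group W S\<^esub> \<otimes>\<^bsub>word_group W S\<^esub> A = A"
    using a nil by (simp add: one mult)
  obtain t where t: "t \<in> W" "(t @ a, []) \<in> word_cong W S"
    using inverse a by blast
  then have "word_cong W S `` {t} \<otimes>\<^bsub>word_group W S\<^esub> A = \<one>\<^bsub>word_group W S\<^esub>"
    using a by (simp add: one mult equiv_class_eq[OF equiv_word_cong])
  moreover have "word_cong W S `` {t} \<in> carrier (word_group W S)"
    unfolding carrier using t by (simp add: quotientI)
  ultimately show "\<exists>B\<in>carrier (word_group W S). B \<otimes>\<^bsub>word_group W S\<^esub> A = \<one>\<^bsub>word_group W S\<^esub>"
    by blast
  assume "B \<in> carrier (word_group W S)"
  then obtain b where b: "b \<in> W" "B = word_cong W S `` {b}"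
    unfolding carrier by (rule quotientE)
  show "A \<otimes>\<^bsub>word_group W S\<^esub> B \<in> carrier (word_group W S)"
    unfolding carrier using a b W by (simp add: mult quotientI)
  assume "C \<in> carrier (word_group W S)"
  then obtain c where c: "c \<in> W" "C = word_cong W S `` {c}"
    unfolding carrier by (rule quotientE)
  show "A \<otimes>\<^bsub>word_group W S\<^esub> B \<otimes>\<^bsub>word_group W S\<^esub> C = A \<otimes>\<^bsub>word_group W S\<^esub> (B \<otimes>\<^bsub>word_group W S\<^esub> C)"
    using a b c W by (simp add: mult)
qed


section \<open>Group presentations\<close>

text \<open>
  The letter \<open>(g, True)\<close> stands for the generator \<open>g\<close> and \<open>(g, False)\<close> for its inverse.
  A pair \<open>(u, v)\<close> in \<open>R\<close> is the relation \<open>u = v\<close>.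
\<close>

definition presented_group ::
    "'g set \<Rightarrow> ('g \<times> bool) list rel \<Rightarrow> ('g \<times> bool) list set monoid" where
  "presented_group X R =
     word_group (lists (X \<times> UNIV)) (R \<union> {([(g, b), (g, \<not> b)], []) | g b. g \<in> X})"

lemma group_presented_group: "group (presented_group X R)"
proof -
  define W where "W = lists (X \<times> (UNIV :: bool set))"
  define S where "S = R \<union> {([(g, b), (g, \<not> b)], []) | g b. g \<in> X}"
  have S: "([(g, \<not> b), (g, b)], []) \<in> S" if "g \<in> X" for g b
    using that unfolding S_def by force
  have append: "s @ t \<in> W" if "s \<in> W" "t \<in> W" for s t
    using that by (simp add: W_def)
  have nil: "[] \<in> W" by (simp add: W_def)
  have letter: "[(g, b)] \<in> W" if "g \<in> X" for g b
    using that by (simp add: W_def)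
  have "\<exists>t\<in>W. (t @ s, []) \<in> word_cong W S" if "s \<in> W" for s
    using that
  proof (induction s)
    case Nil
    show ?case by (rule bexI[OF _ nil]) (simp add: word_cong_def nil)
  next
    case (Cons gb s)
    obtain g b where gb: "gb = (g, b)" by fastforce
    have g: "g \<in> X" and s: "s \<in> W" using Cons.prems by (simp_all add: W_def gb)
    obtain t where t: "t \<in> W" "(t @ s, []) \<in> word_cong W S" using Cons.IH[OF s] by blast
    have t': "t @ [(g, \<not> b)] \<in> W" using t(1) letter[OF g] by (rule append)
    have "t @ [(g, \<not> b), (g, b)] @ s \<in> W" using append[OF t' Cons.prems] by (simp add: gb)
    from replace_step_word_cong[OF S[OF g] this] t(2)
    have "((t @ [(g, \<not> b)]) @ gb # s, []) \<in> word_cong W S" by (simp add: gb)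
    then show ?case using t' by (rule bexI)
  qed
  with append nil have "group (word_group W S)" by (rule group_word_group)
  then show ?thesis by (simp add: presented_group_def W_def S_def)
qed

datatype gen = X | Y

text \<open>The group \<open>\<langle>x, y | x y\<^sup>2 x = y x\<^sup>2 y\<rangle>\<close>.\<close>

definition xyyx_group :: "(gen \<times> bool) list set monoid" where
  "xyyx_group = presented_group {X, Y}
     {([(X, True), (Y, True), (Y, True), (X, True)], [(Y, True), (X, True), (X, True), (Y, True)])}"


section \<open>Fundamental groups of combinatorial 2-complexes\<close>

text \<open>
  Graphs are taken in the sense of Serre: every edge comes with an inverse edge. A 2-cell is given
  by the closed edge path along which it is attached.
\<close>

record ('v, 'e) complex2 =
  verts :: "'v set"
  edges :: "'e set"
  ini :: "'e \<Rightarrow> 'v"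
  ter :: "'e \<Rightarrow> 'v"
  inv_edge :: "'e \<Rightarrow> 'e"
  cells :: "'e list set"

fun edge_path :: "('v, 'e) complex2 \<Rightarrow> 'v \<Rightarrow> 'e list \<Rightarrow> 'v \<Rightarrow> bool" where
  "edge_path K a [] b \<longleftrightarrow> a \<in> verts K \<and> a = b"
| "edge_path K a (e # es) b \<longleftrightarrow> a \<in> verts K \<and> e \<in> edges K \<and> ini K e = a \<and> edge_path K (ter K e) es b"

locale two_complex =
  fixes K :: "('v, 'e) complex2"
  assumes ini_verts: "e \<in> edges K \<Longrightarrow> ini K e \<in> verts K"
    and inv_edges: "e \<in> edges K \<Longrightarrow> inv_edge K e \<in> edges K"
    and inv_inv: "e \<in> edges K \<Longrightarrow> inv_edge K (inv_edge K e) = e"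
    and inv_neq: "e \<in> edges K \<Longrightarrow> inv_edge K e \<noteq> e"
    and ini_inv: "e \<in> edges K \<Longrightarrow> ini K (inv_edge K e) = ter K e"
    and cells_closed: "c \<in> cells K \<Longrightarrow> \<exists>a. edge_path K a c a"

definition loops :: "('v, 'e) complex2 \<Rightarrow> 'v \<Rightarrow> 'e list set" where
  "loops K a = {s. edge_path K a s a}"

text \<open>
  Homotopy of closed edge paths is generated by inserting and deleting factors \<open>e e\<^sup>-\<^sup>1\<close> and
  boundary paths of 2-cells.
\<close>

definition fundamental_group :: "('v, 'e) complex2 \<Rightarrow> 'v \<Rightarrow> 'e list set monoid" where
  "fundamental_group K a =
     word_group (loops K a) ({([e, inv_edge K e], []) | e. e \<in> edges K} \<union> {(c, []) | c. c \<in> cells K})"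

lemma edge_path_append:
  "edge_path K a s b \<Longrightarrow> edge_path K b t c \<Longrightarrow> edge_path K a (s @ t) c"
  by (induction s arbitrary: a) auto

lemma (in two_complex) edge_path_inverse:
  "edge_path K a s b \<Longrightarrow> edge_path K b (rev (map (inv_edge K) s)) a"
proof (induction s arbitrary: a)
  case (Cons e s)
  then have e: "e \<in> edges K" "ini K e = a" and IH: "edge_path K b (rev (map (inv_edge K) s)) (ter K e)"
    by auto
  have "edge_path K (ter K e) [inv_edge K e] a"
    using e ini_verts[OF e(1)] inv_edges[OF e(1)] ini_verts[OF inv_edges[OF e(1)]]
      ini_inv[OF e(1)] ini_inv[OF inv_edges[OF e(1)]] inv_inv[OF e(1)] by simp
  from edge_path_append[OF IH this] show ?case by simp
qed simp

lemma (in two_complex) group_fundamental_group: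
  assumes "a \<in> verts K"
  shows "group (fundamental_group K a)"
proof -
  define S :: "'e list rel" where
    "S = {([e, inv_edge K e], []) | e. e \<in> edges K} \<union> {(c, []) | c. c \<in> cells K}"
  have S: "([inv_edge K e, e], []) \<in> S" if "e \<in> edges K" for e
  proof -
    have "([inv_edge K e, inv_edge K (inv_edge K e)], []) \<in> S"
      unfolding S_def using inv_edges[OF that] by (intro UnI1 CollectI exI[of _ "inv_edge K e"]) simp
    then show ?thesis by (simp add: inv_inv[OF that])
  qed
  have cancel: "(rev (map (inv_edge K) s) @ s, []) \<in> word_cong (loops K b) S"
    if "edge_path K c s b" "b \<in> verts K" for c b s
    using that
  proof (induction s arbitrary: c)
    case Nil
    then show ?case by (simp add: word_cong_def loops_def)
  next
    case (Cons e s)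
    then have e: "e \<in> edges K" "edge_path K (ter K e) s b" by auto
    have "rev (map (inv_edge K) s) @ [inv_edge K e, e] @ s \<in> loops K b"
      using edge_path_append[OF edge_path_inverse[OF Cons.prems(1)] Cons.prems(1)]
      by (simp add: loops_def)
    from replace_step_word_cong[OF S[OF e(1)] this] Cons.IH[OF e(2) Cons.prems(2)]
    show ?case by simp
  qed
  have "s @ t \<in> loops K a" if "s \<in> loops K a" "t \<in> loops K a" for s t
    using that edge_path_append[of K a s a t a] by (simp add: loops_def)
  moreover have "[] \<in> loops K a" using assms by (simp add: loops_def)
  moreover have "\<exists>t\<in>loops K a. (t @ s, []) \<in> word_cong (loops K a) S" if "s \<in> loops K a" for s
  proof (rule bexI)
    have s: "edge_path K a s a" using that by (simp add: loops_def)
    show "(rev (map (inv_edge K) s) @ s, []) \<in> word_cong (loops K a) S"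
      using cancel[OF s assms] .
    show "rev (map (inv_edge K) s) \<in> loops K a"
      using edge_path_inverse[OF s] by (simp add: loops_def)
  qed
  ultimately have "group (word_group (loops K a) S)" by (rule group_word_group)
  then show ?thesis by (simp add: fundamental_group_def S_def)
qed


section \<open>Diagram groups\<close>

definition nonempty_words :: "'a set \<Rightarrow> 'a list set" where
  "nonempty_words A = lists A - {[]}"

definition semigroup_presentation :: "'a set \<Rightarrow> 'a list rel \<Rightarrow> bool" where
  "semigroup_presentation A R \<longleftrightarrow>
     R \<subseteq> nonempty_words A \<times> nonempty_words A \<and> (\<forall>u v. (u, v) \<in> R \<longrightarrow> (v, u) \<notin> R)"

text \<open>The tuple \<open>(p, u, v, q)\<close> is the edge \<open>(p, u \<rightarrow> v, q)\<close> from \<open>puq\<close> to \<open>pvq\<close>.\<close>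

type_synonym 'a squier_edge = "'a list \<times> 'a list \<times> 'a list \<times> 'a list"

fun squier_inv :: "'a squier_edge \<Rightarrow> 'a squier_edge" where
  "squier_inv (p, u, v, q) = (p, v, u, q)"

definition squier_complex :: "'a set \<Rightarrow> 'a list rel \<Rightarrow> ('a list, 'a squier_edge) complex2" where
  "squier_complex A R =
    \<lparr>verts = nonempty_words A,
     edges = {(p, u, v, q). p \<in> lists A \<and> q \<in> lists A \<and> ((u, v) \<in> R \<or> (v, u) \<in> R)},
     ini = (\<lambda>(p, u, v, q). p @ u @ q),
     ter = (\<lambda>(p, u, v, q). p @ v @ q),
     inv_edge = squier_inv,
     cells = {[(p, l1, r1, z @ l2 @ q), (p @ r1 @ z, l2, r2, q)] @
              rev (map squier_inv [(p @ l1 @ z, l2, r2, q), (p, l1, r1, z @ r2 @ q)])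
              | p z q l1 r1 l2 r2.
                p \<in> lists A \<and> z \<in> lists A \<and> q \<in> lists A \<and> (l1, r1) \<in> R \<and> (l2, r2) \<in> R}\<rparr>"

definition diagram_group_of :: "'a set \<Rightarrow> 'a list rel \<Rightarrow> 'a list \<Rightarrow> 'a squier_edge list set monoid" where
  "diagram_group_of A R w = fundamental_group (squier_complex A R) w"

text \<open>
  Type quantification is not available in formulas, so the type from which alphabets are taken
  is a parameter. For countable groups the type \<open>nat\<close> is large enough.
\<close>

definition diagram_group :: "'a itself \<Rightarrow> ('g, 'm) monoid_scheme \<Rightarrow> bool" where
  "diagram_group (_ :: 'a itself) G \<longleftrightarrow> group G \<and>
     (\<exists>(A :: 'a set) R w. semigroup_presentation A R \<and> w \<in> nonempty_words A \<and> G \<cong> diagram_group_of A R w)"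

lemma two_complex_squier_complex:
  assumes "semigroup_presentation A R"
  shows "two_complex (squier_complex A R)"
proof
  have R: "u \<in> lists A" "u \<noteq> []" "v \<in> lists A" "v \<noteq> []" if "(u, v) \<in> R" for u v
    using assms that by (auto simp: semigroup_presentation_def nonempty_words_def)
  fix e
  assume e: "e \<in> edges (squier_complex A R)"
  then obtain p u v q where e_eq: "e = (p, u, v, q)" "p \<in> lists A" "q \<in> lists A" "(u, v) \<in> R \<or> (v, u) \<in> R"
    by (auto simp: squier_complex_def)
  show "ini (squier_complex A R) e \<in> verts (squier_complex A R)"
    using e_eq R[of u v] R[of v u]
    by (auto simp: squier_complex_def nonempty_words_def)
  show "inv_edge (squier_complex A R) e \<in> edges (squier_complex A R)"
    "inv_edge (squier_complex A R) (inv_edge (squier_complex A R) e) = e"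
    "ini (squier_complex A R) (inv_edge (squier_complex A R) e) = ter (squier_complex A R) e"
    using e_eq by (auto simp: squier_complex_def)
  show "inv_edge (squier_complex A R) e \<noteq> e"
    using e_eq assms by (auto simp: squier_complex_def semigroup_presentation_def)
next
  have R: "u \<in> lists A" "u \<noteq> []" "v \<in> lists A" "v \<noteq> []" if "(u, v) \<in> R" for u v
    using assms that by (auto simp: semigroup_presentation_def nonempty_words_def)
  fix c
  assume "c \<in> cells (squier_complex A R)"
  then obtain p z q l1 r1 l2 r2 where c: "c = [(p, l1, r1, z @ l2 @ q), (p @ r1 @ z, l2, r2, q)] @
      rev (map squier_inv [(p @ l1 @ z, l2, r2, q), (p, l1, r1, z @ r2 @ q)])"
    and mem: "p \<in> lists A" "z \<in> lists A" "q \<in> lists A" "(l1, r1) \<in> R" "(l2, r2) \<in> R"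
    by (simp only: squier_complex_def complex2.simps mem_Collect_eq) blast
  have "edge_path (squier_complex A R) (p @ l1 @ z @ l2 @ q) c (p @ l1 @ z @ l2 @ q)"
    unfolding c using mem R[OF mem(4)] R[OF mem(5)]
    by (simp add: squier_complex_def nonempty_words_def)
  then show "\<exists>a. edge_path (squier_complex A R) a c a" by blast
qed

lemma group_diagram_group_of:
  assumes "semigroup_presentation A R" "w \<in> nonempty_words A"
  shows "group (diagram_group_of A R w)"
  unfolding diagram_group_of_def
  by (rule two_complex.group_fundamental_group[OF two_complex_squier_complex[OF assms(1)]])
    (use assms(2) in \<open>simp add: squier_complex_def\<close>)

end

(* Homotopy classes of edge paths over a presentation have unique normal forms, since deletion of
   inverse pairs together with moving the left one of two independent edges to the front is a
   confluent terminating system. The edges with empty left context give a tree on which the diagram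
   group acts. Making a diagram g minimal in its conjugacy class shows that the centralizer of
   g is U(g) C(g), where C(g) contains g, U(g) consists of diagrams on a factor to the left of
   that factor on which g acts, and the elements of C(g) that are elliptic on the tree contain all
   commutators of C(g). The mirror image gives a second decomposition, and the two
   decompositions are linked.

   In the group <x, y | x y^2 x = y x^2 y> let a = xy, b = yx = x^-1 a x and d = x a x^-1. Then a
   commutes with b and d, but b and d do not commute; the group is an HNN extension of the free
   abelian group <a, b> with stable letter x. If the group were a diagram group, the
   decompositions would force b, d to lie in C(a) on both sides, so c = [b, d] is elliptic for a on both
   sides, hence a splits over c on both sides. But modulo <a> the common centralizer of a and c acts
   as a group of translations on an axis of c in the Bass-Serre tree, which leaves no room for both.

   For the embedding, the kernel of x -> 1, y -> -1 is generated by a_n (n an integer) with a_n and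
   a_(n+1) commuting. In a suitable diagram group there are commuting families alpha_n and
   beta_n such that alpha_m and beta_n commute for n < m, permuted by a shift, and a_n is mapped to
   alpha_n beta_(n-2). Injectivity follows by applying Britton's lemma to the beta with largest index. *)
theory Submission
  imports Defs "HOL-Library.Confluence" "HOL-Algebra.Generated_Groups"
begin

section \<open>Free reduction\<close>

text \<open>The shift by 2 in alpha_n beta_(n-2) is forced. Within each family everything commutes,
  so for m < n the only obstacle between the images of a_m and a_n is the pair alpha_m, beta_(n-2).
  It commutes iff n - 2 < m, that is iff n = m + 1: exactly the neighbours commute.

  Each alpha and each beta is realised by a loop at a single letter. As presentations are
  anti-symmetric, a cycle of single-letter relations has length at least three; this is the origin
  of the letters 1, 2, 3 and 5, 6, 7.

  The link between the two decompositions consists of two facts. An element of U(g) lies in the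
  mirrored C(g), because one shortest representative of the conjugacy class is hyperbolic seen from
  either end. And if u \<noteq> 1 is in U(g), then g is in the mirrored U(u): what is left of g has
  g on its right.

  Diagrams are added as classes of arbitrary edge lists, so that end points enter only where they
  matter. This is possible because the rewriting system is confluent on all lists and keeps the ends
  of paths.\<close>

fun flip :: "'c \<times> bool \<Rightarrow> 'c \<times> bool" where
  "flip (c, s) = (c, \<not> s)"

lemma flip_flip [simp]: "flip (flip x) = x"
  by (cases x) simp

fun push :: "'c \<times> bool \<Rightarrow> ('c \<times> bool) list \<Rightarrow> ('c \<times> bool) list" where
  "push x [] = [x]"
| "push x (y # w) = (if y = flip x then w else x # y # w)"

abbreviation freely_reduced :: "('c \<times> bool) list \<Rightarrow> bool" where
  "freely_reduced \<equiv> successively (\<lambda>x y. y \<noteq> flip x)"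

text \<open>The letters act on reduced words, and a word is reduced by letting it act on the empty
  word. This replaces a confluence argument.\<close>

definition free_red :: "('c \<times> bool) list \<Rightarrow> ('c \<times> bool) list" where
  "free_red w = foldr push w []"

lemma freely_reduced_push: "freely_reduced w \<Longrightarrow> freely_reduced (push x w)"
  by (cases w) (auto simp: successively_Cons)

lemma freely_reduced_foldr_push: "freely_reduced s \<Longrightarrow> freely_reduced (foldr push w s)"
  by (induction w) (auto intro: freely_reduced_push)

text \<open>On reduced words pushing \<open>x\<close> is a permutation with inverse pushing
  \<open>flip x\<close>. Invariance of \<open>free_red\<close> under cancellation rests on this
  action of the free group.\<close>

lemma push_flip: "freely_reduced w \<Longrightarrow> push x (push (flip x) w) = w"
  by (cases w rule: remdups_adj.cases) auto

lemma free_red_append: "free_red (a @ b) = foldr push a (free_red b)"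
  by (simp add: free_red_def)

lemma freely_reduced_free_red: "freely_reduced (free_red w)"
  by (simp add: free_red_def freely_reduced_foldr_push)

lemma free_red_cancel: "free_red (a @ [x, flip x] @ b) = free_red (a @ b)"
  by (simp add: free_red_append push_flip freely_reduced_free_red) (simp add: free_red_def push_flip freely_reduced_foldr_push)

lemma free_red_reduced: "freely_reduced w \<Longrightarrow> free_red w = w"
proof (induction w)
  case (Cons x w)
  then show ?case by (cases w) (auto simp: free_red_def successively_Cons)
qed (simp add: free_red_def)

lemma foldr_push_push:
  assumes "freely_reduced w" "freely_reduced s"
  shows "foldr push (push x w) s = push x (foldr push w s)"
proof (cases w)
  case (Cons y w')
  have "freely_reduced (foldr push w' s)" by (rule freely_reduced_foldr_push[OF assms(2)])
  then show ?thesis using Cons by (auto simp: push_flip)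
qed simp

lemma foldr_push_free_red: "freely_reduced s \<Longrightarrow> foldr push w s = foldr push (free_red w) s"
  by (induction w) (simp_all add: free_red_def foldr_push_push freely_reduced_foldr_push)

lemma free_red_append_cong:
  assumes "free_red a = free_red a'" "free_red b = free_red b'"
  shows "free_red (a @ b) = free_red (a' @ b')"
proof -
  have *: "free_red (a @ b) = foldr push (free_red a) (free_red b)" for a b
    unfolding free_red_append by (rule foldr_push_free_red[OF freely_reduced_free_red])
  show ?thesis unfolding * assms ..
qed

lemma not_freely_reducedE:
  assumes "\<not> freely_reduced w"
  obtains a x b where "w = a @ [x, flip x] @ b"
proof -
  have "\<exists>a x b. w = a @ [x, flip x] @ b" using assms
  proof (induction w)
    case (Cons y w)
    show ?case
    proof (cases "freely_reduced w")
      case True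
      obtain z w' where w: "w = z # w'" using Cons.prems by (cases w) simp_all
      then have "z = flip y" using Cons.prems True by simp
      then have "w = flip y # w'" using w by simp
      then have "y # w = [] @ [y, flip y] @ w'" by simp
      then show ?thesis by blast
    next
      case False
      then obtain a x b where "w = a @ [x, flip x] @ b" using Cons.IH by blast
      then have "y # w = (y # a) @ [x, flip x] @ b" by simp
      then show ?thesis by blast
    qed
  qed simp
  then show ?thesis using that by blast
qed


section \<open>Automorphisms of trees\<close>

fun nonbacktracking :: "'v list \<Rightarrow> bool" where
  "nonbacktracking (x # y # z # r) \<longleftrightarrow> x \<noteq> z \<and> nonbacktracking (y # z # r)"
| "nonbacktracking _ \<longleftrightarrow> True"

lemma nonbacktracking_Cons:
  "nonbacktracking (x # w) \<longleftrightarrow> nonbacktracking w \<and> (length w \<ge> 2 \<longrightarrow> w ! 1 \<noteq> x)"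
  by (cases "x # w" rule: nonbacktracking.cases) auto

lemma nonbacktracking_append:
  "nonbacktracking (xs @ y # zs) \<longleftrightarrow> nonbacktracking (xs @ [y]) \<and> nonbacktracking (y # zs) \<and>
     (xs = [] \<or> zs = [] \<or> last xs \<noteq> hd zs)"
proof (induction xs)
  case (Cons x xs)
  show ?case
  proof (cases xs)
    case Nil
    then show ?thesis by (cases zs) auto
  next
    case (Cons x' xs')
    then have "(xs @ y # zs) ! 1 = (xs @ [y]) ! 1" by (cases xs') auto
    then show ?thesis using Cons.IH Cons by (auto simp: nonbacktracking_Cons)
  qed
qed simp

lemma nonbacktracking_rev: "nonbacktracking (rev xs) \<longleftrightarrow> nonbacktracking xs"
proof -
  have *: "nonbacktracking (rev xs)" if "nonbacktracking xs" for xs :: "'v list"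
    using that
  proof (induction xs rule: nonbacktracking.induct)
    case (1 x y z r)
    then have "nonbacktracking (rev r @ [z, y])" by simp
    then show ?case using 1 nonbacktracking_append[of "rev r @ [z]" y "[x]"] by auto
  qed auto
  show ?thesis using *[of xs] *[of "rev xs"] by auto
qed

lemma nonbacktracking_map: "inj_on f (set xs) \<Longrightarrow> nonbacktracking (map f xs) \<longleftrightarrow> nonbacktracking xs"
  by (induction xs rule: nonbacktracking.induct) (auto simp: inj_on_def)

lemma not_nonbacktrackingE:
  assumes "\<not> nonbacktracking xs"
  obtains a x y b where "xs = a @ [x, y, x] @ b"
proof -
  have "\<exists>a x y b. xs = a @ [x, y, x] @ b" using assms
  proof (induction xs rule: nonbacktracking.induct)
    case (1 x y z r)
    show ?case
    proof (cases "x = z")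
      case True
      then have "x # y # z # r = [] @ [x, y, x] @ r" by simp
      then show ?thesis by blast
    next
      case False
      then obtain a x' y' b where "y # z # r = a @ [x', y', x'] @ b" using 1 by auto
      then have "x # y # z # r = (x # a) @ [x', y', x'] @ b" by simp
      then show ?thesis by blast
    qed
  qed auto
  then show ?thesis using that by blast
qed

lemma rtranclp_walk:
  "P\<^sup>*\<^sup>* u v \<Longrightarrow> \<exists>xs. xs \<noteq> [] \<and> hd xs = u \<and> last xs = v \<and> successively P xs"
proof (induction rule: rtranclp_induct)
  case base
  show ?case by (intro exI[of _ "[u]"]) simp
next
  case (step v w)
  then obtain xs where "xs \<noteq> []" "hd xs = u" "last xs = v" "successively P xs" by blast
  then show ?case using step(2) by (intro exI[of _ "xs @ [w]"]) (simp add: successively_append_iff)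
qed

text \<open>\<open>acyclic\<close> excludes loops as well, since the list [v, v] does not backtrack.
  Automorphisms may invert edges, so having no fixed vertex is weaker than being hyperbolic in the
  usual sense.\<close>

locale tree =
  fixes V :: "'v set" and adj :: "'v \<Rightarrow> 'v \<Rightarrow> bool"
  assumes adj_sym: "adj u v \<Longrightarrow> adj v u"
    and adj_V: "adj u v \<Longrightarrow> u \<in> V"
    and connected: "u \<in> V \<Longrightarrow> v \<in> V \<Longrightarrow> \<exists>xs. xs \<noteq> [] \<and> hd xs = u \<and> last xs = v \<and> successively adj xs"
    and acyclic: "xs \<noteq> [] \<Longrightarrow> successively adj xs \<Longrightarrow> nonbacktracking xs \<Longrightarrow> hd xs = last xs \<Longrightarrow> length xs = 1"
begin

definition geod :: "'v \<Rightarrow> 'v list \<Rightarrow> 'v \<Rightarrow> bool" where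
  "geod u xs v \<longleftrightarrow> xs \<noteq> [] \<and> hd xs = u \<and> last xs = v \<and> u \<in> V \<and> successively adj xs \<and> nonbacktracking xs"

lemma walk_V: "successively adj xs \<Longrightarrow> xs \<noteq> [] \<Longrightarrow> hd xs \<in> V \<Longrightarrow> set xs \<subseteq> V"
proof (induction xs)
  case (Cons x xs)
  then show ?case by (cases xs) (auto dest: adj_V adj_sym)
qed simp

lemma geod_V: "geod u xs v \<Longrightarrow> set xs \<subseteq> V"
  unfolding geod_def using walk_V by blast

lemma geod_last_V: "geod u xs v \<Longrightarrow> v \<in> V"
  using geod_V[of u xs v] by (auto simp: geod_def)

lemma geod_rev: "geod u xs v \<Longrightarrow> geod v (rev xs) u"
proof -
  assume g: "geod u xs v"
  have "successively adj (rev xs)" unfolding successively_rev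
    using g by (auto simp: geod_def intro: successively_mono adj_sym)
  then show ?thesis using g geod_last_V[OF g]
    by (auto simp: geod_def hd_rev last_rev nonbacktracking_rev)
qed

lemma geod_closed: "geod u xs u \<Longrightarrow> xs = [u]"
proof -
  assume g: "geod u xs u"
  then have "length xs = 1" unfolding geod_def by (intro acyclic) auto
  with g show ?thesis by (auto simp: geod_def length_Suc_conv)
qed

lemma geod_append:
  assumes "geod u (xs @ [v]) v" "geod v (v # ys) w" "xs = [] \<or> ys = [] \<or> last xs \<noteq> hd ys"
  shows "geod u (xs @ v # ys) w"
proof -
  have "hd (xs @ v # ys) = hd (xs @ [v])" by (cases xs) auto
  moreover have "successively adj (xs @ v # ys)"
    using assms(1,2) by (auto simp: geod_def successively_append_iff)
  ultimately show ?thesis using assms by (auto simp: geod_def nonbacktracking_append[of xs v ys])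
qed

text \<open>If the first steps differ, one path reversed and then the other form a closed path
  without backtracking, which has to be a single vertex.\<close>

lemma geod_unique: "geod u xs v \<Longrightarrow> geod u ys v \<Longrightarrow> xs = ys"
proof (induction xs arbitrary: u ys)
  case (Cons x xs)
  then have [simp]: "x = u" by (simp add: geod_def)
  obtain ys' where ys: "ys = u # ys'" using Cons.prems(2) by (cases ys) (auto simp: geod_def)
  show ?case
  proof (cases "xs = [] \<or> ys' = []")
    case True
    then have "u = v" using Cons.prems ys by (auto simp: geod_def)
    then have "geod u (x # xs) u" "geod u ys u" using Cons.prems by simp_all
    from geod_closed[OF this(1)] geod_closed[OF this(2)] show ?thesis by simp
  next
    case False
    show ?thesis
    proof (cases "hd xs = hd ys'")
      case True
      have tl: "geod (hd zs) zs v" if "geod u (u # zs) v" "zs \<noteq> []" for zs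
        using that geod_V[OF that(1)] by (auto simp: geod_def successively_Cons nonbacktracking_Cons)
      have "geod (hd xs) xs v" "geod (hd xs) ys' v"
        using tl[of xs] tl[of ys'] Cons.prems ys True False by auto
      then show ?thesis using Cons.IH ys by simp
    next
      case neq: False
      have "geod v (rev xs @ [u]) u" using geod_rev[OF Cons.prems(1)] by simp
      then have "geod v (rev xs @ u # ys') v"
        using Cons.prems(2) neq ys geod_append[of v "rev xs" u ys' v] by (simp add: last_rev)
      then have "rev xs @ u # ys' = [v]" by (rule geod_closed)
      then show ?thesis using False by (cases xs) auto
    qed
  qed
qed (simp add: geod_def)

text \<open>Cutting out backtrackings x, y, x shortens the walk. The strict inequality lets
  \<open>axis\<close> recognise geodesics by their length.\<close>

lemma walk_geod:
  assumes "xs \<noteq> []" "hd xs \<in> V" "successively adj xs"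
  shows "\<exists>ys. geod (hd xs) ys (last xs) \<and> (ys = xs \<or> length ys < length xs)"
  using assms
proof (induction "length xs" arbitrary: xs rule: less_induct)
  case less
  show ?case
  proof (cases "nonbacktracking xs")
    case True
    then show ?thesis using less.prems by (auto simp: geod_def)
  next
    case False
    then obtain a x y b where xs: "xs = a @ [x, y, x] @ b" by (rule not_nonbacktrackingE)
    let ?zs = "a @ [x] @ b"
    have "hd ?zs = hd xs" "last ?zs = last xs" using xs by (cases a; auto)+
    moreover have "successively adj ?zs" using less.prems(3) unfolding xs
      by (auto simp: successively_append_iff successively_Cons)
    moreover have "length ?zs < length xs" using xs by simp
    ultimately have "\<exists>ys. geod (hd xs) ys (last xs) \<and> (ys = ?zs \<or> length ys < length ?zs)"
      using less.hyps[of ?zs] less.prems by auto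
    with \<open>length ?zs < length xs\<close> show ?thesis by auto
  qed
qed

lemma geod_exists:
  assumes "u \<in> V" "v \<in> V"
  shows "\<exists>xs. geod u xs v"
proof -
  obtain xs where xs: "xs \<noteq> []" "hd xs = u" "last xs = v" "successively adj xs"
    using connected[OF assms] by blast
  then show ?thesis using walk_geod[of xs] assms by auto
qed

section \<open>Fixed points and axes of tree automorphisms\<close>

definition automorphism :: "('v \<Rightarrow> 'v) \<Rightarrow> bool" where
  "automorphism f \<longleftrightarrow> bij_betw f V V \<and> (\<forall>u v. adj u v \<longrightarrow> adj (f u) (f v))"

lemma automorphism_V: "automorphism f \<Longrightarrow> v \<in> V \<Longrightarrow> f v \<in> V"
  by (auto simp: automorphism_def bij_betw_def)

lemma automorphism_inj: "automorphism f \<Longrightarrow> u \<in> V \<Longrightarrow> v \<in> V \<Longrightarrow> f u = f v \<Longrightarrow> u = v"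
  by (auto simp: automorphism_def bij_betw_def inj_on_def)

lemma geod_map:
  assumes "automorphism f" "geod u xs v"
  shows "geod (f u) (map f xs) (f v)"
proof -
  have "inj_on f (set xs)"
    using assms(1) geod_V[OF assms(2)] by (auto simp: automorphism_def bij_betw_def intro: inj_on_subset)
  moreover have "successively adj (map f xs)"
    using assms unfolding successively_map by (auto simp: geod_def automorphism_def intro: successively_mono)
  ultimately show ?thesis
    using assms automorphism_V[OF assms(1)] by (auto simp: geod_def nonbacktracking_map hd_map last_map)
qed

text \<open>The image of the geodesic has the same ends, hence is the same list. So fixed vertices
  span a subtree.\<close>

lemma fixed_geod:
  assumes "automorphism f" "geod u xs v" "f u = u" "f v = v" "x \<in> set xs"
  shows "f x = x"
proof -
  have "map f xs = xs" using geod_map[OF assms(1,2)] assms(2-4) geod_unique by auto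
  then have "map f xs = map id xs" by simp
  then show ?thesis using assms(5) unfolding map_eq_conv by simp
qed

text \<open>Take a shortest geodesic from a fixed vertex \<open>u\<close> of \<open>f\<close> to a
  fixed vertex \<open>v\<close> of \<open>g\<close>. If it is not trivial, \<open>g\<close> moves
  its last vertex but one, so the path followed by the reversed image under \<open>g\<close> is a
  geodesic from \<open>u\<close> to \<open>g u\<close>. Both ends are fixed by \<open>f\<close>,
  hence so is \<open>v\<close> in the middle.\<close>

lemma commuting_elliptic:
  assumes f: "automorphism f" "u \<in> V" "f u = u" and g: "automorphism g" "v \<in> V" "g v = v"
    and comm: "\<And>x. x \<in> V \<Longrightarrow> f (g x) = g (f x)"
  shows "\<exists>x\<in>V. f x = x \<and> g x = x"
proof -
  define P where "P n \<longleftrightarrow> (\<exists>u v xs. f u = u \<and> g v = v \<and> geod u xs v \<and> length xs = n)" for n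
  have "\<exists>n. P n" using geod_exists[OF f(2) g(2)] f g unfolding P_def by blast
  then have "P (LEAST n. P n)" by (rule LeastI_ex)
  then obtain u v xs where uv: "f u = u" "g v = v" "geod u xs v" "length xs = (LEAST n. P n)"
    unfolding P_def by blast
  obtain ys where xs: "xs = ys @ [v]" using uv(3) by (cases xs rule: rev_cases) (auto simp: geod_def)
  show ?thesis
  proof (cases "ys = []")
    case True
    then have "u = v" using uv(3) xs by (auto simp: geod_def)
    with uv(1,2) have "f v = v \<and> g v = v" by simp
    then show ?thesis using geod_last_V[OF uv(3)] by (rule bexI)
  next
    case False
    obtain zs z where ys: "ys = zs @ [z]" using False by (cases ys rule: rev_cases) auto
    have "hd (zs @ [z, v]) = hd (zs @ [z])" by (cases zs) auto
    then have "geod u ys (last ys)" using uv(3) nonbacktracking_append[of zs z "[v]"] unfolding xs ys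
      by (auto simp: geod_def successively_append_iff)
    then have "g (last ys) \<noteq> last ys"
      using uv(1,4) xs not_less_Least[of "length ys" P] unfolding P_def by auto
    moreover have "geod (g u) (map g xs) v" using geod_map[OF g(1) uv(3)] uv by simp
    then have "geod v (rev (map g xs)) (g u)" by (rule geod_rev)
    then have "geod v (v # rev (map g ys)) (g u)" by (simp add: xs uv(2))
    ultimately have far: "geod u (ys @ v # rev (map g ys)) (g u)"
      using uv(3) xs False geod_append[of u ys v "rev (map g ys)" "g u"] by (simp add: hd_rev last_map)
    have "f (g u) = g u" using comm[of u] uv(1) uv(3) by (simp add: geod_def)
    then have "f v = v" using fixed_geod[OF f(1) far uv(1)] by simp
    with uv(2) have "f v = v \<and> g v = v" by simp
    then show ?thesis using geod_last_V[OF uv(3)] by (rule bexI)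
  qed
qed

text \<open>The condition \<open>junction\<close> says that the geodesic from \<open>x\<close> to
  \<open>f x\<close> continues into its image without turning back. A geodesic from a fixed vertex
  \<open>u\<close> to \<open>x\<close> and its image, which ends in \<open>f x\<close>, have the
  same length; this fails whichever way the first one arrives at \<open>x\<close>.\<close>

lemma no_fixed_point:
  assumes f: "automorphism f" and xs: "geod x (x # y # xs) (f x)"
    and junction: "last (butlast (x # y # xs)) \<noteq> f y"
    and u: "u \<in> V" "f u = u"
  shows False
proof -
  obtain p where p: "geod u p x" using geod_exists u geod_V[OF xs] by fastforce
  obtain p' where p': "p = p' @ [x]" using p by (cases p rule: rev_cases) (auto simp: geod_def)
  have fp: "geod u (map f p) (f x)" using geod_map[OF f p] u by simp
  \<comment> \<open>If the geodesic does not arrive through \<open>y\<close>, it can be continued to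
    \<open>f x\<close>, and the result is longer than its image.\<close>
  have turn: "p' \<noteq> [] \<and> last p' = y"
  proof (rule ccontr)
    assume "\<not> ?thesis"
    then have "geod u (p' @ x # y # xs) (f x)" using p p' xs geod_append[of u p' x "y # xs" "f x"] by auto
    then have "map f p = p' @ x # y # xs" using fp geod_unique by blast
    then have "length p = length (p' @ x # y # xs)" by (metis length_map)
    then show False by (simp add: p')
  qed
  have xs': "x # y # xs = butlast (x # y # xs) @ [f x]"
    using xs append_butlast_last_id[of "x # y # xs", symmetric] by (simp only: geod_def) blast
  have fp': "map f p = map f p' @ [f x]" by (simp add: p')
  have "geod (f x) (rev (x # y # xs)) x" by (rule geod_rev[OF xs])
  then have "geod (f x) (f x # rev (butlast (x # y # xs))) x"
    by (subst (asm) xs') simp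
  moreover have "hd (rev (butlast (x # y # xs))) = last (butlast (x # y # xs))"
    by (simp add: hd_rev)
  moreover have "last (map f p') = f y" using turn by (simp add: last_map)
  ultimately have "geod u (map f p' @ f x # rev (butlast (x # y # xs))) x"
    using fp fp' junction geod_append[of u "map f p'" "f x" "rev (butlast (x # y # xs))" x] by simp
  then have "p = map f p' @ f x # rev (butlast (x # y # xs))" using p geod_unique by blast
  then have "length p = length (map f p' @ f x # rev (butlast (x # y # xs)))" by simp
  then show False by (simp add: p')
qed


text \<open>The geodesic followed by its image satisfies the hypotheses of
  \<open>no_fixed_point\<close> for the square of \<open>f\<close>.\<close>

lemma no_fixed_point_square:
  assumes f: "automorphism f" and xs: "geod x (x # y # xs) (f x)"
    and turn: "last (butlast (x # y # xs)) \<noteq> f y" and u: "u \<in> V"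
  shows "f (f u) \<noteq> u"
proof
  assume fix2: "f (f u) = u"
  have f2: "automorphism (\<lambda>v. f (f v))"
    using f bij_betw_trans[of f V V f V] by (auto simp: automorphism_def comp_def)
  define zs where "zs = butlast (x # y # xs)"
  have zs: "x # y # xs = zs @ [f x]" using xs append_butlast_last_id[of "x # y # xs"] by (simp add: geod_def zs_def)
  have g2: "geod (f x) (f x # f y # map f xs) (f (f x))" using geod_map[OF f xs] by simp
  have "geod x (zs @ f x # f y # map f xs) (f (f x))"
    using geod_append[of x zs "f x" "f y # map f xs" "f (f x)"] xs g2 turn zs_def unfolding zs by simp
  moreover have "zs @ f x # f y # map f xs = x # y # (xs @ f y # map f xs)" using zs by simp
  ultimately have "geod x (x # y # (xs @ f y # map f xs)) (f (f x))" by simp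
  moreover have "last (butlast (x # y # (xs @ f y # map f xs))) = f (last (butlast (x # y # xs)))"
  proof -
    have "zs \<noteq> []" by (simp add: zs_def)
    have "x # y # (xs @ f y # map f xs) = zs @ f x # f y # map f xs"
      using arg_cong[OF zs, of "\<lambda>l. l @ f y # map f xs"] by simp
    also have "f x # f y # map f xs = map f zs @ [f (f x)]" using arg_cong[OF zs, of "map f"] by simp
    finally have "butlast (x # y # (xs @ f y # map f xs)) = zs @ map f zs" by (simp add: butlast_append)
    then show ?thesis using \<open>zs \<noteq> []\<close> unfolding zs_def[symmetric] by (simp add: last_map)
  qed
  moreover have "f (last (butlast (x # y # xs))) \<noteq> f (f y)"
  proof
    assume "f (last (butlast (x # y # xs))) = f (f y)"
    moreover have "last (butlast (x # y # xs)) \<in> V"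
      using geod_V[OF xs] in_set_butlastD[of "last (butlast (x # y # xs))" "x # y # xs"] last_in_set[of "butlast (x # y # xs)"] by auto
    moreover have "f y \<in> V" using geod_V[OF xs] automorphism_V[OF f] by simp
    ultimately show False using automorphism_inj[OF f] turn by blast
  qed
  ultimately show False using no_fixed_point[OF f2, of x y "xs @ f y # map f xs" u] u fix2 by simp
qed

text \<open>
  An automorphism \<open>A\<close> without fixed points translates an axis, on which its centralizer acts by
  shifts: on the vertices of minimal displacement let \<open>s v\<close> be the vertex after \<open>v\<close> on
  the geodesic from \<open>v\<close> to \<open>A v\<close>; the axis is an orbit of \<open>s\<close>.
\<close>

lemma axis:
  assumes A: "automorphism A" and nofix: "\<And>v. v \<in> V \<Longrightarrow> A v \<noteq> v" and V: "V \<noteq> {}"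
  shows "\<exists>l :: int \<Rightarrow> 'v. (\<forall>i. l i \<in> V \<and> adj (l i) (l (i + 1))) \<and>
    ((\<forall>v\<in>V. A (A v) \<noteq> v) \<longrightarrow> inj l) \<and>
    (\<forall>h. automorphism h \<and> (\<forall>v\<in>V. h (A v) = A (h v)) \<longrightarrow> (\<exists>m. \<forall>i. h (l i) = l (i + m)))"
proof -
  define W where "W v = (THE xs. geod v xs (A v))" for v
  have W: "geod v (W v) (A v)" if "v \<in> V" for v
    unfolding W_def
    by (rule theI') (use geod_exists[OF that automorphism_V[OF A that]] geod_unique in blast)
  have W_eq: "W v = xs" if "geod v xs (A v)" for v xs
    using W[of v] that geod_unique[OF W[of v] that] by (auto simp: geod_def)
  define k where "k = (LEAST n. \<exists>v\<in>V. length (W v) = n)"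
  define M where "M = {v \<in> V. length (W v) = k}"
  have k_min: "k \<le> length (W v)" if "v \<in> V" for v
    unfolding k_def by (rule Least_le) (use that in blast)
  have "M \<noteq> {}"
    using LeastI_ex[of "\<lambda>n. \<exists>v\<in>V. length (W v) = n"] V unfolding M_def k_def by auto
  then obtain v0 where v0: "v0 \<in> M" by blast
  have M_V: "v \<in> V" if "v \<in> M" for v using that by (simp add: M_def)
  have W_shape: "\<exists>y ys. W v = v # y # ys" if v: "v \<in> V" for v
  proof -
    obtain xs where xs: "W v = v # xs" using W[OF v] by (cases "W v") (auto simp: geod_def)
    then have "xs \<noteq> []" using W[OF v] nofix[OF v] by (auto simp: geod_def)
    then show ?thesis using xs by (cases xs) auto
  qed
  \<comment> \<open>A walk from \<open>v\<close> to \<open>A v\<close> of the minimal length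
    \<open>k\<close> can only be the geodesic, because reducing it would make it shorter than
    \<open>k\<close>.\<close>
  have short: "W v = xs \<and> v \<in> M"
    if xs: "v \<in> V" "xs \<noteq> []" "hd xs = v" "last xs = A v" "successively adj xs" "length xs = k" for v xs
  proof -
    obtain ys where ys: "geod v ys (A v)" "ys = xs \<or> length ys < length xs"
      using walk_geod[of xs] xs by auto
    then have "ys = xs" using W_eq[OF ys(1)] k_min[OF xs(1)] xs(6) by auto
    then have "W v = xs" using W_eq ys(1) by blast
    then show ?thesis using xs by (simp add: M_def)
  qed
  define s where "s v = W v ! 1" for v
  have s_W: "s v = y" if "W v = v # y # ys" for v y ys using that by (simp add: s_def)
  have adj_s: "adj v (s v)" if "v \<in> M" for v
    using W_shape[OF M_V[OF that]] W[OF M_V[OF that]] s_W by (fastforce simp: geod_def)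
  have A_adj: "successively adj (map A xs)" if "successively adj xs" for xs
    using that A unfolding successively_map by (auto simp: automorphism_def intro: successively_mono)
  \<comment> \<open>Drop the first vertex of \<open>W v\<close> and append the image of the second
    one. The length stays \<open>k\<close>, so this walk is again minimal.\<close>
  have s_step: "s v \<in> M \<and> W (s v) = tl (W v) @ [A (s v)]" if v: "v \<in> M" for v
  proof -
    obtain y ys where ys: "W v = v # y # ys" using W_shape[OF M_V[OF v]] by blast
    have g: "geod v (v # y # ys) (A v)" using W[OF M_V[OF v]] ys by simp
    have sv: "s v = y" by (rule s_W[OF ys])
    have "adj (A v) (A y)" using adj_s[OF v] A sv by (simp add: automorphism_def)
    then have "successively adj ((y # ys) @ [A y])"
      using g successively_append_iff[of adj "y # ys" "[A y]"] by (simp add: geod_def)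
    moreover have "y \<in> V" using geod_V[OF g] by simp
    moreover have "length (y # ys @ [A y]) = k" using v ys by (simp add: M_def)
    ultimately show ?thesis using short[of y "y # ys @ [A y]"] ys sv by simp
  qed
  have A_inj: "A u = A v \<Longrightarrow> u \<in> V \<Longrightarrow> v \<in> V \<Longrightarrow> u = v" for u v
    using automorphism_inj[OF A] by blast
  have s_inj: "inj_on s M"
  proof (rule inj_onI)
    fix u v assume uv: "u \<in> M" "v \<in> M" "s u = s v"
    then have "tl (W u) = tl (W v)" using s_step[of u] s_step[of v] by simp
    moreover have "last (tl (W w)) = A w" if "w \<in> M" for w
      using W[OF M_V[OF that]] W_shape[OF M_V[OF that]] by (auto simp: geod_def)
    ultimately have "A u = A v" using uv by metis
    then show "u = v" using A_inj uv M_V by blast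
  qed
  \<comment> \<open>The predecessor of \<open>v\<close> is the last vertex but one of the geodesic
    that leads from the preimage of \<open>v\<close> to \<open>v\<close>.\<close>
  have s_surj: "v \<in> s ` M" if v: "v \<in> M" for v
  proof -
    obtain w where w: "w \<in> V" "A w = v"
      using A M_V[OF v] unfolding automorphism_def bij_betw_def by (metis imageE)
    have "geod (A w) (map A (W w)) (A (A w))" by (rule geod_map[OF A W[OF w(1)]])
    then have "W v = map A (W w)" using W_eq w by simp
    then have wM: "w \<in> M" using v w by (simp add: M_def)
    obtain y ys where ys: "W w = w # y # ys" using W_shape[OF w(1)] by blast
    define p where "p = butlast (W w)"
    have p: "W w = p @ [v]" "p \<noteq> []" "hd p = w"
      using W[OF w(1)] ys w(2) append_butlast_last_id[of "W w"] unfolding p_def by (auto simp: geod_def)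
    define u where "u = last p"
    have pu: "p = butlast p @ [u]" using p(2) by (simp add: u_def)
    have suc: "successively adj (p @ [v])" using W[OF w(1)] unfolding p(1) geod_def by blast
    then have uv: "adj u v" using p(2) by (simp add: successively_append_iff u_def)
    have "successively adj p" using suc by (simp add: successively_append_iff)
    then have "successively adj (u # map A p)"
      using A_adj[of p] uv p w(2) by (simp add: successively_Cons hd_map)
    moreover have "length (u # map A p) = k" using wM p(1) by (simp add: M_def)
    moreover have "last (u # map A p) = A u" using p(2) by (simp add: last_map u_def)
    ultimately have "W u = u # map A p \<and> u \<in> M" using uv adj_V by (intro short) auto
    moreover have "hd (map A p) = v" using p w(2) by (simp add: hd_map)
    ultimately have "s u = v \<and> u \<in> M" using p(2) by (cases p) (auto simp: s_def)
    then show ?thesis by blast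
  qed
  have s_M: "s v \<in> M" if "v \<in> M" for v using s_step[OF that] by blast
  define r where "r = inv_into M s"
  have r_M: "r v \<in> M" if "v \<in> M" for v using s_surj[OF that] by (simp add: r_def inv_into_into)
  have sr: "s (r v) = v" if "v \<in> M" for v using s_surj[OF that] by (simp add: r_def f_inv_into_f)
  have rs: "r (s v) = v" if "v \<in> M" for v using s_inj that by (simp add: r_def inv_into_f_f)
  define l where "l v i = (if i \<ge> 0 then (s ^^ nat i) v else (r ^^ nat (- i)) v)" for v and i :: int
  have sM: "(s ^^ n) v \<in> M" and rM: "(r ^^ n) v \<in> M" if "v \<in> M" for v n
    using that by (induction n) (auto simp: s_M r_M)
  have l_M: "l v i \<in> M" if "v \<in> M" for v i using sM rM that by (simp add: l_def)
  have l_suc: "l v (i + 1) = s (l v i)" if "v \<in> M" for v i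
  proof (cases "i \<ge> 0")
    case True
    then have "nat (i + 1) = Suc (nat i)" by simp
    then show ?thesis using True by (simp add: l_def)
  next
    case False
    then obtain n where n: "nat (- i) = Suc n" by (cases "nat (- i)") auto
    then have i: "i = - int n - 1" using False by simp
    have "s (l v i) = (r ^^ n) v" using sr[OF rM[OF that]] n False by (simp add: l_def)
    moreover have "l v (i + 1) = (r ^^ n) v" using i by (cases n) (auto simp: l_def nat_add_distrib)
    ultimately show ?thesis by simp
  qed
  have l0: "l v 0 = v" for v by (simp add: l_def)
  have eq_line: "f i = l v i"
    if f: "\<And>i. f i \<in> M" "\<And>i. f (i + 1) = s (f i)" "f 0 = v" and v: "v \<in> M" for f v and i :: int
  proof (induction i rule: int_induct[where k = 0])
    case base show ?case by (simp add: f(3) l0)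
  next
    case (step1 i) then show ?case using f(2) l_suc[OF v] by simp
  next
    case (step2 i)
    have "s (f (i - 1)) = s (l v (i - 1))" using f(2)[of "i - 1"] l_suc[OF v, of "i - 1"] step2 by simp
    then show ?case using inj_onD[OF s_inj] f(1) l_M[OF v] by blast
  qed
  have h_M: "h v \<in> M" and h_s: "s (h v) = h (s v)"
    if h: "automorphism h" "\<forall>v\<in>V. h (A v) = A (h v)" and v: "v \<in> M" for h v
  proof -
    have "geod (h v) (map h (W v)) (A (h v))" using geod_map[OF h(1) W[OF M_V[OF v]]] h(2) M_V[OF v] by simp
    then have Wh: "W (h v) = map h (W v)" by (rule W_eq)
    then show "h v \<in> M" using v automorphism_V[OF h(1)] by (simp add: M_def)
    obtain y ys where "W v = v # y # ys" using W_shape[OF M_V[OF v]] by blast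
    then show "s (h v) = h (s v)" using Wh by (simp add: s_def)
  qed
  have hl: "h (l v i) = l (h v) i"
    if h: "automorphism h" "\<forall>v\<in>V. h (A v) = A (h v)" and v: "v \<in> M" for h v i
    by (rule eq_line) (use h_M[OF h] h_s[OF h] l_M[OF v] l_suc[OF v] v l0 in auto)
  have l_shift: "l (l v j) i = l v (i + j)" if "v \<in> M" for v i j
  proof -
    have "l v (i + j) = l (l v j) i"
    proof (rule eq_line[of "\<lambda>i. l v (i + j)"])
      fix i show "l v (i + 1 + j) = s (l v (i + j))"
        using l_suc[OF that, of "i + j"] by (simp add: algebra_simps)
    qed (use l_M[OF that] in auto)
    then show ?thesis by simp
  qed
  \<comment> \<open>Take a shortest geodesic from one orbit to the other, from \<open>u'\<close> to
    \<open>v'\<close>. If it has an edge, then following it and afterwards \<open>W v'\<close>, or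
    following \<open>W u'\<close> and afterwards its image under \<open>A\<close>, gives two
    geodesics from \<open>u'\<close> to \<open>A v'\<close>. As they agree, the geodesic starts
    along the first orbit and was not the shortest.\<close>
  have same: "\<exists>i j. l u i = l v j" if u: "u \<in> M" and v: "v \<in> M" for u v
  proof -
    define P where "P n \<longleftrightarrow> (\<exists>i j xs. geod (l u i) xs (l v j) \<and> length xs = n)" for n
    have "\<exists>n. P n" using geod_exists[OF M_V[OF l_M[OF u]] M_V[OF l_M[OF v]]] unfolding P_def by blast
    then have "P (LEAST n. P n)" by (rule LeastI_ex)
    then obtain i j xs where xs: "geod (l u i) xs (l v j)" "length xs = (LEAST n. P n)"
      unfolding P_def by blast
    have least: "\<not> geod (l u i') ys (l v j')" if "length ys < length xs" for i' j' ys
      using not_less_Least[of "length ys" P] that xs(2) unfolding P_def by auto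
    define u' v' where "u' = l u i" and "v' = l v j"
    have u'M: "u' \<in> M" and v'M: "v' \<in> M" using l_M u v by (simp_all add: u'_def v'_def)
    have g: "geod u' xs v'" using xs(1) by (simp add: u'_def v'_def)
    show ?thesis
    proof (cases "length xs = 1")
      case True
      then have "l u i = l v j" using xs(1) by (auto simp: geod_def length_Suc_conv)
      then show ?thesis by blast
    next
      case False
      then obtain y ys where ys: "xs = u' # y # ys"
        using g by (cases xs rule: remdups_adj.cases) (auto simp: geod_def)
      obtain p z where p: "xs = p @ [z, v']"
      proof -
        obtain q where q: "xs = q @ [v']" using g by (cases xs rule: rev_cases) (auto simp: geod_def)
        then have "q \<noteq> []" using ys by auto
        then show thesis using q that by (cases q rule: rev_cases) auto
      qed
      obtain b bs where b: "W v' = v' # b # bs" using W_shape[OF M_V[OF v'M]] by blast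
      obtain c cs where c: "W u' = cs @ [c, A u']"
      proof -
        obtain q where q: "W u' = q @ [A u']" using W[OF M_V[OF u'M]]
          by (cases "W u'" rule: rev_cases) (auto simp: geod_def)
        then have "q \<noteq> []" using W_shape[OF M_V[OF u'M]] by auto
        then show thesis using q that by (cases q rule: rev_cases) auto
      qed
      have sub1: "geod u' (p @ [z]) z" using g unfolding p
        using nonbacktracking_append[of p z "[v']"] successively_append_iff[of adj "p @ [z]" "[v']"]
        by (cases p) (auto simp: geod_def)
      have sub2: "geod y (y # ys) v'" using g geod_V[OF g] unfolding ys
        by (auto simp: geod_def nonbacktracking_Cons)
      have "z \<noteq> b"
      proof
        assume "z = b"
        then have "z = l v (j + 1)" using s_W[OF b] l_suc[OF v, of j] by (simp add: v'_def)
        then show False using least[of "p @ [z]" i "j + 1"] sub1 p by (simp add: u'_def)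
      qed
      then have g1: "geod u' ((p @ [z]) @ v' # b # bs) (A v')"
        using g p W[OF M_V[OF v'M]] b geod_append[of u' "p @ [z]" v' "b # bs" "A v'"] by simp
      have "c \<noteq> A y"
      proof
        \<comment> \<open>Then \<open>y\<close> precedes \<open>u'\<close> on its orbit, and the
          connection could be shortened.\<close>
        assume cy: "c = A y"
        obtain w where w: "w \<in> M" "s w = u'" using s_surj[OF u'M] by blast
        have cV: "y \<in> V" using geod_V[OF g] ys by simp
        have AA: "\<forall>v\<in>V. A (A v) = A (A v)" by simp
        have Aw: "A w \<in> M" "s (A w) = A u'" using h_M[OF A AA w(1)] h_s[OF A AA w(1)] w(2) by auto
        have "W (s w) = tl (W w) @ [A (s w)]" using s_step[OF w(1)] by blast
        then have "cs @ [c] = tl (W w)" using c w(2) by simp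
        then have "c = last (tl (W w))" by (metis last_snoc)
        also have "\<dots> = A w" using W[OF M_V[OF w(1)]] W_shape[OF M_V[OF w(1)]] by (auto simp: geod_def)
        finally have "A y = A w" using cy by simp
        then have "y = w" using A_inj cV M_V[OF w(1)] by blast
        moreover have "s w = s (l u (i - 1))" using l_suc[OF u, of "i - 1"] w(2) by (simp add: u'_def)
        then have "w = l u (i - 1)" using inj_onD[OF s_inj] w(1) l_M[OF u] by blast
        ultimately show False using sub2 least[of "y # ys" "i - 1" j] ys by (simp add: v'_def)
      qed
      moreover have "geod (A u') (map A xs) (A v')" by (rule geod_map[OF A g])
      ultimately have g2: "geod u' ((cs @ [c]) @ A u' # A y # map A ys) (A v')"
        using W[OF M_V[OF u'M]] c ys geod_append[of u' "cs @ [c]" "A u'" "A y # map A ys" "A v'"] by simp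
      have "(p @ [z]) @ v' # b # bs = (cs @ [c]) @ A u' # A y # map A ys"
        by (rule geod_unique[OF g1 g2])
      then have "xs @ b # bs = W u' @ A y # map A ys" using p c by simp
      then have "y = W u' ! 1" using ys W_shape[OF M_V[OF u'M]] by auto
      then have "y = s u'" by (simp add: s_def)
      then have "y = l u (i + 1)" using l_suc[OF u] by (simp add: u'_def)
      then show ?thesis using sub2 least[of "y # ys" "i + 1" j] ys by (simp add: v'_def)
    qed
  qed
  define L where "L = l v0"
  have "\<forall>i. L i \<in> V \<and> adj (L i) (L (i + 1))"
    using l_M[OF v0] M_V adj_s l_suc[OF v0] by (simp add: L_def)
  moreover have "\<exists>m. \<forall>i. h (L i) = L (i + m)"
    if h: "automorphism h" "\<forall>v\<in>V. h (A v) = A (h v)" for h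
  proof -
    have hv: "h v0 \<in> M" using h_M[OF h v0] .
    obtain i j where ij: "l (h v0) i = l v0 j" using same[OF hv v0] by blast
    have "h v0 = l (h v0) (- i + i)" by (simp add: l0)
    also have "\<dots> = l v0 (- i + j)" using l_shift[OF hv, of i "- i"] l_shift[OF v0, of j "- i"] ij by simp
    finally have "h v0 = l v0 (j - i)" by simp
    then have "h (L n) = L (n + (j - i))" for n
      using hl[OF h v0, of n] l_shift[OF v0, of "j - i" n] by (simp add: L_def)
    then show ?thesis by blast
  qed
  \<comment> \<open>When \<open>A\<close> exchanges two adjacent vertices, the orbit may alternate
    between them. Otherwise \<open>s\<close> never turns back, and all segments of the orbit are
    geodesics.\<close>
  moreover have "inj L" if noinv: "\<forall>v\<in>V. A (A v) \<noteq> v"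
  proof -
    have turn: "v \<noteq> s (s v)" if v: "v \<in> M" for v
    proof -
      obtain y ys where ys: "W v = v # y # ys" using W_shape[OF M_V[OF v]] by blast
      have sW: "W (s v) = (y # ys) @ [A y]" using s_step[OF v] ys s_W[OF ys] by simp
      show ?thesis
      proof (cases ys)
        case Nil
        then have "y = A v" using W[OF M_V[OF v]] ys by (simp add: geod_def)
        then show ?thesis using sW Nil noinv M_V[OF v] by (auto simp: s_def)
      next
        case (Cons z zs)
        then have "s (s v) = z" using sW by (simp add: s_def)
        then show ?thesis using W[OF M_V[OF v]] ys Cons by (auto simp: geod_def)
      qed
    qed
    have seg: "geod (L i) (map (\<lambda>n. L (i + int n)) [0..<Suc n]) (L (i + int n))" for i n
    proof (induction n)
      case 0 show ?case using M_V[OF l_M[OF v0]] by (simp add: L_def geod_def)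
    next
      case (Suc n)
      note IH = Suc.IH
      let ?f = "\<lambda>n. L (i + int n)"
      have step: "adj (?f n) (?f (Suc n))"
        using adj_s[OF l_M[OF v0], of "i + int n"] l_suc[OF v0, of "i + int n"]
        by (simp add: L_def algebra_simps)
      have e: "geod (?f n) [?f n, ?f (Suc n)] (?f (Suc n))"
        using step adj_V by (auto simp: geod_def)
      show ?case
      proof (cases n)
        case 0 then show ?thesis using e by simp
      next
        case (Suc m)
        have "?f m \<noteq> ?f (Suc n)"
          using turn[OF l_M[OF v0], of "i + int m"] l_suc[OF v0, of "i + int m"] l_suc[OF v0, of "i + int m + 1"]
          by (simp add: L_def Suc algebra_simps)
        then have "last (map ?f [0..<n]) \<noteq> hd [?f (Suc n)]" by (simp add: Suc)
        moreover have "geod (L i) (map ?f [0..<n] @ [?f n]) (?f n)" using IH by simp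
        ultimately have "geod (L i) (map ?f [0..<n] @ ?f n # [?f (Suc n)]) (?f (Suc n))"
          using e geod_append[of "L i" "map ?f [0..<n]" "?f n" "[?f (Suc n)]" "?f (Suc n)"] by blast
        then show ?thesis by simp
      qed
    qed
    have le: "i = j" if "L i = L j" "i \<le> j" for i j
    proof -
      have "geod (L i) (map (\<lambda>n. L (i + int n)) [0..<Suc (nat (j - i))]) (L i)"
        using seg[of i "nat (j - i)"] that by simp
      from geod_closed[OF this] have "length (map (\<lambda>n. L (i + int n)) [0..<Suc (nat (j - i))]) = 1" by simp
      then show ?thesis using that by simp
    qed
    show ?thesis
    proof (rule injI)
      fix i j assume "L i = L j"
      then show "i = j" using le[of i j] le[of j i] by (cases "i \<le> j") auto
    qed
  qed
  ultimately show ?thesis by blast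
qed

end

text \<open>Applied later to the vertices fixed by \<open>a\<close>, which form a tree on which the
  centralizer of \<open>a\<close> acts.\<close>

lemma (in tree) fixed_subtree:
  assumes f: "automorphism f"
  shows "tree {v \<in> V. f v = v} (\<lambda>u v. adj u v \<and> f u = u \<and> f v = v)"
proof
  fix u v assume uv: "u \<in> {v \<in> V. f v = v}" "v \<in> {v \<in> V. f v = v}"
  then obtain xs where xs: "geod u xs v" using geod_exists by blast
  have "\<forall>x\<in>set xs. f x = x" using fixed_geod[OF f xs] uv by auto
  then have "successively (\<lambda>u v. adj u v \<and> f u = u \<and> f v = v) xs"
    using xs successively_mono[of adj xs "\<lambda>u v. adj u v \<and> f u = u \<and> f v = v"] by (auto simp: geod_def)
  then show "\<exists>xs. xs \<noteq> [] \<and> hd xs = u \<and> last xs = v \<and> successively (\<lambda>u v. adj u v \<and> f u = u \<and> f v = v) xs"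
    using xs by (auto simp: geod_def)
next
  fix xs assume "xs \<noteq> []" "successively (\<lambda>u v. adj u v \<and> f u = u \<and> f v = v) xs"
    "nonbacktracking xs" "hd xs = last xs"
  then show "length xs = 1" using acyclic[of xs] by (auto intro: successively_mono)
qed (auto dest: adj_sym adj_V)

lemma (in tree) fixed_subtree_automorphism:
  assumes f: "automorphism f" and h: "automorphism h" and comm: "\<And>v. v \<in> V \<Longrightarrow> f (h v) = h (f v)"
  shows "tree.automorphism {v \<in> V. f v = v} (\<lambda>u v. adj u v \<and> f u = u \<and> f v = v) h"
proof -
  interpret F: tree "{v \<in> V. f v = v}" "\<lambda>u v. adj u v \<and> f u = u \<and> f v = v" by (rule fixed_subtree[OF f])
  have bij: "bij_betw h V V" using h by (simp add: automorphism_def)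
  have "bij_betw h {v \<in> V. f v = v} {v \<in> V. f v = v}"
  proof (rule bij_betw_imageI)
    show "inj_on h {v \<in> V. f v = v}" using bij by (auto simp: bij_betw_def inj_on_def)
    show "h ` {v \<in> V. f v = v} = {v \<in> V. f v = v}"
    proof (intro subset_antisym subsetI)
      fix v assume v: "v \<in> {v \<in> V. f v = v}"
      then obtain u where u: "u \<in> V" "v = h u" using bij by (auto simp: bij_betw_def)
      then have "h (f u) = h u" using comm[OF u(1)] v by simp
      then have "f u = u" using automorphism_inj[OF h] automorphism_V[OF f u(1)] u(1) by blast
      then show "v \<in> h ` {v \<in> V. f v = v}" using u by blast
    qed (use comm automorphism_V[OF h] in auto)
  qed
  moreover have "f (h u) = h u" if "adj u v" "f u = u" for u v
    using comm[OF adj_V[OF that(1)]] that(2) by simp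
  ultimately show ?thesis using h adj_sym unfolding F.automorphism_def automorphism_def by blast
qed


section \<open>Edge lists up to homotopy\<close>

text \<open>
  Homotopy of edge paths is generated by the reductions below: deletion of \<open>e e\<^sup>-\<^sup>1\<close> and an
  exchange of two independent edges that moves the left one to the front. This system terminates
  and is confluent on arbitrary lists of edges, whether or not they form paths.
\<close>

inductive reduce2 :: "'a squier_edge \<Rightarrow> 'a squier_edge \<Rightarrow> 'a squier_edge list \<Rightarrow> bool" where
  deletion: "reduce2 x (squier_inv x) []"
| exchange: "l \<noteq> [] \<Longrightarrow> r \<noteq> [] \<Longrightarrow> u \<noteq> [] \<Longrightarrow> v \<noteq> [] \<Longrightarrow>
    reduce2 (p @ l @ z, u, v, q) (p, l, r, z @ v @ q) [(p, l, r, z @ u @ q), (p @ r @ z, u, v, q)]"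

definition reduce1 :: "'a squier_edge list \<Rightarrow> 'a squier_edge list \<Rightarrow> bool" where
  "reduce1 s t \<longleftrightarrow> (\<exists>a x y rs b. reduce2 x y rs \<and> s = a @ [x, y] @ b \<and> t = a @ rs @ b)"

lemma squier_inv_inv [simp]: "squier_inv (squier_inv x) = x"
  by (cases x) simp

lemma reduce1_context: "reduce1 s t \<Longrightarrow> reduce1 (a @ s @ b) (a @ t @ b)"
  unfolding reduce1_def by (metis append.assoc)

lemma reduces_context: "reduce1\<^sup>*\<^sup>* s t \<Longrightarrow> reduce1\<^sup>*\<^sup>* (a @ s @ b) (a @ t @ b)"
  by (induction rule: rtranclp_induct) (auto intro: reduce1_context rtranclp.rtrancl_into_rtrancl)

lemma reduce2_reduce1: "reduce2 x y rs \<Longrightarrow> reduce1 (a @ x # y # b) (a @ rs @ b)"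
  unfolding reduce1_def by fastforce

lemma reduce1_trans [trans]:
  "reduce1 s t \<Longrightarrow> reduce1 t u \<Longrightarrow> reduce1\<^sup>*\<^sup>* s u"
  "reduce1\<^sup>*\<^sup>* s t \<Longrightarrow> reduce1 t u \<Longrightarrow> reduce1\<^sup>*\<^sup>* s u"
  by auto

lemma reduce2_deterministic: "reduce2 x y rs \<Longrightarrow> reduce2 x y rs' \<Longrightarrow> rs = rs'"
  by (auto elim!: reduce2.cases)

text \<open>These are the critical pairs. Two overlapping exchanges concern three pairwise
  independent edges, and both orders of reduction sort them from left to right. When a deletion
  overlaps an exchange, the third edge is moved past an edge and its inverse.\<close>

lemma reduce2_overlap:
  assumes "reduce2 x y rs1" "reduce2 y w rs2"
  shows "\<exists>t. reduce1\<^sup>*\<^sup>* (rs1 @ [w]) t \<and> reduce1\<^sup>*\<^sup>* (x # rs2) t"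
  using assms(1)
proof cases
  case 1: deletion
  show ?thesis using assms(2)
  proof cases
    case deletion
    then show ?thesis using 1 by auto
  next
    case (exchange l r u v p z q)
    have x: "x = (p @ l @ z, v, u, q)" using 1 exchange by (metis squier_inv.simps squier_inv_inv)
    have "reduce1 (x # rs2) ([] @ [(p, l, r, z @ v @ q), (p @ r @ z, v, u, q)] @ [(p @ r @ z, u, v, q)])"
      unfolding exchange x using reduce2_reduce1[OF reduce2.exchange[OF exchange(4,5,7,6)], of "[]"] by simp
    also have "reduce1 \<dots> ([(p, l, r, z @ v @ q)] @ [])"
      using reduce2_reduce1[OF deletion[of "(p @ r @ z, v, u, q)"], of "[(p, l, r, z @ v @ q)]" "[]"] by simp
    finally have "reduce1\<^sup>*\<^sup>* (x # rs2) [w]" using exchange by simp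
    then show ?thesis using 1 by auto
  qed
next
  case 1: (exchange l r u v p z q)
  show ?thesis using assms(2)
  proof cases
    case deletion
    have "reduce1 (rs1 @ [w]) ([(p, l, r, z @ u @ q)] @ [(p, r, l, z @ u @ q), (p @ l @ z, u, v, q)] @ [])"
      unfolding 1 deletion
      using reduce2_reduce1[OF reduce2.exchange[OF 1(5,4,6,7)], of "[(p, l, r, z @ u @ q)]" p z q "[]"] by simp
    also have "reduce1 \<dots> ([] @ [] @ [(p @ l @ z, u, v, q)])"
      using reduce2_reduce1[OF reduce2.deletion[of "(p, l, r, z @ u @ q)"], of "[]" "[(p @ l @ z, u, v, q)]"]
      by simp
    finally have "reduce1\<^sup>*\<^sup>* (rs1 @ [w]) [x]" using 1 by simp
    then show ?thesis using deletion by auto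
  next
    case 2: (exchange l2 r2 u2 v2 p2 z2 q2)
    have eqs: "p = p2 @ l2 @ z2" "u2 = l" "v2 = r" "q2 = z @ v @ q" using 1(2) 2(1) by auto
    let ?A = "(p2, l2, r2, z2 @ l @ z @ u @ q)" and ?B = "(p2 @ r2 @ z2, l, r, z @ u @ q)"
      and ?C = "(p2 @ r2 @ z2 @ r @ z, u, v, q)"
    have "reduce1 (rs1 @ [w]) ([(p, l, r, z @ u @ q)] @ [(p2, l2, r2, z2 @ r @ z @ u @ q), ?C] @ [])"
      using reduce2_reduce1[OF reduce2.exchange[OF 2(4,5) 1(6,7)], of "[(p, l, r, z @ u @ q)]" p2 "z2 @ r @ z" q "[]"]
        1 2 eqs by simp
    also have "reduce1 \<dots> ([?A, ?B] @ [?C])"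
      using reduce2_reduce1[OF reduce2.exchange[OF 2(4,5) 1(4,5)], of "[]" p2 "z2" "z @ u @ q" "[?C]"] eqs by simp
    finally have L: "reduce1\<^sup>*\<^sup>* (rs1 @ [w]) [?A, ?B, ?C]" by simp
    have "reduce1 (x # rs') ([] @ [?A, (p2 @ r2 @ z2 @ l @ z, u, v, q)] @ [(p2 @ r2 @ z2, l, r, z @ v @ q)])"
      if "rs' = [(p2, l2, r2, z2 @ u2 @ q2), (p2 @ r2 @ z2, u2, v2, q2)]" for rs'
      using reduce2_reduce1[OF reduce2.exchange[OF 2(4,5) 1(6,7)], of "[]" p2 "z2 @ l @ z" q "[(p2 @ r2 @ z2, l, r, z @ v @ q)]"]
        1 eqs that by simp
    from this[OF 2(3)]
    have "reduce1 (x # rs2) ([] @ [?A, (p2 @ r2 @ z2 @ l @ z, u, v, q)] @ [(p2 @ r2 @ z2, l, r, z @ v @ q)])" .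
    also have "reduce1 \<dots> ([?A] @ [?B, ?C] @ [])"
      using reduce2_reduce1[OF reduce2.exchange[OF 1(4,5,6,7)], of "[?A]" "p2 @ r2 @ z2" z q "[]"] by simp
    finally have "reduce1\<^sup>*\<^sup>* (x # rs2) [?A, ?B, ?C]" by simp
    with L show ?thesis by blast
  qed
qed

lemma reduce1_locally_confluent:
  assumes "reduce1 s t1" "reduce1 s t2"
  shows "\<exists>t. reduce1\<^sup>*\<^sup>* t1 t \<and> reduce1\<^sup>*\<^sup>* t2 t"
proof -
  have main: "\<exists>t. reduce1\<^sup>*\<^sup>* (a1 @ r1 @ b1) t \<and> reduce1\<^sup>*\<^sup>* (a2 @ r2 @ b2) t"
    if eq: "a1 @ [x1, y1] @ b1 = a2 @ [x2, y2] @ b2" and len: "length a1 \<le> length a2"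
      and red: "reduce2 x1 y1 r1" "reduce2 x2 y2 r2"
    for a1 x1 y1 b1 a2 x2 y2 b2 :: "_" and r1 r2 :: "'a squier_edge list"
  proof -
    obtain c where c: "a2 = a1 @ c" "x1 # y1 # b1 = c @ [x2, y2] @ b2"
      using eq len by (auto simp: append_eq_append_conv2)
    consider "c = []" | "c = [x1]" | c' where "c = x1 # y1 # c'"
      using c(2) by (cases c rule: remdups_adj.cases) auto
    then show ?thesis
    proof cases
      case 1
      then show ?thesis using c red reduce2_deterministic by fastforce
    next
      case 2
      then have y: "y1 = x2" "b1 = y2 # b2" using c by auto
      obtain t where "reduce1\<^sup>*\<^sup>* (r1 @ [y2]) t" "reduce1\<^sup>*\<^sup>* (x1 # r2) t"
        using reduce2_overlap red y by blast
      then have "reduce1\<^sup>*\<^sup>* (a1 @ (r1 @ [y2]) @ b2) (a1 @ t @ b2)" "reduce1\<^sup>*\<^sup>* (a1 @ (x1 # r2) @ b2) (a1 @ t @ b2)"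
        using reduces_context by blast+
      then show ?thesis using y c 2 by auto
    next
      case 3
      then have b: "b1 = c' @ [x2, y2] @ b2" using c by simp
      have "reduce1 (a1 @ r1 @ b1) (a1 @ r1 @ c' @ r2 @ b2)"
        using reduce2_reduce1[OF red(2), of "a1 @ r1 @ c'" b2] b by simp
      moreover have "reduce1 (a2 @ r2 @ b2) (a1 @ r1 @ c' @ r2 @ b2)"
        using reduce2_reduce1[OF red(1), of "a1" "c' @ r2 @ b2"] c 3 by simp
      ultimately show ?thesis by blast
    qed
  qed
  obtain a1 x1 y1 r1 b1 where 1: "reduce2 x1 y1 r1" "s = a1 @ [x1, y1] @ b1" "t1 = a1 @ r1 @ b1"
    using assms(1) unfolding reduce1_def by blast
  obtain a2 x2 y2 r2 b2 where 2: "reduce2 x2 y2 r2" "s = a2 @ [x2, y2] @ b2" "t2 = a2 @ r2 @ b2"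
    using assms(2) unfolding reduce1_def by blast
  show ?thesis
  proof (cases "length a1 \<le> length a2")
    case True
    have "a1 @ [x1, y1] @ b1 = a2 @ [x2, y2] @ b2" using 1 2 by simp
    from main[OF this True 1(1) 2(1)] show ?thesis using 1 2 by simp
  next
    case False
    have "a2 @ [x2, y2] @ b2 = a1 @ [x1, y1] @ b1" using 1 2 by simp
    from main[OF this _ 2(1) 1(1)] show ?thesis using 1 2 False by auto
  qed
qed

lemma reduce2_length: "reduce2 x y rs \<Longrightarrow> length rs \<le> 2"
  by (auto elim: reduce2.cases)

lemma reduce1_length: "reduce1 s t \<Longrightarrow> length t \<le> length s"
  using reduce2_length by (fastforce simp: reduce1_def)

lemma reduces_length: "reduce1\<^sup>*\<^sup>* s t \<Longrightarrow> length t \<le> length s"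
  by (induction rule: rtranclp_induct) (auto dest: reduce1_length)

text \<open>An exchange lowers the lengths of the left contexts lexicographically.\<close>

lemma wf_reduce1: "wf {(t, s). reduce1 s t}"
proof (rule wf_subset)
  show "wf (inv_image (lenlex less_than) (map (\<lambda>(p, _). length p) :: 'a squier_edge list \<Rightarrow> nat list))"
    by (intro wf_inv_image wf_lenlex) simp
  show "{(t, s). reduce1 s t} \<subseteq> inv_image (lenlex less_than) (map (\<lambda>(p, _). length p) :: 'a squier_edge list \<Rightarrow> nat list)"
  proof clarify
    fix t s :: "'a squier_edge list"
    assume "reduce1 s t"
    then obtain a x y rs b where *: "reduce2 x y rs" "s = a @ [x, y] @ b" "t = a @ rs @ b"
      unfolding reduce1_def by blast
    from *(1) show "(t, s) \<in> inv_image (lenlex less_than) (map (\<lambda>(p, _). length p))"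
    proof cases
      case deletion
      then show ?thesis using * by (simp add: lenlex_conv)
    next
      case (exchange l r u v p z q)
      \<comment> \<open>The edge that comes to the front has the strictly shorter left context, as
        \<open>l\<close> is non-empty.\<close>
      have "(map (\<lambda>(p, _). length p) rs, map (\<lambda>(p, _). length p) [x, y]) \<in> lex less_than"
        unfolding exchange(1-3) using exchange(4) by (cases l) auto
      then have "(map (\<lambda>(p, _). length p) (rs @ b), map (\<lambda>(p, _). length p) ([x, y] @ b)) \<in> lex less_than"
        unfolding map_append by (rule lex_append_rightI) (simp add: exchange)
      then have "(map (\<lambda>(p, _). length p) t, map (\<lambda>(p, _). length p) s) \<in> lex less_than"
        unfolding *(2,3) map_append by (rule lex_append_leftI)
      moreover have "length t = length s" using * exchange by simp
      ultimately show ?thesis by (simp add: lenlex_conv)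
    qed
  qed
qed

text \<open>Newman's lemma, by well-founded induction on \<open>s\<close>.\<close>

lemma reduce1_confluent: "reduce1\<^sup>*\<^sup>* s t1 \<Longrightarrow> reduce1\<^sup>*\<^sup>* s t2 \<Longrightarrow> \<exists>t. reduce1\<^sup>*\<^sup>* t1 t \<and> reduce1\<^sup>*\<^sup>* t2 t"
proof (induction s arbitrary: t1 t2 rule: wf_induct_rule[OF wf_reduce1])
  case (1 s)
  show ?case
  proof (cases "s = t1 \<or> s = t2")
    case True
    then show ?thesis using 1(2,3) by (metis rtranclp.rtrancl_refl)
  next
    case False
    obtain s1 where s1: "reduce1 s s1" "reduce1\<^sup>*\<^sup>* s1 t1"
      using 1(2) False by (auto elim: converse_rtranclpE)
    obtain s2 where s2: "reduce1 s s2" "reduce1\<^sup>*\<^sup>* s2 t2"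
      using 1(3) False by (auto elim: converse_rtranclpE)
    obtain u where u: "reduce1\<^sup>*\<^sup>* s1 u" "reduce1\<^sup>*\<^sup>* s2 u"
      using reduce1_locally_confluent[OF s1(1) s2(1)] by blast
    have "(s1, s) \<in> {(t, s). reduce1 s t}" "(s2, s) \<in> {(t, s). reduce1 s t}" using s1 s2 by simp_all
    note IH = 1(1)[OF this(1)] 1(1)[OF this(2)]
    obtain v1 where v1: "reduce1\<^sup>*\<^sup>* t1 v1" "reduce1\<^sup>*\<^sup>* u v1" using IH(1)[OF s1(2) u(1)] by blast
    have "reduce1\<^sup>*\<^sup>* s2 v1" using u(2) v1(2) by (rule rtranclp_trans)
    then obtain w where w: "reduce1\<^sup>*\<^sup>* t2 w" "reduce1\<^sup>*\<^sup>* v1 w" using IH(2)[OF s2(2)] by blast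
    have "reduce1\<^sup>*\<^sup>* t1 w" using v1(1) w(2) by (rule rtranclp_trans)
    with w(1) show ?thesis by blast
  qed
qed

section \<open>The group of edge lists up to homotopy\<close>

abbreviation homotopic :: "'a squier_edge list \<Rightarrow> 'a squier_edge list \<Rightarrow> bool" where
  "homotopic \<equiv> equivclp reduce1"

lemma homotopic_iff: "homotopic s t \<longleftrightarrow> (\<exists>w. reduce1\<^sup>*\<^sup>* s w \<and> reduce1\<^sup>*\<^sup>* t w)"
proof -
  have "semiconfluentp (reduce1 :: 'a squier_edge list \<Rightarrow> _)"
    by (rule semiconfluentpI) (rule reduce1_confluent[OF r_into_rtranclp])
  then show ?thesis by (auto simp: semiconfluentp_equivclp relcompp_apply rtranclp_conversep)
qed

lemma homotopic_map:
  assumes "\<And>s t. reduce1 s t \<Longrightarrow> homotopic (f s) (f t)" "homotopic s t"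
  shows "homotopic (f s) (f t)"
  using assms(2)
proof (induction rule: equivclp_induct)
  case (step y z)
  then have "homotopic (f y) (f z)" using assms(1) by (auto intro: equivclp_sym)
  with step.IH show ?case by (rule equivclp_trans)
qed simp

lemma homotopic_context: "homotopic s t \<Longrightarrow> homotopic (a @ s @ b) (a @ t @ b)"
  by (rule homotopic_map[of "\<lambda>s. a @ s @ b"]) (auto intro: reduce1_context)

lemma homotopic_append: "homotopic s s' \<Longrightarrow> homotopic t t' \<Longrightarrow> homotopic (s @ t) (s' @ t')"
  using homotopic_context[of s s' "[]" t] homotopic_context[of t t' s' "[]"] equivclp_trans by fastforce

definition path_inv :: "'a squier_edge list \<Rightarrow> 'a squier_edge list" where
  "path_inv s = rev (map squier_inv s)"

lemma path_inv_simps [simp]: "path_inv [] = []" "path_inv (s @ t) = path_inv t @ path_inv s"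
  "path_inv [e] = [squier_inv e]" "path_inv (e # s) = path_inv s @ [squier_inv e]"
  by (simp_all add: path_inv_def)

lemma homotopic_path_inv:
  assumes "homotopic s t"
  shows "homotopic (path_inv s) (path_inv t)"
  using _ assms
proof (rule homotopic_map)
  fix s t :: "'a squier_edge list"
  assume "reduce1 s t"
  then obtain a x y rs b where *: "reduce2 x y rs" "s = a @ [x, y] @ b" "t = a @ rs @ b"
    unfolding reduce1_def by blast
  have "homotopic (path_inv [x, y]) (path_inv rs)"
    using *(1)
  proof cases
    case deletion
    then show ?thesis using reduce2_reduce1[OF reduce2.deletion[of x], of "[]" "[]"] by auto
  next
    case (exchange l r u v p z q)
    then show ?thesis
      using reduce2_reduce1[OF reduce2.exchange[OF exchange(5,4,7,6)], of "[]" p z q "[]"]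
      by (auto intro: equivclp_sym)
  qed
  then show "homotopic (path_inv s) (path_inv t)"
    unfolding * path_inv_simps(2) append.assoc by (rule homotopic_context)
qed

lemma homotopic_inverse: "homotopic (path_inv s @ s) []"
proof (induction s)
  case (Cons e s)
  have "homotopic (path_inv s @ [squier_inv e, e] @ s) (path_inv s @ [] @ s)"
    using reduce2_reduce1[OF deletion[of "squier_inv e"], of "path_inv s" s] by auto
  then show ?case using Cons by (auto intro: equivclp_trans)
qed simp

\<comment> \<open>Without end points the groupoid of path classes becomes a subset of one group, so
  inverses and conjugation are available from the class \<open>group_add\<close>, whose addition
  need not commute.\<close>
quotient_type 'a diagram = "'a squier_edge list" / homotopic
  by (rule equivp_evquivclp)

instantiation diagram :: (type) group_add
begin

lift_definition zero_diagram :: "'a diagram" is "[]" .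
lift_definition plus_diagram :: "'a diagram \<Rightarrow> 'a diagram \<Rightarrow> 'a diagram" is "(@)"
  by (rule homotopic_append)
lift_definition uminus_diagram :: "'a diagram \<Rightarrow> 'a diagram" is path_inv
  by (rule homotopic_path_inv)
definition minus_diagram :: "'a diagram \<Rightarrow> 'a diagram \<Rightarrow> 'a diagram" where
  "minus_diagram a b = a + - b"

instance
proof
  fix a b c :: "'a diagram"
  show "a + b + c = a + (b + c)" by transfer simp
  show "0 + a = a" by transfer simp
  show "a + 0 = a" by transfer simp
  show "- a + a = 0" by transfer (rule homotopic_inverse)
  show "a + - b = a - b" by (simp add: minus_diagram_def)
qed

end

lift_definition dg :: "'a squier_edge list \<Rightarrow> 'a diagram" is "\<lambda>s. s" .

lemma dg_eq_iff: "dg s = dg t \<longleftrightarrow> homotopic s t"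
  by transfer simp

lemma dg_append: "dg (s @ t) = dg s + dg t"
  by transfer simp

lemma dg_Nil: "dg [] = 0"
  by transfer simp

lemma dg_Cons: "dg (e # s) = dg [e] + dg s"
  using dg_append[of "[e]" s] by simp

lemma dg_path_inv: "dg (path_inv s) = - dg s"
  by transfer simp

lemma dg_surj: "\<exists>s. g = dg s"
  by transfer auto

lemma dg_reduces: "reduce1\<^sup>*\<^sup>* s t \<Longrightarrow> dg s = dg t"
  unfolding dg_eq_iff homotopic_iff by blast

section \<open>Shifts by a context, and mirror images\<close>

fun shift_left :: "'a list \<Rightarrow> 'a squier_edge \<Rightarrow> 'a squier_edge" where
  "shift_left x (p, u, v, q) = (x @ p, u, v, q)"

fun shift_right :: "'a list \<Rightarrow> 'a squier_edge \<Rightarrow> 'a squier_edge" where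
  "shift_right y (p, u, v, q) = (p, u, v, q @ y)"

fun mirror_edge :: "'a squier_edge \<Rightarrow> 'a squier_edge" where
  "mirror_edge (p, u, v, q) = (rev q, rev u, rev v, rev p)"

lemma shift_squier_inv [simp]:
  "shift_left w (squier_inv x) = squier_inv (shift_left w x)"
  "shift_right w (squier_inv x) = squier_inv (shift_right w x)"
  "mirror_edge (squier_inv x) = squier_inv (mirror_edge x)"
  by (cases x; simp)+

lemma reduce2_shift_left: "reduce2 x y rs \<Longrightarrow> reduce2 (shift_left w x) (shift_left w y) (map (shift_left w) rs)"
proof (induction rule: reduce2.induct)
  case (exchange l r u v p z q)
  then show ?case using reduce2.exchange[of l r u v "w @ p" z q] by simp
qed (simp add: reduce2.deletion)

lemma reduce2_shift_right: "reduce2 x y rs \<Longrightarrow> reduce2 (shift_right w x) (shift_right w y) (map (shift_right w) rs)"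
proof (induction rule: reduce2.induct)
  case (exchange l r u v p z q)
  then show ?case using reduce2.exchange[of l r u v p z "q @ w"] by simp
qed (simp add: reduce2.deletion)

lemma reduce1_map:
  assumes "\<And>x y rs. reduce2 x y rs \<Longrightarrow> reduce2 (f x) (f y) (map f rs)" "reduce1 s t"
  shows "reduce1 (map f s) (map f t)"
proof -
  obtain a x y rs b where *: "reduce2 x y rs" "s = a @ [x, y] @ b" "t = a @ rs @ b"
    using assms(2) unfolding reduce1_def by blast
  show ?thesis using reduce2_reduce1[OF assms(1)[OF *(1)], of "map f a" "map f b"] * by simp
qed

lift_definition lsh :: "'a list \<Rightarrow> 'a diagram \<Rightarrow> 'a diagram" is "\<lambda>x. map (shift_left x)"
  by (rule homotopic_map) (auto intro: reduce1_map reduce2_shift_left)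

lift_definition rsh :: "'a list \<Rightarrow> 'a diagram \<Rightarrow> 'a diagram" is "\<lambda>x. map (shift_right x)"
  by (rule homotopic_map) (auto intro: reduce1_map reduce2_shift_right)

text \<open>The mirror image of an exchange is an exchange backwards, so only the generated
  equivalence is preserved and not \<open>reduce1\<close> itself.\<close>

lemma homotopic_mirror: "homotopic s t \<Longrightarrow> homotopic (map mirror_edge s) (map mirror_edge t)"
proof (rule homotopic_map[of "map mirror_edge"])
  fix s t :: "'a squier_edge list"
  assume "reduce1 s t"
  then obtain a x y rs b where *: "reduce2 x y rs" "s = a @ [x, y] @ b" "t = a @ rs @ b"
    unfolding reduce1_def by blast
  have "homotopic (map mirror_edge [x, y]) (map mirror_edge rs)"
    using *(1)
  proof cases
    case deletion
    then show ?thesis using deletion reduce2_reduce1[OF reduce2.deletion[of "mirror_edge x"], of "[]" "[]"] by auto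
  next
    case (exchange l r u v p z q)
    then show ?thesis
      using reduce2_reduce1[OF reduce2.exchange[of "rev u" "rev v" "rev l" "rev r"], of "[]" "rev q" "rev z" "rev p" "[]"]
      by (auto intro!: equivclp_sym[OF r_into_equivclp])
  qed
  then show "homotopic (map mirror_edge s) (map mirror_edge t)"
    unfolding * map_append by (rule homotopic_context)
qed

lift_definition mirror :: "'a diagram \<Rightarrow> 'a diagram" is "map mirror_edge"
  by (rule homotopic_mirror)

lemma lsh_dg: "lsh x (dg s) = dg (map (shift_left x) s)" by transfer simp
lemma rsh_dg: "rsh x (dg s) = dg (map (shift_right x) s)" by transfer simp
lemma mirror_dg: "mirror (dg s) = dg (map mirror_edge s)" by transfer simp

lemma lsh_add: "lsh x (g + h) = lsh x g + lsh x h" by transfer simp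
lemma rsh_add: "rsh x (g + h) = rsh x g + rsh x h" by transfer simp
lemma mirror_add: "mirror (g + h) = mirror g + mirror h" by transfer simp
lemma lsh_0 [simp]: "lsh x 0 = 0" by transfer simp
lemma rsh_0 [simp]: "rsh x 0 = 0" by transfer simp
lemma mirror_0 [simp]: "mirror 0 = 0" by transfer simp

lemma hom_minus:
  fixes f :: "'b::group_add \<Rightarrow> 'c::group_add"
  assumes "\<And>g h. f (g + h) = f g + f h"
  shows "f (- g) = - f g"
proof -
  have "f 0 + f 0 = f 0" using assms[of 0 0] by simp
  then have "f 0 = 0" by (metis add.right_neutral add_left_cancel)
  then have "f (- g) + f g = 0" using assms[of "- g" g] by simp
  then show ?thesis by (simp add: eq_neg_iff_add_eq_0)
qed

lemma lsh_minus: "lsh x (- g) = - lsh x g" by (rule hom_minus) (rule lsh_add)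
lemma rsh_minus: "rsh x (- g) = - rsh x g" by (rule hom_minus) (rule rsh_add)
lemma mirror_minus: "mirror (- g) = - mirror g" by (rule hom_minus) (rule mirror_add)

lemma lsh_lsh: "lsh x (lsh y g) = lsh (x @ y) g"
proof -
  obtain s where "g = dg s" using dg_surj by blast
  moreover have "shift_left x (shift_left y e) = shift_left (x @ y) e" for e :: "'a squier_edge" by (cases e) simp
  ultimately show ?thesis by (simp add: lsh_dg comp_def)
qed

lemma rsh_rsh: "rsh x (rsh y g) = rsh (y @ x) g"
proof -
  obtain s where "g = dg s" using dg_surj by blast
  moreover have "shift_right x (shift_right y e) = shift_right (y @ x) e" for e :: "'a squier_edge" by (cases e) simp
  ultimately show ?thesis by (simp add: rsh_dg comp_def)
qed

lemma lsh_rsh: "lsh x (rsh y g) = rsh y (lsh x g)"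
proof -
  obtain s where "g = dg s" using dg_surj by blast
  moreover have "shift_left x (shift_right y e) = shift_right y (shift_left x e)" for e :: "'a squier_edge" by (cases e) simp
  ultimately show ?thesis by (simp add: lsh_dg rsh_dg comp_def)
qed

lemma lsh_Nil [simp]: "lsh [] g = g"
proof -
  obtain s where "g = dg s" using dg_surj by blast
  moreover have "shift_left [] = (\<lambda>e :: 'a squier_edge. e)" by auto
  ultimately show ?thesis by (simp add: lsh_dg comp_def)
qed

lemma rsh_Nil [simp]: "rsh [] g = g"
proof -
  obtain s where "g = dg s" using dg_surj by blast
  moreover have "shift_right [] = (\<lambda>e :: 'a squier_edge. e)" by auto
  ultimately show ?thesis by (simp add: rsh_dg comp_def)
qed

lemma mirror_mirror [simp]: "mirror (mirror g) = g"
proof -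
  obtain s where "g = dg s" using dg_surj by blast
  moreover have "mirror_edge \<circ> mirror_edge = (\<lambda>e :: 'a squier_edge. e)" by auto
  ultimately show ?thesis by (simp add: mirror_dg)
qed

lemma mirror_lsh: "mirror (lsh x g) = rsh (rev x) (mirror g)"
proof -
  obtain s where "g = dg s" using dg_surj by blast
  moreover have "mirror_edge (shift_left x e) = shift_right (rev x) (mirror_edge e)" for e :: "'a squier_edge" by (cases e) simp
  ultimately show ?thesis by (simp add: lsh_dg rsh_dg mirror_dg comp_def)
qed

lemma mirror_rsh: "mirror (rsh x g) = lsh (rev x) (mirror g)"
proof -
  have "mirror (lsh (rev x) (mirror g)) = rsh x g" by (simp add: mirror_lsh)
  then show ?thesis by (metis mirror_mirror)
qed

lemma reduce2_shift_leftD: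
  assumes "reduce2 (shift_left w x) (shift_left w y) rs"
  shows "\<exists>rs'. rs = map (shift_left w) rs' \<and> reduce2 x y rs'"
  using assms
proof cases
  case deletion
  then have "y = squier_inv x" by (cases x; cases y) auto
  then show ?thesis using deletion reduce2.deletion[of x] by auto
next
  case (exchange l r u v p z q)
  obtain p' where y: "y = (p', l, r, z @ v @ q)" "p = w @ p'" using exchange(2) by (cases y) auto
  then have x: "x = (p' @ l @ z, u, v, q)" using exchange(1) by (cases x) auto
  show ?thesis using reduce2.exchange[OF exchange(4-7), of p' z q] exchange(3) x y
    by (intro exI[of _ "[(p', l, r, z @ u @ q), (p' @ r @ z, u, v, q)]"]) simp
qed

lemma reduce2_shift_rightD:
  assumes "reduce2 (shift_right w x) (shift_right w y) rs"
  shows "\<exists>rs'. rs = map (shift_right w) rs' \<and> reduce2 x y rs'"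
  using assms
proof cases
  case deletion
  then have "y = squier_inv x" by (cases x; cases y) auto
  then show ?thesis using deletion reduce2.deletion[of x] by auto
next
  case (exchange l r u v p z q)
  obtain q' where x: "x = (p @ l @ z, u, v, q')" "q = q' @ w" using exchange(1) by (cases x) auto
  then have y: "y = (p, l, r, z @ v @ q')" using exchange(2) by (cases y) auto
  show ?thesis using reduce2.exchange[OF exchange(4-7), of p z q'] exchange(3) x y
    by (intro exI[of _ "[(p, l, r, z @ u @ q'), (p @ r @ z, u, v, q')]"]) simp
qed

lemma reduce1_mapD:
  assumes "\<And>x y rs. reduce2 (f x) (f y) rs \<Longrightarrow> \<exists>rs'. rs = map f rs' \<and> reduce2 x y rs'"
    and "reduce1 (map f s) t"
  shows "\<exists>t'. t = map f t' \<and> reduce1 s t'"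
proof -
  obtain a x y rs b where *: "reduce2 x y rs" "map f s = a @ [x, y] @ b" "t = a @ rs @ b"
    using assms(2) unfolding reduce1_def by blast
  obtain a' x' y' b' where s: "s = a' @ [x', y'] @ b'" "a = map f a'" "x = f x'" "y = f y'" "b = map f b'"
    using *(2) by (auto simp: map_eq_append_conv map_eq_Cons_conv)
  obtain rs' where "rs = map f rs'" "reduce2 x' y' rs'" using assms(1) *(1) s by blast
  then have "t = map f (a' @ rs' @ b')" "reduce1 s (a' @ rs' @ b')"
    using s * reduce2_reduce1[of x' y' rs' a' b'] by simp_all
  then show ?thesis by blast
qed

lemma reduces_mapD:
  assumes "\<And>x y rs. reduce2 (f x) (f y) rs \<Longrightarrow> \<exists>rs'. rs = map f rs' \<and> reduce2 x y rs'"
    and "reduce1\<^sup>*\<^sup>* (map f s) t"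
  shows "\<exists>t'. t = map f t' \<and> reduce1\<^sup>*\<^sup>* s t'"
  using assms(2)
proof (induction rule: rtranclp_induct)
  case base
  then show ?case by blast
next
  case (step t u)
  then obtain t' where t': "t = map f t'" "reduce1\<^sup>*\<^sup>* s t'" by blast
  then obtain u' where "u = map f u'" "reduce1 t' u'" using reduce1_mapD[OF assms(1)] step(2) by blast
  moreover from this t'(2) have "reduce1\<^sup>*\<^sup>* s u'" by simp
  ultimately show ?case by blast
qed

lemma shift_left_inj: "inj (shift_left x)"
  by (rule injI) auto

text \<open>Each reduction of a shifted list is a shifted reduction. A common reduct of two shifted
  lists is therefore shifted and can be pulled back.\<close>

lemma lsh_inj [simp]: "lsh x g = lsh x h \<longleftrightarrow> g = h"
proof
  assume eq: "lsh x g = lsh x h"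
  obtain s t where st: "g = dg s" "h = dg t" using dg_surj by metis
  then obtain w where w: "reduce1\<^sup>*\<^sup>* (map (shift_left x) s) w" "reduce1\<^sup>*\<^sup>* (map (shift_left x) t) w"
    using eq by (auto simp: lsh_dg dg_eq_iff homotopic_iff)
  obtain s' t' where "w = map (shift_left x) s'" "reduce1\<^sup>*\<^sup>* s s'" "w = map (shift_left x) t'" "reduce1\<^sup>*\<^sup>* t t'"
    using reduces_mapD[OF reduce2_shift_leftD w(1)] reduces_mapD[OF reduce2_shift_leftD w(2)] by blast
  then have "reduce1\<^sup>*\<^sup>* s s'" "reduce1\<^sup>*\<^sup>* t s'" using shift_left_inj[of x] by auto
  then show "g = h" unfolding st using dg_reduces by metis
qed simp

lemma rsh_inj [simp]: "rsh x g = rsh x h \<longleftrightarrow> g = h"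
proof
  assume "rsh x g = rsh x h"
  then have "mirror (rsh x g) = mirror (rsh x h)" by simp
  then have "mirror g = mirror h" by (simp add: mirror_rsh)
  then have "mirror (mirror g) = mirror (mirror h)" by simp
  then show "g = h" by simp
qed simp

text \<open>A common reduct of \<open>s\<close> and a shifted list is itself shifted, and reductions
  never lengthen. The bound on the length drives the minimality arguments below.\<close>

lemma lsh_short:
  assumes "dg s = lsh x g"
  shows "\<exists>t. dg s = lsh x (dg t) \<and> length t \<le> length s \<and> reduce1\<^sup>*\<^sup>* s (map (shift_left x) t)"
proof -
  obtain r where "g = dg r" using dg_surj by blast
  then obtain w where w: "reduce1\<^sup>*\<^sup>* s w" "reduce1\<^sup>*\<^sup>* (map (shift_left x) r) w"
    using assms by (auto simp: lsh_dg dg_eq_iff homotopic_iff)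
  obtain t where t: "w = map (shift_left x) t" using reduces_mapD[OF reduce2_shift_leftD w(2)] by blast
  then show ?thesis using w(1) dg_reduces[OF w(1)] reduces_length[OF w(1)] by (auto simp: lsh_dg)
qed


section \<open>Trees given by signed edges\<close>

fun letter_ini :: "('e \<Rightarrow> 'v) \<Rightarrow> ('e \<Rightarrow> 'v) \<Rightarrow> 'e \<times> bool \<Rightarrow> 'v" where
  "letter_ini i t (e, s) = (if s then i e else t e)"

fun letter_walk :: "('e \<Rightarrow> 'v) \<Rightarrow> ('e \<Rightarrow> 'v) \<Rightarrow> 'v list \<Rightarrow> ('e \<times> bool) list \<Rightarrow> bool" where
  "letter_walk i t [x] w \<longleftrightarrow> w = []"
| "letter_walk i t (x # y # xs) (l # w) \<longleftrightarrow>
     letter_ini i t l = x \<and> letter_ini i t (flip l) = y \<and> letter_walk i t (y # xs) w"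
| "letter_walk i t _ _ \<longleftrightarrow> False"

lemma letter_walk_reduced:
  "letter_walk i t xs w \<Longrightarrow> nonbacktracking xs \<Longrightarrow> freely_reduced w"
proof (induction xs w rule: letter_walk.induct[of _ i t])
  case (2 i t x y xs l w)
  show ?case
  proof (cases w)
    case (Cons l' w')
    then obtain z zs where "xs = z # zs" "letter_ini i t (flip l') = z"
      using 2 by (cases xs) auto
    then have "l' \<noteq> flip l" using 2 by auto
    then show ?thesis using 2 Cons by (cases xs) (auto simp: nonbacktracking_Cons)
  qed simp
qed auto

text \<open>Both trees of the proof are known through their edges, where backtracking is a letter
  followed by its inverse. A vertex list without backtracking lifts to a freely reduced word, so it
  is enough to exclude closed reduced words.\<close>

lemma tree_of_edges:
  fixes i t :: "'e \<Rightarrow> 'v"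
  assumes ends: "\<And>e. e \<in> E \<Longrightarrow> i e \<in> V" "\<And>e. e \<in> E \<Longrightarrow> t e \<in> V"
    and adj: "\<And>u v. adj u v \<longleftrightarrow> (\<exists>l. fst l \<in> E \<and> letter_ini i t l = u \<and> letter_ini i t (flip l) = v)"
    and connected: "\<And>u v. u \<in> V \<Longrightarrow> v \<in> V \<Longrightarrow> \<exists>xs. xs \<noteq> [] \<and> hd xs = u \<and> last xs = v \<and> successively adj xs"
    and closed: "\<And>xs w. letter_walk i t xs w \<Longrightarrow> fst ` set w \<subseteq> E \<Longrightarrow> hd xs = last xs \<Longrightarrow> freely_reduced w \<Longrightarrow> w = []"
  shows "tree V adj"
proof
  fix u v assume "adj u v"
  then obtain e s where l: "e \<in> E" "letter_ini i t (e, s) = u" "letter_ini i t (e, \<not> s) = v"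
    unfolding adj by fastforce
  then have "fst (e, \<not> s) \<in> E \<and> letter_ini i t (e, \<not> s) = v \<and> letter_ini i t (flip (e, \<not> s)) = u" by simp
  then show "adj v u" unfolding adj by (rule exI)
  show "u \<in> V" using l(1,2) ends[OF l(1)] by (cases s) auto
next
  fix xs :: "'v list"
  assume xs: "xs \<noteq> []" "successively adj xs" "nonbacktracking xs" "hd xs = last xs"
  have "\<exists>w. letter_walk i t xs w \<and> fst ` set w \<subseteq> E" using xs(1,2)
  proof (induction xs rule: induct_list012)
    case (3 x y zs)
    then obtain w where w: "letter_walk i t (y # zs) w" "fst ` set w \<subseteq> E" by auto
    obtain l where "fst l \<in> E" "letter_ini i t l = x" "letter_ini i t (flip l) = y"
      using 3 adj by auto
    then show ?case using w by (intro exI[of _ "l # w"]) auto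
  qed auto
  then obtain w where w: "letter_walk i t xs w" "fst ` set w \<subseteq> E" by blast
  have "w = []" by (rule closed[OF w xs(4) letter_walk_reduced[OF w(1) xs(3)]])
  then show "length xs = 1" using w(1) by (cases "(i, t, xs, w)" rule: letter_walk.cases) auto
qed (rule connected)


section \<open>Diagrams over a presentation\<close>

locale presentation =
  fixes A :: "'a set" and R :: "'a list rel"
  assumes pres: "semigroup_presentation A R"
begin

abbreviation rel :: "'a list \<Rightarrow> 'a list \<Rightarrow> bool" where
  "rel u v \<equiv> (u, v) \<in> R \<or> (v, u) \<in> R"

lemma rel_words: "rel u v \<Longrightarrow> u \<in> lists A \<and> u \<noteq> [] \<and> v \<in> lists A \<and> v \<noteq> []"
  using pres by (auto simp: semigroup_presentation_def nonempty_words_def)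

lemma antisym: "(u, v) \<in> R \<Longrightarrow> (v, u) \<notin> R"
  using pres by (auto simp: semigroup_presentation_def)

fun path :: "'a list \<Rightarrow> 'a squier_edge list \<Rightarrow> 'a list \<Rightarrow> bool" where
  "path a [] b \<longleftrightarrow> a \<in> lists A \<and> a = b"
| "path a ((p, u, v, q) # s) b \<longleftrightarrow>
     p \<in> lists A \<and> q \<in> lists A \<and> rel u v \<and> a = p @ u @ q \<and> path (p @ v @ q) s b"

lemma path_words: "path a s b \<Longrightarrow> a \<in> lists A \<and> b \<in> lists A"
proof (induction s arbitrary: a)
  case (Cons e s)
  then show ?case using rel_words by (cases e) auto
qed simp

lemma path_append: "path a (s @ t) c \<longleftrightarrow> (\<exists>b. path a s b \<and> path b t c)"
proof (induction s arbitrary: a)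
  case Nil
  then show ?case using path_words[of a t c] by auto
next
  case (Cons e s)
  then show ?case by (cases e) auto
qed

lemma path_reduce2: "reduce2 x y rs \<Longrightarrow> path a [x, y] b \<Longrightarrow> path a rs b"
proof (induction rule: reduce2.induct)
  case (deletion x)
  then show ?case using rel_words by (cases x) auto
next
  case (exchange l r u v p z q)
  then show ?case using rel_words by (auto simp del: in_lists_conv_set)
qed

lemma path_reduce1: "reduce1 s t \<Longrightarrow> path a s b \<Longrightarrow> path a t b"
proof -
  assume "reduce1 s t" and ab: "path a s b"
  then obtain c x y rs d where *: "reduce2 x y rs" "s = c @ [x, y] @ d" "t = c @ rs @ d"
    unfolding reduce1_def by blast
  obtain a1 b1 where "path a c a1" "path a1 [x, y] b1" "path b1 d b"
    using ab unfolding *(2) path_append by blast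
  then show ?thesis using path_reduce2[OF *(1)] unfolding *(3) path_append by blast
qed

lemma path_reduces: "reduce1\<^sup>*\<^sup>* s t \<Longrightarrow> path a s b \<Longrightarrow> path a t b"
  by (induction rule: rtranclp_induct) (auto intro: path_reduce1)

lemma path_path_inv: "path a s b \<Longrightarrow> path b (path_inv s) a"
proof (induction s arbitrary: a)
  case (Cons e s)
  obtain p u v q where e: "e = (p, u, v, q)" by (cases e)
  have "path b (path_inv s) (p @ v @ q)" using Cons e by auto
  then show ?case using Cons.prems rel_words path_words[OF Cons.prems] e
    by (auto simp: path_append intro!: exI[of _ "p @ v @ q"])
qed simp

lemma path_shift_left: "x \<in> lists A \<Longrightarrow> path a s b \<Longrightarrow> path (x @ a) (map (shift_left x) s) (x @ b)"
proof (induction s arbitrary: a)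
  case (Cons e s)
  obtain p u v q where e: "e = (p, u, v, q)" by (cases e)
  have "path (x @ p @ v @ q) (map (shift_left x) s) (x @ b)" using Cons e by auto
  then show ?case using Cons.prems e by auto
qed simp

lemma path_shift_right: "x \<in> lists A \<Longrightarrow> path a s b \<Longrightarrow> path (a @ x) (map (shift_right x) s) (b @ x)"
proof (induction s arbitrary: a)
  case (Cons e s)
  obtain p u v q where e: "e = (p, u, v, q)" by (cases e)
  have "path (p @ v @ q @ x) (map (shift_right x) s) (b @ x)"
    using Cons.IH[of "p @ v @ q"] Cons.prems e by simp
  then show ?case using Cons.prems e by auto
qed simp

lemma path_shift_leftD:
  "path (x @ a) (map (shift_left x) s) b \<Longrightarrow> \<exists>b'. b = x @ b' \<and> path a s b'"
proof (induction s arbitrary: a)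
  case (Cons e s)
  obtain p u v q where e: "e = (p, u, v, q)" by (cases e)
  have "path (x @ (p @ v @ q)) (map (shift_left x) s) b" using Cons e by auto
  then obtain b' where "b = x @ b'" "path (p @ v @ q) s b'" using Cons.IH by blast
  then show ?case using Cons.prems e by auto
qed auto

definition left_free :: "'a squier_edge list \<Rightarrow> bool" where
  "left_free s \<longleftrightarrow> (\<forall>e\<in>set s. fst e \<noteq> [])"

lemma left_free_shift: "x \<noteq> [] \<Longrightarrow> left_free (map (shift_left x) s)"
  by (auto simp: left_free_def)

lemma left_freeE:
  assumes "path (x # a) s b" "left_free s"
  obtains s' b' where "s = map (shift_left [x]) s'" "b = x # b'" "path a s' b'"
proof -
  have "\<exists>s'. s = map (shift_left [x]) s'" using assms
  proof (induction s arbitrary: a)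
    case (Cons e s)
    obtain p u v q where e: "e = (p, u, v, q)" by (cases e)
    obtain p' where p: "p = x # p'" using Cons.prems e by (cases p) (auto simp: left_free_def)
    have "path (x # p' @ v @ q) s b" "left_free s" using Cons.prems e p by (auto simp: left_free_def)
    then obtain s' where "s = map (shift_left [x]) s'" using Cons.IH by blast
    then show ?case using e p by (intro exI[of _ "(p', u, v, q) # s'"]) simp
  qed simp
  then show ?thesis using assms(1) path_shift_leftD[of "[x]"] that by fastforce
qed

definition mor :: "'a list \<Rightarrow> 'a diagram \<Rightarrow> 'a list \<Rightarrow> bool" where
  "mor a g b \<longleftrightarrow> (\<exists>s. path a s b \<and> g = dg s)"

lemma mor_dg: "path a s b \<Longrightarrow> mor a (dg s) b"
  by (auto simp: mor_def)

lemma mor_words: "mor a g b \<Longrightarrow> a \<in> lists A \<and> b \<in> lists A"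
  unfolding mor_def using path_words by blast

lemma mor_0: "a \<in> lists A \<Longrightarrow> mor a 0 a"
  using mor_dg[of a "[]" a] by (simp add: dg_Nil)

lemma mor_add: "mor a g b \<Longrightarrow> mor b h c \<Longrightarrow> mor a (g + h) c"
  unfolding mor_def by (metis dg_append path_append)

lemma mor_minus: "mor a g b \<Longrightarrow> mor b (- g) a"
  unfolding mor_def by (metis dg_path_inv path_path_inv)

lemma mor_lsh: "x \<in> lists A \<Longrightarrow> mor a g b \<Longrightarrow> mor (x @ a) (lsh x g) (x @ b)"
  unfolding mor_def by (metis lsh_dg path_shift_left)

lemma mor_rsh: "x \<in> lists A \<Longrightarrow> mor a g b \<Longrightarrow> mor (a @ x) (rsh x g) (b @ x)"
  unfolding mor_def by (metis rsh_dg path_shift_right)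

text \<open>Reductions of a path are paths with the same ends. Equality in \<open>diagram\<close>
  therefore means homotopy through paths, and the start determines the end.\<close>

lemma path_common_reduct:
  assumes "path a s b" "path a t c" "dg s = dg t"
  obtains w where "reduce1\<^sup>*\<^sup>* s w" "reduce1\<^sup>*\<^sup>* t w" "path a w b" "b = c"
proof -
  obtain w where w: "reduce1\<^sup>*\<^sup>* s w" "reduce1\<^sup>*\<^sup>* t w"
    using assms(3) unfolding dg_eq_iff homotopic_iff by blast
  have "path a w b" "path a w c" using path_reduces w assms by blast+
  moreover have "b = c" if "path a w b" "path a w c" for a w
    using that by (induction w arbitrary: a) auto
  ultimately show ?thesis using w that by blast
qed

lemma mor_unique: "mor a g b \<Longrightarrow> mor a g c \<Longrightarrow> b = c"
  unfolding mor_def using path_common_reduct by metis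

text \<open>The 2-cells make the sum of diagrams functorial in both arguments.\<close>

lemma interchange:
  assumes "mor a g a'" "mor b h b'"
  shows "rsh b g + lsh a' h = lsh a h + rsh b' g"
proof -
  \<comment> \<open>First the case of a single edge on the left, where every edge of
    \<open>t\<close> costs one exchange; then induction over the path on the left.\<close>
  have single: "dg [shift_right b (p, u, v, q)] + lsh (p @ v @ q) (dg t) = lsh (p @ u @ q) (dg t) + dg [shift_right b' (p, u, v, q)]"
    if "rel u v" "path b t b'" for p u v q b t b'
    using that(2)
  proof (induction t arbitrary: b)
    case Nil
    then show ?case by (simp add: dg_Nil)
  next
    case (Cons f t)
    obtain p1 u1 v1 q1 where f: "f = (p1, u1, v1, q1)" by (cases f)
    have b: "b = p1 @ u1 @ q1" "rel u1 v1" and t: "path (p1 @ v1 @ q1) t b'" using Cons.prems f by auto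
    have nonempty: "u \<noteq> []" "v \<noteq> []" "u1 \<noteq> []" "v1 \<noteq> []" using rel_words that(1) b(2) by blast+
    have "reduce1 [(p @ u @ q @ p1, u1, v1, q1), (p, u, v, (q @ p1) @ v1 @ q1)]
      [(p, u, v, (q @ p1) @ u1 @ q1), (p @ v @ q @ p1, u1, v1, q1)]"
      using reduce2_reduce1[OF exchange[OF nonempty], of "[]" p "q @ p1" q1 "[]"] by simp
    then have sq: "dg [(p @ u @ q @ p1, u1, v1, q1)] + dg [(p, u, v, q @ p1 @ v1 @ q1)] =
        dg [(p, u, v, q @ p1 @ u1 @ q1)] + dg [(p @ v @ q @ p1, u1, v1, q1)]"
      using dg_reduces[OF r_into_rtranclp] by (fastforce simp flip: dg_append)
    have "dg [shift_right b (p, u, v, q)] + lsh (p @ v @ q) (dg (f # t)) =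
      (dg [(p, u, v, q @ p1 @ u1 @ q1)] + dg [(p @ v @ q @ p1, u1, v1, q1)]) + lsh (p @ v @ q) (dg t)"
      by (subst dg_Cons) (simp add: lsh_add lsh_dg f b add.assoc)
    also have "\<dots> = dg [(p @ u @ q @ p1, u1, v1, q1)] + (dg [shift_right (p1 @ v1 @ q1) (p, u, v, q)] + lsh (p @ v @ q) (dg t))"
      by (simp add: add.assoc flip: sq)
    also have "\<dots> = dg [(p @ u @ q @ p1, u1, v1, q1)] + (lsh (p @ u @ q) (dg t) + dg [shift_right b' (p, u, v, q)])"
      by (simp only: Cons.IH[OF t])
    also have "\<dots> = lsh (p @ u @ q) (dg (f # t)) + dg [shift_right b' (p, u, v, q)]"
      by (subst dg_Cons[of f]) (simp add: lsh_add lsh_dg f add.assoc)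
    finally show ?case .
  qed
  obtain t where t: "path b t b'" "h = dg t" using assms(2) by (auto simp: mor_def)
  have "rsh b (dg s) + lsh a' h = lsh a h + rsh b' (dg s)" if "path a s a'" for s a
    using that
  proof (induction s arbitrary: a)
    case Nil
    then show ?case by (simp add: dg_Nil)
  next
    case (Cons e s)
    obtain p u v q where e: "e = (p, u, v, q)" by (cases e)
    have a: "a = p @ u @ q" "rel u v" "path (p @ v @ q) s a'" using Cons.prems e by auto
    have "rsh b (dg (e # s)) + lsh a' h = dg [shift_right b e] + (rsh b (dg s) + lsh a' h)"
      by (subst dg_Cons) (simp add: rsh_add rsh_dg add.assoc)
    also have "\<dots> = (dg [shift_right b e] + lsh (p @ v @ q) h) + rsh b' (dg s)"
      by (simp add: Cons.IH[OF a(3)] add.assoc)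
    also have "\<dots> = (lsh a h + dg [shift_right b' e]) + rsh b' (dg s)"
      unfolding t(2) e a(1) single[OF a(2) t(1)] ..
    also have "\<dots> = lsh a h + rsh b' (dg (e # s))"
      by (subst dg_Cons[of e]) (simp add: rsh_add rsh_dg add.assoc)
    finally show ?case .
  qed
  then show ?thesis using assms(1) by (auto simp: mor_def)
qed

abbreviation left_edge :: "'a list \<Rightarrow> 'a list \<Rightarrow> 'a list \<Rightarrow> 'a diagram" where
  "left_edge u v q \<equiv> dg [([], u, v, q)]"

lemma left_edge_slide:
  assumes "rel u v" "mor q k q'"
  shows "left_edge u v q + lsh v k = lsh u k + left_edge u v q'"
proof -
  have "mor u (dg [([], u, v, [])]) v" by (rule mor_dg) (use rel_words[OF assms(1)] assms in simp)
  from interchange[OF this assms(2)] show ?thesis by (simp add: rsh_dg)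
qed

lemma left_edge_inv: "left_edge v u q = - left_edge u v q"
  using dg_path_inv[of "[([], u, v, q)]"] by simp

lemma mor_left_edge: "rel u v \<Longrightarrow> q \<in> lists A \<Longrightarrow> mor (u @ q) (left_edge u v q) (v @ q)"
  by (rule mor_dg) (use rel_words[of u v] in auto)

text \<open>A common reduct of both sides is shifted by \<open>q\<close> on the right and by
  \<open>p\<close> on the left. Its first edge would have to replace a factor of
  \<open>p @ q\<close> outside \<open>p\<close> and outside \<open>q\<close>, which is
  empty.\<close>

lemma sum_trivial:
  assumes "mor p g p'" "mor q h q'" "rsh q g = lsh p h"
  shows "g = 0 \<and> h = 0"
proof -
  obtain s t where s: "path p s p'" "g = dg s" and t: "path q t q'" "h = dg t"
    using assms by (auto simp: mor_def)
  have "dg (map (shift_right q) s) = dg (map (shift_left p) t)"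
    using assms(3) by (simp add: s t lsh_dg rsh_dg)
  then obtain w where w: "reduce1\<^sup>*\<^sup>* (map (shift_right q) s) w" "reduce1\<^sup>*\<^sup>* (map (shift_left p) t) w"
    unfolding dg_eq_iff homotopic_iff by blast
  obtain s' t' where s': "w = map (shift_right q) s'" and t': "w = map (shift_left p) t'"
    using reduces_mapD[OF reduce2_shift_rightD w(1)] reduces_mapD[OF reduce2_shift_leftD w(2)] by blast
  have "path (p @ q) (map (shift_right q) s) (p' @ q)"
    using path_shift_right s path_words[OF t(1)] by blast
  then have pw: "path (p @ q) w (p' @ q)" using path_reduces w(1) by blast
  have "w = []"
  proof (cases s')
    case (Cons e s'')
    obtain e' t'' where "t' = e' # t''" using s' t' Cons by (cases t') auto
    then have ee: "shift_right q e = shift_left p e'" "w = shift_right q e # map (shift_right q) s''"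
      using s' t' Cons by auto
    then obtain p1 u v q1 where e1: "shift_right q e = (p @ p1, u, v, q1 @ q)" by (cases e; cases e') auto
    then have "p @ q = (p @ p1) @ u @ (q1 @ q)" "rel u v" using pw ee(2) by auto
    from arg_cong[OF this(1), of length] have "length u = 0" by simp
    then show ?thesis using rel_words[OF \<open>rel u v\<close>] by simp
  qed (use s' in simp)
  then have "rsh q g = 0" "lsh p h = 0" using dg_reduces[OF w(1)] dg_reduces[OF w(2)]
    by (simp_all add: s t lsh_dg rsh_dg dg_Nil)
  then show ?thesis using rsh_inj[of q g 0] lsh_inj[of p h 0] by simp
qed

end


definition word_inv :: "('c \<times> bool) list \<Rightarrow> ('c \<times> bool) list" where
  "word_inv w = rev (map flip w)"

lemma free_red_word_inv: "free_red (word_inv w @ w @ b) = free_red b"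
proof (induction w arbitrary: b)
  case (Cons x w)
  have "free_red (word_inv (x # w) @ (x # w) @ b) = free_red (word_inv w @ [flip x, flip (flip x)] @ w @ b)"
    by (simp add: word_inv_def)
  then show ?case using Cons free_red_cancel by metis
qed (simp add: word_inv_def)

context presentation
begin

section \<open>The left tree\<close>

text \<open>
  Two left edges \<open>([], u, v, q)\<close> never act on disjoint factors. Contracting all other edges
  in the universal cover of the Squier complex gives a tree: its vertices are the cosets
  \<open>coset [x] c g\<close> and its edges the cosets \<open>coset u c g\<close> of left edges.
\<close>

definition coset :: "'a list \<Rightarrow> 'a list \<Rightarrow> 'a diagram \<Rightarrow> ('a diagram \<times> 'a list) set" where
  "coset u q g = {(g + lsh u d, q') | d q'. mor q d q'}"

definition translate :: "'a diagram \<Rightarrow> ('a diagram \<times> 'a list) set \<Rightarrow> ('a diagram \<times> 'a list) set" where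
  "translate g C = map_prod ((+) g) id ` C"

lemma coset_eqI:
  assumes "mor q d q'"
  shows "coset u q' (g + lsh u d) = coset u q g"
proof (rule subset_antisym; rule subsetI)
  fix y assume "y \<in> coset u q' (g + lsh u d)"
  then obtain d' r where y: "y = (g + lsh u d + lsh u d', r)" "mor q' d' r" unfolding coset_def by blast
  then have "y = (g + lsh u (d + d'), r)" by (simp add: lsh_add add.assoc)
  then show "y \<in> coset u q g" using mor_add[OF assms y(2)] unfolding coset_def by blast
next
  fix y assume "y \<in> coset u q g"
  then obtain d' r where y: "y = (g + lsh u d', r)" "mor q d' r" unfolding coset_def by blast
  have "y = (g + lsh u d + lsh u (- d + d'), r)" using y(1) by (simp add: lsh_add lsh_minus add.assoc)
  then show "y \<in> coset u q' (g + lsh u d)" using mor_add[OF mor_minus[OF assms] y(2)] unfolding coset_def by blast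
qed

lemma coset_self: "q \<in> lists A \<Longrightarrow> (g, q) \<in> coset u q g"
  unfolding coset_def using mor_0[of q] by (auto intro!: exI[of _ 0])

lemma coset_eqD:
  assumes "coset u q g = coset u' q' g'" "q' \<in> lists A"
  obtains d where "mor q d q'" "g' = g + lsh u d"
proof -
  have "(g', q') \<in> coset u q g" using coset_self[OF assms(2)] assms(1) by simp
  then show ?thesis using that unfolding coset_def by blast
qed

lemma translate_coset: "translate g (coset u q h) = coset u q (g + h)"
  unfolding translate_def coset_def by (force simp: add.assoc)

lemma inj_translate: "inj (translate g)"
proof -
  have "inj (map_prod ((+) g) (id :: 'a list \<Rightarrow> _))" by (intro prod.inj_map) (simp_all add: inj_def)
  then show ?thesis unfolding translate_def by (simp add: inj_def inj_image_eq_iff)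
qed

type_synonym 'b tree_letter = "(('b diagram \<times> 'b list) set \<times> 'b list \<times> 'b list) \<times> bool"

text \<open>Tree edges are recorded in the direction given by \<open>R\<close>, which is well
  defined by antisymmetry. An edge crossed backwards is named by its coset at the far end.\<close>

fun letter :: "'a diagram \<Rightarrow> 'a squier_edge \<Rightarrow> 'a tree_letter" where
  "letter g (p, u, v, q) =
    (if (u, v) \<in> R then ((coset u q g, u, v), True) else ((coset v q (g + dg [(p, u, v, q)]), v, u), False))"

fun tree_word :: "'a diagram \<Rightarrow> 'a squier_edge list \<Rightarrow> 'a tree_letter list" where
  "tree_word g [] = []"
| "tree_word g (e # s) = (if fst e = [] then [letter g e] else []) @ tree_word (g + dg [e]) s"

lemma tree_word_append: "tree_word g (s @ t) = tree_word g s @ tree_word (g + dg s) t"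
proof (induction s arbitrary: g)
  case (Cons e s)
  then show ?case using dg_Cons[of e s] by (simp add: add.assoc)
qed (simp add: dg_Nil)

lemma tree_word_left_free: "left_free s \<Longrightarrow> tree_word g s = []"
  by (induction s arbitrary: g) (auto simp: left_free_def)

fun translate_letter :: "'a diagram \<Rightarrow> 'a tree_letter \<Rightarrow> 'a tree_letter" where
  "translate_letter g ((C, uv), b) = ((translate g C, uv), b)"

lemma translate_letter_letter: "translate_letter g (letter h e) = letter (g + h) e"
  by (cases e) (simp add: translate_coset add.assoc)

lemma tree_word_translate: "tree_word (g + h) s = map (translate_letter g) (tree_word h s)"
  by (induction s arbitrary: h) (simp_all add: translate_letter_letter add.assoc)

lemma translate_letter_eq_iff: "translate_letter g x = translate_letter g y \<longleftrightarrow> x = y"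
  using inj_translate[of g] by (cases x; cases y) (auto simp: inj_eq)

lemma translate_letter_flip: "translate_letter g (flip x) = flip (translate_letter g x)"
  by (cases x) auto

lemma freely_reduced_translate: "freely_reduced (map (translate_letter g) w) \<longleftrightarrow> freely_reduced w"
  unfolding successively_map by (simp add: translate_letter_eq_iff flip: translate_letter_flip)

lemma letter_inverse:
  assumes "rel u v"
  shows "letter (g + dg [(p, u, v, q)]) (p, v, u, q) = flip (letter g (p, u, v, q))"
proof -
  have "dg [(p, v, u, q)] = - dg [(p, u, v, q)]" using dg_path_inv[of "[(p, u, v, q)]"] by simp
  then show ?thesis using assms antisym by (auto simp: add.assoc)
qed

text \<open>What happens to the right of \<open>u\<close> commutes with the left edge, so it does
  not affect which edge of the tree is crossed.\<close>

lemma letter_slide: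
  assumes "rel u v" "mor q d q'"
  shows "letter (g + lsh u d) ([], u, v, q') = letter g ([], u, v, q)"
proof -
  have "g + lsh u d + left_edge u v q' = (g + left_edge u v q) + lsh v d"
    by (simp add: add.assoc left_edge_slide[OF assms])
  then show ?thesis using coset_eqI[OF assms(2)] by simp
qed

text \<open>In an exchange the edge further to the right is never a left edge, as \<open>l\<close>
  is non-empty. If the other one is a left edge, \<open>letter_slide\<close> keeps its letter. A
  deletion cancels inverse letters.\<close>

lemma free_red_tree_word_reduce2:
  assumes "reduce2 x y rs" "path a [x, y] b"
  shows "free_red (tree_word g [x, y]) = free_red (tree_word g rs)"
  using assms(1)
proof cases
  case deletion
  obtain p u v q where x: "x = (p, u, v, q)" by (cases x)
  then have "rel u v" using assms(2) by auto
  then have "letter (g + dg [x]) y = flip (letter g x)"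
    using deletion x letter_inverse[of u v g p q] by simp
  then have "tree_word g [x, y] = (if p = [] then [] @ [letter g x, flip (letter g x)] @ [] else [])"
    using x deletion by (auto simp del: letter.simps)
  then show ?thesis using deletion free_red_cancel[of "[]" "letter g x" "[]"] by simp
next
  case (exchange l r u v p z q)
  have rel: "rel l r" "rel u v" and words: "z \<in> lists A" "q \<in> lists A"
    using assms(2) exchange by auto
  show ?thesis
  proof (cases "p = []")
    case True
    have "path (z @ u @ q) [(z, u, v, q)] (z @ v @ q)" using rel words rel_words[OF rel(2)] by auto
    then have "letter (g + lsh l (dg [(z, u, v, q)])) ([], l, r, z @ v @ q) = letter g ([], l, r, z @ u @ q)"
      by (intro letter_slide[OF rel(1)] mor_dg)
    then show ?thesis using exchange True by (simp add: lsh_dg del: letter.simps)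
  next
    case False
    then show ?thesis using exchange by simp
  qed
qed

lemma free_red_tree_word_reduces:
  assumes "reduce1\<^sup>*\<^sup>* s t" "path a s b"
  shows "free_red (tree_word g s) = free_red (tree_word g t)"
  using assms(1)
proof (induction rule: rtranclp_induct)
  case (step t t')
  obtain c x y rs d where *: "reduce2 x y rs" "t = c @ [x, y] @ d" "t' = c @ rs @ d"
    using step(2) unfolding reduce1_def by blast
  have "path a t b" using path_reduces[OF step(1) assms(2)] .
  then obtain a1 b1 where "path a1 [x, y] b1" unfolding *(2) path_append by blast
  then have "free_red (tree_word (g + dg c) [x, y]) = free_red (tree_word (g + dg c) rs)"
    by (rule free_red_tree_word_reduce2[OF *(1)])
  moreover have "dg [x, y] = dg rs"
    using dg_reduces[of "[x, y]" rs] reduce2_reduce1[OF *(1), of "[]" "[]"] by (simp add: r_into_rtranclp)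
  ultimately have "free_red (tree_word g t) = free_red (tree_word g t')"
    unfolding *(2,3) tree_word_append
    by (intro free_red_append_cong[OF refl free_red_append_cong]) (simp_all del: tree_word.simps)
  with step.IH show ?case by simp
qed simp

lemma free_red_tree_word_eq:
  assumes "path a s b" "path a t c" "dg s = dg t"
  shows "free_red (tree_word g s) = free_red (tree_word g t)"
proof -
  obtain w where "reduce1\<^sup>*\<^sup>* s w" "reduce1\<^sup>*\<^sup>* t w" using path_common_reduct[OF assms] by blast
  then show ?thesis using free_red_tree_word_reduces assms by metis
qed

lemma tree_word_ConsE:
  assumes "tree_word g s = x # w"
  obtains d e s' where "s = d @ [e] @ s'" "left_free d" "fst e = []" "x = letter (g + dg d) e"
    "w = tree_word (g + dg d + dg [e]) s'"
proof -
  have "\<exists>d e s'. s = d @ [e] @ s' \<and> left_free d \<and> fst e = [] \<and> x = letter (g + dg d) e \<and> w = tree_word (g + dg d + dg [e]) s'"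
    using assms
  proof (induction s arbitrary: g)
    case (Cons f s)
    show ?case
    proof (cases "fst f = []")
      case True
      then show ?thesis using Cons.prems
        by (intro exI[of _ "[]"] exI[of _ f] exI[of _ s]) (auto simp: left_free_def dg_Nil)
    next
      case False
      then have "tree_word (g + dg [f]) s = x # w" using Cons.prems by simp
      then obtain d e s' where *: "s = d @ [e] @ s'" "left_free d" "fst e = []" "x = letter (g + dg [f] + dg d) e"
        "w = tree_word (g + dg [f] + dg d + dg [e]) s'"
        using Cons.IH by blast
      show ?thesis using * False dg_Cons[of f d]
        by (intro exI[of _ "f # d"] exI[of _ e] exI[of _ s']) (simp add: left_free_def add.assoc)
    qed
  qed simp
  then show ?thesis using that by blast
qed

lemma tree_word_appendE:
  assumes "tree_word g s = w1 @ w2"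
  obtains s1 s2 where "s = s1 @ s2" "tree_word g s1 = w1" "tree_word (g + dg s1) s2 = w2"
proof -
  have "\<exists>s1 s2. s = s1 @ s2 \<and> tree_word g s1 = w1 \<and> tree_word (g + dg s1) s2 = w2"
    using assms
  proof (induction w1 arbitrary: g s)
    case Nil
    then show ?case by (intro exI[of _ "[]"] exI[of _ s]) (simp add: dg_Nil)
  next
    case (Cons x w1)
    from Cons.prems have "tree_word g s = x # (w1 @ w2)" by simp
    then obtain d e s' where *: "s = d @ [e] @ s'" "left_free d" "fst e = []" "x = letter (g + dg d) e"
      "w1 @ w2 = tree_word (g + dg d + dg [e]) s'" by (rule tree_word_ConsE)
    obtain s1 s2 where **: "s' = s1 @ s2" "tree_word (g + dg d + dg [e]) s1 = w1"
      "tree_word (g + dg d + dg [e] + dg s1) s2 = w2" using Cons.IH[OF *(5)[symmetric]] by blast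
    show ?case using * ** dg_Cons[of e s1]
      by (intro exI[of _ "d @ [e] @ s1"] exI[of _ s2])
        (simp add: tree_word_append tree_word_left_free dg_append add.assoc)
  qed
  then show ?thesis using that by blast
qed

text \<open>Coming back over the same tree edge means that two cosets agree, so all that was done in
  between took place to the right of \<open>v\<close>. This plays the part of Britton's
  lemma.\<close>

lemma pinch:
  assumes "fst e = []" "fst e' = []" "path a [e] b" "path b d c" "path c [e'] c'"
    and flip: "letter (g + dg [e] + dg d) e' = flip (letter g e)"
  obtains u v q q' k where "e = ([], u, v, q)" "e' = ([], v, u, q')" "rel u v" "mor q k q'" "dg d = lsh v k"
proof -
  obtain u v q where e: "e = ([], u, v, q)" using assms(1) by (cases e) auto
  obtain v' u' q' where e': "e' = ([], v', u', q')" using assms(2) by (cases e') auto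
  have rel: "rel u v" "rel v' u'" "q \<in> lists A" "q' \<in> lists A" using assms(3,5) e e' by auto
  show ?thesis
  proof (cases "(u, v) \<in> R")
    case True
    then have "v' = v" "u' = u" and eq: "coset u q g = coset u q' (g + dg [e] + dg d + left_edge v u q')"
      using flip rel unfolding e e' by (auto split: if_splits)
    obtain k where k: "mor q k q'" "g + dg [e] + dg d + left_edge v u q' = g + lsh u k"
      using coset_eqD[OF eq rel(4)] by blast
    have "left_edge u v q + (dg d + - left_edge u v q') = lsh u k"
      using k(2) by (simp add: e add.assoc left_edge_inv[of v u] del: add_uminus_conv_diff)
    moreover have "left_edge u v q + dg d = left_edge u v q + (dg d + - left_edge u v q') + left_edge u v q'"
      by (simp add: add.assoc del: add_uminus_conv_diff)
    ultimately have "left_edge u v q + dg d = lsh u k + left_edge u v q'" by simp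
    also have "\<dots> = left_edge u v q + lsh v k" by (simp add: left_edge_slide[OF rel(1) k(1)])
    finally have "dg d = lsh v k" by simp
    then show ?thesis using that e e' \<open>v' = v\<close> \<open>u' = u\<close> rel k(1) by blast
  next
    case False
    then have "v' = v" "u' = u" and eq: "coset v q (g + dg [e]) = coset v q' (g + dg [e] + dg d)"
      using flip rel unfolding e e' by (auto split: if_splits)
    obtain k where k: "mor q k q'" "g + dg [e] + dg d = g + dg [e] + lsh v k"
      using coset_eqD[OF eq rel(4)] by blast
    then show ?thesis using that[OF _ _ rel(1) k(1)] e e' \<open>v' = v\<close> \<open>u' = u\<close> by simp
  qed
qed

lemma lsh_short_path:
  assumes "path (v @ q) d c" "dg d = lsh v k" "mor q k q'"
  obtains t where "path q t q'" "k = dg t" "length t \<le> length d"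
proof -
  obtain t where t: "dg d = lsh v (dg t)" "length t \<le> length d" "reduce1\<^sup>*\<^sup>* d (map (shift_left v) t)"
    using lsh_short[OF assms(2)] by blast
  have "path (v @ q) (map (shift_left v) t) c" using path_reduces[OF t(3) assms(1)] .
  then obtain q1 where "path q t q1" using path_shift_leftD by blast
  moreover have "k = dg t" using t(1) assms(2) by simp
  ultimately have "path q t q'" using mor_unique[OF mor_dg, of q t q1 q'] assms(3) by simp
  then show ?thesis using that t \<open>k = dg t\<close> by blast
qed

text \<open>By \<open>pinch\<close> a left edge, a path \<open>d'\<close> and the returning left
  edge add up to some \<open>lsh u k\<close>. It can be written with no more edges than
  \<open>d'\<close>, so two edges are saved.\<close>

lemma shorten:
  assumes "path a s b" "\<not> freely_reduced (tree_word g s)"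
  shows "\<exists>t. path a t b \<and> dg t = dg s \<and> length t < length s"
proof -
  obtain w1 x w2 where w: "tree_word g s = w1 @ [x, flip x] @ w2"
    using not_freely_reducedE[OF assms(2)] by blast
  obtain s1 s2 where s12: "s = s1 @ s2" "tree_word (g + dg s1) s2 = [x, flip x] @ w2"
    using w by (rule tree_word_appendE)
  then have w2: "tree_word (g + dg s1) s2 = x # flip x # w2" by simp
  obtain d e s' where e: "s2 = d @ [e] @ s'" "left_free d" "fst e = []" "x = letter (g + dg s1 + dg d) e"
    "flip x # w2 = tree_word (g + dg s1 + dg d + dg [e]) s'" using w2 by (rule tree_word_ConsE)
  obtain d' e' s'' where e': "s' = d' @ [e'] @ s''" "left_free d'" "fst e' = []"
    "flip x = letter (g + dg s1 + dg d + dg [e] + dg d') e'" using tree_word_ConsE[OF e(5)[symmetric]] by metis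
  have s: "s = (s1 @ d) @ [e] @ d' @ [e'] @ s''" using s12 e e' by simp
  obtain a1 a2 a3 a4 where p: "path a (s1 @ d) a1" "path a1 [e] a2" "path a2 d' a3" "path a3 [e'] a4" "path a4 s'' b"
    using assms(1) unfolding s path_append by blast
  obtain u v q q' k where uv: "e = ([], u, v, q)" "e' = ([], v, u, q')" "rel u v" "mor q k q'" "dg d' = lsh v k"
    using pinch[OF e(3) e'(3) p(2,3,4), of "g + dg s1 + dg d"] e(4) e'(4) by metis
  have a: "a1 = u @ q" "a2 = v @ q" "a4 = u @ q'" using p uv by auto
  obtain t where t: "path q t q'" "k = dg t" "length t \<le> length d'"
    using lsh_short_path uv(4,5) p(3) a by blast
  have "path (u @ q) (map (shift_left u) t) (u @ q')"
    using path_shift_left t(1) rel_words[OF uv(3)] by blast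
  then have "path a ((s1 @ d) @ map (shift_left u) t @ s'') b"
    using p(1,5) a unfolding path_append by blast
  moreover have "lsh u k = dg [e] + dg d' + dg [e']"
    using left_edge_slide[OF uv(3,4)] uv(1,2,5) left_edge_inv[of v u q'] by (simp add: add.assoc)
  then have "dg ((s1 @ d) @ map (shift_left u) t @ s'') = dg s"
    unfolding s by (simp only: dg_append lsh_dg[symmetric] t(2)[symmetric] add.assoc)
  moreover have "length ((s1 @ d) @ map (shift_left u) t @ s'') < length s" using t(3) s by simp
  ultimately show ?thesis by blast
qed

lemma shorten_reduced:
  assumes "path a s b"
  shows "\<exists>t. path a t b \<and> dg t = dg s \<and> length t \<le> length s \<and> freely_reduced (tree_word g t)"
  using assms
proof (induction "length s" arbitrary: s rule: less_induct)
  case less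
  show ?case
  proof (cases "freely_reduced (tree_word g s)")
    case False
    then obtain t where "path a t b" "dg t = dg s" "length t < length s" using shorten less.prems by blast
    then show ?thesis using less.hyps[of t] by auto
  qed (use less.prems in blast)
qed

text \<open>In the left tree, \<open>h\<close> fixes the vertex \<open>coset [x] c g\<close>; see
  \<open>elliptic_iff\<close>. The form given here can be used before the tree is
  constructed.\<close>

definition elliptic :: "'a list \<Rightarrow> 'a diagram \<Rightarrow> bool" where
  "elliptic q h \<longleftrightarrow> (\<exists>g x c d. mor q g (x # c) \<and> mor c d c \<and> h + g = g + lsh [x] d)"

text \<open>
  If \<open>h\<close> is not elliptic, a diagram conjugating \<open>lsh p h\<close> into the stabilizer of
  the prefix \<open>u\<close> has to produce this prefix inside \<open>p\<close>.
\<close>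

lemma hyperbolic_split:
  assumes h: "mor q h q" "\<not> elliptic q h"
  shows "path (p @ q) s (u @ c) \<Longrightarrow> u \<in> lists A \<Longrightarrow> mor c d c \<Longrightarrow> lsh p h + dg s = dg s + lsh u d \<Longrightarrow>
    \<exists>p' t1 t2. path p t1 (u @ p') \<and> path (p' @ q) t2 c \<and> dg s = rsh q (dg t1) + lsh u (dg t2) \<and>
      length t1 + length t2 \<le> length s"
\<comment> \<open>Passing to the first letter of \<open>u\<close> need not shorten \<open>s\<close>,
  so the length of \<open>u\<close> is the second component of the measure.\<close>
proof (induction "(length s, length u)" arbitrary: p s u c d rule: wf_induct_rule[OF wf_lex_prod[OF wf_less_than wf_less_than]])
  case 1
  have IH: "\<exists>p' t1 t2. path p t1 (u' @ p') \<and> path (p' @ q) t2 c \<and> dg s' = rsh q (dg t1) + lsh u' (dg t2) \<and>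
      length t1 + length t2 \<le> length s'"
    if "length s' < length s \<or> length s' = length s \<and> length u' < length u"
      "path (p @ q) s' (u' @ c)" "u' \<in> lists A" "mor c d c" "lsh p h + dg s' = dg s' + lsh u' d" for s' u' p c d
    using 1(1)[of s' u' p c d] that by auto
  note s = 1(2) and u = 1(3) and d = 1(4) and conj = 1(5)
  have qA: "q \<in> lists A" using mor_words[OF h(1)] by simp
  have pA: "p \<in> lists A" using path_words[OF s] by simp
  have slide: "lsh p h + rsh q (dg t) = rsh q (dg t) + lsh p' h" if "path p t p'" for p t p'
    using interchange[OF mor_dg[OF that] h(1)] by simp
  consider "u = []" | y where "u = [y]" | y u' where "u = y # u'" "u' \<noteq> []" by (cases u) auto
  then show ?case
  proof cases
    case 1
    then show ?thesis using s pA
      by (intro exI[of _ p] exI[of _ "[]"] exI[of _ s]) (simp add: dg_Nil)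
  next
    case (3 y u')
    have yA: "[y] \<in> lists A" and u'A: "u' \<in> lists A" using u 3 by auto
    have "path (p @ q) s ([y] @ u' @ c)" using s 3 by simp
    moreover have "lsh p h + dg s = dg s + lsh [y] (lsh u' d)" using conj 3 by (simp add: lsh_lsh)
    moreover have "length s < length s \<or> length s = length s \<and> length [y] < length u" using 3 by (cases u') auto
    ultimately obtain p1 t1 t2 where t: "path p t1 ([y] @ p1)" "path (p1 @ q) t2 (u' @ c)"
      "dg s = rsh q (dg t1) + lsh [y] (dg t2)" "length t1 + length t2 \<le> length s"
      using IH[of s "[y]" p "u' @ c" "lsh u' d"] yA mor_lsh[OF u'A d] by blast
    have "rsh q (dg t1) + (lsh ([y] @ p1) h + lsh [y] (dg t2)) = rsh q (dg t1) + (lsh [y] (dg t2) + lsh u d)"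
      using conj slide[OF t(1)] unfolding t(3) by (simp add: add.assoc[symmetric])
    then have "lsh [y] (lsh p1 h + dg t2) = lsh [y] (dg t2 + lsh u' d)"
      using 3 by (simp add: lsh_add lsh_lsh)
    then have "lsh p1 h + dg t2 = dg t2 + lsh u' d" by simp
    moreover have "length t2 < length s \<or> length t2 = length s \<and> length u' < length u" using t(4) 3 by auto
    ultimately obtain p2 r1 r2 where r: "path p1 r1 (u' @ p2)" "path (p2 @ q) r2 c"
      "dg t2 = rsh q (dg r1) + lsh u' (dg r2)" "length r1 + length r2 \<le> length t2"
      using IH[of t2 u' p1 c d] t(2) u'A d by blast
    have "path ([y] @ p1) (map (shift_left [y]) r1) ([y] @ u' @ p2)" by (rule path_shift_left[OF yA r(1)])
    then have "path p (t1 @ map (shift_left [y]) r1) (u @ p2)" using t(1) 3 unfolding path_append by auto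
    moreover have "dg s = rsh q (dg (t1 @ map (shift_left [y]) r1)) + lsh u (dg r2)"
      using 3 unfolding t(3) r(3) by (simp add: dg_append rsh_add lsh_add lsh_rsh lsh_lsh add.assoc flip: lsh_dg)
    moreover have "length (t1 @ map (shift_left [y]) r1) + length r2 \<le> length s" using t(4) r(4) by simp
    ultimately show ?thesis using r(2) by blast
  next
    case (2 y)
    show ?thesis
    proof (cases p)
      case Nil
      \<comment> \<open>With \<open>p\<close> empty, \<open>s\<close> itself conjugates
        \<open>h\<close> into the stabilizer of the letter \<open>y\<close>.\<close>
      then have "elliptic q h" unfolding elliptic_def using mor_dg[OF s] 2 d conj by auto
      then show ?thesis using h by simp
    next
      case p: (Cons x p')
      have xA: "[x] \<in> lists A" and p'A: "p' \<in> lists A" using pA p by auto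
      obtain s' where s': "path (p @ q) s' (u @ c)" "dg s' = dg s" "length s' \<le> length s" "freely_reduced (tree_word 0 s')"
        using shorten_reduced[OF s] by blast
      have conj': "lsh p h + dg s' = dg s' + lsh u d" using conj s'(2) by simp
      show ?thesis
      proof (cases "length s' < length s")
        case True
        then obtain p2 r1 r2 where r: "path p r1 (u @ p2)" "path (p2 @ q) r2 c"
          "dg s' = rsh q (dg r1) + lsh u (dg r2)" "length r1 + length r2 \<le> length s'"
          using IH[of s' u p c d] s'(1) u d conj' by blast
        moreover have "dg s = rsh q (dg r1) + lsh u (dg r2)" using r(3) s'(2) by simp
        moreover have "length r1 + length r2 \<le> length s" using r(4) True by simp
        ultimately show ?thesis by blast
      next
        case False
        then have len: "length s' = length s" using s'(3) by simp
        obtain b where b: "path q b q" "h = dg b" using h(1) by (auto simp: mor_def)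
        obtain ds where ds: "path c ds c" "d = dg ds" using d by (auto simp: mor_def)
        show ?thesis
        proof (cases "tree_word 0 s'")
          \<comment> \<open>Without left edges the first letter of \<open>p\<close> is never
            touched, so it is the letter \<open>u\<close> that has to be produced.\<close>
          case Nil
          have "left_free s'"
          proof -
            have "left_free r" if "tree_word g r = []" for g r using that
              by (induction r arbitrary: g) (auto simp: left_free_def split: if_splits)
            then show ?thesis using Nil by blast
          qed
          moreover have "path (x # p' @ q) s' (u @ c)" using s'(1) p by simp
          ultimately obtain r c' where r: "s' = map (shift_left [x]) r" "u @ c = x # c'" "path (p' @ q) r c'"
            using left_freeE by metis
          then have "dg s = lsh u (dg r)" "u = [x]" "c' = c" using 2 s'(2) by (auto simp: lsh_dg)
          then show ?thesis using r len p p'A xA pA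
            by (intro exI[of _ p'] exI[of _ "[]"] exI[of _ r]) (simp add: dg_Nil)
        next
          case (Cons l w)
          then obtain d0 e s2 where e: "s' = d0 @ [e] @ s2" "left_free d0" "fst e = []" "l = letter (0 + dg d0) e"
            by (rule tree_word_ConsE)
          define bs where "bs = map (shift_left p) b"
          have bs: "left_free bs" "dg bs = lsh p h" "path (p @ q) bs (p @ q)"
            using left_free_shift[of p] p path_shift_left[OF pA b(1)] unfolding bs_def b(2) by (simp_all add: lsh_dg)
          have uds: "left_free (map (shift_left u) ds)" "path (u @ c) (map (shift_left u) ds) (u @ c)"
            using left_free_shift[of u] 2 path_shift_left[OF u ds(1)] by simp_all
          have "path (p @ q) (bs @ s') (u @ c)" "path (p @ q) (s' @ map (shift_left u) ds) (u @ c)"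
            using bs s'(1) uds unfolding path_append by blast+
          moreover have "dg (bs @ s') = dg (s' @ map (shift_left u) ds)"
            using conj' bs ds by (simp add: dg_append lsh_dg)
          \<comment> \<open>The paths for \<open>lsh p h\<close> and \<open>lsh u d\<close> contain
            no left edge, since \<open>p\<close> and \<open>u\<close> are non-empty. Hence
            \<open>lsh p h\<close> fixes the tree word of \<open>s'\<close>, in particular its first
            edge.\<close>
          ultimately have "free_red (tree_word 0 (bs @ s')) = free_red (tree_word 0 (s' @ map (shift_left u) ds))"
            by (rule free_red_tree_word_eq)
          then have "free_red (tree_word (lsh p h + 0) s') = free_red (tree_word 0 s')"
            by (simp add: tree_word_append tree_word_left_free bs uds)
          then have "tree_word (lsh p h + 0) s' = tree_word 0 s'"
            unfolding tree_word_translate by (simp add: free_red_reduced s'(4) freely_reduced_translate)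
          then have "translate_letter (lsh p h) l = l" unfolding tree_word_translate Cons by simp
          then have stab: "letter (lsh p h + dg d0) e = letter (dg d0) e" using e(4) by (simp add: translate_letter_letter)
          obtain a1 a2 where pe: "path (p @ q) d0 a1" "path a1 [e] a2" "path a2 s2 (u @ c)"
            using s'(1) unfolding e(1) path_append by blast
          obtain u0 v0 q0 where e0: "e = ([], u0, v0, q0)" using e(3) by (cases e) auto
          have rel: "rel u0 v0" "q0 \<in> lists A" "a1 = u0 @ q0" "a2 = v0 @ q0" using pe(2) e0 by auto
          have u0: "u0 \<noteq> []" "u0 \<in> lists A" "v0 \<in> lists A" using rel_words[OF rel(1)] by auto
          have "path (x # p' @ q) d0 a1" using pe(1) p by simp
          then obtain r0 c0 where r0: "d0 = map (shift_left [x]) r0" "a1 = x # c0" "path (p' @ q) r0 c0"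
            using left_freeE e(2) by metis
          obtain u1 where u1: "u0 = x # u1" "c0 = u1 @ q0" using rel(3) r0(2) u0 by (cases u0) auto
          have u1A: "u1 \<in> lists A" using u0 u1 by auto
          \<comment> \<open>The edge is fixed, so after \<open>d0\<close> the diagram
            \<open>lsh p h\<close> acts to the right of \<open>u0\<close>.\<close>
          obtain d1 where d1: "mor q0 d1 q0" "lsh p h + dg d0 = dg d0 + lsh u0 d1"
          proof (cases "(u0, v0) \<in> R")
            case True
            then have "coset u0 q0 (dg d0) = coset u0 q0 (lsh p h + dg d0)" using stab e0 by simp
            then show thesis using coset_eqD[OF _ rel(2)] that by metis
          next
            case False
            then have "coset v0 q0 (dg d0 + dg [e]) = coset v0 q0 (lsh p h + dg d0 + dg [e])" using stab e0 by simp
            then obtain d1 where d1: "mor q0 d1 q0" "lsh p h + dg d0 + dg [e] = dg d0 + dg [e] + lsh v0 d1"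
              using coset_eqD[OF _ rel(2)] by metis
            have "lsh p h + dg d0 + dg [e] = dg d0 + lsh u0 d1 + dg [e]"
              using d1(2) left_edge_slide[OF rel(1) d1(1)] e0 by (simp add: add.assoc)
            then show thesis using that d1(1) by simp
          qed
          have "lsh [x] (lsh p' h + dg r0) = lsh [x] (dg r0 + lsh u1 d1)"
            using d1(2) p u1 r0(1) by (simp add: lsh_add lsh_lsh lsh_dg)
          then have conj0: "lsh p' h + dg r0 = dg r0 + lsh u1 d1" by simp
          have len0: "length s = length r0 + 1 + length s2" using len e(1) r0(1) by simp
          then have "length r0 < length s \<or> length r0 = length s \<and> length u1 < length u" by simp
          moreover have "path (p' @ q) r0 (u1 @ q0)" using r0(3) u1(2) by simp
          \<comment> \<open>By induction for the shorter path \<open>r0\<close>, the prefix that the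
            first left edge replaces is already produced inside \<open>p\<close>.\<close>
          ultimately obtain p1 t1 t2 where t: "path p' t1 (u1 @ p1)" "path (p1 @ q) t2 q0"
            "dg r0 = rsh q (dg t1) + lsh u1 (dg t2)" "length t1 + length t2 \<le> length r0"
            using IH[of r0 u1 p' q0 d1] u1A d1(1) conj0 by blast
          have p1A: "p1 \<in> lists A" using path_words[OF t(2)] by simp
          \<comment> \<open>\<open>g1\<close> performs that left edge within \<open>p\<close>. The
            edges of \<open>t2\<close> are slid past it into \<open>rem\<close>, which is shorter
            than \<open>s\<close>, and the induction hypothesis applies again.\<close>
          define g1 where "g1 = map (shift_left [x]) t1 @ [([], u0, v0, p1)]"
          define rem where "rem = map (shift_left v0) t2 @ s2"
          have "path ([x] @ p') (map (shift_left [x]) t1) ([x] @ u1 @ p1)" by (rule path_shift_left[OF xA t(1)])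
          moreover have "path (u0 @ p1) [([], u0, v0, p1)] (v0 @ p1)" using rel p1A u0 by auto
          ultimately have g1: "path p g1 (v0 @ p1)" unfolding g1_def path_append using p u1 by auto
          have rem: "path ((v0 @ p1) @ q) rem (u @ c)"
            using path_shift_left[OF u0(3) t(2)] pe(3) rel(4) unfolding rem_def path_append by auto
          have "dg d0 = lsh [x] (dg r0)" by (simp add: r0(1) lsh_dg)
          then have "dg s' = rsh q (lsh [x] (dg t1)) + lsh u0 (dg t2) + left_edge u0 v0 q0 + dg s2"
            unfolding e(1) e0 using u1 by (simp add: dg_append dg_Cons[of _ s2] t(3) lsh_add lsh_lsh lsh_rsh add.assoc)
          also have "\<dots> = rsh q (lsh [x] (dg t1)) + (left_edge u0 v0 (p1 @ q) + lsh v0 (dg t2)) + dg s2"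
            using left_edge_slide[OF rel(1) mor_dg[OF t(2)]] by (simp add: add.assoc)
          also have "\<dots> = rsh q (dg g1) + dg rem"
            by (simp add: g1_def rem_def dg_append lsh_dg rsh_add rsh_dg add.assoc)
          finally have s_eq: "dg s = rsh q (dg g1) + dg rem" using s'(2) by simp
          have "rsh q (dg g1) + (lsh (v0 @ p1) h + dg rem) = rsh q (dg g1) + (dg rem + lsh u d)"
            using conj slide[OF g1] unfolding s_eq by (simp add: add.assoc[symmetric])
          then have "lsh (v0 @ p1) h + dg rem = dg rem + lsh u d" by simp
          moreover have "length rem < length s \<or> length rem = length s \<and> length u < length u"
            using t(4) len0 by (simp add: rem_def)
          ultimately obtain p2 r1 r2 where r: "path (v0 @ p1) r1 (u @ p2)" "path (p2 @ q) r2 c"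
            "dg rem = rsh q (dg r1) + lsh u (dg r2)" "length r1 + length r2 \<le> length rem"
            using IH[of rem u "v0 @ p1" c d] rem u d by blast
          have "path p (g1 @ r1) (u @ p2)" using g1 r(1) unfolding path_append by blast
          moreover have "dg s = rsh q (dg (g1 @ r1)) + lsh u (dg r2)"
            unfolding s_eq r(3) by (simp add: dg_append rsh_add add.assoc)
          moreover have "length (g1 @ r1) + length r2 \<le> length s"
            using r(4) t(4) len0 by (simp add: g1_def rem_def)
          ultimately show ?thesis using r(2) by blast
        qed
      qed
    qed
  qed
qed

text \<open>Split \<open>g\<close> at the prefix \<open>p'\<close>. A letter left over in
  \<open>r\<close> would be fixed by a conjugate of \<open>h'\<close> and make it elliptic. For
  \<open>p = p'\<close> and \<open>h = h'\<close> this describes the centralizer of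
  \<open>lsh p h\<close>.\<close>

lemma hyperbolic_conjugate:
  assumes h: "mor q h q" "\<not> elliptic q h" and h': "mor q' h' q'" "\<not> elliptic q' h'"
    and g: "mor (p @ q) g (p' @ q')" "lsh p h + g = g + lsh p' h'"
  obtains g1 g2 where "mor p g1 p'" "mor q g2 q'" "g = rsh q g1 + lsh p' g2" "h + g2 = g2 + h'"
proof -
  obtain s where s: "path (p @ q) s (p' @ q')" "g = dg s" using g(1) by (auto simp: mor_def)
  have p'A: "p' \<in> lists A" using path_words[OF s(1)] by simp
  obtain r t1 t2 where t: "path p t1 (p' @ r)" "path (r @ q) t2 q'" "dg s = rsh q (dg t1) + lsh p' (dg t2)"
    using hyperbolic_split[OF h s(1) p'A h'(1)] g(2) s(2) by blast
  have "lsh p h + rsh q (dg t1) = rsh q (dg t1) + lsh (p' @ r) h"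
    using interchange[OF mor_dg[OF t(1)] h(1)] by simp
  then have "rsh q (dg t1) + (lsh (p' @ r) h + lsh p' (dg t2)) = rsh q (dg t1) + (lsh p' (dg t2) + lsh p' h')"
    using g(2) unfolding s(2) t(3) by (simp add: add.assoc[symmetric])
  then have "lsh p' (lsh r h + dg t2) = lsh p' (dg t2 + h')" by (simp add: lsh_add lsh_lsh)
  then have conj: "lsh r h + dg t2 = dg t2 + h'" by simp
  have "r = []"
  proof (cases r)
    case (Cons x r')
    have "- dg t2 + (lsh r h + dg t2) + - dg t2 = - dg t2 + (dg t2 + h') + - dg t2" by (simp only: conj)
    then have "h' + - dg t2 = - dg t2 + lsh [x] (lsh r' h)"
      by (simp add: add.assoc lsh_lsh Cons del: add_uminus_conv_diff)
    moreover have "r' \<in> lists A" using path_words[OF t(2)] Cons by simp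
    then have "mor (r' @ q) (lsh r' h) (r' @ q)" using h(1) by (rule mor_lsh)
    moreover have "mor q' (- dg t2) (x # r' @ q)" using mor_minus[OF mor_dg[OF t(2)]] Cons by simp
    ultimately have "elliptic q' h'" unfolding elliptic_def by blast
    then show ?thesis using h' by simp
  qed simp
  then show ?thesis using that[OF mor_dg mor_dg] t conj s(2) by auto
qed

text \<open>
  A closed path of minimal length in its conjugacy class has a cyclically reduced tree word,
  so it moves every vertex of the left tree unless it contains no left edge.
\<close>

lemma minimal_hyperbolic:
  assumes s: "path q s q" "\<not> left_free s"
    and min: "\<And>g q' s'. mor q g q' \<Longrightarrow> path q' s' q' \<Longrightarrow> dg s + g = g + dg s' \<Longrightarrow> length s \<le> length s'"
  shows "\<not> elliptic q (dg s)"
proof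
  assume "elliptic q (dg s)"
  then obtain g x c d where g: "mor q g (x # c)" "mor c d c" "dg s + g = g + lsh [x] d"
    by (auto simp: elliptic_def)
  have qA: "q \<in> lists A" using path_words[OF s(1)] by simp
  define w where "w = tree_word 0 s"
  have w: "freely_reduced w"
  proof (rule ccontr)
    assume "\<not> freely_reduced w"
    then obtain t where "path q t q" "dg t = dg s" "length t < length s"
      using shorten[OF s(1)] unfolding w_def by blast
    then show False using min[OF mor_0[OF qA]] by fastforce
  qed
  have "w \<noteq> []"
  proof -
    have "left_free r" if "tree_word g r = []" for g r using that
      by (induction r arbitrary: g) (auto simp: left_free_def split: if_splits)
    then show ?thesis using s(2) unfolding w_def by blast
  qed
  then obtain l w' where lw: "w = l # w'" by (cases w) auto
  obtain l' w'' where lw': "w = w'' @ [l']" using \<open>w \<noteq> []\<close> by (cases w rule: rev_cases) auto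
  obtain t where t: "path q t (x # c)" "g = dg t" "freely_reduced (tree_word 0 t)"
    using g(1) shorten_reduced[of q _ "x # c" 0] by (auto simp: mor_def) metis
  obtain ds where ds: "path c ds c" "d = dg ds" using g(2) by (auto simp: mor_def)
  have xA: "[x] \<in> lists A" using path_words[OF t(1)] by simp
  define v where "v = tree_word 0 t"
  define v' where "v' = map (translate_letter (dg s)) v"
  have v: "freely_reduced v" "freely_reduced v'"
    using t(3) by (simp_all add: v_def v'_def freely_reduced_translate)
  have "free_red (tree_word 0 (s @ t)) = free_red (tree_word 0 (t @ map (shift_left [x]) ds))"
  proof (rule free_red_tree_word_eq)
    show "path q (s @ t) (x # c)" using s t unfolding path_append by blast
    show "path q (t @ map (shift_left [x]) ds) (x # c)"
      using t path_shift_left[OF xA ds(1)] unfolding path_append by auto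
    show "dg (s @ t) = dg (t @ map (shift_left [x]) ds)" using g(3) t(2) ds(2) by (simp add: dg_append lsh_dg)
  qed
  \<comment> \<open>Since \<open>v\<close> and its translate \<open>v'\<close> are equally long,
    \<open>w\<close> cancels against \<open>v'\<close>, and the inverse of \<open>w\<close> cancels
    against \<open>v\<close>. Together this shows that the last letter of \<open>w\<close> is
    inverse to the translate of the first one: \<open>w\<close> is not cyclically reduced.\<close>
  then have wv: "free_red (w @ v') = v"
    using tree_word_translate[of "dg s" 0 t] v free_red_reduced[OF v(1)]
    by (simp add: tree_word_append tree_word_left_free left_free_shift w_def v_def v'_def)
  have len: "length v' = length v" by (simp add: v'_def)
  have "\<not> freely_reduced (w @ v')" using free_red_reduced[of "w @ v'"] wv len \<open>w \<noteq> []\<close> by auto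
  then have v'_hd: "v' \<noteq> [] \<and> hd v' = flip l'"
    using w v lw' by (auto simp: successively_append_iff successively_Cons)
  have "free_red (word_inv w @ v) = free_red (word_inv w @ (w @ v'))"
    using free_red_append_cong[of "word_inv w" "word_inv w" v "w @ v'"] wv free_red_reduced[OF v(1)] by simp
  also have "\<dots> = v'" by (simp add: free_red_word_inv free_red_reduced v(2))
  finally have "\<not> freely_reduced (word_inv w @ v)"
    using free_red_reduced[of "word_inv w @ v"] len \<open>w \<noteq> []\<close> by (auto simp: word_inv_def)
  moreover have "freely_reduced (word_inv w)"
  proof -
    have "(\<lambda>a b. flip a \<noteq> b) = (\<lambda>a b :: 'a tree_letter. b \<noteq> flip a)" by auto
    then show ?thesis using w unfolding word_inv_def successively_rev successively_map
      by (metis (mono_tags, lifting) flip_flip successively_mono)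
  qed
  ultimately have "v \<noteq> [] \<and> hd v = flip (last (word_inv w))"
    using v(1) by (auto simp: successively_append_iff)
  then have v_hd: "v \<noteq> []" "hd v = l" by (auto simp: word_inv_def lw)
  then have junction: "translate_letter (dg s) l = flip l'"
    using v'_hd by (simp add: v'_def hd_map)
  obtain d0 e' t0 where e': "s = d0 @ [e'] @ t0" "left_free d0" "fst e' = []" "l = letter (0 + dg d0) e'"
    using lw unfolding w_def by (rule tree_word_ConsE)
  obtain t1 r where r: "s = t1 @ r" "tree_word (0 + dg t1) r = [l']"
    using lw' unfolding w_def by (rule tree_word_appendE)
  obtain d1' e d1 where e: "r = d1' @ [e] @ d1" "left_free d1'" "fst e = []" "l' = letter (0 + dg t1 + dg d1') e"
    "[] = tree_word (0 + dg t1 + dg d1' + dg [e]) d1" using tree_word_ConsE[OF r(2)] by metis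
  define t2 where "t2 = t1 @ d1'"
  have s2: "s = t2 @ [e] @ d1" using r e by (simp add: t2_def)
  have l': "l' = letter (dg t2) e" using e(4) by (simp add: t2_def dg_append)
  have flip_e: "letter (dg t2 + dg [e] + dg (d1 @ d0)) e' = flip (letter (dg t2) e)"
    using junction l' e'(4) s2 by (simp add: translate_letter_letter dg_append dg_Cons[of e d1] add.assoc)
  obtain a1 a2 where pe: "path q t2 a1" "path a1 [e] a2" "path a2 d1 q" using s(1) unfolding s2 path_append by blast
  obtain b1 b2 where pe': "path q d0 b1" "path b1 [e'] b2" "path b2 t0 q" using s(1) unfolding e'(1) path_append by blast
  have "path a2 (d1 @ d0) b1" using pe pe' unfolding path_append by blast
  then obtain u v1 q1 q2 k where uv: "e = ([], u, v1, q1)" "e' = ([], v1, u, q2)" "rel u v1" "mor q1 k q2"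
    "dg (d1 @ d0) = lsh v1 k"
    using pinch[OF e(3) e'(3) pe(2) _ pe'(2) flip_e] by metis
  \<comment> \<open>The first left edge \<open>e'\<close> comes before the last one
    \<open>e\<close>. They are different since they apply the same relation in opposite
    directions.\<close>
  have "\<exists>m. t2 = d0 @ [e'] @ m"
  proof -
    have eq: "d0 @ [e'] @ t0 = t2 @ [e] @ d1" using e'(1) s2 by simp
    then obtain us where "d0 = t2 @ us \<and> us @ [e'] @ t0 = [e] @ d1 \<or> d0 @ us = t2 \<and> [e'] @ t0 = us @ [e] @ d1"
      using append_eq_append_conv2[of d0 _ t2] by blast
    moreover have "us = []" if "d0 = t2 @ us" "us @ [e'] @ t0 = [e] @ d1" for us
      using that e'(2) e(3) by (cases us) (auto simp: left_free_def)
    moreover have "e' \<noteq> e" using uv antisym by auto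
    ultimately show ?thesis by (cases us) auto
  qed
  then obtain m where m: "t2 = d0 @ [e'] @ m" by blast
  have ab: "a1 = u @ q1" "a2 = v1 @ q1" "b1 = v1 @ q2" "b2 = u @ q2" using pe(2) pe'(2) uv by auto
  obtain k' where k': "path q1 k' q2" "k = dg k'" "length k' \<le> length (d1 @ d0)"
    using lsh_short_path[OF _ uv(5,4)] \<open>path a2 (d1 @ d0) b1\<close> ab by metis
  have "path b2 m a1" using pe(1) unfolding m path_append using pe' by (metis mor_dg mor_unique)
  moreover have "path (u @ q1) (map (shift_left u) k') (u @ q2)"
    using path_shift_left k'(1) rel_words[OF uv(3)] by blast
  ultimately have pm: "path b2 (m @ map (shift_left u) k') b2" unfolding path_append ab by blast
  \<comment> \<open>Conjugation by \<open>d0 @ [e']\<close> brings \<open>e\<close> and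
    \<open>e'\<close> together across the end of the closed path, where the pinch removes
    both.\<close>
  have gm: "mor q (dg (d0 @ [e'])) b2" using pe' by (intro mor_dg) (auto simp: path_append simp del: path.simps)
  have "lsh u k + dg [([], u, v1, q2)] = dg [e] + dg (d1 @ d0)"
    using left_edge_slide[OF uv(3,4)] uv by simp
  then have "lsh u k = dg [e] + dg (d1 @ d0) + dg [e']"
    using left_edge_inv[of v1 u q2] uv(2) by (metis add_diff_cancel diff_conv_add_uminus)
  then have "dg s + dg (d0 @ [e']) = dg (d0 @ [e']) + dg (m @ map (shift_left u) k')"
    unfolding s2 m by (simp only: dg_append lsh_dg[symmetric] k'(2)[symmetric] add.assoc)
  from min[OF gm pm this] have "length s \<le> length (m @ map (shift_left u) k')" .
  then show False using k'(3) s2 m by simp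
qed

end


definition cnj :: "'b::group_add \<Rightarrow> 'b \<Rightarrow> 'b" where
  "cnj f x = f + x + - f"

lemma cnj_add: "cnj f (x + y) = cnj f x + cnj f y"
  by (simp add: cnj_def add.assoc del: add_uminus_conv_diff)

lemma cnj_minus: "cnj f (- x) = - cnj f x"
  by (rule hom_minus) (rule cnj_add)

lemma cnj_0 [simp]: "cnj f 0 = 0" "cnj 0 x = x"
  by (simp_all add: cnj_def)

lemma cnj_cnj: "cnj f (cnj k x) = cnj (f + k) x"
  by (simp add: cnj_def add.assoc minus_add del: add_uminus_conv_diff)

lemma cnj_inj [simp]: "cnj f x = cnj f y \<longleftrightarrow> x = y"
  unfolding cnj_def add_right_cancel add_left_cancel ..

lemma cnj_eq_iff: "cnj k y = x \<longleftrightarrow> x + k = k + y"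
  by (auto simp: cnj_def diff_eq_eq)

section \<open>The left tree as a tree with a group action\<close>

context presentation
begin

definition vertices :: "'a list \<Rightarrow> ('a diagram \<times> 'a list) set set" where
  "vertices q = {coset [x] c g | x c g. mor q g (x # c)}"

definition tree_edges :: "'a list \<Rightarrow> (('a diagram \<times> 'a list) set \<times> 'a list \<times> 'a list) set" where
  "tree_edges q = {(coset u c g, u, v) | u v c g. (u, v) \<in> R \<and> mor q g (u @ c)}"

text \<open>On a tree edge all representatives in \<open>C\<close> give the same coset. The union
  returns it without a choice of representative; the same is done for
  \<open>edge_ter\<close>.\<close>

fun edge_ini :: "('a diagram \<times> 'a list) set \<times> 'a list \<times> 'a list \<Rightarrow> ('a diagram \<times> 'a list) set" where
  "edge_ini (C, u, v) = (\<Union>(g, c)\<in>C. coset [hd u] (tl u @ c) g)"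

fun edge_ter :: "('a diagram \<times> 'a list) set \<times> 'a list \<times> 'a list \<Rightarrow> ('a diagram \<times> 'a list) set" where
  "edge_ter (C, u, v) = (\<Union>(g, c)\<in>C. coset [hd v] (tl v @ c) (g + left_edge u v c))"

abbreviation adj :: "'a list \<Rightarrow> ('a diagram \<times> 'a list) set \<Rightarrow> ('a diagram \<times> 'a list) set \<Rightarrow> bool" where
  "adj q V V' \<equiv> (\<exists>l. fst l \<in> tree_edges q \<and> letter_ini edge_ini edge_ter l = V \<and> letter_ini edge_ini edge_ter (flip l) = V')"

lemma coset_hd:
  assumes "mor c d c'" "u \<in> lists A" "u \<noteq> []"
  shows "coset [hd u] (tl u @ c') (g + lsh u d) = coset [hd u] (tl u @ c) g"
proof -
  obtain x u' where u: "u = x # u'" using assms(3) by (cases u) auto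
  have "mor (u' @ c) (lsh u' d) (u' @ c')" using mor_lsh[OF _ assms(1)] assms(2) u by auto
  from coset_eqI[OF this, of "[x]" g] show ?thesis using u by (simp add: lsh_lsh)
qed

lemma edge_ini_coset:
  assumes "rel u v" "c \<in> lists A"
  shows "edge_ini (coset u c g, u, v) = coset [hd u] (tl u @ c) g"
proof -
  have u: "u \<in> lists A" "u \<noteq> []" using rel_words[OF assms(1)] by auto
  have "coset [hd u] (tl u @ c') g' = coset [hd u] (tl u @ c) g" if "(g', c') \<in> coset u c g" for g' c'
    using that coset_hd[OF _ u] unfolding coset_def[of u] by blast
  then have "edge_ini (coset u c g, u, v) = (\<Union>(g', c')\<in>coset u c g. coset [hd u] (tl u @ c) g)"
    unfolding edge_ini.simps by (intro SUP_cong) auto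
  also have "\<dots> = coset [hd u] (tl u @ c) g" using coset_self[OF assms(2), of g u] by auto
  finally show ?thesis .
qed

lemma edge_ter_coset:
  assumes "rel u v" "c \<in> lists A"
  shows "edge_ter (coset u c g, u, v) = coset [hd v] (tl v @ c) (g + left_edge u v c)"
proof -
  have v: "v \<in> lists A" "v \<noteq> []" using rel_words[OF assms(1)] by auto
  have "coset [hd v] (tl v @ c') (g' + left_edge u v c') = coset [hd v] (tl v @ c) (g + left_edge u v c)"
    if gc: "(g', c') \<in> coset u c g" for g' c'
  proof -
    obtain d where d: "mor c d c'" "g' = g + lsh u d" using gc unfolding coset_def by blast
    have "g' + left_edge u v c' = g + left_edge u v c + lsh v d"
      using left_edge_slide[OF assms(1) d(1)] d(2) by (simp add: add.assoc)
    then show ?thesis using coset_hd[OF d(1) v] by simp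
  qed
  then have "edge_ter (coset u c g, u, v) = (\<Union>(g', c')\<in>coset u c g. coset [hd v] (tl v @ c) (g + left_edge u v c))"
    unfolding edge_ter.simps by (intro SUP_cong) auto
  also have "\<dots> = coset [hd v] (tl v @ c) (g + left_edge u v c)" using coset_self[OF assms(2), of g u] by auto
  finally show ?thesis .
qed

lemma letter_edge:
  assumes "rel u v" "mor q g (u @ c)"
  shows "fst (letter g ([], u, v, c)) \<in> tree_edges q"
    "letter_ini edge_ini edge_ter (letter g ([], u, v, c)) = coset [hd u] (tl u @ c) g"
    "letter_ini edge_ini edge_ter (flip (letter g ([], u, v, c))) = coset [hd v] (tl v @ c) (g + left_edge u v c)"
proof -
  have c: "c \<in> lists A" using mor_words[OF assms(2)] by simp
  have "mor q (g + left_edge u v c) (v @ c)" using mor_add[OF assms(2) mor_left_edge[OF assms(1) c]] .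
  then show "fst (letter g ([], u, v, c)) \<in> tree_edges q"
    using assms unfolding tree_edges_def by auto
  have inv: "g + left_edge u v c + left_edge v u c = g" by (simp add: left_edge_inv[of v u])
  show "letter_ini edge_ini edge_ter (letter g ([], u, v, c)) = coset [hd u] (tl u @ c) g"
    "letter_ini edge_ini edge_ter (flip (letter g ([], u, v, c))) = coset [hd v] (tl v @ c) (g + left_edge u v c)"
    using edge_ini_coset[OF assms(1) c] edge_ter_coset[OF assms(1) c]
      edge_ini_coset[of v u c "g + left_edge u v c"] edge_ter_coset[of v u c "g + left_edge u v c"] assms(1) c inv
    by auto
qed

lemma tree_edge_letter:
  assumes "fst l \<in> tree_edges q"
  obtains g u v c where "rel u v" "mor q g (u @ c)" "l = letter g ([], u, v, c)"
proof -
  obtain u v c g s where l: "l = ((coset u c g, u, v), s)" "(u, v) \<in> R" "mor q g (u @ c)"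
    using assms unfolding tree_edges_def by (cases l) auto
  have c: "c \<in> lists A" using mor_words[OF l(3)] by simp
  show ?thesis
  proof (cases s)
    case True
    then show ?thesis using that[of u v g c] l by simp
  next
    case False
    have "mor q (g + left_edge u v c) (v @ c)" using mor_add[OF l(3) mor_left_edge] l(2) c by blast
    then show ?thesis using that[of v u "g + left_edge u v c" c] l False antisym[OF l(2)]
      by (simp add: left_edge_inv[of v u])
  qed
qed

lemma adj_iff:
  "adj q V V' \<longleftrightarrow> (\<exists>g u v c. rel u v \<and> mor q g (u @ c) \<and> V = coset [hd u] (tl u @ c) g \<and>
    V' = coset [hd v] (tl v @ c) (g + left_edge u v c))"
proof
  assume "adj q V V'"
  then obtain l where l: "fst l \<in> tree_edges q" "letter_ini edge_ini edge_ter l = V" "letter_ini edge_ini edge_ter (flip l) = V'"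
    by blast
  obtain g u v c where g: "rel u v" "mor q g (u @ c)" "l = letter g ([], u, v, c)"
    using l(1) by (rule tree_edge_letter)
  have "V = coset [hd u] (tl u @ c) g" "V' = coset [hd v] (tl v @ c) (g + left_edge u v c)"
    using l(2,3) letter_edge(2,3)[OF g(1,2)] g(3) by simp_all
  then show "\<exists>g u v c. rel u v \<and> mor q g (u @ c) \<and> V = coset [hd u] (tl u @ c) g \<and>
    V' = coset [hd v] (tl v @ c) (g + left_edge u v c)" using g(1,2) by blast
next
  assume "\<exists>g u v c. rel u v \<and> mor q g (u @ c) \<and> V = coset [hd u] (tl u @ c) g \<and>
    V' = coset [hd v] (tl v @ c) (g + left_edge u v c)"
  then obtain g u v c where g: "rel u v" "mor q g (u @ c)" "V = coset [hd u] (tl u @ c) g"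
    "V' = coset [hd v] (tl v @ c) (g + left_edge u v c)" by blast
  show "adj q V V'" using letter_edge[OF g(1,2)] unfolding g(3,4)
    by (intro exI[of _ "letter g ([], u, v, c)"] conjI)
qed

lemma coset_hd_vertex:
  assumes "mor q g (u @ c)" "u \<noteq> []"
  shows "coset [hd u] (tl u @ c) g \<in> vertices q"
proof -
  have uc: "u @ c = hd u # tl u @ c" using assms(2) by (cases u) auto
  have "mor q g (hd u # tl u @ c)" using assms(1) unfolding uc .
  then show ?thesis unfolding vertices_def by blast
qed

text \<open>A left edge leads to an adjacent vertex, and any other edge stays in the coset of the
  first letter.\<close>

lemma path_connected:
  "path (x # c) s (x' # c') \<Longrightarrow> mor q g (x # c) \<Longrightarrow> (adj q)\<^sup>*\<^sup>* (coset [x] c g) (coset [x'] c' (g + dg s))"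
proof (induction s arbitrary: x c g)
  case Nil
  then show ?case by (simp add: dg_Nil)
next
  case (Cons e s)
  obtain p u v r where e: "e = (p, u, v, r)" by (cases e)
  have e': "p \<in> lists A" "r \<in> lists A" "rel u v" "x # c = p @ u @ r" "path (p @ v @ r) s (x' # c')"
    using Cons.prems(1) e by auto
  have u: "u \<noteq> []" and v: "v \<noteq> []" using rel_words[OF e'(3)] by auto
  have "path (x # c) [e] (p @ v @ r)" using Cons.prems(1) path_words[OF e'(5)] e by auto
  then have me: "mor q (g + dg [e]) (p @ v @ r)" using mor_add[OF Cons.prems(2) mor_dg] by blast
  have g: "g + dg (e # s) = (g + dg [e]) + dg s" by (subst dg_Cons) (simp add: add.assoc)
  show ?case
  proof (cases p)
    case Nil
    have v': "p @ v @ r = hd v # tl v @ r" using Nil v by (cases v) auto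
    have "x = hd u" "c = tl u @ r" using e'(4) Nil u by (cases u; auto)+
    then have "adj q (coset [x] c g) (coset [hd v] (tl v @ r) (g + dg [e]))"
    proof -
      have "mor q g (u @ r)" using Cons.prems(2) unfolding e'(4) Nil by simp
      moreover have "coset [x] c g = coset [hd u] (tl u @ r) g"
        "coset [hd v] (tl v @ r) (g + dg [e]) = coset [hd v] (tl v @ r) (g + left_edge u v r)"
        using \<open>x = hd u\<close> \<open>c = tl u @ r\<close> Nil e by simp_all
      ultimately show ?thesis unfolding adj_iff using e'(3) by blast
    qed
    moreover have "(adj q)\<^sup>*\<^sup>* (coset [hd v] (tl v @ r) (g + dg [e])) (coset [x'] c' (g + dg (e # s)))"
      unfolding g using Cons.IH e'(5) me unfolding v' by blast
    ultimately show ?thesis by (rule converse_rtranclp_into_rtranclp)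
  next
    case (Cons y p')
    then have y: "y = x" "c = p' @ u @ r" using e'(4) by auto
    have "mor c (dg [(p', u, v, r)]) (p' @ v @ r)"
      by (rule mor_dg) (use e' y rel_words[OF e'(3)] Cons in auto)
    from coset_eqI[OF this, of "[x]" g] have "coset [x] (p' @ v @ r) (g + dg [e]) = coset [x] c g"
      using e Cons y by (simp add: lsh_dg)
    then show ?thesis unfolding g using Cons.IH[of x "p' @ v @ r" "g + dg [e]"] e'(5) me Cons y by simp
  qed
qed

text \<open>Where two edges of a walk meet, the cosets agree, so a path to the right of the first
  letter joins them. Thus a walk in the tree becomes a path whose tree word it is.\<close>

lemma letter_walk_lift:
  "letter_walk edge_ini edge_ter xs l \<Longrightarrow> fst ` set l \<subseteq> tree_edges q \<Longrightarrow> hd xs = coset [x] c g \<Longrightarrow> mor q g (x # c) \<Longrightarrow>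
    \<exists>s x' c'. path (x # c) s (x' # c') \<and> last xs = coset [x'] c' (g + dg s) \<and> tree_word g s = l"
proof (induction edge_ini edge_ter xs l arbitrary: x c g rule: letter_walk.induct)
  case (1 V l)
  then show ?case using mor_words[OF 1(4)]
    by (intro exI[of _ "[]"] exI[of _ x] exI[of _ c]) (simp add: dg_Nil)
next
  case (2 V V' xs l w)
  then have "fst l \<in> tree_edges q" by simp
  then obtain g1 u v c1 where l: "rel u v" "mor q g1 (u @ c1)" "l = letter g1 ([], u, v, c1)"
    by (rule tree_edge_letter)
  have u: "u \<noteq> []" "v \<noteq> []" using rel_words[OF l(1)] by auto
  have c1: "c1 \<in> lists A" "tl u @ c1 \<in> lists A" using mor_words[OF l(2)] u by (cases u; auto)+
  have V: "V = coset [hd u] (tl u @ c1) g1" "V' = coset [hd v] (tl v @ c1) (g1 + left_edge u v c1)"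
    using 2(2) letter_edge(2,3)[OF l(1,2)] l(3) by auto
  have "coset [x] c g = coset [hd u] (tl u @ c1) g1" using 2(4) V(1) by simp
  then obtain d where d: "mor c d (tl u @ c1)" "g1 = g + lsh [x] d" using coset_eqD c1(2) by blast
  obtain ds where ds: "path c ds (tl u @ c1)" "d = dg ds" using d(1) by (auto simp: mor_def)
  have xA: "[x] \<in> lists A" using mor_words[OF 2(5)] by simp
  have "mor q g1 ([x] @ tl u @ c1)" using mor_add[of q g "[x] @ c"] mor_lsh[OF xA d(1)] 2(5) d(2) by simp
  then have xu: "x # tl u @ c1 = u @ c1" using mor_unique[OF _ l(2)] by simp
  let ?s0 = "map (shift_left [x]) ds @ [([], u, v, c1)]"
  have p1: "path (x # c) (map (shift_left [x]) ds) (u @ c1)" using path_shift_left[OF xA ds(1)] xu by simp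
  have p2: "path (u @ c1) [([], u, v, c1)] (v @ c1)" using l(1) c1 rel_words[OF l(1)] by auto
  have p0: "path (x # c) ?s0 (v @ c1)" using p1 p2 unfolding path_append by blast
  have g0: "g + dg ?s0 = g1 + left_edge u v c1" using d ds(2) by (simp add: dg_append lsh_dg add.assoc)
  have vv: "v @ c1 = hd v # tl v @ c1" using u by (cases v) auto
  have "mor q (g1 + left_edge u v c1) (hd v # tl v @ c1)"
    using mor_add[OF l(2) mor_left_edge[OF l(1) c1(1)]] unfolding vv .
  moreover have "fst ` set w \<subseteq> tree_edges q" "hd (V' # xs) = coset [hd v] (tl v @ c1) (g1 + left_edge u v c1)"
    "letter_walk edge_ini edge_ter (V' # xs) w"
    using 2(2,3) V(2) by auto
  ultimately obtain s x' c' where s: "path (hd v # tl v @ c1) s (x' # c')"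
    "last (V' # xs) = coset [x'] c' (g1 + left_edge u v c1 + dg s)" "tree_word (g1 + left_edge u v c1) s = w"
    using 2(1)[of "hd v" "tl v @ c1" "g1 + left_edge u v c1"] by blast
  have "path (v @ c1) s (x' # c')" using s(1) unfolding vv .
  then have "path (x # c) (?s0 @ s) (x' # c')" using p0 path_append[of "x # c" ?s0 s "x' # c'"] by blast
  moreover have "last (V # V' # xs) = coset [x'] c' (g + dg (?s0 @ s))"
    using s(2) unfolding g0[symmetric] by (simp add: dg_append dg_Cons[of _ s] add.assoc)
  moreover have "tree_word g (?s0 @ s) = l # w"
    using s(3) l(3) d(2) ds(2) unfolding tree_word_append
    by (simp add: tree_word_left_free left_free_shift g0[symmetric] lsh_dg dg_append add.assoc del: letter.simps)
  ultimately show ?case by blast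
qed auto

lemma tree_left:
  assumes q: "q \<in> lists A" "q \<noteq> []"
  shows "tree (vertices q) (adj q)"
proof (rule tree_of_edges[of "tree_edges q" edge_ini _ edge_ter])
  fix e assume "e \<in> tree_edges q"
  then obtain u v c g where e: "e = (coset u c g, u, v)" "(u, v) \<in> R" "mor q g (u @ c)"
    unfolding tree_edges_def by blast
  have uv: "u \<noteq> []" "v \<noteq> []" using rel_words e(2) by blast+
  have c: "c \<in> lists A" using mor_words[OF e(3)] by simp
  have "mor q (g + left_edge u v c) (v @ c)" using mor_add[OF e(3) mor_left_edge] e(2) c by blast
  from coset_hd_vertex[OF this uv(2)] coset_hd_vertex[OF e(3) uv(1)]
  show "edge_ini e \<in> vertices q" "edge_ter e \<in> vertices q"
    using e(1,2) edge_ini_coset[of u v c g] edge_ter_coset[of u v c g] c by simp_all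
next
  fix V V' assume "V \<in> vertices q" "V' \<in> vertices q"
  obtain y q0 where yq: "q = y # q0" using q by (cases q) auto
  have base: "(adj q)\<^sup>*\<^sup>* (coset [y] q0 0) W" if W_in: "W \<in> vertices q" for W
  proof -
    obtain x c g where W: "W = coset [x] c g" "mor q g (x # c)" using W_in unfolding vertices_def by blast
    then obtain s where "path (y # q0) s (x # c)" "g = dg s" using yq by (auto simp: mor_def)
    then show ?thesis using path_connected[of y q0 s x c q 0] mor_0[OF q(1)] W yq by simp
  qed
  have sym: "adj q W' W" if WW: "adj q W W'" for W W'
  proof -
    obtain e s where l: "e \<in> tree_edges q" "letter_ini edge_ini edge_ter (e, s) = W"
      "letter_ini edge_ini edge_ter (e, \<not> s) = W'" using WW by fastforce
    show ?thesis using l by (intro exI[of _ "(e, \<not> s)"]) simp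
  qed
  have "symp (adj q)" using sym by (rule sympI)
  then have "symp (adj q)\<^sup>*\<^sup>*" by (rule symp_rtranclp)
  then have "(adj q)\<^sup>*\<^sup>* V (coset [y] q0 0)" using base[OF \<open>V \<in> vertices q\<close>] by (rule sympD)
  then have "(adj q)\<^sup>*\<^sup>* V V'" using base[OF \<open>V' \<in> vertices q\<close>] by (rule rtranclp_trans)
  then show "\<exists>xs. xs \<noteq> [] \<and> hd xs = V \<and> last xs = V' \<and> successively (adj q) xs" by (rule rtranclp_walk)
next
  fix xs w
  assume w: "letter_walk edge_ini edge_ter xs w" "fst ` set w \<subseteq> tree_edges q" "hd xs = last xs" "freely_reduced w"
  show "w = []"
  proof (rule ccontr)
    assume "w \<noteq> []"
    then obtain l w' where lw: "w = l # w'" by (cases w) auto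
    then obtain V xs' where xs: "xs = V # xs'" "letter_ini edge_ini edge_ter l = V"
      using w(1) by (cases xs rule: remdups_adj.cases) auto
    have "fst l \<in> tree_edges q" using w(2) lw by simp
    then obtain g u v c where l: "rel u v" "mor q g (u @ c)" "l = letter g ([], u, v, c)"
      by (rule tree_edge_letter)
    have "u \<noteq> []" using rel_words[OF l(1)] by auto
    then have uc: "u @ c = hd u # tl u @ c" by (cases u) auto
    have hd: "hd xs = coset [hd u] (tl u @ c) g" using xs letter_edge(2)[OF l(1,2)] l(3) by simp
    have m: "mor q g (hd u # tl u @ c)" using l(2) unfolding uc .
    obtain s x' c' where s: "path (hd u # tl u @ c) s (x' # c')" "last xs = coset [x'] c' (g + dg s)" "tree_word g s = w"
      using letter_walk_lift[OF w(1,2) hd m] by blast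
    have "coset [x'] c' (g + dg s) = coset [hd u] (tl u @ c) g" using s(2) hd w(3) by simp
    moreover have "tl u @ c \<in> lists A" using mor_words[OF m] by simp
    ultimately obtain d where d: "mor c' d (tl u @ c)" "g = g + dg s + lsh [x'] d" using coset_eqD by blast
    obtain ds where ds: "path c' ds (tl u @ c)" "d = dg ds" using d(1) by (auto simp: mor_def)
    have x'A: "[x'] \<in> lists A" using path_words[OF s(1)] by simp
    let ?t = "s @ map (shift_left [x']) ds"
    have t: "path (hd u # tl u @ c) ?t (x' # tl u @ c)"
      using s(1) path_shift_left[OF x'A ds(1)] unfolding path_append by auto
    have "g + dg ?t = g + 0" using d(2) ds(2) by (simp add: dg_append lsh_dg add.assoc)
    then have "dg ?t = dg []" unfolding dg_Nil by (simp only: add_left_cancel)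
    \<comment> \<open>The lift of a closed walk, closed up to the right of its last letter, has the
      trivial class. So its tree word reduces to the empty word.\<close>
    then have "free_red (tree_word g ?t) = free_red (tree_word g [])"
      using free_red_tree_word_eq[OF t, of "[]" "hd u # tl u @ c"] mor_words[OF m] by simp
    then have "free_red w = []" using s(3) by (simp add: tree_word_append tree_word_left_free left_free_shift free_red_def)
    then show False using free_red_reduced[OF w(4)] \<open>w \<noteq> []\<close> by simp
  qed
qed simp

lemma automorphism_translate:
  assumes q: "q \<in> lists A" "q \<noteq> []" and h: "mor q h q"
  shows "tree.automorphism (vertices q) (adj q) (translate h)"
proof -
  have V: "translate k V \<in> vertices q" if kV: "mor q k q" "V \<in> vertices q" for k V
  proof -
    obtain x c g where W: "V = coset [x] c g" "mor q g (x # c)" using kV(2) unfolding vertices_def by blast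
    have "translate k V = coset [x] c (k + g)" "mor q (k + g) (x # c)"
      using W mor_add[OF kV(1)] by (simp_all add: translate_coset)
    then show ?thesis unfolding vertices_def by blast
  qed
  have inv: "translate h (translate (- h) V) = V" if "V \<in> vertices q" for V
    using that unfolding vertices_def by (auto simp: translate_coset)
  have "bij_betw (translate h) (vertices q) (vertices q)"
    unfolding bij_betw_def
  proof
    show "inj_on (translate h) (vertices q)" using inj_translate inj_on_subset by blast
    show "translate h ` vertices q = vertices q"
    proof (rule subset_antisym; rule subsetI)
      fix W assume "W \<in> translate h ` vertices q"
      then show "W \<in> vertices q" using V[OF h] by auto
    next
      fix W assume W: "W \<in> vertices q"
      from imageI[OF V[OF mor_minus[OF h] W], of "translate h"] show "W \<in> translate h ` vertices q"
        unfolding inv[OF W] .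
    qed
  qed
  moreover have "adj q (translate h V) (translate h V')" if VV': "adj q V V'" for V V'
  proof -
    obtain g u v c where g: "rel u v" "mor q g (u @ c)" "V = coset [hd u] (tl u @ c) g"
      "V' = coset [hd v] (tl v @ c) (g + left_edge u v c)" using VV' unfolding adj_iff by blast
    have "mor q (h + g) (u @ c)" using mor_add[OF h g(2)] .
    moreover have "translate h V = coset [hd u] (tl u @ c) (h + g)"
      "translate h V' = coset [hd v] (tl v @ c) (h + g + left_edge u v c)"
      using g(3,4) by (simp_all add: translate_coset add.assoc)
    ultimately show ?thesis unfolding adj_iff using g(1) by blast
  qed
  ultimately show ?thesis unfolding tree.automorphism_def[OF tree_left[OF q]] by blast
qed

lemma elliptic_iff:
  assumes "mor q h q"
  shows "elliptic q h \<longleftrightarrow> (\<exists>V\<in>vertices q. translate h V = V)"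
proof
  assume "elliptic q h"
  then obtain g x c d where g: "mor q g (x # c)" "mor c d c" "h + g = g + lsh [x] d" by (auto simp: elliptic_def)
  then have "translate h (coset [x] c g) = coset [x] c g"
    using coset_eqI[OF g(2), of "[x]" g] by (simp add: translate_coset)
  then show "\<exists>V\<in>vertices q. translate h V = V" using g(1) unfolding vertices_def by blast
next
  assume "\<exists>V\<in>vertices q. translate h V = V"
  then obtain x c g where g: "mor q g (x # c)" "translate h (coset [x] c g) = coset [x] c g"
    unfolding vertices_def by blast
  have "coset [x] c g = coset [x] c (h + g)" using g(2) by (simp add: translate_coset)
  moreover have "c \<in> lists A" using mor_words[OF g(1)] by simp
  ultimately obtain d where "mor c d c" "h + g = g + lsh [x] d" using coset_eqD by blast
  then show "elliptic q h" using g(1) by (auto simp: elliptic_def)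
qed

lemma translate_translate: "translate g (translate h V) = translate (g + h) V"
  unfolding translate_def by (force simp: add.assoc)

lemma translate_0: "translate 0 V = V"
  unfolding translate_def by (force simp: map_prod_def)

lemma elliptic_nonempty: "elliptic q h \<Longrightarrow> mor q h q \<Longrightarrow> q \<noteq> []"
proof
  assume "elliptic q h" "q = []"
  then obtain g x c where "mor [] g (x # c)" by (auto simp: elliptic_def)
  then obtain s where "path [] s (x # c)" by (auto simp: mor_def)
  then show False
  proof (cases s)
    case (Cons e s')
    obtain p u v r where "e = (p, u, v, r)" by (cases e)
    then have "rel u v" "u = []" using Cons \<open>path [] s (x # c)\<close> by auto
    then show False using rel_words by blast
  qed simp
qed

text \<open>By \<open>commuting_elliptic\<close> the two diagrams have a common fixed
  vertex.\<close>

lemma elliptic_add: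
  assumes "mor q g q" "mor q h q" "elliptic q g" "elliptic q h" "g + h = h + g"
  shows "elliptic q (g + h)"
proof -
  have q: "q \<in> lists A" "q \<noteq> []" using mor_words assms(1) elliptic_nonempty assms(3) by blast+
  obtain V where V: "V \<in> vertices q" "translate g V = V" using elliptic_iff[OF assms(1)] assms(3) by blast
  obtain W where W: "W \<in> vertices q" "translate h W = W" using elliptic_iff[OF assms(2)] assms(4) by blast
  have "\<exists>X\<in>vertices q. translate g X = X \<and> translate h X = X"
    by (rule tree.commuting_elliptic[OF tree_left[OF q] automorphism_translate[OF q assms(1)] V
      automorphism_translate[OF q assms(2)] W]) (simp add: translate_translate assms(5))
  then obtain X where X: "X \<in> vertices q" "translate g X = X" "translate h X = X" by blast
  then have "translate (g + h) X = X" by (simp flip: translate_translate)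
  then show ?thesis using elliptic_iff[OF mor_add[OF assms(1,2)]] X(1) by blast
qed

lemma elliptic_minus:
  assumes "mor q g q" "elliptic q g"
  shows "elliptic q (- g)"
proof -
  obtain V where V: "V \<in> vertices q" "translate g V = V" using elliptic_iff[OF assms(1)] assms(2) by blast
  then have "translate (- g) V = translate (- g) (translate g V)" by simp
  then have "translate (- g) V = V" unfolding translate_translate by (simp add: translate_0)
  then show ?thesis using elliptic_iff[OF mor_minus[OF assms(1)]] V(1) by blast
qed

text \<open>Both diagrams centralize \<open>g\<close>, so they act as shifts on the orbit found in
  \<open>axis\<close>. Shifts commute, and the commutator fixes every vertex there.\<close>

lemma elliptic_commutator:
  assumes g: "mor q g q" "\<not> elliptic q g" and q: "q \<noteq> []"
    and x: "mor q x q" "x + g = g + x" and y: "mor q y q" "y + g = g + y"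
  shows "elliptic q (x + y - x - y)"
proof -
  have qA: "q \<in> lists A" using mor_words[OF g(1)] by simp
  interpret T: tree "vertices q" "adj q" by (rule tree_left[OF qA q])
  note auto = automorphism_translate[OF qA q]
  obtain V where V: "V \<in> vertices q"
    using mor_0[OF qA] q unfolding vertices_def by (cases q) auto
  have nofix: "translate g v \<noteq> v" if "v \<in> vertices q" for v
    using elliptic_iff[OF g(1)] g(2) that by auto
  have ne: "vertices q \<noteq> {}" using V by auto
  obtain l :: "int \<Rightarrow> ('a diagram \<times> 'a list) set" where l0: "\<forall>i. l i \<in> vertices q \<and> adj q (l i) (l (i + 1))"
    and l1: "\<forall>h. T.automorphism h \<and> (\<forall>v\<in>vertices q. h (translate g v) = translate g (h v)) \<longrightarrow>
      (\<exists>m. \<forall>i. h (l i) = l (i + m))"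
  proof -
    have "\<exists>l :: int \<Rightarrow> _. (\<forall>i. l i \<in> vertices q \<and> adj q (l i) (l (i + 1))) \<and>
      ((\<forall>v\<in>vertices q. translate g (translate g v) \<noteq> v) \<longrightarrow> inj l) \<and>
      (\<forall>h. T.automorphism h \<and> (\<forall>v\<in>vertices q. h (translate g v) = translate g (h v)) \<longrightarrow>
        (\<exists>m. \<forall>i. h (l i) = l (i + m)))"
      by (rule T.axis[OF auto[OF g(1)] _ ne]) (rule nofix)
    then show thesis by (elim exE conjE) (rule that)
  qed
  have shift: "\<exists>m. \<forall>i. translate h (l i) = l (i + m)" if "mor q h q" "h + g = g + h" for h
    using l1[rule_format, of "translate h"] auto[OF that(1)] that(2) by (simp add: translate_translate)
  obtain m where m: "\<And>i. translate x (l i) = l (i + m)" using shift[OF x] by blast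
  obtain n where n: "\<And>i. translate y (l i) = l (i + n)" using shift[OF y] by blast
  have minv: "translate (- x) (l i) = l (i - m)" for i
  proof -
    have "translate (- x) (l i) = translate (- x) (translate x (l (i - m)))" using m[of "i - m"] by simp
    then show ?thesis unfolding translate_translate by (simp add: translate_0)
  qed
  have ninv: "translate (- y) (l i) = l (i - n)" for i
  proof -
    have "translate (- y) (l i) = translate (- y) (translate y (l (i - n)))" using n[of "i - n"] by simp
    then show ?thesis unfolding translate_translate by (simp add: translate_0)
  qed
  have "translate (x + (y + (- x + - y))) (l 0) = l 0"
    unfolding translate_translate[symmetric] by (simp add: m n minv ninv)
  moreover have "x + y - x - y = x + (y + (- x + - y))"
    by (simp only: diff_conv_add_uminus add.assoc)
  ultimately have "translate (x + y - x - y) (l 0) = l 0" by simp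
  moreover have "mor q (x + y - x - y) q"
    using mor_add[OF mor_add[OF mor_add[OF x(1) y(1)] mor_minus[OF x(1)]] mor_minus[OF y(1)]] by simp
  ultimately show ?thesis using elliptic_iff l0[rule_format, of 0] by blast
qed

lemma elliptic_cnj:
  assumes "mor q k q'" "elliptic q' b"
  shows "elliptic q (cnj k b)"
proof -
  obtain g x c d where g: "mor q' g (x # c)" "mor c d c" "b + g = g + lsh [x] d" using assms(2) by (auto simp: elliptic_def)
  have "cnj k b + (k + g) = k + (b + g)" by (simp add: cnj_def add.assoc[symmetric])
  also have "\<dots> = (k + g) + lsh [x] d" by (simp add: g(3) add.assoc)
  finally show ?thesis using mor_add[OF assms(1) g(1)] g(2) unfolding elliptic_def by blast
qed

lemma mor_cnj: "mor a f b \<Longrightarrow> mor b x b \<Longrightarrow> mor a (cnj f x) a"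
  unfolding cnj_def using mor_add[OF mor_add mor_minus, of a f b x b a f] by simp

end


section \<open>Mirror images of presentations\<close>

definition mirror_rel :: "'a list rel \<Rightarrow> 'a list rel" where
  "mirror_rel R = {(u, v). (rev u, rev v) \<in> R}"

lemma mirror_rel_iff [simp]: "(u, v) \<in> mirror_rel R \<longleftrightarrow> (rev u, rev v) \<in> R"
  by (simp add: mirror_rel_def)

lemma mirror_rel_mirror_rel [simp]: "mirror_rel (mirror_rel R) = R"
  by auto

lemma mirror_edge_comp [simp]: "mirror_edge \<circ> mirror_edge = id"
proof
  fix e :: "'a squier_edge" show "(mirror_edge \<circ> mirror_edge) e = id e" by (cases e) simp
qed

lemma map_mirror_edge: "map mirror_edge (map mirror_edge s) = s"
  by simp

lemma rev_in_lists: "rev x \<in> lists A \<longleftrightarrow> x \<in> lists A"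
  by (simp add: in_lists_conv_set)

lemma lsh_cnj: "lsh x (cnj f g) = cnj (lsh x f) (lsh x g)"
  by (simp add: cnj_def lsh_add lsh_minus del: add_uminus_conv_diff)

lemma rsh_cnj: "rsh x (cnj f g) = cnj (rsh x f) (rsh x g)"
  by (simp add: cnj_def rsh_add rsh_minus del: add_uminus_conv_diff)

lemma mirror_cnj: "mirror (cnj f g) = cnj (mirror f) (mirror g)"
  by (simp add: cnj_def mirror_add mirror_minus del: add_uminus_conv_diff)

lemma cnj_commute: "cnj k x + cnj k y = cnj k y + cnj k x \<longleftrightarrow> x + y = y + x"
  by (simp flip: cnj_add)

lemma commute_minus: "x + z = z + x \<Longrightarrow> - x + z = z + - (x :: 'b :: group_add)"
proof -
  assume "x + z = z + x"
  then have "- x + (x + z) + - x = - x + (z + x) + - x" by simp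
  then show ?thesis by (simp add: add.assoc del: add_uminus_conv_diff)
qed

lemma commute_add:
  fixes x y z :: "'b :: group_add"
  assumes "x + z = z + x" "y + z = z + y"
  shows "(x + y) + z = z + (x + y)"
proof -
  have "(x + y) + z = x + (z + y)" by (simp add: add.assoc assms(2))
  also have "\<dots> = z + (x + y)" by (simp add: add.assoc[symmetric] assms(1))
  finally show ?thesis .
qed

context presentation
begin

lemma path_Nil: "path [] s b \<Longrightarrow> s = []"
proof (cases s)
  case (Cons e s')
  obtain p u v q where e: "e = (p, u, v, q)" by (cases e)
  assume "path [] s b"
  then have "rel u v" "u = []" using Cons e by auto
  then show ?thesis using rel_words by blast
qed simp

lemma mirror_presentation: "presentation A (mirror_rel R)"
proof
  show "semigroup_presentation A (mirror_rel R)"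
    using pres unfolding semigroup_presentation_def nonempty_words_def by fastforce
qed

abbreviation "mpath \<equiv> presentation.path A (mirror_rel R)"
abbreviation "mmor \<equiv> presentation.mor A (mirror_rel R)"
abbreviation "melliptic \<equiv> presentation.elliptic A (mirror_rel R)"

lemma mirror_path: "path a s b \<Longrightarrow> mpath (rev a) (map mirror_edge s) (rev b)"
proof (induction s arbitrary: a)
  case Nil
  interpret M: presentation A "mirror_rel R" by (rule mirror_presentation)
  show ?case using Nil by auto
next
  case (Cons e s)
  interpret M: presentation A "mirror_rel R" by (rule mirror_presentation)
  obtain p u v q where e: "e = (p, u, v, q)" by (cases e)
  then have *: "p \<in> lists A" "q \<in> lists A" "rel u v" "a = p @ u @ q" "path (p @ v @ q) s b" using Cons.prems by auto
  have "mpath (rev (p @ v @ q)) (map mirror_edge s) (rev b)" by (rule Cons.IH[OF *(5)])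
  then show ?case using * e by auto
qed

lemma mirror_path_iff: "mpath (rev a) (map mirror_edge s) (rev b) \<longleftrightarrow> path a s b"
proof
  assume m: "mpath (rev a) (map mirror_edge s) (rev b)"
  have "map mirror_edge (map mirror_edge s) = s" by (rule map_mirror_edge)
  then show "path a s b" using presentation.mirror_path[OF mirror_presentation m] by simp
qed (rule mirror_path)

lemma mirror_mor_iff: "mmor (rev a) (mirror g) (rev b) \<longleftrightarrow> mor a g b"
proof -
  interpret M: presentation A "mirror_rel R" by (rule mirror_presentation)
  have *: "map mirror_edge (map mirror_edge s) = s" for s :: "'a squier_edge list" by (rule map_mirror_edge)
  show ?thesis
  proof
    assume "mmor (rev a) (mirror g) (rev b)"
    then obtain s where s: "mpath (rev a) s (rev b)" "mirror g = dg s" by (auto simp: M.mor_def)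
    then have "path a (map mirror_edge s) b" using mirror_path_iff[of a "map mirror_edge s" b] * by simp
    moreover have "g = dg (map mirror_edge s)" using s(2) by (metis mirror_dg mirror_mirror)
    ultimately show "mor a g b" unfolding mor_def by blast
  next
    assume "mor a g b"
    then obtain s where "path a s b" "g = dg s" by (auto simp: mor_def)
    then show "mmor (rev a) (mirror g) (rev b)" using M.mor_dg[OF mirror_path] by (simp add: mirror_dg)
  qed
qed

text \<open>Split off the longest prefix that the path never touches. A non-empty path touches some
  letter, so the process stops.\<close>

lemma strip_left:
  assumes "path w s w" "s \<noteq> []"
  obtains p q t where "w = p @ q" "s = map (shift_left p) t" "path q t q" "\<not> left_free t"
proof -
  have "\<exists>p q t. w = p @ q \<and> s = map (shift_left p) t \<and> path q t q \<and> \<not> left_free t"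
    using assms
  proof (induction w arbitrary: s)
    case Nil
    then show ?case using path_Nil by blast
  next
    case (Cons x w)
    show ?case
    proof (cases "left_free s")
      case True
      then obtain s' b where s': "s = map (shift_left [x]) s'" "x # w = x # b" "path w s' b"
        using left_freeE[OF Cons.prems(1)] by blast
      then obtain p q t where t: "w = p @ q" "s' = map (shift_left p) t" "path q t q" "\<not> left_free t"
        using Cons.IH[of s'] Cons.prems(2) by auto
      have "shift_left [x] \<circ> shift_left p = (shift_left (x # p) :: 'a squier_edge \<Rightarrow> _)" by auto
      then have "s = map (shift_left (x # p)) t" using s'(1) t(2) by simp
      then show ?thesis using t by (intro exI[of _ "x # p"] exI[of _ q] exI[of _ t]) simp
    next
      case False
      have "shift_left [] = (\<lambda>e :: 'a squier_edge. e)" by auto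
      then have "s = map (shift_left []) s" by simp
      then show ?thesis using False Cons.prems by (intro exI[of _ "[]"] exI[of _ "x # w"] exI[of _ s]) simp
    qed
  qed
  then show ?thesis using that by blast
qed

section \<open>Minimal representatives and the parts of a centralizer\<close>

definition conj_minimal :: "'a list \<Rightarrow> 'a squier_edge list \<Rightarrow> bool" where
  "conj_minimal w s \<longleftrightarrow> (\<forall>g q s'. mor w g q \<longrightarrow> path q s' q \<longrightarrow> dg s + g = g + dg s' \<longrightarrow> length s \<le> length s')"

lemma conj_minimal_shift_left:
  assumes "conj_minimal (p @ c) (map (shift_left p) t)" "p \<in> lists A"
  shows "conj_minimal c t"
  unfolding conj_minimal_def
proof (intro allI impI)
  fix g q s' assume *: "mor c g q" "path q s' q" "dg t + g = g + dg s'"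
  have "dg (map (shift_left p) t) + lsh p g = lsh p g + dg (map (shift_left p) s')"
    using *(3) by (simp flip: lsh_dg lsh_add)
  then have "length (map (shift_left p) t) \<le> length (map (shift_left p) s')"
    using assms(1) mor_lsh[OF assms(2) *(1)] path_shift_left[OF assms(2) *(2)] unfolding conj_minimal_def by blast
  then show "length t \<le> length s'" by simp
qed

lemma conj_minimal_mirror:
  assumes "conj_minimal w s"
  shows "presentation.conj_minimal A (mirror_rel R) (rev w) (map mirror_edge s)"
proof -
  interpret M: presentation A "mirror_rel R" by (rule mirror_presentation)
  show ?thesis unfolding M.conj_minimal_def
  proof (intro allI impI)
    fix g q s' assume *: "mmor (rev w) g q" "mpath q s' q" "dg (map mirror_edge s) + g = g + dg s'"
    have mm: "map mirror_edge (map mirror_edge t) = t" for t :: "'a squier_edge list" by (rule map_mirror_edge)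
    have "mor w (mirror g) (rev q)" using mirror_mor_iff[of w "mirror g" "rev q"] *(1) by simp
    moreover have "path (rev q) (map mirror_edge s') (rev q)"
      using mirror_path_iff[of "rev q" "map mirror_edge s'" "rev q"] *(2) mm by simp
    moreover have "mirror (dg (map mirror_edge s) + g) = mirror (g + dg s')" using *(3) by simp
    then have "dg s + mirror g = mirror g + dg (map mirror_edge s')" by (simp add: mirror_add mirror_dg mm)
    ultimately have "length s \<le> length (map mirror_edge s')" using assms unfolding conj_minimal_def by blast
    then show "length (map mirror_edge s) \<le> length s'" by simp
  qed
qed

text \<open>Choose a shortest closed path in the conjugacy class and strip the untouched prefix
  \<open>p\<close> and the untouched suffix \<open>r\<close>. Minimality is inherited by what
  remains after stripping one side and by mirror images, so one representative is hyperbolic on both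
  sides.\<close>

lemma normal_form:
  assumes "mor w g w" "g \<noteq> 0"
  obtains f p q r a where "mor w f (p @ q @ r)" "mor q a q" "g = cnj f (lsh p (rsh r a))"
    "\<not> elliptic (q @ r) (rsh r a)" "\<not> melliptic (rev q @ rev p) (rsh (rev p) (mirror a))"
proof -
  interpret M: presentation A "mirror_rel R" by (rule mirror_presentation)
  define P where "P n \<longleftrightarrow> (\<exists>f w' s. mor w f w' \<and> path w' s w' \<and> g = cnj f (dg s) \<and> length s = n)" for n
  have wA: "w \<in> lists A" using mor_words[OF assms(1)] by simp
  obtain s0 where "path w s0 w" "g = dg s0" using assms(1) by (auto simp: mor_def)
  then have "P (length s0)" unfolding P_def using mor_0[OF wA] by (metis cnj_0(2))
  then have "P (LEAST n. P n)" by (rule LeastI)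
  then obtain f w' s where s: "mor w f w'" "path w' s w'" "g = cnj f (dg s)" "length s = (LEAST n. P n)"
    unfolding P_def by blast
  have min: "conj_minimal w' s"
    unfolding conj_minimal_def
  proof (intro allI impI)
    fix k q s' assume *: "mor w' k q" "path q s' q" "dg s + k = k + dg s'"
    have "cnj k (dg s') = dg s" using *(3) cnj_eq_iff by blast
    then have "g = cnj (f + k) (dg s')" using s(3) by (simp flip: cnj_cnj)
    then have "P (length s')" unfolding P_def using mor_add[OF s(1) *(1)] *(2) by blast
    then show "length s \<le> length s'" using s(4) Least_le[of P] by simp
  qed
  have "s \<noteq> []" using s(3) assms(2) by (auto simp: dg_Nil)
  then obtain p c t where t: "w' = p @ c" "s = map (shift_left p) t" "path c t c" "\<not> left_free t"
    using strip_left[OF s(2)] by blast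
  have "map mirror_edge t \<noteq> []" using \<open>s \<noteq> []\<close> t(2) by auto
  then obtain r' q' t' where t': "rev c = r' @ q'" "map mirror_edge t = map (shift_left r') t'"
    "mpath q' t' q'" "\<not> M.left_free t'"
    using M.strip_left[OF mirror_path[OF t(3)]] by blast
  define q r a where "q = rev q'" and "r = rev r'" and "a = map mirror_edge t'"
  have mm: "map mirror_edge (map mirror_edge t) = t" for t :: "'a squier_edge list" by (rule map_mirror_edge)
  have ma: "map mirror_edge a = t'" unfolding a_def by (rule mm)
  have c: "c = q @ r" using t'(1) by (metis q_def r_def rev_append rev_rev_ident)
  have "path q a q" using mirror_path_iff[of q a q] t'(3) ma by (simp add: q_def)
  have ta: "t = map (shift_right r) a"
  proof -
    have "t = map mirror_edge (map (shift_left r') t')" using t'(2) mm[of t] by simp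
    moreover have "mirror_edge (shift_left r' e) = shift_right r (mirror_edge e)" for e :: "'a squier_edge"
      by (cases e) (simp add: r_def)
    ultimately show ?thesis by (simp add: a_def)
  qed
  have words: "p \<in> lists A" "q \<in> lists A" "r \<in> lists A" using path_words[OF s(2)] t(1) c by auto
  have "conj_minimal c t" using conj_minimal_shift_left min t(1,2) words(1) by blast
  then have "\<not> elliptic c (dg t)"
    using minimal_hyperbolic[OF t(3,4)] unfolding conj_minimal_def by blast
  then have hyp: "\<not> elliptic (q @ r) (rsh r (dg a))" using c ta by (simp add: rsh_dg)
  define b where "b = map mirror_edge (map (shift_left p) a)"
  have b: "b = map (shift_right (rev p)) t'"
  proof -
    have "mirror_edge (shift_left p e) = shift_right (rev p) (mirror_edge e)" for e :: "'a squier_edge" by (cases e) simp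
    then show ?thesis unfolding b_def using ma by (simp flip: ma)
  qed
  have s_eq: "map mirror_edge s = map (shift_left (rev r)) b"
  proof -
    have "mirror_edge (shift_left p (shift_right r e)) = shift_left (rev r) (mirror_edge (shift_left p e))" for e :: "'a squier_edge"
      by (cases e) simp
    then show ?thesis unfolding b_def t(2) ta by simp
  qed
  have "M.conj_minimal (rev w') (map mirror_edge s)" by (rule conj_minimal_mirror[OF min])
  then have "M.conj_minimal (rev r @ rev q @ rev p) (map (shift_left (rev r)) b)" using s_eq t(1) c by simp
  then have cm: "M.conj_minimal (rev q @ rev p) b"
    by (rule M.conj_minimal_shift_left) (simp add: rev_in_lists words(3))
  have "\<not> M.left_free b"
  proof -
    have "fst (shift_right x e) = fst e" for x and e :: "'a squier_edge" by (cases e) simp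
    then show ?thesis using t'(4) unfolding b M.left_free_def by simp
  qed
  moreover have "mpath (rev q @ rev p) b (rev q @ rev p)"
    using mirror_path[OF path_shift_left[OF words(1) \<open>path q a q\<close>]] unfolding b_def by simp
  ultimately have "\<not> melliptic (rev q @ rev p) (dg b)"
    using M.minimal_hyperbolic cm unfolding M.conj_minimal_def by blast
  moreover have "dg b = rsh (rev p) (mirror (dg a))" unfolding b_def by (simp only: mirror_dg[symmetric] lsh_dg[symmetric] mirror_lsh)
  moreover have "g = cnj f (lsh p (rsh r (dg a)))" using s(3) t(2) ta by (simp add: lsh_dg rsh_dg)
  ultimately show ?thesis using that[of f p q r "dg a"] s(1) t(1) c mor_dg[OF \<open>path q a q\<close>] hyp by simp
qed

definition frame :: "'a list \<Rightarrow> 'a diagram \<Rightarrow> 'a diagram \<Rightarrow> 'a list \<Rightarrow> 'a list \<Rightarrow> 'a diagram \<Rightarrow> bool" where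
  "frame w g f p q a \<longleftrightarrow> mor w f (p @ q) \<and> mor q a q \<and> \<not> elliptic q a \<and> g = cnj f (lsh p a)"

text \<open>The part of the centralizer of \<open>g\<close> to the left of \<open>g\<close>, a complement, and the elliptic elements of the latter.\<close>

definition Uset :: "'a list \<Rightarrow> 'a diagram \<Rightarrow> 'a diagram set" where
  "Uset w g = {cnj f (rsh q y) | f p q a y. frame w g f p q a \<and> mor p y p}"

definition Cset :: "'a list \<Rightarrow> 'a diagram \<Rightarrow> 'a diagram set" where
  "Cset w g = {cnj f (lsh p b) | f p q a b. frame w g f p q a \<and> mor q b q \<and> b + a = a + b}"

definition Eset :: "'a list \<Rightarrow> 'a diagram \<Rightarrow> 'a diagram set" where
  "Eset w g = {cnj f (lsh p b) | f p q a b. frame w g f p q a \<and> mor q b q \<and> b + a = a + b \<and> elliptic q b}"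

text \<open>Two frames give conjugate hyperbolic diagrams, so the change of frame splits into a part
  on \<open>p\<close> and a part on \<open>q\<close>. Hence \<open>Uset\<close>, \<open>Cset\<close>
  and \<open>Eset\<close> can be computed in any frame.\<close>

lemma frame_unique:
  assumes "frame w g f p q a" "frame w g f' p' q' a'"
  obtains k1 k2 where "mor p k1 p'" "mor q k2 q'" "f' = f + (rsh q k1 + lsh p' k2)" "cnj k2 a' = a"
proof -
  define k where "k = - f + f'"
  have k: "mor (p @ q) k (p' @ q')" using assms mor_add mor_minus unfolding frame_def k_def by blast
  have f': "f' = f + k" by (simp add: k_def)
  have "cnj f (lsh p a) = cnj f (cnj k (lsh p' a'))" using assms unfolding frame_def cnj_cnj f' by simp
  then have "lsh p a + k = k + lsh p' a'" by (metis cnj_inj cnj_eq_iff)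
  then obtain g1 g2 where g: "mor p g1 p'" "mor q g2 q'" "k = rsh q g1 + lsh p' g2" "a + g2 = g2 + a'"
    using hyperbolic_conjugate assms k unfolding frame_def by metis
  have "cnj g2 a' = a" using g(4) cnj_eq_iff by blast
  then show ?thesis using that g(1-3) f' by blast
qed

lemma cnj_slide_right:
  assumes "mor p k1 p'" "mor q b q"
  shows "cnj (rsh q k1) (lsh p' b) = lsh p b"
  unfolding cnj_eq_iff using interchange[OF assms] by simp

lemma cnj_slide_left:
  assumes "mor p y p" "mor q k2 q'"
  shows "cnj (lsh p k2) (rsh q' y) = rsh q y"
  unfolding cnj_eq_iff using interchange[OF assms] by simp

lemma Uset_eq:
  assumes F: "frame w g f p q a"
  shows "Uset w g = {cnj f (rsh q y) | y. mor p y p}"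
proof (rule subset_antisym; rule subsetI)
  fix x assume "x \<in> Uset w g"
  then obtain f' p' q' a' y where x: "x = cnj f' (rsh q' y)" "frame w g f' p' q' a'" "mor p' y p'"
    unfolding Uset_def by blast
  obtain k1 k2 where k: "mor p k1 p'" "mor q k2 q'" "f' = f + (rsh q k1 + lsh p' k2)" using frame_unique[OF F x(2)] by blast
  have "x = cnj f (cnj (rsh q k1) (cnj (lsh p' k2) (rsh q' y)))" unfolding x(1) k(3) cnj_cnj ..
  also have "\<dots> = cnj f (rsh q (cnj k1 y))" unfolding cnj_slide_left[OF x(3) k(2)] rsh_cnj ..
  finally show "x \<in> {cnj f (rsh q y) | y. mor p y p}" using mor_cnj[OF k(1) x(3)] by blast
qed (use F in \<open>unfold Uset_def, blast\<close>)

lemma Cset_Eset_aux: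
  assumes F: "frame w g f p q a" and F': "frame w g f' p' q' a'"
    and b: "mor q' b q'" "b + a' = a' + b"
  shows "\<exists>b'. cnj f' (lsh p' b) = cnj f (lsh p b') \<and> mor q b' q \<and> b' + a = a + b' \<and> (elliptic q' b \<longrightarrow> elliptic q b')"
proof -
  obtain k1 k2 where k: "mor p k1 p'" "mor q k2 q'" "f' = f + (rsh q k1 + lsh p' k2)" "cnj k2 a' = a"
    using frame_unique[OF F F'] by blast
  have mb: "mor q (cnj k2 b) q" by (rule mor_cnj[OF k(2) b(1)])
  have "cnj f' (lsh p' b) = cnj f (cnj (rsh q k1) (cnj (lsh p' k2) (lsh p' b)))" unfolding k(3) cnj_cnj ..
  also have "\<dots> = cnj f (lsh p (cnj k2 b))" unfolding lsh_cnj[symmetric] cnj_slide_right[OF k(1) mb] ..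
  finally have "cnj f' (lsh p' b) = cnj f (lsh p (cnj k2 b))" .
  moreover have "cnj k2 b + a = a + cnj k2 b" using b(2) unfolding k(4)[symmetric] cnj_commute .
  ultimately show ?thesis using mb elliptic_cnj[OF k(2)] by blast
qed

lemma Cset_eq:
  assumes F: "frame w g f p q a"
  shows "Cset w g = {cnj f (lsh p b) | b. mor q b q \<and> b + a = a + b}"
proof (rule subset_antisym; rule subsetI)
  fix x assume "x \<in> Cset w g"
  then obtain f' p' q' a' b where x: "x = cnj f' (lsh p' b)" "frame w g f' p' q' a'" "mor q' b q'" "b + a' = a' + b"
    unfolding Cset_def by blast
  then show "x \<in> {cnj f (lsh p b) | b. mor q b q \<and> b + a = a + b}" using Cset_Eset_aux[OF F x(2-4)] by blast
qed (use F in \<open>unfold Cset_def, blast\<close>)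

lemma Eset_eq:
  assumes F: "frame w g f p q a"
  shows "Eset w g = {cnj f (lsh p b) | b. mor q b q \<and> b + a = a + b \<and> elliptic q b}"
proof (rule subset_antisym; rule subsetI)
  fix x assume "x \<in> Eset w g"
  then obtain f' p' q' a' b where x: "x = cnj f' (lsh p' b)" "frame w g f' p' q' a'" "mor q' b q'" "b + a' = a' + b" "elliptic q' b"
    unfolding Eset_def by blast
  then show "x \<in> {cnj f (lsh p b) | b. mor q b q \<and> b + a = a + b \<and> elliptic q b}" using Cset_Eset_aux[OF F x(2-4)] by blast
qed (use F in \<open>unfold Eset_def, blast\<close>)

lemma frame_exists:
  assumes "mor w g w" "g \<noteq> 0"
  obtains f p q a where "frame w g f p q a" "q \<noteq> []"
proof -
  obtain f p q r a where *: "mor w f (p @ q @ r)" "mor q a q" "g = cnj f (lsh p (rsh r a))" "\<not> elliptic (q @ r) (rsh r a)"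
    using normal_form[OF assms] by metis
  have "r \<in> lists A" using mor_words[OF *(1)] by auto
  then have "frame w g f p (q @ r) (rsh r a)" using * mor_rsh unfolding frame_def by simp
  moreover have "q @ r \<noteq> []"
  proof
    assume "q @ r = []"
    then obtain s where s: "path [] s []" "a = dg s" using *(2) by (auto simp: mor_def)
    then show False using *(3) assms(2) path_Nil[OF s(1)] by (simp add: dg_Nil)
  qed
  ultimately show ?thesis using that by blast
qed

context
  fixes w g assumes g: "mor w g w" "g \<noteq> 0"
begin

lemma set_mor: "x \<in> Uset w g \<Longrightarrow> mor w x w" "x \<in> Cset w g \<Longrightarrow> mor w x w"
proof -
  obtain f p q a where F: "frame w g f p q a" "q \<noteq> []" by (rule frame_exists[OF g])
  have f: "mor w f (p @ q)" and A: "p \<in> lists A" "q \<in> lists A" using F(1) mor_words[of w f "p @ q"] by (auto simp: frame_def)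
  show "x \<in> Uset w g \<Longrightarrow> mor w x w"
    unfolding Uset_eq[OF F(1)] using mor_cnj[OF f mor_rsh[OF A(2)]] by blast
  show "x \<in> Cset w g \<Longrightarrow> mor w x w"
    unfolding Cset_eq[OF F(1)] using mor_cnj[OF f mor_lsh[OF A(1)]] by blast
qed

lemma Uset_group: "0 \<in> Uset w g" "x \<in> Uset w g \<Longrightarrow> y \<in> Uset w g \<Longrightarrow> x + y \<in> Uset w g"
  "x \<in> Uset w g \<Longrightarrow> - x \<in> Uset w g"
proof -
  obtain f p q a where F: "frame w g f p q a" "q \<noteq> []" by (rule frame_exists[OF g])
  have A: "p \<in> lists A" using F(1) mor_words[of w f "p @ q"] by (auto simp: frame_def)
  note eq = Uset_eq[OF F(1)]
  have "0 = cnj f (rsh q 0)" by simp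
  then show "0 \<in> Uset w g" unfolding eq using mor_0[OF A] by blast
  show "x + y \<in> Uset w g" if xy: "x \<in> Uset w g" "y \<in> Uset w g"
  proof -
    obtain x' y' where "x = cnj f (rsh q x')" "mor p x' p" "y = cnj f (rsh q y')" "mor p y' p" using xy unfolding eq by blast
    then have "x + y = cnj f (rsh q (x' + y'))" "mor p (x' + y') p" using mor_add by (auto simp: rsh_add cnj_add)
    then show ?thesis unfolding eq by blast
  qed
  show "- x \<in> Uset w g" if x: "x \<in> Uset w g"
  proof -
    obtain x' where "x = cnj f (rsh q x')" "mor p x' p" using x unfolding eq by blast
    then have "- x = cnj f (rsh q (- x'))" "mor p (- x') p" using mor_minus by (auto simp: rsh_minus cnj_minus)
    then show ?thesis unfolding eq by blast
  qed
qed

lemma Cset_group: "0 \<in> Cset w g" "x \<in> Cset w g \<Longrightarrow> y \<in> Cset w g \<Longrightarrow> x + y \<in> Cset w g"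
  "x \<in> Cset w g \<Longrightarrow> - x \<in> Cset w g"
proof -
  obtain f p q a where F: "frame w g f p q a" "q \<noteq> []" by (rule frame_exists[OF g])
  have A: "q \<in> lists A" using F(1) mor_words[of w f "p @ q"] by (auto simp: frame_def)
  note eq = Cset_eq[OF F(1)]
  have "0 = cnj f (lsh p 0)" "0 + a = a + 0" by simp_all
  then show "0 \<in> Cset w g" unfolding eq using mor_0[OF A] by blast
  show "x + y \<in> Cset w g" if xy: "x \<in> Cset w g" "y \<in> Cset w g"
  proof -
    obtain x' y' where *: "x = cnj f (lsh p x')" "mor q x' q" "x' + a = a + x'" "y = cnj f (lsh p y')" "mor q y' q" "y' + a = a + y'"
      using xy unfolding eq by blast
    have "x + y = cnj f (lsh p (x' + y'))" "mor q (x' + y') q" using * mor_add by (auto simp: lsh_add cnj_add)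
    moreover have "(x' + y') + a = a + (x' + y')" by (rule commute_add[OF *(3,6)])
    ultimately show ?thesis unfolding eq by blast
  qed
  show "- x \<in> Cset w g" if x: "x \<in> Cset w g"
  proof -
    obtain x' where *: "x = cnj f (lsh p x')" "mor q x' q" "x' + a = a + x'" using x unfolding eq by blast
    then have "- x = cnj f (lsh p (- x'))" "mor q (- x') q" using mor_minus by (auto simp: lsh_minus cnj_minus)
    then show ?thesis unfolding eq using commute_minus[OF *(3)] by blast
  qed
qed

lemma Uset_Cset_commute: "x \<in> Uset w g \<Longrightarrow> y \<in> Cset w g \<Longrightarrow> x + y = y + x"
proof -
  obtain f p q a where F: "frame w g f p q a" "q \<noteq> []" by (rule frame_exists[OF g])
  assume "x \<in> Uset w g" "y \<in> Cset w g"
  then obtain x' y' where "x = cnj f (rsh q x')" "mor p x' p" "y = cnj f (lsh p y')" "mor q y' q"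
    unfolding Uset_eq[OF F(1)] Cset_eq[OF F(1)] by blast
  then show ?thesis using interchange[of p x' p q y' q] by (simp flip: cnj_add)
qed

lemma Uset_Cset_disjoint: "x \<in> Uset w g \<Longrightarrow> x \<in> Cset w g \<Longrightarrow> x = 0"
proof -
  obtain f p q a where F: "frame w g f p q a" "q \<noteq> []" by (rule frame_exists[OF g])
  assume "x \<in> Uset w g" "x \<in> Cset w g"
  then obtain x' y' where *: "x = cnj f (rsh q x')" "mor p x' p" "x = cnj f (lsh p y')" "mor q y' q"
    unfolding Uset_eq[OF F(1)] Cset_eq[OF F(1)] by blast
  then have "rsh q x' = lsh p y'" by simp
  then show ?thesis using sum_trivial[OF *(2,4)] * by simp
qed

lemma self_Cset: "g \<in> Cset w g" and self_Eset: "g \<notin> Eset w g"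
proof -
  obtain f p q a where F: "frame w g f p q a" "q \<noteq> []" by (rule frame_exists[OF g])
  then have *: "g = cnj f (lsh p a)" "mor q a q" "\<not> elliptic q a" by (auto simp: frame_def)
  then show "g \<in> Cset w g" unfolding Cset_eq[OF F(1)] by blast
  show "g \<notin> Eset w g" unfolding Eset_eq[OF F(1)] using * by auto
qed

text \<open>In a frame the element commutes with the hyperbolic \<open>lsh p a\<close>, and
  \<open>hyperbolic_conjugate\<close> splits it.\<close>

lemma decompose:
  assumes "mor w x w" "x + g = g + x"
  shows "\<exists>u\<in>Uset w g. \<exists>y\<in>Cset w g. x = u + y"
proof -
  obtain f p q a where F: "frame w g f p q a" "q \<noteq> []" by (rule frame_exists[OF g])
  define k where "k = cnj (- f) x"
  have x: "x = cnj f k" unfolding k_def cnj_cnj by simp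
  have f: "mor w f (p @ q)" "mor q a q" "\<not> elliptic q a" "g = cnj f (lsh p a)" using F by (auto simp: frame_def)
  have k: "mor (p @ q) k (p @ q)" unfolding k_def by (rule mor_cnj[OF mor_minus[OF f(1)] assms(1)])
  have "k + lsh p a = lsh p a + k" using assms(2) unfolding x f(4) cnj_commute .
  then obtain k1 k2 where *: "mor p k1 p" "mor q k2 q" "k = rsh q k1 + lsh p k2" "a + k2 = k2 + a"
    using hyperbolic_conjugate[OF f(2,3) f(2,3) k] by metis
  have "x = cnj f (rsh q k1) + cnj f (lsh p k2)" using x *(3) by (simp add: cnj_add)
  moreover have "cnj f (rsh q k1) \<in> Uset w g" unfolding Uset_eq[OF F(1)] using *(1) by blast
  moreover have "cnj f (lsh p k2) \<in> Cset w g" unfolding Cset_eq[OF F(1)] using *(2,4) by auto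
  ultimately show ?thesis by blast
qed

lemma Eset_Cset: "x \<in> Eset w g \<Longrightarrow> x \<in> Cset w g"
  unfolding Eset_def Cset_def by blast

lemma Eset_add: "x \<in> Eset w g \<Longrightarrow> y \<in> Eset w g \<Longrightarrow> x + y = y + x \<Longrightarrow> x + y \<in> Eset w g"
proof -
  obtain f p q a where F: "frame w g f p q a" "q \<noteq> []" by (rule frame_exists[OF g])
  assume xy: "x \<in> Eset w g" "y \<in> Eset w g" "x + y = y + x"
  then obtain x' y' where *: "x = cnj f (lsh p x')" "mor q x' q" "x' + a = a + x'" "elliptic q x'"
    "y = cnj f (lsh p y')" "mor q y' q" "y' + a = a + y'" "elliptic q y'"
    unfolding Eset_eq[OF F(1)] by blast
  have "lsh p x' + lsh p y' = lsh p y' + lsh p x'" using xy(3) unfolding *(1,5) cnj_commute .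
  then have "x' + y' = y' + x'" by (simp flip: lsh_add)
  then have "elliptic q (x' + y')" using elliptic_add * by blast
  moreover have "(x' + y') + a = a + (x' + y')" by (rule commute_add[OF *(3,7)])
  moreover have "x + y = cnj f (lsh p (x' + y'))" "mor q (x' + y') q" using * mor_add by (auto simp: lsh_add cnj_add)
  ultimately show ?thesis unfolding Eset_eq[OF F(1)] by blast
qed

lemma Eset_minus: "x \<in> Eset w g \<Longrightarrow> - x \<in> Eset w g"
proof -
  obtain f p q a where F: "frame w g f p q a" "q \<noteq> []" by (rule frame_exists[OF g])
  assume "x \<in> Eset w g"
  then obtain x' where *: "x = cnj f (lsh p x')" "mor q x' q" "x' + a = a + x'" "elliptic q x'" unfolding Eset_eq[OF F(1)] by blast
  then have "- x = cnj f (lsh p (- x'))" "mor q (- x') q" "elliptic q (- x')" "- x' + a = a + - x'"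
    using mor_minus elliptic_minus commute_minus[OF *(3)] by (auto simp: lsh_minus cnj_minus)
  then show ?thesis unfolding Eset_eq[OF F(1)] by blast
qed

lemma Eset_commutator:
  assumes "x \<in> Cset w g" "y \<in> Cset w g"
  shows "x + y - x - y \<in> Eset w g"
proof -
  obtain f p q a where F: "frame w g f p q a" "q \<noteq> []" by (rule frame_exists[OF g])
  obtain x' y' where *: "x = cnj f (lsh p x')" "mor q x' q" "x' + a = a + x'" "y = cnj f (lsh p y')" "mor q y' q" "y' + a = a + y'"
    using assms unfolding Cset_eq[OF F(1)] by blast
  have a: "mor q a q" "\<not> elliptic q a" using F by (auto simp: frame_def)
  let ?z = "x' + y' - x' - y'"
  have z: "?z = x' + (y' + (- x' + - y'))" by (simp only: diff_conv_add_uminus add.assoc)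
  have "elliptic q ?z" using elliptic_commutator[OF a F(2)] * by blast
  moreover have "mor q ?z q"
    unfolding z using mor_add[OF *(2) mor_add[OF *(5) mor_add[OF mor_minus[OF *(2)] mor_minus[OF *(5)]]]] .
  moreover have "?z + a = a + ?z"
    unfolding z by (intro commute_add commute_minus *(3,6))
  moreover have "x + y - x - y = cnj f (lsh p ?z)"
    unfolding z * by (simp only: diff_conv_add_uminus add.assoc lsh_add lsh_minus cnj_add cnj_minus)
  ultimately show ?thesis unfolding Eset_eq[OF F(1)] by blast
qed

text \<open>Such an \<open>x\<close> has a frame with the same prefix and the same conjugating
  diagram as \<open>g\<close>, and \<open>Uset\<close> depends on nothing else.\<close>

lemma Uset_hyperbolic: "x \<in> Cset w g \<Longrightarrow> x \<notin> Eset w g \<Longrightarrow> Uset w x = Uset w g"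
proof -
  obtain f p q a where F: "frame w g f p q a" "q \<noteq> []" by (rule frame_exists[OF g])
  assume "x \<in> Cset w g" "x \<notin> Eset w g"
  then obtain b where "x = cnj f (lsh p b)" "mor q b q" "\<not> elliptic q b"
    unfolding Cset_eq[OF F(1)] Eset_eq[OF F(1)] by blast
  then have "frame w x f p q b" using F by (auto simp: frame_def)
  then show ?thesis using Uset_eq F by simp
qed

text \<open>An elliptic \<open>x\<close> fixes one more letter \<open>y\<close>, so it has a frame
  whose prefix also contains \<open>y\<close>. If \<open>g\<close> were in \<open>Cset w x\<close>,
  it would act to the right of \<open>y\<close> too and be elliptic in its own frame.\<close>

lemma Eset_separates:
  assumes "x \<in> Eset w g" "x \<noteq> 0"
  shows "g \<notin> Cset w x"
proof
  obtain f p q a where F: "frame w g f p q a" "q \<noteq> []" by (rule frame_exists[OF g])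
  assume gx: "g \<in> Cset w x"
  obtain b where b: "x = cnj f (lsh p b)" "mor q b q" "elliptic q b"
    using assms(1) unfolding Eset_eq[OF F(1)] by blast
  then obtain k y c d where k: "mor q k (y # c)" "mor c d c" "b + k = k + lsh [y] d" unfolding elliptic_def by blast
  have bk: "b = cnj k (lsh [y] d)" using k(3) cnj_eq_iff by metis
  have "d \<noteq> 0" using b(1) bk assms(2) by auto
  then obtain f1 p1 q1 a1 where F1: "frame c d f1 p1 q1 a1" "q1 \<noteq> []" by (rule frame_exists[OF k(2)])
  have pA: "p \<in> lists A" using F(1) mor_words[of w f "p @ q"] by (auto simp: frame_def)
  have yA: "[y] \<in> lists A" using mor_words[OF k(1)] by auto
  define k' where "k' = k + lsh [y] f1"
  have k': "mor q k' (y # p1 @ q1)"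
    using mor_add[OF k(1), of "lsh [y] f1"] mor_lsh[OF yA, of c f1 "p1 @ q1"] F1 unfolding k'_def frame_def by simp
  have f': "mor w (f + lsh p k') (p @ y # p1 @ q1)"
    using mor_add mor_lsh[OF pA k'] F unfolding frame_def by blast
  have xk: "x = cnj (f + lsh p k') (lsh (p @ y # p1) a1)"
  proof -
    have "x = cnj f (lsh p (cnj k (lsh [y] (cnj f1 (lsh p1 a1)))))" using b(1) bk F1 by (simp add: frame_def)
    then show ?thesis by (simp add: k'_def lsh_cnj lsh_lsh lsh_add flip: cnj_cnj)
  qed
  have Fx: "frame w x (f + lsh p k') (p @ y # p1) q1 a1"
    using f' F1 xk by (auto simp: frame_def)
  obtain a' where a': "g = cnj (f + lsh p k') (lsh (p @ y # p1) a')" "mor q1 a' q1"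
    using gx unfolding Cset_eq[OF Fx] by blast
  have "cnj f (lsh p a) = cnj f (lsh p (cnj k' (lsh (y # p1) a')))"
    using F a'(1) by (simp add: frame_def lsh_cnj lsh_lsh flip: cnj_cnj)
  then have a: "a = cnj k' (lsh [y] (lsh p1 a'))" by (simp add: lsh_lsh)
  have "p1 \<in> lists A" using F1(1) mor_words[of c f1 "p1 @ q1"] by (auto simp: frame_def)
  then have "mor (p1 @ q1) (lsh p1 a') (p1 @ q1)" using mor_lsh a'(2) by blast
  moreover have "a + k' = k' + lsh [y] (lsh p1 a')" using a cnj_eq_iff by metis
  ultimately have "elliptic q a" unfolding elliptic_def using k' by blast
  then show False using F by (simp add: frame_def)
qed

lemma Uset_cnj:
  assumes "mor w t w" "x \<in> Uset w g"
  shows "cnj t x \<in> Uset w (cnj t g)"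
proof -
  obtain f p q a where F: "frame w g f p q a" "q \<noteq> []" by (rule frame_exists[OF g])
  then have F': "frame w (cnj t g) (t + f) p q a"
    using mor_add[OF assms(1)] by (auto simp: frame_def cnj_cnj)
  obtain y where "x = cnj f (rsh q y)" "mor p y p" using assms(2) unfolding Uset_eq[OF F(1)] by blast
  then have "cnj t x = cnj (t + f) (rsh q y)" "mor p y p" by (simp_all add: cnj_cnj)
  then show ?thesis unfolding Uset_eq[OF F'] by blast
qed

lemma Cset_cnj:
  assumes "mor w t w" "x \<in> Cset w g"
  shows "cnj t x \<in> Cset w (cnj t g)"
proof -
  obtain f p q a where F: "frame w g f p q a" "q \<noteq> []" by (rule frame_exists[OF g])
  then have F': "frame w (cnj t g) (t + f) p q a"
    using mor_add[OF assms(1)] by (auto simp: frame_def cnj_cnj)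
  obtain y where "x = cnj f (lsh p y)" "mor q y q" "y + a = a + y" using assms(2) unfolding Cset_eq[OF F(1)] by blast
  then have "cnj t x = cnj (t + f) (lsh p y)" "mor q y q" "y + a = a + y" by (simp_all add: cnj_cnj)
  then show ?thesis unfolding Cset_eq[OF F'] by blast
qed

end

section \<open>Links between the decompositions on the two sides\<close>

abbreviation "mUset \<equiv> presentation.Uset A (mirror_rel R)"
abbreviation "mCset \<equiv> presentation.Cset A (mirror_rel R)"

text \<open>Both frames are built from the same \<open>f\<close> and \<open>a\<close>, which makes
  the two decompositions comparable.\<close>

lemma normal_form_frames:
  assumes "mor w f (p @ q @ r)" "mor q a q" "g = cnj f (lsh p (rsh r a))"
    "\<not> elliptic (q @ r) (rsh r a)" "\<not> melliptic (rev q @ rev p) (rsh (rev p) (mirror a))"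
  shows "frame w g f p (q @ r) (rsh r a)"
    and "presentation.frame A (mirror_rel R) (rev w) (mirror g) (mirror f) (rev r) (rev q @ rev p) (rsh (rev p) (mirror a))"
proof -
  interpret M: presentation A "mirror_rel R" by (rule mirror_presentation)
  have words: "p \<in> lists A" "r \<in> lists A" using mor_words[OF assms(1)] by auto
  show "frame w g f p (q @ r) (rsh r a)" using assms mor_rsh[OF words(2) assms(2)] by (simp add: frame_def)
  have "mmor (rev w) (mirror f) (rev r @ rev q @ rev p)" using mirror_mor_iff[of w f "p @ q @ r"] assms(1) by simp
  moreover have "mmor (rev q @ rev p) (rsh (rev p) (mirror a)) (rev q @ rev p)"
    by (rule M.mor_rsh) (simp_all add: rev_in_lists mirror_mor_iff assms(2) words(1))
  ultimately show "M.frame (rev w) (mirror g) (mirror f) (rev r) (rev q @ rev p) (rsh (rev p) (mirror a))"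
    using assms(5) unfolding M.frame_def assms(3) by (simp add: mirror_cnj mirror_lsh mirror_rsh lsh_rsh)
qed

text \<open>An element of \<open>Uset w g\<close> acts on \<open>p\<close> only. In the mirrored
  frame \<open>p\<close> belongs to the part on which \<open>g\<close> is hyperbolic, and the
  element commutes with \<open>g\<close> because they act on disjoint factors.\<close>

lemma Uset_mCset:
  assumes g: "mor w g w" "g \<noteq> 0" and x: "x \<in> Uset w g"
  shows "mirror x \<in> mCset (rev w) (mirror g)"
proof -
  interpret M: presentation A "mirror_rel R" by (rule mirror_presentation)
  obtain f p q r a where n: "mor w f (p @ q @ r)" "mor q a q" "g = cnj f (lsh p (rsh r a))"
    "\<not> elliptic (q @ r) (rsh r a)" "\<not> melliptic (rev q @ rev p) (rsh (rev p) (mirror a))"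
    using normal_form[OF g] by blast
  note F = normal_form_frames[OF n]
  obtain y where y: "x = cnj f (rsh (q @ r) y)" "mor p y p" using x unfolding Uset_eq[OF F(1)] by blast
  have my: "mmor (rev p) (mirror y) (rev p)" and ma: "mmor (rev q) (mirror a) (rev q)"
    using mirror_mor_iff y(2) n(2) by blast+
  have "mirror x = cnj (mirror f) (lsh (rev r) (lsh (rev q) (mirror y)))"
    unfolding y(1) by (simp add: mirror_cnj mirror_rsh lsh_lsh)
  moreover have "mmor (rev q @ rev p) (lsh (rev q) (mirror y)) (rev q @ rev p)"
    using M.mor_lsh[OF _ my] M.mor_words[OF ma] by blast
  moreover have "lsh (rev q) (mirror y) + rsh (rev p) (mirror a) = rsh (rev p) (mirror a) + lsh (rev q) (mirror y)"
    using M.interchange[OF ma my] by simp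
  ultimately show ?thesis unfolding M.Cset_eq[OF F(2)] by blast
qed

text \<open>The element \<open>u\<close> acts on \<open>p\<close> and \<open>g\<close> acts on
  \<open>q @ r\<close>. A normal form of \<open>u\<close> within \<open>p\<close> gives a mirrored
  frame of \<open>u\<close> whose untouched part contains \<open>q @ r\<close>.\<close>

lemma Uset_mUset:
  assumes g: "mor w g w" "g \<noteq> 0" and u: "u \<in> Uset w g" "u \<noteq> 0"
  shows "mirror g \<in> mUset (rev w) (mirror u)"
proof -
  interpret M: presentation A "mirror_rel R" by (rule mirror_presentation)
  obtain f p q r a where n: "mor w f (p @ q @ r)" "mor q a q" "g = cnj f (lsh p (rsh r a))"
    "\<not> elliptic (q @ r) (rsh r a)" "\<not> melliptic (rev q @ rev p) (rsh (rev p) (mirror a))"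
    using normal_form[OF g] by blast
  note F = normal_form_frames(1)[OF n]
  obtain y where y: "u = cnj f (rsh (q @ r) y)" "mor p y p" using u(1) unfolding Uset_eq[OF F] by blast
  have "y \<noteq> 0" using u(2) y(1) by auto
  then obtain f1 p1 q1 r1 a1 where n1: "mor p f1 (p1 @ q1 @ r1)" "mor q1 a1 q1" "y = cnj f1 (lsh p1 (rsh r1 a1))"
    "\<not> melliptic (rev q1 @ rev p1) (rsh (rev p1) (mirror a1))"
    using normal_form[OF y(2)] by metis
  have words: "q @ r \<in> lists A" "r1 \<in> lists A" "p1 \<in> lists A" "q1 \<in> lists A" "r \<in> lists A"
    using mor_words[OF n(1)] mor_words[OF n1(1)] by auto
  define f2 where "f2 = f + rsh (q @ r) f1"
  define r2 where "r2 = r1 @ q @ r"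
  have f2: "mor w f2 (p1 @ q1 @ r2)"
    using mor_add[OF n(1), of "rsh (q @ r) f1"] mor_rsh[OF words(1) n1(1)] unfolding f2_def r2_def by simp
  have u_eq: "u = cnj f2 (lsh p1 (rsh r2 a1))"
    unfolding y(1) n1(3) f2_def r2_def by (simp add: rsh_cnj lsh_rsh rsh_rsh flip: cnj_cnj)
  have "M.frame (rev w) (mirror u) (mirror f2) (rev r2) (rev q1 @ rev p1) (rsh (rev p1) (mirror a1))"
  proof -
    have "mmor (rev w) (mirror f2) (rev r2 @ rev q1 @ rev p1)" using mirror_mor_iff[of w f2 "p1 @ q1 @ r2"] f2 by simp
    moreover have "mmor (rev q1 @ rev p1) (rsh (rev p1) (mirror a1)) (rev q1 @ rev p1)"
      by (rule M.mor_rsh) (simp_all add: rev_in_lists mirror_mor_iff n1(2) words(3))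
    ultimately show ?thesis
      using n1(4) unfolding M.frame_def u_eq by (simp add: mirror_cnj mirror_lsh mirror_rsh lsh_rsh)
  qed
  note MU = M.Uset_eq[OF this]
  have ra: "mor (q @ r) (rsh r a) (q @ r)" using mor_rsh[OF words(5) n(2)] .
  have "cnj (rsh (q @ r) f1) (lsh (p1 @ q1 @ r1) (rsh r a)) = lsh p (rsh r a)"
    using cnj_slide_right[OF n1(1) ra] .
  then have "g = cnj f2 (lsh (p1 @ q1) (lsh r1 (rsh r a)))" unfolding n(3) f2_def by (simp add: lsh_lsh flip: cnj_cnj)
  then have "mirror g = cnj (mirror f2) (rsh (rev q1 @ rev p1) (mirror (lsh r1 (rsh r a))))"
    by (simp add: mirror_cnj mirror_lsh)
  moreover have "mor r2 (lsh r1 (rsh r a)) r2" using mor_lsh[OF words(2) ra] unfolding r2_def .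
  then have "mmor (rev r2) (mirror (lsh r1 (rsh r a))) (rev r2)" using mirror_mor_iff by blast
  ultimately show ?thesis unfolding MU by blast
qed

end


section \<open>Centralizers split on both sides\<close>

lemma (in group) centralizer_subgroup:
  assumes "a \<in> carrier G"
  shows "subgroup {x \<in> carrier G. x \<otimes> a = a \<otimes> x} G"
proof (rule subgroupI)
  fix x assume "x \<in> {x \<in> carrier G. x \<otimes> a = a \<otimes> x}"
  then have x: "x \<in> carrier G" "x \<otimes> a = a \<otimes> x" by auto
  have "inv x \<otimes> a = inv x \<otimes> (a \<otimes> x) \<otimes> inv x" using x assms by (simp add: m_assoc)
  also have "\<dots> = inv x \<otimes> (x \<otimes> a) \<otimes> inv x" using x by simp
  also have "\<dots> = a \<otimes> inv x" using x(1) assms by (simp add: m_assoc[symmetric])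
  finally show "inv x \<in> {x \<in> carrier G. x \<otimes> a = a \<otimes> x}" using x by simp
next
  fix x y assume "x \<in> {x \<in> carrier G. x \<otimes> a = a \<otimes> x}" "y \<in> {x \<in> carrier G. x \<otimes> a = a \<otimes> x}"
  then have x: "x \<in> carrier G" "x \<otimes> a = a \<otimes> x" and y: "y \<in> carrier G" "y \<otimes> a = a \<otimes> y" by auto
  have "x \<otimes> y \<otimes> a = x \<otimes> (a \<otimes> y)" using x y assms by (simp add: m_assoc)
  also have "\<dots> = a \<otimes> (x \<otimes> y)" using x y assms by (simp add: m_assoc[symmetric])
  finally show "x \<otimes> y \<in> {x \<in> carrier G. x \<otimes> a = a \<otimes> x}" using x y by simp
qed (use assms in auto)

lemma (in group) commute_factor:
  assumes "x \<in> carrier G" "y \<in> carrier G" "x \<otimes> y = y \<otimes> x"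
  shows "x \<otimes> (x \<otimes> y) = (x \<otimes> y) \<otimes> x"
  using assms m_assoc[of x y x] by simp

lemma (in group) conj_mult:
  assumes "t \<in> carrier G" "x \<in> carrier G" "y \<in> carrier G"
  shows "t \<otimes> (x \<otimes> y) \<otimes> inv t = (t \<otimes> x \<otimes> inv t) \<otimes> (t \<otimes> y \<otimes> inv t)"
proof -
  have "(t \<otimes> x \<otimes> inv t) \<otimes> (t \<otimes> y \<otimes> inv t) = t \<otimes> x \<otimes> (inv t \<otimes> t) \<otimes> y \<otimes> inv t"
    using assms by (simp only: m_assoc m_closed inv_closed)
  then show ?thesis using assms by (simp add: m_assoc)
qed

lemma (in group) conj_inv_conj:
  assumes "t \<in> carrier G" "x \<in> carrier G"
  shows "inv t \<otimes> (t \<otimes> x \<otimes> inv t) \<otimes> t = x" "t \<otimes> (inv t \<otimes> x \<otimes> t) \<otimes> inv t = x"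
proof -
  have "inv t \<otimes> (t \<otimes> x \<otimes> inv t) \<otimes> t = (inv t \<otimes> t) \<otimes> x \<otimes> (inv t \<otimes> t)"
    using assms by (simp only: m_assoc m_closed inv_closed)
  then show "inv t \<otimes> (t \<otimes> x \<otimes> inv t) \<otimes> t = x" using assms by simp
  have "t \<otimes> (inv t \<otimes> x \<otimes> t) \<otimes> inv t = (t \<otimes> inv t) \<otimes> x \<otimes> (t \<otimes> inv t)"
    using assms by (simp only: m_assoc m_closed inv_closed)
  then show "t \<otimes> (inv t \<otimes> x \<otimes> t) \<otimes> inv t = x" using assms by simp
qed

text \<open>The properties of \<open>Uset\<close>, \<open>Cset\<close> and \<open>Eset\<close> in
  the language of abstract groups. It is used once for diagrams and once for their mirror
  images.\<close>

locale half = group G for G (structure) +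
  fixes U C E :: "'a \<Rightarrow> 'a set"
  assumes decompose: "g \<in> carrier G \<Longrightarrow> g \<noteq> \<one> \<Longrightarrow> x \<in> carrier G \<Longrightarrow> x \<otimes> g = g \<otimes> x \<Longrightarrow> \<exists>u\<in>U g. \<exists>y\<in>C g. x = u \<otimes> y"
    and U_subgroup: "g \<in> carrier G \<Longrightarrow> g \<noteq> \<one> \<Longrightarrow> subgroup (U g) G"
    and C_subgroup: "g \<in> carrier G \<Longrightarrow> g \<noteq> \<one> \<Longrightarrow> subgroup (C g) G"
    and U_C_commute: "g \<in> carrier G \<Longrightarrow> g \<noteq> \<one> \<Longrightarrow> u \<in> U g \<Longrightarrow> y \<in> C g \<Longrightarrow> u \<otimes> y = y \<otimes> u"
    and U_C_disjoint: "g \<in> carrier G \<Longrightarrow> g \<noteq> \<one> \<Longrightarrow> x \<in> U g \<Longrightarrow> x \<in> C g \<Longrightarrow> x = \<one>"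
    and self_C: "g \<in> carrier G \<Longrightarrow> g \<noteq> \<one> \<Longrightarrow> g \<in> C g"
    and E_C: "g \<in> carrier G \<Longrightarrow> g \<noteq> \<one> \<Longrightarrow> x \<in> E g \<Longrightarrow> x \<in> C g"
    and self_E: "g \<in> carrier G \<Longrightarrow> g \<noteq> \<one> \<Longrightarrow> g \<notin> E g"
    and E_mult: "g \<in> carrier G \<Longrightarrow> g \<noteq> \<one> \<Longrightarrow> x \<in> E g \<Longrightarrow> y \<in> E g \<Longrightarrow> x \<otimes> y = y \<otimes> x \<Longrightarrow> x \<otimes> y \<in> E g"
    and E_inv: "g \<in> carrier G \<Longrightarrow> g \<noteq> \<one> \<Longrightarrow> x \<in> E g \<Longrightarrow> inv x \<in> E g"
    and E_commutator: "g \<in> carrier G \<Longrightarrow> g \<noteq> \<one> \<Longrightarrow> x \<in> C g \<Longrightarrow> y \<in> C g \<Longrightarrow> x \<otimes> y \<otimes> inv x \<otimes> inv y \<in> E g"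
    and U_hyperbolic: "g \<in> carrier G \<Longrightarrow> g \<noteq> \<one> \<Longrightarrow> x \<in> C g \<Longrightarrow> x \<notin> E g \<Longrightarrow> U x = U g"
    and E_separates: "g \<in> carrier G \<Longrightarrow> g \<noteq> \<one> \<Longrightarrow> x \<in> E g \<Longrightarrow> x \<noteq> \<one> \<Longrightarrow> g \<notin> C x"
    and U_conj: "g \<in> carrier G \<Longrightarrow> g \<noteq> \<one> \<Longrightarrow> t \<in> carrier G \<Longrightarrow> x \<in> U g \<Longrightarrow> t \<otimes> x \<otimes> inv t \<in> U (t \<otimes> g \<otimes> inv t)"
    and C_conj: "g \<in> carrier G \<Longrightarrow> g \<noteq> \<one> \<Longrightarrow> t \<in> carrier G \<Longrightarrow> x \<in> C g \<Longrightarrow> t \<otimes> x \<otimes> inv t \<in> C (t \<otimes> g \<otimes> inv t)"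
begin

lemma U_carrier: "g \<in> carrier G \<Longrightarrow> g \<noteq> \<one> \<Longrightarrow> u \<in> U g \<Longrightarrow> u \<in> carrier G"
  by (rule subgroup.mem_carrier[OF U_subgroup])

lemma C_carrier: "g \<in> carrier G \<Longrightarrow> g \<noteq> \<one> \<Longrightarrow> u \<in> C g \<Longrightarrow> u \<in> carrier G"
  by (rule subgroup.mem_carrier[OF C_subgroup])

lemma subgroup_int_pow: "subgroup H G \<Longrightarrow> x \<in> H \<Longrightarrow> x [^] (n :: int) \<in> H"
  by (rule subgroup_int_pow_closed)

lemma E_int_pow:
  assumes g: "g \<in> carrier G" "g \<noteq> \<one>" and x: "x \<in> E g"
  shows "x [^] (n :: int) \<in> E g"
proof -
  have xc: "x \<in> carrier G" using C_carrier[OF g E_C[OF g x]] .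
  have one: "\<one> \<in> E g" using E_mult[OF g x E_inv[OF g x]] xc by simp
  have nat: "x [^] (k :: nat) \<in> E g" for k
  proof (induction k)
    case (Suc k)
    have "x [^] k \<otimes> x \<in> E g" by (rule E_mult[OF g Suc x]) (use xc nat_pow_comm[of x k 1] in simp)
    then show ?case by simp
  qed (use one in simp)
  have "inv (x [^] nat (- n)) \<in> E g" by (rule E_inv[OF g nat])
  then show ?thesis using nat[of "nat n"] unfolding int_pow_def2 by (cases "n < 0") (simp_all only: if_True if_False)
qed

end

locale lr = L: half G UL CL EL + R: half G UR CR ER
  for G (structure) and UL CL EL UR CR ER +
  assumes UL_CR: "g \<in> carrier G \<Longrightarrow> g \<noteq> \<one> \<Longrightarrow> x \<in> UL g \<Longrightarrow> x \<in> CR g"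
    and UR_CL: "g \<in> carrier G \<Longrightarrow> g \<noteq> \<one> \<Longrightarrow> x \<in> UR g \<Longrightarrow> x \<in> CL g"
    and UL_UR: "g \<in> carrier G \<Longrightarrow> g \<noteq> \<one> \<Longrightarrow> u \<in> UL g \<Longrightarrow> u \<noteq> \<one> \<Longrightarrow> g \<in> UR u"
    and UR_UL: "g \<in> carrier G \<Longrightarrow> g \<noteq> \<one> \<Longrightarrow> u \<in> UR g \<Longrightarrow> u \<noteq> \<one> \<Longrightarrow> g \<in> UL u"

lemma (in lr) lr_mirror: "lr G UR CR ER UL CL EL"
  by (intro lr.intro R.half_axioms L.half_axioms, unfold_locales) (fact UR_CL UL_CR UR_UL UL_UR)+

section \<open>Commuting pairs and their place in the decompositions\<close>

locale commuting_pair = group G for G (structure) +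
  fixes a b
  assumes ab_closed: "a \<in> carrier G" "b \<in> carrier G"
    and ab: "a \<otimes> b = b \<otimes> a"
begin

definition e :: "int \<Rightarrow> int \<Rightarrow> 'a" where "e i j = a [^] i \<otimes> b [^] j"

lemma e_closed [simp]: "e i j \<in> carrier G"
  using ab_closed by (simp add: e_def)

lemma pow_commute: "a [^] (i :: int) \<otimes> b [^] (j :: int) = b [^] j \<otimes> a [^] i"
proof -
  have "b [^] j \<in> {x \<in> carrier G. x \<otimes> a = a \<otimes> x}"
    by (rule subgroup_int_pow_closed[OF centralizer_subgroup]) (use ab_closed ab in auto)
  then have "a [^] i \<in> {x \<in> carrier G. x \<otimes> b [^] j = b [^] j \<otimes> x}"
    by (intro subgroup_int_pow_closed[OF centralizer_subgroup]) (use ab_closed in auto)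
  then show ?thesis by simp
qed

lemma e_mult: "e i j \<otimes> e k l = e (i + k) (j + l)"
proof -
  have "e i j \<otimes> e k l = a [^] i \<otimes> (b [^] j \<otimes> a [^] k) \<otimes> b [^] l" using ab_closed by (simp add: e_def m_assoc)
  also have "\<dots> = (a [^] i \<otimes> a [^] k) \<otimes> (b [^] j \<otimes> b [^] l)" using ab_closed by (simp add: pow_commute[symmetric] m_assoc)
  finally show ?thesis using ab_closed by (simp add: e_def int_pow_mult)
qed

lemma e_0: "e 0 0 = \<one>" and e_a: "e 1 0 = a" and e_b: "e 0 1 = b" and e_i: "e i 0 = a [^] i"
  using ab_closed by (simp_all add: e_def int_pow_1)

lemma e_inv: "inv (e i j) = e (- i) (- j)"
proof -
  have "e (- i) (- j) \<otimes> e i j = \<one>" by (simp add: e_mult e_0)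
  then show ?thesis using inv_equality by simp
qed

lemma e_pow: "e i j [^] (n :: int) = e (i * n) (j * n)"
proof -
  have nat: "e i j [^] (k :: nat) = e (i * int k) (j * int k)" for k
    by (induction k) (simp_all add: e_0 e_mult algebra_simps)
  show ?thesis by (cases "n \<ge> 0") (simp_all add: int_pow_def2 nat e_inv)
qed

end

text \<open>What is needed of a = xy, b = yx and t = x in the one-relator group to place
  \<open>b\<close> in both complements of \<open>a\<close>.\<close>

locale shifted_pair = commuting_pair +
  fixes t
  assumes t_closed: "t \<in> carrier G"
    and tbt: "t \<otimes> b \<otimes> inv t = a"
    and not_next: "t \<otimes> a \<otimes> inv t \<otimes> b \<noteq> b \<otimes> (t \<otimes> a \<otimes> inv t)"
    and independent: "a [^] (i :: int) \<otimes> b [^] (j :: int) = \<one> \<Longrightarrow> i = 0 \<and> j = 0"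
    and centralizer: "i \<noteq> 0 \<Longrightarrow> j \<noteq> 0 \<Longrightarrow> x \<in> carrier G \<Longrightarrow>
      x \<otimes> (a [^] (i :: int) \<otimes> b [^] (j :: int)) = (a [^] i \<otimes> b [^] j) \<otimes> x \<Longrightarrow> \<exists>(k :: int) (l :: int). x = a [^] k \<otimes> b [^] l"
begin

lemmas closed = ab_closed t_closed

lemma e_eq_iff: "e i j = e k l \<longleftrightarrow> i = k \<and> j = l"
proof
  assume "e i j = e k l"
  then have "e i j \<otimes> e (- k) (- l) = e k l \<otimes> e (- k) (- l)" by simp
  then have "e (i - k) (j - l) = \<one>" by (simp add: e_mult e_0)
  then show "i = k \<and> j = l" using independent[of "i - k" "j - l"] by (simp add: e_def)
qed simp

lemma ne_one: "a \<noteq> \<one>" "b \<noteq> \<one>"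
  using e_eq_iff[of 1 0 0 0] e_eq_iff[of 0 1 0 0] by (simp_all add: e_0 e_a e_b)

lemma centralizer_e:
  assumes "i \<noteq> 0" "j \<noteq> 0" "x \<in> carrier G" "x \<otimes> e i j = e i j \<otimes> x"
  obtains k l where "x = e k l"
  using centralizer[OF assms(1-3)] assms(4) that unfolding e_def by blast

lemma centralizer_a_b:
  assumes "x \<in> carrier G" "x \<otimes> a = a \<otimes> x" "x \<otimes> b = b \<otimes> x"
  obtains k l where "x = e k l"
proof -
  have "x \<otimes> (a \<otimes> b) = (a \<otimes> b) \<otimes> x"
  proof -
    have "x \<otimes> (a \<otimes> b) = a \<otimes> x \<otimes> b" using assms closed by (simp add: m_assoc[symmetric])
    then show ?thesis using assms closed by (simp add: m_assoc)
  qed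
  then have "x \<otimes> e 1 1 = e 1 1 \<otimes> x" using closed by (simp add: e_def int_pow_1)
  then show ?thesis using centralizer_e[of 1 1 x] assms(1) that by auto
qed

text \<open>Conjugation by \<open>t\<close> carries t^-1 b t and a to b and t a t^-1, so
  \<open>not_next\<close> passes to the exchanged pair.\<close>

lemma swap: "shifted_pair G b a (inv t)"
proof
  have ta: "inv t \<otimes> a \<otimes> t = b" using conj_inv_conj(1)[OF closed(3,2)] tbt by simp
  show "inv t \<otimes> a \<otimes> inv (inv t) = b" using closed ta by simp
  show "b \<otimes> a = a \<otimes> b" using ab by simp
  show "inv t \<otimes> b \<otimes> inv (inv t) \<otimes> a \<noteq> a \<otimes> (inv t \<otimes> b \<otimes> inv (inv t))"
  proof
    assume *: "inv t \<otimes> b \<otimes> inv (inv t) \<otimes> a = a \<otimes> (inv t \<otimes> b \<otimes> inv (inv t))"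
    define b' where "b' = inv t \<otimes> b \<otimes> t"
    have b': "b' \<in> carrier G" using closed by (simp add: b'_def)
    have "t \<otimes> b' \<otimes> inv t = b" unfolding b'_def by (rule conj_inv_conj(2)[OF closed(3,2)])
    moreover have "b' \<otimes> a = a \<otimes> b'" using * closed by (simp add: b'_def)
    then have "(t \<otimes> b' \<otimes> inv t) \<otimes> (t \<otimes> a \<otimes> inv t) = (t \<otimes> a \<otimes> inv t) \<otimes> (t \<otimes> b' \<otimes> inv t)"
      using conj_mult[OF closed(3) b' closed(1)] conj_mult[OF closed(3,1) b'] by simp
    ultimately show False using not_next by simp
  qed
  show "b [^] i \<otimes> a [^] j = \<one> \<Longrightarrow> i = 0 \<and> j = 0" for i j :: int
    using independent[of j i] pow_commute[of j i] by simp
  show "\<exists>(k :: int) (l :: int). x = b [^] k \<otimes> a [^] l"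
    if "i \<noteq> 0" "j \<noteq> 0" "x \<in> carrier G" "x \<otimes> (b [^] i \<otimes> a [^] j) = b [^] i \<otimes> a [^] j \<otimes> x" for i j :: int and x
    using centralizer[of j i x] that by (metis pow_commute)
qed (use closed in auto)

end

locale lr_pair = lr G UL CL EL UR CR ER + shifted_pair G a b t
  for G (structure) and UL CL EL UR CR ER a b t
begin

text \<open>Write b = x y with x in \<open>UL a\<close> and y in \<open>CL a\<close>. Both factors
  lie in <a, b>, and comparing powers leaves x = a^i b. For i = 0 conjugation by \<open>t\<close>
  contradicts \<open>not_next\<close>. For i \<noteq> 0 the centralizer of x lies in <a, b> and in
  \<open>CL x\<close>, and then a, b and hence x itself would be elliptic for x.\<close>

lemma b_CL: "b \<in> CL a"
proof (rule ccontr)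
  assume nb: "b \<notin> CL a"
  note a = closed(1) ne_one(1)
  obtain x y where xy: "x \<in> UL a" "y \<in> CL a" "b = x \<otimes> y"
    using L.decompose[OF a closed(2)] ab by metis
  have xc: "x \<in> carrier G" and yc: "y \<in> carrier G" using L.U_carrier[OF a xy(1)] L.C_carrier[OF a xy(2)] .
  have comm: "x \<otimes> y = y \<otimes> x" using L.U_C_commute[OF a xy(1,2)] .
  have xa: "x \<otimes> a = a \<otimes> x" using L.U_C_commute[OF a xy(1) L.self_C[OF a]] .
  have "x \<otimes> b = b \<otimes> x" using L.commute_factor[OF xc yc comm] xy(3) by simp
  then obtain i j where x: "x = e i j" using centralizer_a_b[OF xc xa] by blast
  have "e i j \<otimes> y = e 0 1" using xy(3) x e_b by simp
  then have "y = inv (e i j) \<otimes> e 0 1" using yc L.inv_solve_left[of y "e i j" "e 0 1"] by simp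
  then have y: "y = e (- i) (1 - j)" by (simp add: e_inv e_mult)
  \<comment> \<open>A power of x in \<open>UL a\<close> turns out to lie in \<open>CL a\<close>, so
    it is trivial. As x \<noteq> 1, this forces j = 1.\<close>
  have "x [^] (1 - j) = y [^] j \<otimes> a [^] i"
    unfolding x y by (simp add: e_pow e_mult algebra_simps flip: e_i)
  moreover have "x [^] (1 - j) \<in> UL a" using L.subgroup_int_pow[OF L.U_subgroup[OF a] xy(1)] .
  moreover have "y [^] j \<otimes> a [^] i \<in> CL a"
    using subgroup.m_closed[OF L.C_subgroup[OF a]] L.subgroup_int_pow[OF L.C_subgroup[OF a]] xy(2) L.self_C[OF a] by blast
  ultimately have "x [^] (1 - j) = \<one>" using L.U_C_disjoint[OF a] by simp
  then have "i * (1 - j) = 0 \<and> j * (1 - j) = 0" unfolding x e_pow using e_eq_iff[of _ _ 0 0] by (simp add: e_0)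
  moreover have "x \<noteq> \<one>" using nb xy yc by auto
  then have "\<not> (i = 0 \<and> j = 0)" using x e_0 by auto
  ultimately have j: "j = 1" by auto
  have x1: "x \<noteq> \<one>" using \<open>x \<noteq> \<one>\<close> .
  have a_UR: "a \<in> UR x" using UL_UR[OF a xy(1) x1] .
  show False
  proof (cases "i = 0")
    case True
    then have "x = b" using x j e_b by simp
    \<comment> \<open>From a in \<open>UR b\<close> follows t a t^-1 in \<open>UR a\<close>, which
      is contained in \<open>CL a\<close>. So t a t^-1 commutes with b, which is in
      \<open>UL a\<close>.\<close>
    then have "t \<otimes> a \<otimes> inv t \<in> UR (t \<otimes> b \<otimes> inv t)"
      using a_UR R.U_conj[OF closed(2) ne_one(2) closed(3)] by blast
    then have "t \<otimes> a \<otimes> inv t \<in> CL a" using UR_CL[OF a] tbt by simp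
    then show False using L.U_C_commute[OF a xy(1)] \<open>x = b\<close> not_next by simp
  next
    case False
    note u = xc x1
    have UL1: "w = \<one>" if w: "w \<in> UL x" for w
    proof -
      have wc: "w \<in> carrier G" using L.U_carrier[OF u w] .
      have "w \<otimes> x = x \<otimes> w" using L.U_C_commute[OF u w L.self_C[OF u]] .
      then obtain m n where mn: "w = e m n" using centralizer_e[OF False _ wc, of 1] x j by auto
      have "w = x [^] n \<otimes> a [^] (m - i * n)" unfolding x mn j by (simp add: e_pow e_mult flip: e_i)
      moreover have "a \<in> CL x" using UR_CL[OF u a_UR] .
      ultimately have "w \<in> CL x"
        using subgroup.m_closed[OF L.C_subgroup[OF u]] L.subgroup_int_pow[OF L.C_subgroup[OF u]] L.self_C[OF u] by blast
      then show ?thesis using L.U_C_disjoint[OF u w] by blast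
    qed
    have in_CL: "z \<in> CL x" if z: "z \<in> carrier G" "z \<otimes> x = x \<otimes> z" for z
    proof -
      obtain u' y' where "u' \<in> UL x" "y' \<in> CL x" "z = u' \<otimes> y'" using L.decompose[OF u z] by blast
      moreover have "u' = \<one>" using UL1 \<open>u' \<in> UL x\<close> .
      ultimately show ?thesis using L.C_carrier[OF u] by simp
    qed
    \<comment> \<open>Otherwise \<open>UL a\<close> equals the trivial \<open>UL x\<close>, although
      it contains x. For b the same argument uses the conjugate t^-1 x t in
      \<open>UL b\<close>.\<close>
    have aE: "a \<in> EL x"
    proof (rule ccontr)
      assume "a \<notin> EL x"
      then have "UL a = UL x" using L.U_hyperbolic[OF u in_CL[OF closed(1) xa[symmetric]]] by blast
      then show False using UL1 xy(1) x1 by blast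
    qed
    have bE: "b \<in> EL x"
    proof (rule ccontr)
      assume "b \<notin> EL x"
      then have Ub: "UL b = UL x" using L.U_hyperbolic[OF u in_CL[OF closed(2)]] \<open>x \<otimes> b = b \<otimes> x\<close> by simp
      have "inv t \<otimes> a \<otimes> inv (inv t) = b" using shifted_pair.tbt[OF swap] .
      then have "inv t \<otimes> x \<otimes> inv (inv t) \<in> UL b" using L.U_conj[OF a _ xy(1), of "inv t"] closed(3) by simp
      then have "inv t \<otimes> x \<otimes> t = \<one>" using Ub UL1 closed(3) by simp
      then have "x = \<one>" using L.conj_inv_conj(2)[OF closed(3) xc] closed(3) by simp
      then show False using x1 by simp
    qed
    have "a [^] i \<otimes> b \<in> EL x"
      using L.E_mult[OF u L.E_int_pow[OF u aE] bE] pow_commute[of i 1] closed by (simp add: L.int_pow_1)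
    then show False using L.self_E[OF u] x j closed by (simp add: e_def L.int_pow_1)
  qed
qed

end

lemma (in lr_pair) lr_pair_mirror: "lr_pair G UR CR ER UL CL EL a b t"
  by (rule lr_pair.intro[OF lr_mirror shifted_pair_axioms])

lemma (in lr_pair) lr_pair_swap: "lr_pair G UL CL EL UR CR ER b a (inv t)"
  by (rule lr_pair.intro[OF lr_axioms swap])

text \<open>\<open>\<sigma>\<close> will be the signed translation length along an axis of
  \<open>c\<close> in the Bass-Serre tree, for elements that commute with \<open>a\<close> and
  \<open>c\<close>.\<close>

locale shifted_triple = shifted_pair +
  fixes c \<sigma>
  assumes c_eq: "c = b \<otimes> (t \<otimes> a \<otimes> inv t) \<otimes> inv b \<otimes> inv (t \<otimes> a \<otimes> inv t)"
    and \<sigma>_mult: "x \<in> carrier G \<Longrightarrow> y \<in> carrier G \<Longrightarrow> x \<otimes> a = a \<otimes> x \<Longrightarrow> y \<otimes> a = a \<otimes> y \<Longrightarrow> x \<otimes> c = c \<otimes> x \<Longrightarrow> y \<otimes> c = c \<otimes> y \<Longrightarrow>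
      \<sigma> (x \<otimes> y) = \<sigma> x + (\<sigma> y :: int)"
    and \<sigma>_0: "x \<in> carrier G \<Longrightarrow> x \<otimes> a = a \<otimes> x \<Longrightarrow> x \<otimes> c = c \<otimes> x \<Longrightarrow> \<sigma> x = 0 \<Longrightarrow> \<exists>n :: int. x = a [^] n"
    and \<sigma>_c: "\<sigma> c \<noteq> 0"

theorem (in lr_pair) no_shifted_triple: "\<not> shifted_triple G a b t c \<sigma>"
proof
  assume "shifted_triple G a b t c \<sigma>"
  then interpret T: shifted_triple G a b t c \<sigma> .
  define d where "d = t \<otimes> a \<otimes> inv t"
  have c_def: "c = b \<otimes> d \<otimes> inv b \<otimes> inv d" unfolding d_def by (rule T.c_eq)
  have d: "d \<in> carrier G" using closed by (simp add: d_def)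
  have c: "c \<in> carrier G" using closed d by (simp add: c_def)
  note a = closed(1) ne_one(1)
  \<comment> \<open>\<open>b_CL\<close> is applied to the given, the mirrored and the exchanged
    pairs; for \<open>d\<close> the statement on \<open>a\<close> and \<open>b\<close> is conjugated
    by \<open>t\<close>.\<close>
  have in_C: "b \<in> CL a" "d \<in> CL a" "b \<in> CR a" "d \<in> CR a"
  proof -
    show "b \<in> CL a" by (rule b_CL)
    show "b \<in> CR a" by (rule lr_pair.b_CL[OF lr_pair_mirror])
    have "a \<in> CL b" by (rule lr_pair.b_CL[OF lr_pair_swap])
    then show "d \<in> CL a" using L.C_conj[OF closed(2) ne_one(2) closed(3), of a] tbt d_def by simp
    have "a \<in> CR b" by (rule lr_pair.b_CL[OF lr_pair.lr_pair_mirror[OF lr_pair_swap]])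
    then show "d \<in> CR a" using R.C_conj[OF closed(2) ne_one(2) closed(3), of a] tbt d_def by simp
  qed
  have cE: "c \<in> EL a" "c \<in> ER a" unfolding c_def using L.E_commutator[OF a in_C(1,2)] R.E_commutator[OF a in_C(3,4)] .
  have c1: "c \<noteq> \<one>"
  proof
    assume "c = \<one>"
    then have "b \<otimes> d \<otimes> inv b = d" unfolding c_def using closed d L.inv_solve_right[of "b \<otimes> d \<otimes> inv b" \<one> d]
      by (metis L.inv_closed L.inv_inv L.inv_equality L.m_closed)
    then have "b \<otimes> d \<otimes> inv b \<otimes> b = d \<otimes> b" by simp
    then have "b \<otimes> d = d \<otimes> b" using closed d by (simp add: L.m_assoc)
    then show False using not_next unfolding d_def by simp
  qed
  note cc = c c1
  have ac: "a \<otimes> c = c \<otimes> a"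
  proof -
    let ?Z = "{x \<in> carrier G. x \<otimes> a = a \<otimes> x}"
    have "d \<otimes> a = a \<otimes> d"
      using L.conj_mult[OF closed(3,1,2)] L.conj_mult[OF closed(3,2,1)] ab unfolding tbt d_def by simp
    then have "d \<in> ?Z" "b \<in> ?Z" using d closed ab by auto
    then have "c \<in> ?Z" unfolding c_def using L.centralizer_subgroup[OF closed(1)]
      by (intro subgroup.m_closed subgroup.m_inv_closed)
    then show ?thesis by simp
  qed
  \<comment> \<open>As \<open>c\<close> is elliptic for \<open>a\<close>, \<open>a\<close> lies in
    neither complement of \<open>c\<close>. So the factors \<open>g\<close> and \<open>g'\<close> of
    \<open>a\<close> on the two sides are non-trivial.\<close>
  have nC: "a \<notin> CL c" "a \<notin> CR c" using L.E_separates[OF a cE(1) c1] R.E_separates[OF a cE(2) c1] .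
  obtain g y where g: "g \<in> UL c" "y \<in> CL c" "a = g \<otimes> y" using L.decompose[OF cc a(1) ac] by blast
  obtain g' y' where g': "g' \<in> UR c" "y' \<in> CR c" "a = g' \<otimes> y'" using R.decompose[OF cc a(1) ac] by blast
  have carr: "g \<in> carrier G" "y \<in> carrier G" "g' \<in> carrier G" "y' \<in> carrier G"
    using L.U_carrier[OF cc] L.C_carrier[OF cc] R.U_carrier[OF cc] R.C_carrier[OF cc] g g' by blast+
  have g1: "g \<noteq> \<one>" "g' \<noteq> \<one>" using nC g g' carr by auto
  have gy: "g \<otimes> y = y \<otimes> g" "g' \<otimes> y' = y' \<otimes> g'"
    using L.U_C_commute[OF cc g(1,2)] R.U_C_commute[OF cc g'(1,2)] .
  have gc: "g \<otimes> c = c \<otimes> g" "g' \<otimes> c = c \<otimes> g'"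
    using L.U_C_commute[OF cc g(1) L.self_C[OF cc]] R.U_C_commute[OF cc g'(1) R.self_C[OF cc]] .
  have ga: "g \<otimes> a = a \<otimes> g" "g' \<otimes> a = a \<otimes> g'"
    using L.commute_factor[OF carr(1,2) gy(1)] L.commute_factor[OF carr(3,4) gy(2)] g(3) g'(3) by simp_all
  define Z where "Z = {x \<in> carrier G. x \<otimes> a = a \<otimes> x \<and> x \<otimes> c = c \<otimes> x}"
  have Z: "subgroup Z G"
  proof -
    have "Z = {x \<in> carrier G. x \<otimes> a = a \<otimes> x} \<inter> {x \<in> carrier G. x \<otimes> c = c \<otimes> x}" by (auto simp: Z_def)
    then show ?thesis using L.subgroups_Inter_pair[OF L.centralizer_subgroup[OF a(1)] L.centralizer_subgroup[OF c]] by simp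
  qed
  have \<sigma>m: "\<sigma> (x \<otimes> y) = \<sigma> x + \<sigma> y" if "x \<in> Z" "y \<in> Z" for x y
    using T.\<sigma>_mult[of x y] that unfolding Z_def by simp
  have \<sigma>0: "\<exists>n :: int. x = a [^] n" if "x \<in> Z" "\<sigma> x = 0" for x
    using T.\<sigma>_0[of x] that unfolding Z_def by simp
  have \<sigma>_one: "\<sigma> \<one> = 0" using \<sigma>m[of \<one> \<one>] subgroup.one_closed[OF Z] by simp
  have \<sigma>_inv: "\<sigma> (inv x) = - \<sigma> x" if "x \<in> Z" for x
    using \<sigma>m[OF that subgroup.m_inv_closed[OF Z that]] \<sigma>_one subgroup.mem_carrier[OF Z that] by simp
  have \<sigma>_nat: "\<sigma> (x [^] (n :: nat)) = int n * \<sigma> x \<and> x [^] n \<in> Z" if "x \<in> Z" for x n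
  proof (induction n)
    case 0
    show ?case using \<sigma>_one subgroup.one_closed[OF Z] by simp
  next
    case (Suc n)
    then have "\<sigma> (x [^] n \<otimes> x) = \<sigma> (x [^] n) + \<sigma> x" "x [^] n \<otimes> x \<in> Z"
      using \<sigma>m[OF _ that] subgroup.m_closed[OF Z _ that] by blast+
    then show ?case using Suc.IH by (simp add: algebra_simps)
  qed
  have \<sigma>_pow: "\<sigma> (x [^] (n :: int)) = n * \<sigma> x" if "x \<in> Z" for x n
  proof (cases "n < 0")
    case True
    have "\<sigma> (inv (x [^] nat (- n))) = - (int (nat (- n)) * \<sigma> x)" using \<sigma>_inv \<sigma>_nat[OF that] by metis
    then show ?thesis using True unfolding int_pow_def2 by simp
  next
    case False
    then show ?thesis using \<sigma>_nat[OF that, of "nat n"] unfolding int_pow_def2 by (simp only: if_False) simp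
  qed
  have torsion_free: "n = 0" if "x \<in> Z" "x \<noteq> \<one>" "x [^] (n :: int) = \<one>" for x n
  proof (rule ccontr)
    assume "n \<noteq> 0"
    then have "\<sigma> x = 0" using \<sigma>_pow[OF that(1), of n] that(3) \<sigma>_one by simp
    then have "\<exists>m :: int. x = a [^] m" using \<sigma>0[OF that(1)] by simp
    then obtain m :: int where m: "x = a [^] m" by blast
    then have "e (m * n) 0 = \<one>" using that(3) e_pow[of m 0 n] by (simp add: e_i)
    then have "m = 0" using e_eq_iff[of "m * n" 0 0 0] \<open>n \<noteq> 0\<close> e_0 by simp
    then show False using m that(2) by simp
  qed
  have gZ: "g \<in> Z" "g' \<in> Z" "c \<in> Z" using carr ga gc c ac by (auto simp: Z_def)
  define z x where "z = \<sigma> c" and "x = \<sigma> g"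
  have z: "z \<noteq> 0" using T.\<sigma>_c by (simp add: z_def)
  \<comment> \<open>The exponents make \<open>\<sigma>\<close> vanish, so this is a power of
    \<open>a\<close>. Both factors lie in \<open>CR c\<close>; compared with a = g' y' this puts the
    power of \<open>g'\<close> into \<open>CR c\<close> as well, which gives n = 0.\<close>
  have "g [^] z \<otimes> c [^] (- x) \<in> Z"
    using subgroup.m_closed[OF Z] L.subgroup_int_pow[OF Z] gZ by blast
  moreover have "\<sigma> (g [^] z \<otimes> c [^] (- x)) = 0"
    using \<sigma>m[OF L.subgroup_int_pow[OF Z gZ(1)] L.subgroup_int_pow[OF Z gZ(3)]] \<sigma>_pow gZ by (simp add: z_def x_def)
  ultimately have "\<exists>n :: int. g [^] z \<otimes> c [^] (- x) = a [^] n" using \<sigma>0 by simp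
  then obtain n :: int where n: "g [^] z \<otimes> c [^] (- x) = a [^] n" by blast
  have an: "a [^] n = g [^] n \<otimes> y [^] n" "a [^] n = g' [^] n \<otimes> y' [^] n"
    using g(3) g'(3) L.int_pow_mult_distrib gy carr by metis+
  have "g \<in> CR c" "c \<in> CR c" using UL_CR[OF cc g(1)] R.self_C[OF cc] .
  then have "a [^] n \<in> CR c" unfolding n[symmetric]
    using subgroup.m_closed[OF R.C_subgroup[OF cc]] L.subgroup_int_pow[OF R.C_subgroup[OF cc]] by blast
  moreover have "g' [^] n = a [^] n \<otimes> inv (y' [^] n)"
    using an(2) carr by (simp add: L.m_assoc)
  ultimately have "g' [^] n \<in> CR c"
    using subgroup.m_closed[OF R.C_subgroup[OF cc]] subgroup.m_inv_closed[OF R.C_subgroup[OF cc]]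
      L.subgroup_int_pow[OF R.C_subgroup[OF cc] g'(2)] by simp
  then have "g' [^] n = \<one>" using R.U_C_disjoint[OF cc] L.subgroup_int_pow[OF R.U_subgroup[OF cc] g'(1)] by blast
  then have "n = 0" using torsion_free gZ g1 by blast
  \<comment> \<open>Now a power of \<open>g\<close> with non-zero exponent is a power of
    \<open>c\<close> and lies in both parts on the left.\<close>
  then have "g [^] z = c [^] x" using n carr c by (simp add: L.int_pow_neg L.inv_solve_right')
  then have "g [^] z \<in> CL c" using L.subgroup_int_pow[OF L.C_subgroup[OF cc] L.self_C[OF cc]] by simp
  then have "g [^] z = \<one>" using L.U_C_disjoint[OF cc] L.subgroup_int_pow[OF L.U_subgroup[OF cc] g(1)] by blast
  then show False using torsion_free gZ g1 z by blast
qed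


section \<open>The group \<open>\<langle>x, y | x y\<^sup>2 x = y x\<^sup>2 y\<rangle>\<close>\<close>

definition xyyx_rules :: "(gen \<times> bool) list rel" where
  "xyyx_rules = {([(X, True), (Y, True), (Y, True), (X, True)], [(Y, True), (X, True), (X, True), (Y, True)])} \<union>
     {([(g, b), (g, \<not> b)], []) | g b. g \<in> {X, Y}}"

lemma xyyx_rules_cases:
  assumes "(l, r) \<in> xyyx_rules"
  obtains "l = [(X, True), (Y, True), (Y, True), (X, True)]" "r = [(Y, True), (X, True), (X, True), (Y, True)]"
    | g b where "l = [(g, b), (g, \<not> b)]" "r = []"
  using assms unfolding xyyx_rules_def by blast

lemma gen_lists: "lists ({X, Y} \<times> (UNIV :: bool set)) = UNIV"
proof -
  have "g \<in> {X, Y}" for g by (cases g) auto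
  then have "{X, Y} \<times> (UNIV :: bool set) = UNIV" by auto
  then show ?thesis by simp
qed

lemma xyyx_group_eq: "xyyx_group = word_group UNIV xyyx_rules"
  unfolding xyyx_group_def presented_group_def gen_lists xyyx_rules_def ..

definition el :: "(gen \<times> bool) list \<Rightarrow> (gen \<times> bool) list set" where
  "el s = word_cong UNIV xyyx_rules `` {s}"

lemma el_rule:
  assumes "(l, r) \<in> xyyx_rules"
  shows "el (s @ l @ t) = el (s @ r @ t)"
proof -
  have "(s @ r @ t, s @ r @ t) \<in> word_cong UNIV xyyx_rules"
    using equiv_word_cong[of UNIV xyyx_rules] by (simp add: equiv_def refl_on_def)
  from replace_step_word_cong[OF assms UNIV_I this] show ?thesis
    unfolding el_def by (rule equiv_class_eq[OF equiv_word_cong])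
qed

lemma el_invariant:
  assumes f: "\<And>s t l r. (l, r) \<in> xyyx_rules \<Longrightarrow> f (s @ l @ t) = f (s @ r @ t)" and st: "el s = el t"
  shows "f s = f t"
proof -
  have "(s, t) \<in> word_cong UNIV xyyx_rules"
    using st eq_equiv_class[OF _ equiv_word_cong] unfolding el_def by blast
  then have "equivclp (replace_step UNIV xyyx_rules) s t" by (simp add: word_cong_def)
  moreover have *: "f u = f v" if "replace_step UNIV xyyx_rules u v" for u v
    using that f unfolding replace_step_def by fastforce
  ultimately show ?thesis
  proof (induction rule: equivclp_induct)
    case (step u v)
    then show ?case using *[of u v] *[of v u] by auto
  qed simp
qed

lemma el_some: "el (SOME t. el t = el s) = el s"
  by (rule someI[of "\<lambda>t. el t = el s" s]) (rule refl)

fun weight :: "gen \<times> bool \<Rightarrow> int" where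
  "weight (X, _) = 0"
| "weight (Y, s) = (if s then 1 else - 1)"

text \<open>The action of the group on \<open>\<int>\<^sup>2\<close> in which \<open>x\<close> exchanges the coordinates and \<open>xy\<close> increases the first one.\<close>

fun act :: "gen \<times> bool \<Rightarrow> int \<times> int \<Rightarrow> int \<times> int" where
  "act (X, _) (p, q) = (q, p)"
| "act (Y, s) (p, q) = (if s then (q, p + 1) else (q - 1, p))"

lemma act_rules:
  assumes "(l, r) \<in> xyyx_rules"
  shows "foldr act l z = foldr act r z"
  using assms
proof (cases rule: xyyx_rules_cases)
  case 1
  then show ?thesis by (cases z) simp
next
  case (2 g b)
  then show ?thesis by (cases z; cases g) auto
qed

section \<open>The one-relator group and its invariants\<close>

locale xyyx =
  fixes G :: "(gen \<times> bool) list set monoid" (structure)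
  assumes G_eq: "G = xyyx_group"

sublocale xyyx \<subseteq> group G
  unfolding G_eq xyyx_group_def by (rule group_presented_group)

context xyyx
begin

lemma el_mult: "el s \<otimes> el t = el (s @ t)"
  unfolding G_eq xyyx_group_eq el_def by (rule word_group_mult) auto

lemma el_Nil: "el [] = \<one>"
  unfolding G_eq xyyx_group_eq by (simp add: el_def word_group_def)

lemma carrier_eq: "carrier G = range el"
  unfolding G_eq xyyx_group_eq el_def by (auto simp: word_group_def quotient_def)

lemma el_closed [simp]: "el s \<in> carrier G"
  by (simp add: carrier_eq)

lemma el_cases: "g \<in> carrier G \<Longrightarrow> (\<And>s. g = el s \<Longrightarrow> thesis) \<Longrightarrow> thesis"
  unfolding carrier_eq by blast

lemma el_cancel: "el (s @ (g, b) # (g, \<not> b) # t) = el (s @ t)"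
proof -
  have "([(g, b), (g, \<not> b)], []) \<in> xyyx_rules" unfolding xyyx_rules_def by (cases g) auto
  from el_rule[OF this, of s t] show ?thesis by simp
qed

text \<open>The homomorphism to the integers with x to 0 and y to 1. Its value at \<open>a\<close>
  is 1, so \<open>a\<close> is conjugate to no other power of itself.\<close>

definition deg :: "(gen \<times> bool) list set \<Rightarrow> int" where
  "deg h = sum_list (map weight (SOME s. el s = h))"

lemma deg_el: "deg (el s) = sum_list (map weight s)"
proof -
  have inv: "sum_list (map weight t) = sum_list (map weight s)" if "el t = el s" for t
    using that
  proof (rule el_invariant[rotated])
    fix s t l r assume "(l, r) \<in> xyyx_rules"
    then show "sum_list (map weight (s @ l @ t)) = sum_list (map weight (s @ r @ t))"
    proof (cases rule: xyyx_rules_cases)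
      case (2 g b)
      then show ?thesis by (cases g) auto
    qed simp
  qed
  show ?thesis unfolding deg_def by (rule inv[OF el_some])
qed

lemma deg_mult: "g \<in> carrier G \<Longrightarrow> h \<in> carrier G \<Longrightarrow> deg (g \<otimes> h) = deg g + deg h"
  by (elim el_cases) (simp add: el_mult deg_el)

lemma deg_one: "deg \<one> = 0"
  unfolding el_Nil[symmetric] by (simp add: deg_el)

lemma deg_inv: "g \<in> carrier G \<Longrightarrow> deg (inv g) = - deg g"
  using deg_mult[of g "inv g"] by (simp add: deg_one)

lemma deg_pow: "g \<in> carrier G \<Longrightarrow> deg (g [^] (n :: int)) = n * deg g"
proof -
  assume g: "g \<in> carrier G"
  have nat: "deg (g [^] (k :: nat)) = int k * deg g" for k
    by (induction k) (simp_all add: deg_one deg_mult g algebra_simps)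
  show ?thesis
  proof (cases "n < 0")
    case True
    then have "deg (g [^] n) = deg (inv (g [^] nat (- n)))" by (simp only: int_pow_def2 if_True)
    also have "\<dots> = - (int (nat (- n)) * deg g)" by (simp only: deg_inv nat_pow_closed g nat)
    finally show ?thesis using True by simp
  next
    case False
    then have "deg (g [^] n) = deg (g [^] nat n)" by (simp only: int_pow_def2 if_False)
    also have "\<dots> = int (nat n) * deg g" by (rule nat)
    finally show ?thesis using False by simp
  qed
qed

definition action :: "(gen \<times> bool) list set \<Rightarrow> int \<times> int \<Rightarrow> int \<times> int" where
  "action h = foldr act (SOME s. el s = h)"

lemma action_el: "action (el s) = foldr act s"
proof -
  have inv: "foldr act t = foldr act s" if "el t = el s" for t
    using that by (rule el_invariant[rotated]) (simp add: fun_eq_iff act_rules)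
  show ?thesis unfolding action_def by (rule inv[OF el_some])
qed

lemma action_mult: "g \<in> carrier G \<Longrightarrow> h \<in> carrier G \<Longrightarrow> action (g \<otimes> h) z = action g (action h z)"
  by (elim el_cases) (simp add: el_mult action_el)

lemma action_one: "action \<one> z = z"
  unfolding el_Nil[symmetric] by (simp add: action_el)

lemma action_inv: "g \<in> carrier G \<Longrightarrow> action g z = z' \<Longrightarrow> action (inv g) z' = z"
  using action_mult[of "inv g" g z] by (simp add: action_one)

lemma action_pow:
  assumes "g \<in> carrier G" "\<And>p q. action g (p, q) = (p + i, q + j)"
  shows "action (g [^] (n :: int)) (p, q) = (p + n * i, q + n * j)"
proof -
  have nat: "action (g [^] (k :: nat)) (p, q) = (p + int k * i, q + int k * j)" for k p q
    by (induction k arbitrary: p q) (simp_all add: action_one action_mult assms algebra_simps)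
  show ?thesis
  proof (cases "n < 0")
    case True
    have "action (inv (g [^] nat (- n))) (p, q) = (p + n * i, q + n * j)"
      by (rule action_inv) (use assms(1) True nat[of "nat (- n)"] in \<open>simp_all add: algebra_simps\<close>)
    then show ?thesis unfolding int_pow_def2 using True by simp
  next
    case False
    then have "action (g [^] n) (p, q) = action (g [^] nat n) (p, q)" by (simp only: int_pow_def2 if_False)
    also have "\<dots> = (p + int (nat n) * i, q + int (nat n) * j)" by (rule nat)
    finally show ?thesis using False by simp
  qed
qed

definition x where "x = el [(X, True)]"
definition a where "a = el [(X, True), (Y, True)]"
definition b where "b = el [(Y, True), (X, True)]"

lemma closed [simp]: "x \<in> carrier G" "a \<in> carrier G" "b \<in> carrier G"
  by (simp_all add: x_def a_def b_def)

lemma inv_x: "inv x = el [(X, False)]"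
  by (rule inv_equality) (simp_all add: x_def el_mult el_cancel[of "[]" X False "[]", simplified] el_Nil)

lemma x_b: "x \<otimes> b = a \<otimes> x"
  by (simp add: a_def b_def x_def el_mult)

lemma b_conj: "b = inv x \<otimes> a \<otimes> x"
  by (simp add: a_def b_def x_def inv_x[unfolded x_def] el_mult el_cancel[of "[]" X False, simplified])

lemma a_b: "a \<otimes> b = b \<otimes> a"
proof -
  have "([(X, True), (Y, True), (Y, True), (X, True)], [(Y, True), (X, True), (X, True), (Y, True)]) \<in> xyyx_rules"
    by (simp add: xyyx_rules_def)
  from el_rule[OF this, of "[]" "[]"] show ?thesis by (simp add: a_def b_def el_mult)
qed

end

sublocale xyyx \<subseteq> commuting_pair G a b
  by unfold_locales (simp_all add: a_b)

context xyyx
begin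

lemma action_e: "action (e i j) (p, q) = (p + i, q + j)"
proof -
  have "action a (p, q) = (p + 1, q + 0)" "action b (p, q) = (p + 0, q + 1)" for p q
    by (simp_all add: a_def b_def action_el)
  then have "action (a [^] k) (p, q) = (p + k * 1, q + k * 0)" "action (b [^] k) (p, q) = (p + k * 0, q + k * 1)" for k :: int and p q
    using action_pow[OF closed(2), of 1 0] action_pow[OF closed(3), of 0 1] by simp_all
  then show ?thesis by (simp add: e_def action_mult)
qed

lemma e_inj: "e i j = e k l \<longleftrightarrow> i = k \<and> j = l"
proof
  assume "e i j = e k l"
  then have "action (e i j) (0, 0) = action (e k l) (0, 0)" by simp
  then show "i = k \<and> j = l" unfolding action_e by simp
qed simp

lemma x_e: "e i 0 \<otimes> x = x \<otimes> e 0 i"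
proof -
  have nat: "a [^] k \<otimes> x = x \<otimes> b [^] k" for k :: nat
  proof (induction k)
    case (Suc k)
    have "a [^] Suc k \<otimes> x = a [^] k \<otimes> (x \<otimes> b)" by (simp add: m_assoc x_b)
    also have "\<dots> = x \<otimes> b [^] Suc k" using Suc by (simp add: m_assoc[symmetric])
    finally show ?case .
  qed simp
  have "a [^] i \<otimes> x = x \<otimes> b [^] i"
  proof (cases "i < 0")
    case True
    define u v where "u = a [^] nat (- i)" and "v = b [^] nat (- i)"
    have uv: "u \<in> carrier G" "v \<in> carrier G" "u \<otimes> x = x \<otimes> v" by (simp_all only: u_def v_def nat nat_pow_closed closed)
    have "inv u \<otimes> x = inv u \<otimes> (x \<otimes> v) \<otimes> inv v" using uv(1,2) by (simp add: m_assoc)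
    also have "\<dots> = x \<otimes> inv v" unfolding uv(3)[symmetric] using uv(1,2) by (simp add: m_assoc[symmetric])
    finally show ?thesis using True by (simp only: int_pow_def2 if_True u_def v_def)
  next
    case False
    then show ?thesis using nat[of "nat i"] by (simp only: int_pow_def2 if_False)
  qed
  then show ?thesis by (simp add: e_def)
qed

section \<open>The Bass-Serre tree of the HNN extension\<close>

definition vtx :: "(gen \<times> bool) list set \<Rightarrow> (gen \<times> bool) list set set" where
  "vtx g = {g \<otimes> e i j | i j. True}"

definition edge :: "(gen \<times> bool) list set \<Rightarrow> (gen \<times> bool) list set set" where
  "edge g = {g \<otimes> e i 0 | i. True}"

lemma e_inverse: "h = g \<otimes> e i j \<Longrightarrow> g \<in> carrier G \<Longrightarrow> g = h \<otimes> e (- i) (- j)"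
  by (simp add: m_assoc e_mult e_0)

lemma vtx_e: "g \<in> carrier G \<Longrightarrow> vtx (g \<otimes> e i j) = vtx g"
proof -
  have sub: "vtx (h \<otimes> e i j) \<subseteq> vtx h" if "h \<in> carrier G" for h i j
    using that by (auto simp: vtx_def m_assoc e_mult)
  assume g: "g \<in> carrier G"
  have "vtx g = vtx (g \<otimes> e i j \<otimes> e (- i) (- j))" using e_inverse[OF refl g, of i j] by simp
  also have "\<dots> \<subseteq> vtx (g \<otimes> e i j)" using sub[of "g \<otimes> e i j" "- i" "- j"] g by simp
  finally show ?thesis using sub[OF g, of i j] by (intro subset_antisym)
qed

lemma edge_e: "g \<in> carrier G \<Longrightarrow> edge (g \<otimes> e i 0) = edge g"
proof -
  have sub: "edge (h \<otimes> e i 0) \<subseteq> edge h" if "h \<in> carrier G" for h i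
    using that by (auto simp: edge_def m_assoc e_mult)
  assume g: "g \<in> carrier G"
  have "edge g = edge (g \<otimes> e i 0 \<otimes> e (- i) 0)" using e_inverse[OF refl g, of i 0] by simp
  also have "\<dots> \<subseteq> edge (g \<otimes> e i 0)" using sub[of "g \<otimes> e i 0" "- i"] g by simp
  finally show ?thesis using sub[OF g, of i] by (intro subset_antisym)
qed

lemma self_vtx: "g \<in> carrier G \<Longrightarrow> g \<in> vtx g" and self_edge: "g \<in> carrier G \<Longrightarrow> g \<in> edge g"
  unfolding vtx_def edge_def using e_0 r_one by (metis (mono_tags, lifting) mem_Collect_eq)+

lemma vtx_eqD: "g \<in> carrier G \<Longrightarrow> h \<in> carrier G \<Longrightarrow> vtx g = vtx h \<Longrightarrow> \<exists>i j. h = g \<otimes> e i j"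
proof -
  assume "g \<in> carrier G" "h \<in> carrier G" "vtx g = vtx h"
  then have "h \<in> vtx g" using self_vtx by simp
  then show "\<exists>i j. h = g \<otimes> e i j" by (simp add: vtx_def)
qed

lemma edge_eqD: "g \<in> carrier G \<Longrightarrow> h \<in> carrier G \<Longrightarrow> edge g = edge h \<Longrightarrow> \<exists>i. h = g \<otimes> e i 0"
proof -
  assume "g \<in> carrier G" "h \<in> carrier G" "edge g = edge h"
  then have "h \<in> edge g" using self_edge by simp
  then show "\<exists>i. h = g \<otimes> e i 0" by (simp add: edge_def)
qed

text \<open>
  The group is an HNN extension of \<open>\<langle>a, b\<rangle>\<close> with stable letter \<open>x\<close>. A word describes a walk in the
  Bass-Serre tree; its letters are the traversed edges, where \<open>y = x\<^sup>-\<^sup>1a\<close> traverses an edge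
  against its direction.
\<close>

fun label :: "(gen \<times> bool) list set \<Rightarrow> gen \<times> bool \<Rightarrow> (gen \<times> bool) list set set \<times> bool" where
  "label g (X, s) = (if s then (edge g, True) else (edge (g \<otimes> inv x), False))"
| "label g (Y, s) = (if s then (edge (g \<otimes> inv x), False) else (edge g, True))"

fun walk :: "(gen \<times> bool) list set \<Rightarrow> (gen \<times> bool) list \<Rightarrow> ((gen \<times> bool) list set set \<times> bool) list" where
  "walk g [] = []"
| "walk g (l # s) = label g l # walk (g \<otimes> el [l]) s"

lemma walk_append: "g \<in> carrier G \<Longrightarrow> walk g (s @ t) = walk g s @ walk (g \<otimes> el s) t"
proof (induction s arbitrary: g)
  case (Cons l s)
  have "el [l] \<otimes> el s = el (l # s)" by (simp add: el_mult)
  then show ?case using Cons by (simp add: m_assoc)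
qed (simp add: el_Nil)

lemma el_X: "el [(X, True)] = x"
  by (simp add: x_def)

lemma el_Y: "el [(Y, True)] = inv x \<otimes> a"
  by (simp add: inv_x a_def el_mult el_cancel[of "[]" X False, simplified])

lemma el_Y': "el [(Y, False)] = inv a \<otimes> x"
proof -
  have "el [(Y, False)] \<otimes> el [(Y, True)] = \<one>"
    by (simp add: el_mult el_cancel[of "[]" Y False "[]", simplified] el_Nil)
  then have "el [(Y, False)] = inv (inv x \<otimes> a)" unfolding el_Y by (rule inv_equality[symmetric]) simp_all
  then show ?thesis by (simp add: inv_mult_group)
qed

lemma edge_a:
  assumes "g \<in> carrier G"
  shows "edge (g \<otimes> a) = edge g" "edge (g \<otimes> inv a) = edge g"
  using edge_e[OF assms, of 1] edge_e[OF assms, of "- 1"] e_inv[of 1 0] by (simp_all add: e_a)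

text \<open>As xy = a and yx = b lie in the vertex group, these walks turn back at once, just like
  those of cancelling pairs.\<close>

lemma walk_pairs:
  assumes g: "g \<in> carrier G"
  shows "walk g [(X, True), (Y, True)] = [(edge g, True), (edge g, False)]"
    and "walk g [(Y, True), (X, True)] = [(edge (g \<otimes> inv x), False), (edge (g \<otimes> inv x), True)]"
    and "walk g [(X, True), (X, False)] = [(edge g, True), (edge g, False)]"
    and "walk g [(X, False), (X, True)] = [(edge (g \<otimes> inv x), False), (edge (g \<otimes> inv x), True)]"
    and "walk g [(Y, True), (Y, False)] = [(edge (g \<otimes> inv x), False), (edge (g \<otimes> inv x), True)]"
    and "walk g [(Y, False), (Y, True)] = [(edge g, True), (edge g, False)]"
proof -
  have "g \<otimes> inv x \<otimes> a = g \<otimes> (inv x \<otimes> a)" "g \<otimes> (inv a \<otimes> x) \<otimes> inv x = g \<otimes> inv a"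
    using g by (simp_all add: m_assoc)
  then show "walk g [(Y, True), (X, True)] = [(edge (g \<otimes> inv x), False), (edge (g \<otimes> inv x), True)]"
    "walk g [(Y, True), (Y, False)] = [(edge (g \<otimes> inv x), False), (edge (g \<otimes> inv x), True)]"
    "walk g [(Y, False), (Y, True)] = [(edge g, True), (edge g, False)]"
    using edge_a[of "g \<otimes> inv x"] edge_a[OF g] g by (simp_all add: el_Y el_Y')
qed (use g in \<open>simp_all add: el_X inv_x[symmetric] m_assoc\<close>)

lemma free_red_pair: "free_red [(c, True), (c, False)] = []" "free_red [(c, False), (c, True)] = []"
  by (simp_all add: free_red_def)

lemma walk_rules:
  assumes g: "g \<in> carrier G" and lr: "(l, r) \<in> xyyx_rules"
  shows "free_red (walk g l) = free_red (walk g r)"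
  using lr
proof (cases rule: xyyx_rules_cases)
  case 1
  \<comment> \<open>Both sides of the relation are products of xy and yx, so their walks reduce to
    nothing.\<close>
  have "l = [(X, True), (Y, True)] @ [(Y, True), (X, True)]" "r = [(Y, True), (X, True)] @ [(X, True), (Y, True)]"
    using 1 by simp_all
  moreover have "free_red (walk g (s @ t)) = free_red ([] @ [])"
    if "\<And>g. g \<in> carrier G \<Longrightarrow> free_red (walk g s) = []" "\<And>g. g \<in> carrier G \<Longrightarrow> free_red (walk g t) = []" for s t
    unfolding walk_append[OF g]
    by (rule free_red_append_cong) (use that g in \<open>simp_all add: free_red_def[of "[]"]\<close>)
  ultimately show ?thesis by (simp only: walk_pairs free_red_pair)
next
  case (2 c s)
  then show ?thesis using walk_pairs[OF g] by (cases c; cases s) (simp_all only: not_True_eq_False not_False_eq_True free_red_pair free_red_def[of "[]"] walk.simps(1) foldr.simps id_apply)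
qed

lemma walk_el:
  assumes g: "g \<in> carrier G" and st: "el s = el t"
  shows "free_red (walk g s) = free_red (walk g t)"
  using st
proof (rule el_invariant[rotated])
  fix s t l r assume lr: "(l, r) \<in> xyyx_rules"
  have lr_el: "el l = el r" using el_rule[OF lr, of "[]" "[]"] by simp
  show "free_red (walk g (s @ l @ t)) = free_red (walk g (s @ r @ t))"
    using g walk_rules[OF _ lr, of "g \<otimes> el s"] unfolding walk_append[OF g] walk_append[OF m_closed[OF g el_closed]] lr_el
    by (intro free_red_append_cong refl) simp
qed

text \<open>The geodesic from \<open>vtx g\<close> to \<open>vtx (g \<otimes> h)\<close> as a word
  of signed edges. It takes the place of a normal form theorem for HNN extensions.\<close>

definition route :: "(gen \<times> bool) list set \<Rightarrow> (gen \<times> bool) list set \<Rightarrow> ((gen \<times> bool) list set set \<times> bool) list" where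
  "route g h = free_red (walk g (SOME s. el s = h))"

lemma route_el: "g \<in> carrier G \<Longrightarrow> route g (el s) = free_red (walk g s)"
  unfolding route_def by (rule walk_el[OF _ el_some])

lemma route_reduced: "free_red (route g h) = route g h"
  unfolding route_def by (rule free_red_reduced[OF freely_reduced_free_red])

lemma route_mult:
  assumes "g \<in> carrier G" "h \<in> carrier G" "k \<in> carrier G"
  shows "route g (h \<otimes> k) = free_red (route g h @ route (g \<otimes> h) k)"
proof -
  obtain s t where st: "h = el s" "k = el t" using assms el_cases by metis
  have "free_red (walk g s @ walk (g \<otimes> el s) t) = free_red (route g h @ route (g \<otimes> h) k)"
    by (rule free_red_append_cong) (simp_all add: st route_el assms(1) route_reduced flip: route_el)
  then show ?thesis using assms(1) by (simp add: st el_mult route_el walk_append)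
qed

lemma route_one: "g \<in> carrier G \<Longrightarrow> route g \<one> = []"
  unfolding el_Nil[symmetric] by (simp add: route_el free_red_def)

text \<open>The elements whose route is empty from every start form a subgroup, which contains
  \<open>a\<close> and \<open>b\<close>.\<close>

lemma route_e: "g \<in> carrier G \<Longrightarrow> route g (e i j) = []"
proof -
  let ?T = "{h \<in> carrier G. \<forall>g\<in>carrier G. route g h = []}"
  have T: "subgroup ?T G"
  proof (rule subgroupI)
    fix h assume h: "h \<in> ?T"
    have "route g (inv h) = []" if "g \<in> carrier G" for g
      using route_mult[of g "inv h" h] h that route_reduced[of g "inv h"] by (simp add: route_one)
    then show "inv h \<in> ?T" using h by simp
  next
    fix h k assume "h \<in> ?T" "k \<in> ?T"
    then show "h \<otimes> k \<in> ?T" by (simp add: route_mult free_red_def)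
  qed (use route_one in auto)
  have "a \<in> ?T" "b \<in> ?T"
    unfolding a_def b_def mem_Collect_eq by (simp_all del: walk.simps add: route_el walk_pairs(1,2) free_red_pair)
  then have "e i j \<in> ?T" unfolding e_def by (intro subgroup.m_closed[OF T] subgroup_int_pow_closed[OF T])
  then show "g \<in> carrier G \<Longrightarrow> route g (e i j) = []" by simp
qed

lemma route_e_left: "g \<in> carrier G \<Longrightarrow> h \<in> carrier G \<Longrightarrow> route g (e i j \<otimes> h) = route (g \<otimes> e i j) h"
  by (simp add: route_mult route_e route_reduced)

lemma route_e_right: "g \<in> carrier G \<Longrightarrow> h \<in> carrier G \<Longrightarrow> route g (h \<otimes> e i j) = route g h"
  by (simp add: route_mult route_e route_reduced)

lemma route_x:
  assumes "g \<in> carrier G"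
  shows "route g x = [(edge g, True)]" "route g (inv x) = [(edge (g \<otimes> inv x), False)]"
  using assms route_el[OF assms, of "[(X, True)]"] route_el[OF assms, of "[(X, False)]"]
  by (simp_all add: inv_x el_X free_red_def)

text \<open>Britton's lemma for a single letter: the two sides have routes of one edge, given by the
  cosets of a^i b^j and of 1 modulo <a>.\<close>

lemma edge_stabilizer:
  assumes "e i j \<otimes> x = x \<otimes> e k l"
  shows "j = 0"
proof -
  have "[(edge (e i j), True)] = route \<one> (e i j \<otimes> x)" by (simp add: route_e_left route_x)
  also have "\<dots> = [(edge \<one>, True)]" unfolding assms by (simp add: route_e_right route_x)
  finally obtain m where "e i j = \<one> \<otimes> e m 0" using edge_eqD[of \<one> "e i j"] by auto
  then show ?thesis by (simp add: e_inj)
qed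

definition edge_ini :: "(gen \<times> bool) list set set \<Rightarrow> (gen \<times> bool) list set set" where
  "edge_ini c = vtx (SOME g. g \<in> carrier G \<and> edge g = c)"

definition edge_ter :: "(gen \<times> bool) list set set \<Rightarrow> (gen \<times> bool) list set set" where
  "edge_ter c = vtx ((SOME g. g \<in> carrier G \<and> edge g = c) \<otimes> x)"

lemma edge_ends:
  assumes g: "g \<in> carrier G"
  shows "edge_ini (edge g) = vtx g" "edge_ter (edge g) = vtx (g \<otimes> x)"
proof -
  define h where "h = (SOME h. h \<in> carrier G \<and> edge h = edge g)"
  have h: "h \<in> carrier G \<and> edge h = edge g" unfolding h_def
    by (rule someI[of "\<lambda>h. h \<in> carrier G \<and> edge h = edge g" g]) (simp add: g)
  then obtain i where i: "h = g \<otimes> e i 0" using edge_eqD[OF g, of h] by auto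
  show "edge_ini (edge g) = vtx g" unfolding edge_ini_def h_def[symmetric] i by (rule vtx_e[OF g])
  have "h \<otimes> x = g \<otimes> x \<otimes> e 0 i" using g by (simp add: i m_assoc x_e)
  then show "edge_ter (edge g) = vtx (g \<otimes> x)" unfolding edge_ter_def h_def[symmetric] using vtx_e[of "g \<otimes> x"] g by simp
qed

definition vertices :: "(gen \<times> bool) list set set set" where
  "vertices = vtx ` carrier G"

definition adj :: "(gen \<times> bool) list set set \<Rightarrow> (gen \<times> bool) list set set \<Rightarrow> bool" where
  "adj u v \<longleftrightarrow> (\<exists>g\<in>carrier G. u = vtx g \<and> v = vtx (g \<otimes> x) \<or> v = vtx g \<and> u = vtx (g \<otimes> x))"

lemma adj_x: "g \<in> carrier G \<Longrightarrow> adj (vtx g) (vtx (g \<otimes> x))" "g \<in> carrier G \<Longrightarrow> adj (vtx (g \<otimes> x)) (vtx g)"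
  by (auto simp: adj_def)

lemma adj_letter: "adj u v \<longleftrightarrow> (\<exists>l. fst l \<in> edge ` carrier G \<and> letter_ini edge_ini edge_ter l = u \<and> letter_ini edge_ini edge_ter (flip l) = v)"
proof
  assume "adj u v"
  then obtain g where g: "g \<in> carrier G" "u = vtx g \<and> v = vtx (g \<otimes> x) \<or> v = vtx g \<and> u = vtx (g \<otimes> x)"
    unfolding adj_def by blast
  then show "\<exists>l. fst l \<in> edge ` carrier G \<and> letter_ini edge_ini edge_ter l = u \<and> letter_ini edge_ini edge_ter (flip l) = v"
    by (intro exI[of _ "(edge g, u = vtx g \<and> v = vtx (g \<otimes> x))"]) (auto simp: edge_ends)
next
  assume "\<exists>l. fst l \<in> edge ` carrier G \<and> letter_ini edge_ini edge_ter l = u \<and> letter_ini edge_ini edge_ter (flip l) = v"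
  then obtain g s where "g \<in> carrier G" "letter_ini edge_ini edge_ter (edge g, s) = u" "letter_ini edge_ini edge_ter (edge g, \<not> s) = v"
    by fastforce
  then show "adj u v" by (cases s) (auto simp: edge_ends intro: adj_x)
qed

lemma letter_walk_route:
  assumes "letter_walk edge_ini edge_ter us w" "fst ` set w \<subseteq> edge ` carrier G" "g \<in> carrier G" "hd us = vtx g"
  shows "\<exists>h\<in>carrier G. last us = vtx (g \<otimes> h) \<and> route g h = free_red w"
  using assms
proof (induction edge_ini edge_ter us w arbitrary: g rule: letter_walk.induct)
  case (1 u w)
  then show ?case using route_one by (intro bexI[of _ \<one>]) (simp_all add: free_red_def)
next
  case (2 u v us l w)
  obtain c s where l: "l = (edge c, s)" and c: "c \<in> carrier G" using "2.prems"(2) by (cases l) auto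
  note g = \<open>g \<in> carrier G\<close>
  have "\<exists>h\<in>carrier G. v = vtx (g \<otimes> h) \<and> route g h = [l]"
  proof (cases s)
    case True
    then have "vtx g = vtx c" "v = vtx (c \<otimes> x)" using "2.prems" l c by (auto simp: edge_ends)
    then obtain i j where "c = g \<otimes> e i j" using vtx_eqD[OF g c] by blast
    then show ?thesis using \<open>v = vtx (c \<otimes> x)\<close> g True l
      by (intro bexI[of _ "e i j \<otimes> x"]) (simp_all add: m_assoc route_e_left route_x)
  next
    case False
    then have "vtx g = vtx (c \<otimes> x)" "v = vtx c" using "2.prems" l c by (auto simp: edge_ends)
    then obtain i j where ij: "c \<otimes> x = g \<otimes> e i j" using vtx_eqD[OF g, of "c \<otimes> x"] c by auto
    have "g \<otimes> (e i j \<otimes> inv x) = c \<otimes> x \<otimes> inv x" unfolding ij using g by (simp add: m_assoc)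
    then have "g \<otimes> (e i j \<otimes> inv x) = c" using c by (simp add: m_assoc)
    then show ?thesis using \<open>v = vtx c\<close> g False l
      by (intro bexI[of _ "e i j \<otimes> inv x"]) (simp_all add: route_e_left route_x m_assoc)
  qed
  then obtain h where h: "h \<in> carrier G" "v = vtx (g \<otimes> h)" "route g h = [l]" by blast
  have "letter_walk edge_ini edge_ter (v # us) w" "fst ` set w \<subseteq> edge ` carrier G" using "2.prems" by auto
  from "2.hyps"[OF this, of "g \<otimes> h"] obtain k
    where k: "k \<in> carrier G" "last (v # us) = vtx (g \<otimes> h \<otimes> k)" "route (g \<otimes> h) k = free_red w"
    using g h by auto
  have "route g (h \<otimes> k) = free_red ([l] @ w)" unfolding route_mult[OF g h(1) k(1)]
    by (rule free_red_append_cong) (use h k route_reduced[of "g \<otimes> h" k] in \<open>simp_all add: k(3)\<close>)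
  then show ?case using k h g by (intro bexI[of _ "h \<otimes> k"]) (simp_all add: m_assoc)
qed auto

lemma connected_one: "adj\<^sup>*\<^sup>* (vtx \<one>) (vtx (el s))"
proof (induction s rule: rev_induct)
  case Nil
  show ?case by (simp add: el_Nil)
next
  case (snoc l s)
  have x1: "adj (vtx (el s)) (vtx (el s \<otimes> x))" by (simp add: adj_x)
  have x2: "adj (vtx (el s)) (vtx (el s \<otimes> inv x))" using adj_x(2)[of "el s \<otimes> inv x"] by (simp add: m_assoc)
  have "vtx (el s \<otimes> (inv x \<otimes> a)) = vtx (el s \<otimes> inv x)"
    using vtx_e[of "el s \<otimes> inv x" 1 0] by (simp add: e_a m_assoc)
  moreover have "vtx (el s \<otimes> (inv a \<otimes> x)) = vtx (el s \<otimes> x)"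
  proof -
    have "inv a \<otimes> x = x \<otimes> e 0 (- 1)" using x_e[of "- 1"] e_inv[of 1 0] by (simp add: e_a)
    then show ?thesis using vtx_e[of "el s \<otimes> x" 0 "- 1"] by (simp add: m_assoc)
  qed
  moreover have "el (s @ [l]) = el s \<otimes> el [l]" by (simp add: el_mult)
  moreover obtain c s' where "l = (c, s')" by (cases l)
  ultimately have "adj (vtx (el s)) (vtx (el (s @ [l])))"
    using x1 x2 by (cases c; cases s') (simp_all only: el_X inv_x[symmetric] el_Y el_Y')
  with snoc show ?case by simp
qed

sublocale T: tree vertices adj
proof (rule tree_of_edges[of "edge ` carrier G" edge_ini _ edge_ter])
  fix u v assume "u \<in> vertices" "v \<in> vertices"
  then obtain g h where "g \<in> carrier G" "u = vtx g" "h \<in> carrier G" "v = vtx h" by (auto simp: vertices_def)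
  then have uv: "adj\<^sup>*\<^sup>* (vtx \<one>) u" "adj\<^sup>*\<^sup>* (vtx \<one>) v" using connected_one by (auto simp: carrier_eq)
  have "symp adj" by (rule sympI) (auto simp: adj_def)
  then have "symp adj\<^sup>*\<^sup>*" by (rule symp_rtranclp)
  from sympD[OF this uv(1)] have "adj\<^sup>*\<^sup>* u v" using uv(2) by (rule rtranclp_trans)
  then show "\<exists>xs. xs \<noteq> [] \<and> hd xs = u \<and> last xs = v \<and> successively adj xs" by (rule rtranclp_walk)
next
  fix us w
  assume w: "letter_walk edge_ini edge_ter us w" "fst ` set w \<subseteq> edge ` carrier G" "hd us = last us" "freely_reduced w"
  show "w = []"
  proof (rule ccontr)
    assume "w \<noteq> []"
    then obtain l w' where lw: "w = l # w'" by (cases w) auto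
    then obtain u v us' where us: "us = u # v # us'" using w(1) by (cases "(edge_ini, edge_ter, us, w)" rule: letter_walk.cases) auto
    obtain c s where l: "l = (edge c, s)" and c: "c \<in> carrier G" using w(2) lw by (cases l) auto
    have "\<exists>g\<in>carrier G. hd us = vtx g" using w(1) lw us l c by (cases s) (auto simp: edge_ends)
    then obtain g where g: "g \<in> carrier G" "hd us = vtx g" by blast
    obtain h where h: "h \<in> carrier G" "last us = vtx (g \<otimes> h)" "route g h = free_red w"
      using letter_walk_route[OF w(1,2) g] by blast
    have gh: "g \<otimes> h \<in> carrier G" using g(1) h(1) by simp
    have "vtx g = vtx (g \<otimes> h)" using w(3) g(2) h(2) by simp
    then obtain i j where "g \<otimes> h = g \<otimes> e i j" using vtx_eqD[OF g(1) gh] by blast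
    then have "h = e i j" using g(1) h(1) by simp
    then have "free_red w = []" using h(3) route_e[OF g(1)] by simp
    then show False using free_red_reduced[OF w(4)] \<open>w \<noteq> []\<close> by simp
  qed
qed (auto simp: adj_letter vertices_def edge_ends)

end


section \<open>The action on the Bass-Serre tree\<close>

context xyyx
begin

definition smul :: "(gen \<times> bool) list set \<Rightarrow> (gen \<times> bool) list set set \<Rightarrow> (gen \<times> bool) list set set" where
  "smul h u = (\<lambda>k. h \<otimes> k) ` u"

lemma smul_vtx: "h \<in> carrier G \<Longrightarrow> g \<in> carrier G \<Longrightarrow> smul h (vtx g) = vtx (h \<otimes> g)"
  by (auto simp: smul_def vtx_def m_assoc)

lemma vtx_vertices [simp]: "g \<in> carrier G \<Longrightarrow> vtx g \<in> vertices"
  by (simp add: vertices_def)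

lemma smul_vertices: "h \<in> carrier G \<Longrightarrow> u \<in> vertices \<Longrightarrow> smul h u \<in> vertices"
  by (auto simp: vertices_def smul_vtx)

lemma smul_mult: "g \<in> carrier G \<Longrightarrow> h \<in> carrier G \<Longrightarrow> u \<in> vertices \<Longrightarrow> smul (g \<otimes> h) u = smul g (smul h u)"
  by (auto simp: vertices_def smul_vtx m_assoc)

lemma smul_inv: "h \<in> carrier G \<Longrightarrow> u \<in> vertices \<Longrightarrow> smul (inv h) (smul h u) = u"
  "h \<in> carrier G \<Longrightarrow> u \<in> vertices \<Longrightarrow> smul h (smul (inv h) u) = u"
  by (auto simp: vertices_def smul_vtx m_assoc[symmetric])

lemma smul_adj: "h \<in> carrier G \<Longrightarrow> adj u v \<Longrightarrow> adj (smul h u) (smul h v)"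
  by (auto simp: adj_def smul_vtx m_assoc[symmetric] intro!: bexI[of _ "h \<otimes> _"])

lemma smul_automorphism:
  assumes h: "h \<in> carrier G"
  shows "T.automorphism (smul h)"
proof -
  have "bij_betw (smul h) vertices vertices"
    by (rule bij_betw_byWitness[where f' = "smul (inv h)"]) (use h in \<open>auto simp: smul_inv smul_vertices\<close>)
  then show ?thesis using smul_adj[OF h] by (simp add: T.automorphism_def)
qed

lemma smul_inj: "h \<in> carrier G \<Longrightarrow> u \<in> vertices \<Longrightarrow> v \<in> vertices \<Longrightarrow> smul h u = smul h v \<longleftrightarrow> u = v"
  using smul_inv(1) by metis

lemma fixed_vtx: "h \<in> carrier G \<Longrightarrow> g \<in> carrier G \<Longrightarrow> smul h (vtx g) = vtx g \<Longrightarrow> \<exists>i j. h \<otimes> g = g \<otimes> e i j"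
  using vtx_eqD[of g "h \<otimes> g"] by (simp add: smul_vtx)

lemma fixed_edge:
  assumes h: "h \<in> carrier G" and g: "g \<in> carrier G" and fixed: "smul h (vtx g) = vtx g" "smul h (vtx (g \<otimes> x)) = vtx (g \<otimes> x)"
  shows "\<exists>m. h \<otimes> g = g \<otimes> e m 0"
proof -
  obtain i j where ij: "h \<otimes> g = g \<otimes> e i j" using fixed_vtx[OF h g fixed(1)] by blast
  obtain k l where kl: "h \<otimes> (g \<otimes> x) = g \<otimes> x \<otimes> e k l" using fixed_vtx[OF h _ fixed(2)] g by auto
  have "g \<otimes> (e i j \<otimes> x) = h \<otimes> g \<otimes> x" using g ij by (simp add: m_assoc)
  also have "\<dots> = g \<otimes> (x \<otimes> e k l)" using g h kl by (simp add: m_assoc)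
  finally have "e i j \<otimes> x = x \<otimes> e k l" using g by simp
  then have "j = 0" by (rule edge_stabilizer)
  with ij show ?thesis by blast
qed

lemma fixed_adj:
  assumes "adj u v"
  shows "\<exists>g\<in>carrier G. (u = vtx g \<or> u = vtx (g \<otimes> x)) \<and>
    (\<forall>h\<in>carrier G. smul h u = u \<longrightarrow> smul h v = v \<longrightarrow> (\<exists>m. h \<otimes> g = g \<otimes> e m 0))"
proof -
  obtain g where g: "g \<in> carrier G" "u = vtx g \<and> v = vtx (g \<otimes> x) \<or> v = vtx g \<and> u = vtx (g \<otimes> x)"
    using assms unfolding adj_def by blast
  moreover have "\<exists>m. h \<otimes> g = g \<otimes> e m 0" if "h \<in> carrier G" "smul h u = u" "smul h v = v" for h
    using fixed_edge[OF that(1) g(1)] g(2) that(2,3) by blast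
  ultimately show ?thesis by blast
qed

text \<open>If \<open>z\<close> moves \<open>vtx \<one>\<close>, then a^i b^j fixes this vertex and
  its image and hence the first edge between them. Edge stabilizers are conjugates of <a>; at a
  vertex stabilized by <a, b> they appear as <a> or <b>, so an exponent would vanish.\<close>

lemma centralizer_e:
  assumes ij: "i \<noteq> 0" "j \<noteq> 0" and z: "z \<in> carrier G" "z \<otimes> e i j = e i j \<otimes> z"
  shows "\<exists>k l. z = e k l"
proof (cases "vtx \<one> = vtx z")
  case True
  then show ?thesis using vtx_eqD[of \<one> z] z(1) by auto
next
  case False
  have e1: "smul (e i j) (vtx \<one>) = vtx \<one>" using vtx_e[of \<one> i j] by (simp add: smul_vtx)
  have ez: "smul (e i j) (vtx z) = vtx z" using vtx_e[of z i j] z by (simp add: smul_vtx)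
  obtain xs where xs: "T.geod (vtx \<one>) xs (vtx z)" using T.geod_exists[of "vtx \<one>" "vtx z"] z(1) by auto
  then obtain v xs' where xs': "xs = vtx \<one> # v # xs'" using False
    by (cases xs rule: remdups_adj.cases) (auto simp: T.geod_def)
  then have av: "adj (vtx \<one>) v" using xs by (simp add: T.geod_def)
  have ev: "smul (e i j) v = v" using T.fixed_geod[OF smul_automorphism xs e1 ez, of v] xs' by simp
  obtain g m where g: "g \<in> carrier G" "vtx \<one> = vtx g \<or> vtx \<one> = vtx (g \<otimes> x)" "e i j \<otimes> g = g \<otimes> e m 0"
    using fixed_adj[OF av] e1 ev e_closed by blast
  from g(2) have False
  proof
    assume "vtx \<one> = vtx g"
    then obtain k l where "g = e k l" using vtx_eqD[of \<one> g] g(1) by auto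
    then show False using g(3) ij by (simp add: e_mult e_inj)
  next
    assume "vtx \<one> = vtx (g \<otimes> x)"
    then obtain k l where gx: "g \<otimes> x = e k l" using vtx_eqD[of \<one> "g \<otimes> x"] g(1) by auto
    have "e i j \<otimes> (g \<otimes> x) = g \<otimes> e m 0 \<otimes> x" using g(1,3) by (simp add: m_assoc[symmetric])
    also have "\<dots> = g \<otimes> x \<otimes> e 0 m" using g(1) by (simp add: m_assoc x_e)
    finally show False using ij by (simp add: gx e_mult e_inj)
  qed
  then show ?thesis ..
qed

definition d where "d = x \<otimes> a \<otimes> inv x"
definition c where "c = b \<otimes> d \<otimes> inv b \<otimes> inv d"

lemma d_c_closed [simp]: "d \<in> carrier G" "c \<in> carrier G"
  by (simp_all add: d_def c_def)

lemma d_x: "d \<otimes> x = x \<otimes> a"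
  by (simp add: d_def m_assoc)

lemma b_d_fixed:
  "smul b (vtx \<one>) = vtx \<one>" "smul d (vtx x) = vtx x" "smul d (vtx \<one>) \<noteq> vtx \<one>" "smul b (vtx x) \<noteq> vtx x"
proof -
  show "smul b (vtx \<one>) = vtx \<one>" using vtx_e[of \<one> 0 1] by (simp add: smul_vtx e_b)
  show "smul d (vtx x) = vtx x" using vtx_e[of x 1 0] by (simp add: smul_vtx e_a d_x)
  show "smul d (vtx \<one>) \<noteq> vtx \<one>"
  proof
    assume "smul d (vtx \<one>) = vtx \<one>"
    then obtain i j where ij: "d = e i j" using fixed_vtx[of d \<one>] by auto
    then have *: "e i j \<otimes> x = x \<otimes> e 1 0" using d_x by (simp add: e_a)
    then have "j = 0" by (rule edge_stabilizer)
    then have "x \<otimes> e 0 i = x \<otimes> e 1 0" using * by (simp add: x_e)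
    then show False by (simp add: e_inj)
  qed
  show "smul b (vtx x) \<noteq> vtx x"
  proof
    assume "smul b (vtx x) = vtx x"
    then obtain i j where "e 0 1 \<otimes> x = x \<otimes> e i j" using fixed_vtx[of b x] by (auto simp: e_b)
    then show False using edge_stabilizer by fastforce
  qed
qed

text \<open>\<open>b\<close> and \<open>d\<close> fix adjacent vertices, and each moves the vertex
  of the other. Therefore b d b^-1 d^-1 moves \<open>vtx x\<close> along a path of length four. The
  second claim is the turning condition of \<open>no_fixed_point\<close>.\<close>

lemma c_geod:
  "T.geod (vtx x) [vtx x, vtx \<one>, smul b (vtx x), smul b (smul d (vtx \<one>)), smul c (vtx x)] (smul c (vtx x))"
  "smul b (smul d (vtx \<one>)) \<noteq> smul c (vtx \<one>)"
proof -
  let ?v = "vtx \<one>" and ?w = "vtx x"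
  note V = smul_vertices vtx_vertices
  have bi: "smul (inv b) ?v = ?v" using smul_inv(1)[of b ?v] by (simp add: b_d_fixed)
  have di: "smul (inv d) ?w = ?w" using smul_inv(1)[of d ?w] by (simp add: b_d_fixed)
  have c: "smul c u = smul b (smul d (smul (inv b) (smul (inv d) u)))" if "u \<in> vertices" for u
    using that by (simp add: c_def smul_mult V)
  have cw: "smul c ?w = smul b (smul d (smul (inv b) ?w))" by (simp add: c di)
  have vw: "adj ?v ?w" "adj ?w ?v" using adj_x[of \<one>] by simp_all
  have "adj ?v (smul b ?w)" using smul_adj[OF _ vw(1), of b] by (simp add: b_d_fixed)
  moreover have "adj (smul b ?w) (smul b (smul d ?v))"
    using smul_adj[OF closed(3) smul_adj[OF _ vw(2), of d]] by (simp add: b_d_fixed)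
  moreover have "adj ?v (smul (inv b) ?w)" using smul_adj[OF _ vw(1), of "inv b"] by (simp add: bi)
  then have "adj (smul b (smul d ?v)) (smul c ?w)" unfolding cw by (intro smul_adj) simp_all
  moreover have "?v \<noteq> smul b (smul d ?v)"
    using b_d_fixed(1,3) smul_inj[of b ?v "smul d ?v"] by (simp add: V)
  moreover have "smul b ?w \<noteq> smul c ?w"
  proof
    assume "smul b ?w = smul c ?w"
    then have "?w = smul d (smul (inv b) ?w)" unfolding cw by (simp add: smul_inj V)
    then have "smul d ?w = smul d (smul (inv b) ?w)" by (simp add: b_d_fixed)
    then have "?w = smul (inv b) ?w" by (simp add: smul_inj V)
    then show False using smul_inv(2)[of b ?w] b_d_fixed(4) by simp
  qed
  ultimately show "T.geod ?w [?w, ?v, smul b ?w, smul b (smul d ?v), smul c ?w] (smul c ?w)"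
    using vw b_d_fixed(4)[symmetric] by (simp add: T.geod_def)
  show "smul b (smul d ?v) \<noteq> smul c ?v"
  proof
    assume "smul b (smul d ?v) = smul c ?v"
    then have "?v = smul (inv b) (smul (inv d) ?v)"
      unfolding c[OF vtx_vertices[OF one_closed]] by (simp add: smul_inj V)
    then have "smul b ?v = smul b (smul (inv b) (smul (inv d) ?v))" by (rule arg_cong)
    then have "?v = smul (inv d) ?v" by (simp add: b_d_fixed smul_inv V)
    then show False using smul_inv(2)[of d ?v] b_d_fixed(3) by simp
  qed
qed

lemma c_no_fixed: "u \<in> vertices \<Longrightarrow> smul c u \<noteq> u" "u \<in> vertices \<Longrightarrow> smul c (smul c u) \<noteq> u"
  using T.no_fixed_point[OF smul_automorphism c_geod(1), of u] T.no_fixed_point_square[OF smul_automorphism c_geod(1), of u]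
    c_geod(2) by auto

lemma shifted_pair_x: "shifted_pair G a b x"
proof
  show "x \<otimes> b \<otimes> inv x = a" by (simp add: x_b m_assoc)
  show "x \<otimes> a \<otimes> inv x \<otimes> b \<noteq> b \<otimes> (x \<otimes> a \<otimes> inv x)"
  proof
    assume "x \<otimes> a \<otimes> inv x \<otimes> b = b \<otimes> (x \<otimes> a \<otimes> inv x)"
    then have "d \<otimes> b = b \<otimes> d" by (simp only: d_def)
    then have "c = \<one>" unfolding c_def by (metis closed(3) d_c_closed(1) inv_closed m_assoc r_inv r_one)
    then show False using c_no_fixed(1)[of "vtx \<one>"] by (simp add: smul_vtx)
  qed
  show "a [^] i \<otimes> b [^] j = \<one> \<Longrightarrow> i = 0 \<and> j = 0" for i j :: int
    using e_inj[of i j 0 0] unfolding e_0 by (simp add: e_def)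
  show "\<exists>(k :: int) (l :: int). z = a [^] k \<otimes> b [^] l" if "i \<noteq> 0" "j \<noteq> 0" "z \<in> carrier G"
      "z \<otimes> (a [^] i \<otimes> b [^] j) = a [^] i \<otimes> b [^] j \<otimes> z" for i j :: int and z
    using centralizer_e[of i j z] that by (simp add: e_def)
qed simp

text \<open>The centralizer of \<open>a\<close> acts on the subtree \<open>F\<close> fixed by
  \<open>a\<close>, and \<open>c\<close> has an axis there on which its centralizer acts by shifts.
  As \<open>c\<close> inverts no edge, the axis is injective and the shift is unique. An element
  that does not shift fixes an edge of \<open>F\<close>.\<close>

theorem shifted_triple_x: "\<exists>\<sigma>. shifted_triple G a b x c \<sigma>"
proof -
  define F where "F = {v \<in> vertices. smul a v = v}"
  define adjF where "adjF = (\<lambda>u v. adj u v \<and> smul a u = u \<and> smul a v = v)"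
  have aut_a: "T.automorphism (smul a)" by (rule smul_automorphism) simp
  interpret F: tree F adjF unfolding F_def adjF_def by (rule T.fixed_subtree[OF aut_a])
  have FV: "v \<in> vertices" if "v \<in> F" for v using that by (simp add: F_def)
  have aut: "F.automorphism (smul h)" if "h \<in> carrier G" "h \<otimes> a = a \<otimes> h" for h
    unfolding F_def adjF_def
    by (rule T.fixed_subtree_automorphism[OF aut_a smul_automorphism]) (use that in \<open>simp_all add: smul_mult[symmetric]\<close>)
  have "d \<otimes> a = a \<otimes> d"
    using arg_cong[OF a_b, of "\<lambda>z. x \<otimes> z \<otimes> inv x"] conj_mult[of x a b] conj_mult[of x b a]
    by (simp add: d_def x_b m_assoc)
  let ?Z = "{z \<in> carrier G. z \<otimes> a = a \<otimes> z}"
  have "d \<in> ?Z" "b \<in> ?Z" using \<open>d \<otimes> a = a \<otimes> d\<close> a_b by auto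
  then have "c \<in> ?Z" unfolding c_def
    by (intro subgroup.m_closed[OF centralizer_subgroup] subgroup.m_inv_closed[OF centralizer_subgroup] closed)
  then have ca: "c \<otimes> a = a \<otimes> c" by simp
  have "smul a (vtx \<one>) = vtx \<one>" using vtx_e[of \<one> 1 0] by (simp add: smul_vtx e_a)
  then have "vtx \<one> \<in> F" by (simp add: F_def)
  then have F_ne: "F \<noteq> {}" by blast
  have no_fix: "smul c v \<noteq> v" "smul c (smul c v) \<noteq> v" if "v \<in> F" for v
    using c_no_fixed FV[OF that] by simp_all
  have "\<exists>l :: int \<Rightarrow> (gen \<times> bool) list set set. (\<forall>i. l i \<in> F \<and> adjF (l i) (l (i + 1))) \<and>
    ((\<forall>v\<in>F. smul c (smul c v) \<noteq> v) \<longrightarrow> inj l) \<and>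
    (\<forall>h. F.automorphism h \<and> (\<forall>v\<in>F. h (smul c v) = smul c (h v)) \<longrightarrow> (\<exists>m. \<forall>i. h (l i) = l (i + m)))"
    by (rule F.axis[OF aut[OF d_c_closed(2) ca] _ F_ne]) (rule no_fix(1))
  then obtain l :: "int \<Rightarrow> (gen \<times> bool) list set set" where "(\<forall>i. l i \<in> F \<and> adjF (l i) (l (i + 1))) \<and>
    ((\<forall>v\<in>F. smul c (smul c v) \<noteq> v) \<longrightarrow> inj l) \<and>
    (\<forall>h. F.automorphism h \<and> (\<forall>v\<in>F. h (smul c v) = smul c (h v)) \<longrightarrow> (\<exists>m. \<forall>i. h (l i) = l (i + m)))"
    by (elim exE)
  then have l: "\<And>i. l i \<in> F" "\<And>i. adjF (l i) (l (i + 1))" "inj l"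
    and shift: "\<And>h. F.automorphism h \<Longrightarrow> (\<And>v. v \<in> F \<Longrightarrow> h (smul c v) = smul c (h v)) \<Longrightarrow> \<exists>m. \<forall>i. h (l i) = l (i + m)"
    using no_fix(2) by simp_all
  define \<sigma> where "\<sigma> h = (THE m. \<forall>i. smul h (l i) = l (i + m))" for h
  have \<sigma>: "smul h (l i) = l (i + \<sigma> h)" if h: "h \<in> carrier G" "h \<otimes> a = a \<otimes> h" "h \<otimes> c = c \<otimes> h" for h i
  proof -
    have "\<exists>m. \<forall>i. smul h (l i) = l (i + m)"
      by (rule shift[OF aut[OF h(1,2)]]) (use h FV in \<open>simp_all add: smul_mult[symmetric]\<close>)
    then obtain m where m: "\<forall>i. smul h (l i) = l (i + m)" by blast
    have "n = m" if "\<forall>i. smul h (l i) = l (i + n)" for n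
    proof -
      have "l (0 + n) = l (0 + m)" using m that by metis
      then show ?thesis using l(3) by (simp add: inj_eq)
    qed
    with m have "\<sigma> h = m" unfolding \<sigma>_def by (intro the_equality) auto
    with m show ?thesis by simp
  qed
  interpret P: shifted_pair G a b x by (rule shifted_pair_x)
  have powers: "\<exists>n :: int. h = a [^] n" if h: "h \<in> carrier G" "h \<otimes> a = a \<otimes> h" "h \<otimes> c = c \<otimes> h" "\<sigma> h = 0" for h
  proof -
    have fix_h: "smul h (l i) = l i" for i using \<sigma>[OF h(1-3)] h(4) by simp
    have fix_a: "smul a (l i) = l i" for i using l(1)[of i] by (simp add: F_def)
    have l01: "adj (l 0) (l (0 + 1))" using l(2)[of 0] by (simp only: adjF_def)
    obtain g where g: "g \<in> carrier G" "\<forall>h\<in>carrier G. smul h (l 0) = l 0 \<longrightarrow> smul h (l (0 + 1)) = l (0 + 1) \<longrightarrow> (\<exists>m. h \<otimes> g = g \<otimes> e m 0)"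
      using fixed_adj[OF l01] by blast
    obtain m where m: "h \<otimes> g = g \<otimes> e m 0" using g(2)[rule_format, OF h(1) fix_h fix_h] by (elim exE)
    obtain n where n: "a \<otimes> g = g \<otimes> e n 0" using g(2)[rule_format, OF closed(2) fix_a fix_a] by (elim exE)
    \<comment> \<open>The stabilizer of the edge is g <a> g^-1 and contains \<open>a\<close>. By the
      degree \<open>a\<close> can only be g a g^-1, so the stabilizer consists of powers of
      \<open>a\<close>.\<close>
    have "deg (a \<otimes> g) = deg (g \<otimes> e n 0)" by (simp only: n)
    then have "n = 1" using g(1) deg_pow[OF closed(2), of n] deg_el[of "[(X, True), (Y, True)]"] by (simp add: deg_mult e_i flip: a_def)
    then have ag: "a \<otimes> g = g \<otimes> a" using n by (simp add: e_a)
    have "g \<in> {z \<in> carrier G. z \<otimes> a = a \<otimes> z}" using g(1) ag by simp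
    then have "a \<in> {z \<in> carrier G. z \<otimes> g = g \<otimes> z}" by simp
    then have "a [^] m \<in> {z \<in> carrier G. z \<otimes> g = g \<otimes> z}"
      by (rule subgroup_int_pow_closed[OF centralizer_subgroup[OF g(1)]])
    then have "h \<otimes> g = a [^] m \<otimes> g" using m by (simp add: e_i)
    then have "h = a [^] m" using g(1) h(1) by simp
    then show ?thesis by blast
  qed
  have "shifted_triple G a b x c \<sigma>"
  proof
    show "c = b \<otimes> (x \<otimes> a \<otimes> inv x) \<otimes> inv b \<otimes> inv (x \<otimes> a \<otimes> inv x)" by (simp only: c_def d_def)
    show "\<sigma> (y \<otimes> z) = \<sigma> y + \<sigma> z"
      if y: "y \<in> carrier G" and z: "z \<in> carrier G" and "y \<otimes> a = a \<otimes> y" "z \<otimes> a = a \<otimes> z" "y \<otimes> c = c \<otimes> y" "z \<otimes> c = c \<otimes> z" for y z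
    proof -
      let ?Y = "{z \<in> carrier G. z \<otimes> a = a \<otimes> z}" and ?W = "{z \<in> carrier G. z \<otimes> c = c \<otimes> z}"
      have "y \<otimes> z \<in> ?Y" "y \<otimes> z \<in> ?W"
        using subgroup.m_closed[OF centralizer_subgroup[OF closed(2)], of y z]
          subgroup.m_closed[OF centralizer_subgroup[OF d_c_closed(2)], of y z] that by auto
      then have "smul (y \<otimes> z) (l 0) = l (0 + \<sigma> (y \<otimes> z))" using \<sigma> by blast
      moreover have "smul (y \<otimes> z) (l 0) = l (0 + \<sigma> z + \<sigma> y)"
        using \<sigma>[of z 0] \<sigma>[of y "0 + \<sigma> z"] that FV[OF l(1)] by (simp only: smul_mult)
      ultimately show ?thesis using l(3) by (simp add: inj_eq)
    qed
    show "\<exists>n :: int. h = a [^] n" if "h \<in> carrier G" "h \<otimes> a = a \<otimes> h" "h \<otimes> c = c \<otimes> h" "\<sigma> h = 0" for h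
      using powers that by blast
    show "\<sigma> c \<noteq> 0"
    proof
      assume "\<sigma> c = 0"
      then have "smul c (l 0) = l 0" using \<sigma>[of c 0] ca by simp
      then show False using c_no_fixed(1) FV l(1) by blast
    qed
  qed
  then show ?thesis by blast
qed

lemma not_lr: "\<not> lr G UL CL EL UR CR ER"
proof
  assume lr: "lr G UL CL EL UR CR ER"
  obtain \<sigma> where "shifted_triple G a b x c \<sigma>" using shifted_triple_x by (elim exE)
  then show False using lr_pair.no_shifted_triple[OF lr_pair.intro[OF lr shifted_pair_x]] by (rule notE[rotated])
qed

end


section \<open>Diagram groups as groups of diagrams\<close>

lemma squier_complex_sel:
  "verts (squier_complex A R) = nonempty_words A"
  "edges (squier_complex A R) = {(p, u, v, q). p \<in> lists A \<and> q \<in> lists A \<and> ((u, v) \<in> R \<or> (v, u) \<in> R)}"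
  "ini (squier_complex A R) (p, u, v, q) = p @ u @ q"
  "ter (squier_complex A R) (p, u, v, q) = p @ v @ q"
  "inv_edge (squier_complex A R) = squier_inv"
  by (simp_all add: squier_complex_def)

definition squier_rules :: "'a set \<Rightarrow> 'a list rel \<Rightarrow> 'a squier_edge list rel" where
  "squier_rules A R = {([e, squier_inv e], []) | e. e \<in> edges (squier_complex A R)} \<union>
    {(c, []) | c. c \<in> cells (squier_complex A R)}"

lemma diagram_group_of_eq: "diagram_group_of A R w = word_group (loops (squier_complex A R) w) (squier_rules A R)"
  by (simp add: diagram_group_of_def fundamental_group_def squier_rules_def squier_complex_sel)

context presentation
begin

lemma edge_path_iff: "a \<in> nonempty_words A \<Longrightarrow> edge_path (squier_complex A R) a s b \<longleftrightarrow> path a s b"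
proof (induction s arbitrary: a)
  case Nil
  then show ?case by (auto simp: squier_complex_sel nonempty_words_def)
next
  case (Cons e s)
  obtain p u v q where e: "e = (p, u, v, q)" by (cases e)
  have "p @ v @ q \<in> nonempty_words A" if "p \<in> lists A" "q \<in> lists A" "rel u v"
    using rel_words[OF that(3)] that by (simp add: nonempty_words_def)
  then show ?case using Cons by (auto simp: e squier_complex_sel)
qed

lemma dg_squier_rules: "(l, r) \<in> squier_rules A R \<Longrightarrow> dg l = dg r"
proof -
  assume "(l, r) \<in> squier_rules A R"
  then consider e where "l = [e, squier_inv e]" "r = []" | "l \<in> cells (squier_complex A R)" "r = []"
    unfolding squier_rules_def by blast
  then show ?thesis
  proof cases
    case (1 e)
    then show ?thesis using dg_reduces[OF r_into_rtranclp, of "[e, squier_inv e]" "[]"]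
        reduce2_reduce1[OF deletion[of e], of "[]" "[]"] by simp
  next
    case 2
    then obtain p z q l1 r1 l2 r2 where l: "l = [(p, l1, r1, z @ l2 @ q), (p @ r1 @ z, l2, r2, q)] @
        path_inv [(p @ l1 @ z, l2, r2, q), (p, l1, r1, z @ r2 @ q)]" "(l1, r1) \<in> R" "(l2, r2) \<in> R"
      unfolding squier_complex_def path_inv_def complex2.simps by blast
    have "l1 \<noteq> []" "r1 \<noteq> []" "l2 \<noteq> []" "r2 \<noteq> []" using rel_words l(2,3) by blast+
    from reduce2_reduce1[OF exchange[OF this], of "[]" p z q "[]"]
    have "dg [(p @ l1 @ z, l2, r2, q), (p, l1, r1, z @ r2 @ q)] = dg [(p, l1, r1, z @ l2 @ q), (p @ r1 @ z, l2, r2, q)]"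
      using dg_reduces[OF r_into_rtranclp] by fastforce
    then show ?thesis using 2 by (simp only: l(1) dg_append dg_path_inv dg_Nil right_minus)
  qed
qed

end

section \<open>Homotopy of loops at the base point\<close>

locale base_point = presentation A R for A :: "'a set" and R +
  fixes w
  assumes w: "w \<in> nonempty_words A"
begin

definition cong :: "'a squier_edge list rel" where
  "cong = word_cong (loops (squier_complex A R) w) (squier_rules A R)"

lemma loops_iff: "s \<in> loops (squier_complex A R) w \<longleftrightarrow> path w s w"
  by (simp add: loops_def edge_path_iff[OF w])

lemma cong_dg: "(s, t) \<in> cong \<Longrightarrow> dg s = dg t"
proof -
  assume "(s, t) \<in> cong"
  then have "equivclp (replace_step (loops (squier_complex A R) w) (squier_rules A R)) s t"
    by (simp add: cong_def word_cong_def)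
  moreover have *: "dg u = dg v" if "replace_step (loops (squier_complex A R) w) (squier_rules A R) u v" for u v
    using that by (auto simp: replace_step_def dg_append dest: dg_squier_rules)
  ultimately show ?thesis
  proof (induction rule: equivclp_induct)
    case (step u v)
    then show ?case using *[of u v] *[of v u] by auto
  qed simp
qed

lemma equiv_cong: "equiv {s. path w s w} cong"
proof -
  have "loops (squier_complex A R) w = {s. path w s w}" using loops_iff by blast
  then show ?thesis using equiv_word_cong[of "loops (squier_complex A R) w" "squier_rules A R"] by (simp add: cong_def)
qed

lemma cong_refl: "path w s w \<Longrightarrow> (s, s) \<in> cong"
  and cong_sym: "(s, t) \<in> cong \<Longrightarrow> (t, s) \<in> cong"
  and cong_trans: "(s, t) \<in> cong \<Longrightarrow> (t, u) \<in> cong \<Longrightarrow> (s, u) \<in> cong"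
  using equiv_cong by (auto simp: equiv_def dest: refl_onD symD transD)

text \<open>\<open>cong\<close> knows only loops at \<open>w\<close>, but 2-cells have to be cut
  open and turned elsewhere. Hence paths count as equivalent if they can replace each other in every
  loop at \<open>w\<close>.\<close>

definition eqv :: "'a list \<Rightarrow> 'a squier_edge list \<Rightarrow> 'a squier_edge list \<Rightarrow> 'a list \<Rightarrow> bool" where
  "eqv c s t d \<longleftrightarrow> path c s d \<and> path c t d \<and>
    (\<forall>x y. path w x c \<longrightarrow> path d y w \<longrightarrow> (x @ s @ y, x @ t @ y) \<in> cong)"

lemma eqv_refl: "path c s d \<Longrightarrow> eqv c s s d"
  unfolding eqv_def using path_append cong_refl by blast

lemma eqv_sym: "eqv c s t d \<Longrightarrow> eqv c t s d"
  unfolding eqv_def using cong_sym by blast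

lemma eqv_trans [trans]: "eqv c s t d \<Longrightarrow> eqv c t u d \<Longrightarrow> eqv c s u d"
  unfolding eqv_def using cong_trans by blast

lemma eqv_context:
  assumes "eqv c s t d" "path c' x c" "path d y d'"
  shows "eqv c' (x @ s @ y) (x @ t @ y) d'"
  unfolding eqv_def
proof (intro conjI allI impI)
  show "path c' (x @ s @ y) d'" "path c' (x @ t @ y) d'" using assms unfolding eqv_def path_append by blast+
  fix u v assume uv: "path w u c'" "path d' v w"
  then have "path w (u @ x) c" "path d (y @ v) w" using assms(2,3) path_append by blast+
  then have "((u @ x) @ s @ (y @ v), (u @ x) @ t @ (y @ v)) \<in> cong" using assms(1) unfolding eqv_def by blast
  then show "(u @ (x @ s @ y) @ v, u @ (x @ t @ y) @ v) \<in> cong" by simp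
qed

lemma eqv_rule:
  assumes "(s, []) \<in> squier_rules A R" "path c s c"
  shows "eqv c s [] c"
  unfolding eqv_def
proof (intro conjI allI impI)
  show "path c s c" by (rule assms)
  show "path c [] c" using path_words[OF assms(2)] by simp
  fix x y assume xy: "path w x c" "path c y w"
  have "(x @ [] @ y, x @ [] @ y) \<in> cong" by (rule cong_refl) (use xy path_append in auto)
  moreover have "x @ s @ y \<in> loops (squier_complex A R) w"
    unfolding loops_iff using xy assms(2) path_append by blast
  ultimately show "(x @ s @ y, x @ [] @ y) \<in> cong"
    using replace_step_word_cong[OF assms(1)] unfolding cong_def by blast
qed

lemma eqv_inverse: "path c s d \<Longrightarrow> eqv c (s @ path_inv s) [] c"
proof (induction s arbitrary: c)
  case Nil
  then show ?case using eqv_refl[of c "[]" c] by auto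
next
  case (Cons e s)
  obtain p u v q where e: "e = (p, u, v, q)" by (cases e)
  define c' where "c' = p @ v @ q"
  have s: "path c' s d" and ec: "path c [e] c'" using Cons.prems rel_words by (auto simp: e c'_def)
  have "path c' [squier_inv e] c" using path_path_inv[OF ec] by (simp add: path_inv_def)
  have "eqv c ([e] @ (s @ path_inv s) @ [squier_inv e]) ([e] @ [] @ [squier_inv e]) c"
    by (rule eqv_context[OF Cons.IH[OF s] ec]) fact
  also have "eqv c ([e] @ [] @ [squier_inv e]) [] c"
  proof (rule eqv_rule)
    show "([e] @ [] @ [squier_inv e], []) \<in> squier_rules A R"
      using Cons.prems by (auto simp: squier_rules_def squier_complex_sel e)
    show "path c ([e] @ [] @ [squier_inv e]) c" using ec \<open>path c' [squier_inv e] c\<close> path_append[of c "[e]" "[squier_inv e]" c] by auto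
  qed
  finally show ?case by (simp add: path_inv_def)
qed

lemma path_inv_path_inv [simp]: "path_inv (path_inv s) = s"
  by (simp add: path_inv_def rev_map comp_def)

lemma eqv_inverse': "path c s d \<Longrightarrow> eqv d (path_inv s @ s) [] d"
  using eqv_inverse[OF path_path_inv] by simp

lemma eqv_rotate:
  assumes "eqv c (s @ t) [] c" "path c s d"
  shows "eqv d (t @ s) [] d"
proof -
  have t: "path d t c" using assms path_append[of c s t c] path_common_reduct[of c s d s] unfolding eqv_def by metis
  note s' = path_path_inv[OF assms(2)]
  have "eqv d ([] @ [] @ (t @ s)) ([] @ (path_inv s @ s) @ (t @ s)) d"
    by (rule eqv_context[OF eqv_sym[OF eqv_inverse'[OF assms(2)]]])
      (use t assms(2) path_words[OF t] path_append in auto)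
  also have "eqv d ([] @ (path_inv s @ s) @ (t @ s)) (path_inv s @ [] @ s) d"
    using eqv_context[OF assms(1) s' assms(2)] by simp
  also have "eqv d (path_inv s @ [] @ s) [] d" using eqv_inverse'[OF assms(2)] by simp
  finally show ?thesis by simp
qed

lemma eqv_quotient:
  assumes "eqv c (s @ path_inv t) [] c" "path c t d"
  shows "eqv c s t d"
proof -
  have s: "path c s d"
    using assms path_append[of c s "path_inv t" c] path_path_inv[of _ "path_inv t" c] path_common_reduct[of c t d t]
    unfolding eqv_def by (metis path_inv_path_inv)
  have "eqv c (s @ [] @ []) (s @ (path_inv t @ t) @ []) d"
    by (rule eqv_context[OF eqv_sym[OF eqv_inverse'[OF assms(2)]] s]) (use path_words[OF s] in simp)
  also have "eqv c (s @ (path_inv t @ t) @ []) ([] @ [] @ t) d"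
    using eqv_context[OF assms(1) _ assms(2), of c "[]"] path_words[OF s] by simp
  finally show ?thesis by simp
qed

lemma eqv_cell:
  assumes "p \<in> lists A" "z \<in> lists A" "q \<in> lists A" "(l, r) \<in> R" "(u, v) \<in> R"
  shows "eqv (p @ l @ z @ u @ q) [(p, l, r, z @ u @ q), (p @ r @ z, u, v, q), (p, r, l, z @ v @ q), (p @ l @ z, v, u, q)] []
    (p @ l @ z @ u @ q)"
proof (rule eqv_rule)
  have "[(p, l, r, z @ u @ q), (p @ r @ z, u, v, q)] @ rev (map squier_inv [(p @ l @ z, u, v, q), (p, l, r, z @ v @ q)])
      \<in> cells (squier_complex A R)"
    unfolding squier_complex_def complex2.simps using assms by blast
  then show "([(p, l, r, z @ u @ q), (p @ r @ z, u, v, q), (p, r, l, z @ v @ q), (p @ l @ z, v, u, q)], []) \<in> squier_rules A R"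
    by (simp add: squier_rules_def)
  show "path (p @ l @ z @ u @ q) [(p, l, r, z @ u @ q), (p @ r @ z, u, v, q), (p, r, l, z @ v @ q), (p @ l @ z, v, u, q)] (p @ l @ z @ u @ q)"
    using assms rel_words[of l r] rel_words[of u v] by simp
qed

text \<open>2-cells exist for relations directed as in \<open>R\<close>. The other orientations of
  the square are obtained by starting its boundary at another corner.\<close>

lemma eqv_exchange:
  assumes pzq: "p \<in> lists A" "z \<in> lists A" "q \<in> lists A" and lr: "rel l r" and uv: "rel u v"
  shows "eqv (p @ l @ z @ u @ q) [(p @ l @ z, u, v, q), (p, l, r, z @ v @ q)] [(p, l, r, z @ u @ q), (p @ r @ z, u, v, q)] (p @ r @ z @ v @ q)"
proof -
  note words = rel_words[OF lr] rel_words[OF uv]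
  have paths: "path (p @ l @ z @ u @ q) [(p @ l @ z, u, v, q), (p, l, r, z @ v @ q)] (p @ r @ z @ v @ q)"
    "path (p @ l @ z @ u @ q) [(p, l, r, z @ u @ q), (p @ r @ z, u, v, q)] (p @ r @ z @ v @ q)"
    using assms words by auto
  have steps: "path (p @ l @ z @ v @ q) [(p, l, r, z @ v @ q), (p @ r @ z, v, u, q), (p, r, l, z @ u @ q)] (p @ l @ z @ u @ q)"
    "path (p @ r @ z @ u @ q) [(p, r, l, z @ u @ q)] (p @ l @ z @ u @ q)"
    "path (p @ r @ z @ v @ q) [(p, r, l, z @ v @ q), (p @ l @ z, v, u, q)] (p @ l @ z @ u @ q)"
    using assms words by auto
  consider "(l, r) \<in> R" "(u, v) \<in> R" | "(l, r) \<in> R" "(v, u) \<in> R" | "(r, l) \<in> R" "(u, v) \<in> R" | "(r, l) \<in> R" "(v, u) \<in> R"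
    using lr uv by blast
  then show ?thesis
  proof cases
    case 1
    show ?thesis
      by (rule eqv_sym, rule eqv_quotient[OF _ paths(1)]) (use eqv_cell[OF pzq 1] in \<open>simp add: path_inv_def\<close>)
  next
    case 2
    show ?thesis
      by (rule eqv_quotient[OF _ paths(2)])
        (use eqv_rotate[OF _ steps(1), of "[(p @ l @ z, u, v, q)]"] eqv_cell[OF pzq 2] in \<open>simp add: path_inv_def\<close>)
  next
    case 3
    show ?thesis
      by (rule eqv_quotient[OF _ paths(2)])
        (use eqv_rotate[OF _ steps(2), of "[(p @ l @ z, u, v, q), (p, l, r, z @ v @ q), (p @ r @ z, v, u, q)]"] eqv_cell[OF pzq 3] in \<open>simp add: path_inv_def\<close>)
  next
    case 4
    show ?thesis
      by (rule eqv_sym, rule eqv_quotient[OF _ paths(1)])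
        (use eqv_rotate[OF _ steps(3), of "[(p, l, r, z @ u @ q), (p @ r @ z, u, v, q)]"] eqv_cell[OF pzq 4] in \<open>simp add: path_inv_def\<close>)
  qed
qed

lemma eqv_reduce2:
  assumes "reduce2 x y rs" "path c [x, y] d"
  shows "eqv c [x, y] rs d"
  using assms(1)
proof cases
  case deletion
  obtain p u v q where "x = (p, u, v, q)" by (cases x)
  then have "path c [x] (p @ v @ q)" "d = c" using assms(2) rel_words deletion by auto
  then show ?thesis using eqv_inverse[of c "[x]"] deletion by (simp add: path_inv_def)
next
  case (exchange l r u v p z q)
  have "p \<in> lists A" "z \<in> lists A" "q \<in> lists A" "rel l r" "rel u v" "c = p @ l @ z @ u @ q" "d = p @ r @ z @ v @ q"
    using assms(2) exchange(1,2) by auto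
  then show ?thesis using eqv_exchange[of p z q l r u v] exchange(1-3) by simp
qed

lemma reduce1_cong:
  assumes "reduce1 s t" "path w s w"
  shows "(s, t) \<in> cong"
proof -
  obtain a x y rs b where r: "reduce2 x y rs" "s = a @ [x, y] @ b" "t = a @ rs @ b"
    using assms(1) unfolding reduce1_def by blast
  then obtain c d where "path w a c" "path c [x, y] d" "path d b w" using assms(2) unfolding r path_append by blast
  then show ?thesis using eqv_reduce2[OF r(1)] r unfolding eqv_def by blast
qed

lemma reduces_cong: "reduce1\<^sup>*\<^sup>* s t \<Longrightarrow> path w s w \<Longrightarrow> (s, t) \<in> cong"
proof (induction rule: rtranclp_induct)
  case base
  then show ?case by (rule cong_refl)
next
  case (step t u)
  then show ?case using cong_trans reduce1_cong path_reduces by blast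
qed

text \<open>Reductions of loops at \<open>w\<close> are congruences of loops, so the fundamental
  group consists of the diagrams from \<open>w\<close> to \<open>w\<close>.\<close>

lemma cong_iff: "path w s w \<Longrightarrow> path w t w \<Longrightarrow> (s, t) \<in> cong \<longleftrightarrow> dg s = dg t"
proof
  assume st: "path w s w" "path w t w" "dg s = dg t"
  obtain r where "reduce1\<^sup>*\<^sup>* s r" "reduce1\<^sup>*\<^sup>* t r" by (rule path_common_reduct[OF st])
  then show "(s, t) \<in> cong" using reduces_cong st cong_sym cong_trans by blast
qed (rule cong_dg)

definition cls :: "'a squier_edge list \<Rightarrow> 'a squier_edge list set" where
  "cls s = cong `` {s}"

lemma cls_mult:
  assumes "path w s w" "path w t w"
  shows "cls s \<otimes>\<^bsub>diagram_group_of A R w\<^esub> cls t = cls (s @ t)"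
  unfolding diagram_group_of_eq cls_def cong_def
proof (rule word_group_mult)
  show "s @ t \<in> loops (squier_complex A R) w"
    if "s \<in> loops (squier_complex A R) w" "t \<in> loops (squier_complex A R) w" for s t
    using that unfolding loops_iff path_append by blast
  show "[] \<in> loops (squier_complex A R) w" "s \<in> loops (squier_complex A R) w" "t \<in> loops (squier_complex A R) w"
    using assms path_words unfolding loops_iff by auto
qed

lemma cls_carrier: "carrier (diagram_group_of A R w) = cls ` {s. path w s w}"
proof -
  have "loops (squier_complex A R) w = {s. path w s w}" using loops_iff by blast
  then show ?thesis by (auto simp: diagram_group_of_eq word_group_def quotient_def cls_def cong_def)
qed

lemma cls_eq_iff: "path w s w \<Longrightarrow> path w t w \<Longrightarrow> cls s = cls t \<longleftrightarrow> dg s = dg t"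
  using eq_equiv_class_iff[OF equiv_cong, of s t] cong_iff[of s t] by (simp add: cls_def)

definition diagram_of :: "'a squier_edge list set \<Rightarrow> 'a diagram" where
  "diagram_of z = dg (SOME s. path w s w \<and> cls s = z)"

lemma diagram_of_cls:
  assumes "path w s w"
  shows "diagram_of (cls s) = dg s"
proof -
  have "path w (SOME t. path w t w \<and> cls t = cls s) w \<and> cls (SOME t. path w t w \<and> cls t = cls s) = cls s"
    by (rule someI[of "\<lambda>t. path w t w \<and> cls t = cls s" s]) (simp add: assms)
  then show ?thesis using assms cls_eq_iff unfolding diagram_of_def by blast
qed

lemma diagram_of_bij: "bij_betw diagram_of (carrier (diagram_group_of A R w)) {g. mor w g w}"
proof (rule bij_betw_imageI)
  show "inj_on diagram_of (carrier (diagram_group_of A R w))"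
    by (auto simp: inj_on_def cls_carrier diagram_of_cls cls_eq_iff)
  show "diagram_of ` carrier (diagram_group_of A R w) = {g. mor w g w}"
    by (auto simp: cls_carrier diagram_of_cls mor_def image_iff)
qed

lemma diagram_of_mult:
  assumes "x \<in> carrier (diagram_group_of A R w)" "y \<in> carrier (diagram_group_of A R w)"
  shows "diagram_of (x \<otimes>\<^bsub>diagram_group_of A R w\<^esub> y) = diagram_of x + diagram_of y"
proof -
  obtain s t where st: "path w s w" "x = cls s" "path w t w" "y = cls t" using assms unfolding cls_carrier by blast
  then have "path w (s @ t) w" using path_append by blast
  then show ?thesis using st by (simp add: cls_mult diagram_of_cls dg_append)
qed

end

section \<open>Transfer of the decompositions to abstract groups\<close>

locale diagram_coordinates = group G + presentation A R
  for G :: "('g, 'm) monoid_scheme" (structure) and A :: "'a set" and R +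
  fixes w :: "'a list" and \<iota> :: "'g \<Rightarrow> 'a diagram"
  assumes bij: "bij_betw \<iota> (carrier G) {g. mor w g w}"
    and add: "x \<in> carrier G \<Longrightarrow> y \<in> carrier G \<Longrightarrow> \<iota> (x \<otimes> y) = \<iota> x + \<iota> y"
begin

lemma inj: "x \<in> carrier G \<Longrightarrow> y \<in> carrier G \<Longrightarrow> \<iota> x = \<iota> y \<longleftrightarrow> x = y"
  using bij by (auto simp: bij_betw_def inj_on_def)

lemma mor_iota: "x \<in> carrier G \<Longrightarrow> mor w (\<iota> x) w"
  using bij by (auto simp: bij_betw_def)

lemma iota_surj: "mor w g w \<Longrightarrow> \<exists>x\<in>carrier G. g = \<iota> x"
  using bij by (auto simp: bij_betw_def)

lemma iota_one: "\<iota> \<one> = 0"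
proof -
  have "\<iota> \<one> + \<iota> \<one> = \<iota> \<one> + 0" using add[of \<one> \<one>] by simp
  then show ?thesis unfolding add_left_cancel .
qed

lemma iota_zero: "x \<in> carrier G \<Longrightarrow> \<iota> x = 0 \<longleftrightarrow> x = \<one>"
  using inj[of x \<one>] by (simp add: iota_one)

lemma iota_inv: "x \<in> carrier G \<Longrightarrow> \<iota> (inv x) = - \<iota> x"
  using add[of x "inv x"] by (simp add: iota_one eq_neg_iff_add_eq_0 neg_eq_iff_add_eq_0[symmetric])

lemma iota_commute: "x \<in> carrier G \<Longrightarrow> y \<in> carrier G \<Longrightarrow> \<iota> x + \<iota> y = \<iota> y + \<iota> x \<longleftrightarrow> x \<otimes> y = y \<otimes> x"
  using inj[of "x \<otimes> y" "y \<otimes> x"] by (simp add: add)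

lemma iota_cnj: "t \<in> carrier G \<Longrightarrow> x \<in> carrier G \<Longrightarrow> \<iota> (t \<otimes> x \<otimes> inv t) = cnj (\<iota> t) (\<iota> x)"
  by (simp add: add iota_inv cnj_def del: add_uminus_conv_diff)

definition U where "U g = {x \<in> carrier G. \<iota> x \<in> Uset w (\<iota> g)}"
definition C where "C g = {x \<in> carrier G. \<iota> x \<in> Cset w (\<iota> g)}"
definition E where "E g = {x \<in> carrier G. \<iota> x \<in> Eset w (\<iota> g)}"

lemma subgroup_preimage:
  assumes "0 \<in> H" "\<And>x y. x \<in> H \<Longrightarrow> y \<in> H \<Longrightarrow> x + y \<in> H" "\<And>x. x \<in> H \<Longrightarrow> - x \<in> H"
  shows "subgroup {x \<in> carrier G. \<iota> x \<in> H} G"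
  by (rule subgroupI) (use assms in \<open>auto simp: add iota_inv iota_one intro!: exI[of _ \<one>]\<close>)

lemma half: "half G U C E"
proof (intro half.intro half_axioms.intro group_axioms)
  fix g assume g: "g \<in> carrier G" "g \<noteq> \<one>"
  have m: "mor w (\<iota> g) w" "\<iota> g \<noteq> 0" using g mor_iota iota_zero by auto
  show "subgroup (U g) G" unfolding U_def by (rule subgroup_preimage) (use Uset_group[OF m] in blast)+
  show "subgroup (C g) G" unfolding C_def by (rule subgroup_preimage) (use Cset_group[OF m] in blast)+
  show "u \<otimes> y = y \<otimes> u" if "u \<in> U g" "y \<in> C g" for u y
    using that Uset_Cset_commute[OF m, of "\<iota> u" "\<iota> y"] iota_commute[of u y] by (auto simp: U_def C_def)
  show "x = \<one>" if "x \<in> U g" "x \<in> C g" for x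
    using that Uset_Cset_disjoint[OF m, of "\<iota> x"] iota_zero[of x] by (auto simp: U_def C_def)
  show "g \<in> C g" "g \<notin> E g" using self_Cset[OF m] self_Eset[OF m] g by (auto simp: C_def E_def)
  show "x \<in> C g" if "x \<in> E g" for x using that Eset_Cset[OF m, of "\<iota> x"] by (auto simp: C_def E_def)
  show "x \<otimes> y \<in> E g" if "x \<in> E g" "y \<in> E g" "x \<otimes> y = y \<otimes> x" for x y
    using that Eset_add[OF m, of "\<iota> x" "\<iota> y"] iota_commute[of x y] by (auto simp: E_def add)
  show "inv x \<in> E g" if "x \<in> E g" for x using that Eset_minus[OF m, of "\<iota> x"] by (auto simp: E_def iota_inv)
  show "x \<otimes> y \<otimes> inv x \<otimes> inv y \<in> E g" if "x \<in> C g" "y \<in> C g" for x y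
    using that Eset_commutator[OF m, of "\<iota> x" "\<iota> y"] by (auto simp: E_def C_def add iota_inv)
  show "U x = U g" if "x \<in> C g" "x \<notin> E g" for x
    using that Uset_hyperbolic[OF m, of "\<iota> x"] by (auto simp: E_def C_def U_def)
  show "g \<notin> C x" if "x \<in> E g" "x \<noteq> \<one>" for x
    using that Eset_separates[OF m, of "\<iota> x"] iota_zero[of x] by (auto simp: E_def C_def)
  show "\<exists>u\<in>U g. \<exists>y\<in>C g. x = u \<otimes> y" if x: "x \<in> carrier G" "x \<otimes> g = g \<otimes> x" for x
  proof -
    obtain u y where uy: "u \<in> Uset w (\<iota> g)" "y \<in> Cset w (\<iota> g)" "\<iota> x = u + y"
      using decompose[OF m mor_iota[OF x(1)]] iota_commute[OF x(1) g(1)] x(2) by blast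
    obtain u' where u': "u' \<in> carrier G" "u = \<iota> u'" using iota_surj[OF set_mor(1)[OF m uy(1)]] by blast
    obtain y' where y': "y' \<in> carrier G" "y = \<iota> y'" using iota_surj[OF set_mor(2)[OF m uy(2)]] by blast
    have "x = u' \<otimes> y'" using uy(3) u' y' x inj[of x "u' \<otimes> y'"] by (simp add: add)
    then show ?thesis using uy u' y' by (auto simp: U_def C_def)
  qed
  fix t x assume t: "t \<in> carrier G"
  show "t \<otimes> x \<otimes> inv t \<in> U (t \<otimes> g \<otimes> inv t)" if "x \<in> U g"
    using that Uset_cnj[OF m mor_iota[OF t], of "\<iota> x"] t g by (simp add: U_def iota_cnj)
  show "t \<otimes> x \<otimes> inv t \<in> C (t \<otimes> g \<otimes> inv t)" if "x \<in> C g"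
    using that Cset_cnj[OF m mor_iota[OF t], of "\<iota> x"] t g by (simp add: C_def iota_cnj)
qed

lemma mirror_coordinates: "diagram_coordinates G A (mirror_rel R) (rev w) (\<lambda>x. mirror (\<iota> x))"
proof -
  interpret M: presentation A "mirror_rel R" by (rule mirror_presentation)
  show ?thesis
  proof
    have "bij_betw mirror {g. mor w g w} {g. M.mor (rev w) g (rev w)}"
    proof (rule bij_betw_byWitness[where f' = mirror])
      show "mirror ` {g. mor w g w} \<subseteq> {g. M.mor (rev w) g (rev w)}" using mirror_mor_iff by blast
      show "mirror ` {g. M.mor (rev w) g (rev w)} \<subseteq> {g. mor w g w}"
        using mirror_mor_iff[of w _ w] by (metis (mono_tags, lifting) image_subsetI mem_Collect_eq mirror_mirror)
    qed simp_all
    from bij_betw_trans[OF bij this] show "bij_betw (\<lambda>x. mirror (\<iota> x)) (carrier G) {g. M.mor (rev w) g (rev w)}"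
      by (simp add: comp_def)
  qed (simp add: add mirror_add)
qed

text \<open>The right half is the left half for the mirrored presentation. Each link is used for
  both presentations, since mirroring twice changes nothing.\<close>

lemma lr_exists: "\<exists>UL CL EL UR CR ER. lr G UL CL EL UR CR ER"
proof -
  interpret M: diagram_coordinates G A "mirror_rel R" "rev w" "\<lambda>x. mirror (\<iota> x)" by (rule mirror_coordinates)
  have "lr G U C E M.U M.C M.E"
  proof (intro lr.intro half M.half lr_axioms.intro)
    fix g assume g: "g \<in> carrier G" "g \<noteq> \<one>"
    have m: "mor w (\<iota> g) w" "\<iota> g \<noteq> 0" using g mor_iota iota_zero by auto
    have mm: "M.mor (rev w) (mirror (\<iota> g)) (rev w)" "mirror (\<iota> g) \<noteq> 0" using g M.mor_iota M.iota_zero by auto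
    show "x \<in> M.C g" if "x \<in> U g" for x
      using that Uset_mCset[OF m, of "\<iota> x"] by (simp add: U_def M.C_def)
    show "x \<in> C g" if "x \<in> M.U g" for x
      using that M.Uset_mCset[OF mm, of "mirror (\<iota> x)"] by (simp add: M.U_def C_def)
    show "g \<in> M.U u" if "u \<in> U g" "u \<noteq> \<one>" for u
      using that Uset_mUset[OF m, of "\<iota> u"] iota_zero[of u] g by (simp add: U_def M.U_def)
    show "g \<in> U u" if "u \<in> M.U g" "u \<noteq> \<one>" for u
      using that M.Uset_mUset[OF mm, of "mirror (\<iota> u)"] M.iota_zero[of u] g by (simp add: U_def M.U_def)
  qed
  then show ?thesis by blast
qed

end

theorem diagram_group_lr:
  assumes "diagram_group TYPE('a) G"
  shows "\<exists>UL CL EL UR CR ER. lr G UL CL EL UR CR ER"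
proof -
  obtain A :: "'a set" and R w where ARw: "semigroup_presentation A R" "w \<in> nonempty_words A" and iso: "G \<cong> diagram_group_of A R w"
    and G: "group G"
    using assms unfolding diagram_group_def by blast
  interpret base_point A R w by unfold_locales (rule ARw)+
  obtain \<phi> where \<phi>: "\<phi> \<in> iso G (diagram_group_of A R w)" using iso unfolding is_iso_def by blast
  have \<phi>_bij: "bij_betw \<phi> (carrier G) (carrier (diagram_group_of A R w))" using \<phi> by (simp add: iso_def)
  interpret G: group G by (rule G)
  interpret diagram_coordinates G A R w "\<lambda>x. diagram_of (\<phi> x)"
  proof
    show "bij_betw (\<lambda>x. diagram_of (\<phi> x)) (carrier G) {g. mor w g w}"
      using bij_betw_trans[OF \<phi>_bij diagram_of_bij] by (simp add: comp_def)
    fix x y assume "x \<in> carrier G" "y \<in> carrier G"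
    then show "diagram_of (\<phi> (x \<otimes>\<^bsub>G\<^esub> y)) = diagram_of (\<phi> x) + diagram_of (\<phi> y)"
      using \<phi> diagram_of_mult[of "\<phi> x" "\<phi> y"] by (auto simp: iso_def hom_def)
  qed
  show ?thesis by (rule lr_exists)
qed

theorem xyyx_not_diagram_group: "\<not> diagram_group TYPE('a) xyyx_group"
proof
  interpret xyyx xyyx_group by unfold_locales (rule refl)
  assume "diagram_group TYPE('a) xyyx_group"
  from diagram_group_lr[OF this] obtain UL CL EL UR CR ER where "lr xyyx_group UL CL EL UR CR ER" by (elim exE)
  then show False using not_lr by (rule notE[rotated])
qed


section \<open>A partially commutative group\<close>

text \<open>
  The generator \<open>(True, n)\<close> is written \<open>\<alpha>\<^sub>n\<close> and \<open>(False, n)\<close> is written \<open>\<beta>\<^sub>n\<close>. All pairs of generators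
  commute except \<open>\<alpha>\<^sub>m\<close> and \<open>\<beta>\<^sub>n\<close> for \<open>m \<le> n\<close>.
\<close>

definition comm :: "bool \<times> int \<Rightarrow> bool \<times> int \<Rightarrow> bool" where
  "comm c d \<longleftrightarrow> c \<noteq> d \<and> (fst c = fst d \<or> (if fst c then snd d < snd c else snd c < snd d))"

definition commute_rules :: "((bool \<times> int) \<times> bool) list rel" where
  "commute_rules = {([c, flip c], []) | c. True} \<union> {([c, d], [d, c]) | c d. comm (fst c) (fst d)}"

definition sim :: "((bool \<times> int) \<times> bool) list \<Rightarrow> ((bool \<times> int) \<times> bool) list \<Rightarrow> bool" (infix "\<approx>" 50) where
  "s \<approx> t \<longleftrightarrow> (s, t) \<in> word_cong UNIV commute_rules"

lemma fst_flip [simp]: "fst (flip c) = fst c" "snd (flip c) = (\<not> snd c)"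
  by (cases c; simp)+

lemma comm_sym: "comm c d \<Longrightarrow> comm d c"
  by (auto simp: comm_def split: if_splits)

lemma sim_refl [simp]: "s \<approx> s"
  and sim_sym: "s \<approx> t \<Longrightarrow> t \<approx> s"
  and sim_trans [trans]: "s \<approx> t \<Longrightarrow> t \<approx> u \<Longrightarrow> s \<approx> u"
  using equiv_word_cong[of UNIV commute_rules] unfolding sim_def equiv_def
  by (auto dest: refl_onD symD transD)

lemma sim_context: "s \<approx> t \<Longrightarrow> a @ s @ b \<approx> a @ t @ b"
  unfolding sim_def by (rule word_cong_context) auto

lemma sim_append: "s \<approx> s' \<Longrightarrow> t \<approx> t' \<Longrightarrow> s @ t \<approx> s' @ t'"
  using sim_trans[of "s @ t" "s' @ t" "s' @ t'"] sim_context[of s s' "[]" t] sim_context[of t t' s' "[]"] by simp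

lemma sim_rule: "(l, r) \<in> commute_rules \<Longrightarrow> l \<approx> r"
  using replace_step_word_cong[of l r commute_rules "[]" "[]" UNIV r] sim_refl[of r] unfolding sim_def by simp

lemma sim_invariant:
  assumes f: "\<And>s t l r. (l, r) \<in> commute_rules \<Longrightarrow> f (s @ l @ t) = f (s @ r @ t)" and st: "s \<approx> t"
  shows "f s = f t"
proof -
  have "equivclp (replace_step UNIV commute_rules) s t" using st by (simp add: sim_def word_cong_def)
  moreover have *: "f u = f v" if "replace_step UNIV commute_rules u v" for u v
    using that f unfolding replace_step_def by fastforce
  ultimately show ?thesis
  proof (induction rule: equivclp_induct)
    case (step u v)
    then show ?case using *[of u v] *[of v u] by auto
  qed simp
qed

lemma sim_flip: "[c, flip c] \<approx> []"
  by (rule sim_rule) (unfold commute_rules_def, blast)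

lemma sim_flip': "[flip c, c] \<approx> []"
  using sim_flip[of "flip c"] by simp

lemma sim_comm: "comm (fst c) (fst d) \<Longrightarrow> [c, d] \<approx> [d, c]"
  by (rule sim_rule) (unfold commute_rules_def, blast)

abbreviation commutes :: "(bool \<times> int) \<times> bool \<Rightarrow> (bool \<times> int) \<times> bool \<Rightarrow> bool" where
  "commutes c d \<equiv> fst c = fst d \<or> comm (fst c) (fst d)"

lemma sim_commutes: "commutes c d \<Longrightarrow> [c, d] \<approx> [d, c]"
proof (elim disjE)
  assume "fst c = fst d"
  then have "c = d \<or> d = flip c" by (cases c; cases d) auto
  moreover have "[c, flip c] \<approx> [flip c, c]" by (rule sim_trans[OF sim_flip sim_sym[OF sim_flip']])
  ultimately show "[c, d] \<approx> [d, c]" by (elim disjE) (simp_all only: sim_refl)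
qed (rule sim_comm)

lemma sim_commute_words:
  assumes "\<And>c d. c \<in> set s \<Longrightarrow> d \<in> set t \<Longrightarrow> commutes c d"
  shows "s @ t \<approx> t @ s"
proof -
  have one: "[c] @ t \<approx> t @ [c]" if "\<And>d. d \<in> set t \<Longrightarrow> commutes c d" for c t
    using that
  proof (induction t)
    case (Cons d t)
    have "[] @ [c, d] @ t \<approx> [] @ [d, c] @ t" by (rule sim_context) (rule sim_commutes, use Cons.prems in simp)
    also have "[] @ [d, c] @ t \<approx> [d] @ t @ [c]" using sim_context[OF Cons.IH, of "[d]" "[]"] Cons.prems by simp
    finally show ?case by simp
  qed simp
  show ?thesis using assms
  proof (induction s)
    case (Cons c s)
    have "[c] @ (s @ t) @ [] \<approx> [c] @ (t @ s) @ []" by (rule sim_context) (use Cons in simp)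
    also have "[c] @ (t @ s) @ [] \<approx> (t @ [c]) @ s" using sim_context[OF one[of t c], of "[]" s] Cons.prems by simp
    finally show ?case by simp
  qed simp
qed

definition winv :: "('c \<times> bool) list \<Rightarrow> ('c \<times> bool) list" where
  "winv s = rev (map flip s)"

lemma winv_winv [simp]: "winv (winv s) = s"
  by (simp add: winv_def rev_map comp_def)

lemma sim_winv: "s @ winv s \<approx> []"
proof (induction s)
  case (Cons c s)
  have "[c] @ (s @ winv s) @ [flip c] \<approx> [c] @ [] @ [flip c]" by (rule sim_context) (rule Cons)
  also have "[c] @ [] @ [flip c] \<approx> []" using sim_flip by simp
  finally show ?case by (simp add: winv_def)
qed (simp add: winv_def)

lemma sim_winv': "winv s @ s \<approx> []"
  using sim_winv[of "winv s"] by simp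

lemma sim_cancel: "u @ s \<approx> u @ t \<Longrightarrow> s \<approx> t"
proof -
  assume "u @ s \<approx> u @ t"
  have "[] @ s \<approx> (winv u @ u) @ s" by (rule sim_append[OF sim_sym[OF sim_winv'] sim_refl])
  also have "(winv u @ u) @ s \<approx> (winv u @ u) @ t" using sim_context[OF \<open>u @ s \<approx> u @ t\<close>, of "winv u" "[]"] by simp
  also have "(winv u @ u) @ t \<approx> [] @ t" by (rule sim_append[OF sim_winv' sim_refl])
  finally show "s \<approx> t" by simp
qed

text \<open>Deleting generators respects the relations of a partially commutative group. The proof
  works with congruence classes because \<open>sim_invariant\<close> is about functions.\<close>

lemma sim_filter:
  assumes "s \<approx> t"
  shows "filter (\<lambda>c. P (fst c)) s \<approx> filter (\<lambda>c. P (fst c)) t"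
proof -
  let ?f = "\<lambda>s. {u. u \<approx> filter (\<lambda>c. P (fst c)) s}"
  have "?f s = ?f t" using assms
  proof (rule sim_invariant[rotated])
    fix s t l r assume lr: "(l, r) \<in> commute_rules"
    then have "filter (\<lambda>c. P (fst c)) l \<approx> filter (\<lambda>c. P (fst c)) r"
      unfolding commute_rules_def using sim_flip sim_comm by auto
    then have "filter (\<lambda>c. P (fst c)) (s @ l @ t) \<approx> filter (\<lambda>c. P (fst c)) (s @ r @ t)"
      using sim_context by simp
    then show "?f (s @ l @ t) = ?f (s @ r @ t)" using sim_trans sim_sym by blast
  qed
  moreover have "filter (\<lambda>c. P (fst c)) s \<in> ?f s" by simp
  ultimately show ?thesis by blast
qed

definition expo :: "'c \<Rightarrow> ('c \<times> bool) list \<Rightarrow> int" where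
  "expo g s = (\<Sum>c\<leftarrow>s. if fst c = g then if snd c then 1 else - 1 else 0)"

lemma expo_simps [simp]: "expo g [] = 0" "expo g (s @ t) = expo g s + expo g t"
  "expo g (c # s) = (if fst c = g then if snd c then 1 else - 1 else 0) + expo g s"
  by (simp_all add: expo_def)

lemma expo_sim: "s \<approx> t \<Longrightarrow> expo g s = expo g t"
  by (rule sim_invariant[of "expo g"]) (auto simp: commute_rules_def)

lemma expo_filter: "expo g (filter (\<lambda>c. P (fst c)) s) = (if P g then expo g s else 0)"
  by (induction s) auto

lemma expo_notin: "g \<notin> fst ` set s \<Longrightarrow> expo g s = 0"
  by (induction s) auto

lemma expo_flip_notin: "flip c \<notin> set s \<Longrightarrow> if snd c then expo (fst c) s \<ge> 0 else expo (fst c) s \<le> 0"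
proof (induction s)
  case (Cons d s)
  have "fst d = fst c \<Longrightarrow> snd d = snd c" using Cons.prems by (cases c; cases d) auto
  then show ?case using Cons by (auto split: if_splits)
qed simp

text \<open>As the exponents vanish, each first letter has its inverse further back and can be moved
  there.\<close>

lemma sim_abelian:
  assumes "\<And>c d. c \<in> set s \<Longrightarrow> d \<in> set s \<Longrightarrow> commutes c d" "\<And>g. expo g s = 0"
  shows "s \<approx> []"
  using assms
proof (induction "length s" arbitrary: s rule: less_induct)
  case less
  show ?case
  proof (cases s)
    case (Cons c s')
    have "flip c \<in> set s'"
    proof (rule ccontr)
      assume "flip c \<notin> set s'"
      from expo_flip_notin[OF this] less.prems(2)[of "fst c"] show False unfolding Cons by (auto split: if_splits)
    qed
    then obtain s1 s2 where s': "s' = s1 @ flip c # s2" by (meson split_list)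
    have "([c] @ s1) @ (flip c # s2) \<approx> (s1 @ [c]) @ (flip c # s2)"
      by (rule sim_append[OF sim_commute_words sim_refl]) (use less.prems(1) Cons s' in auto)
    also have "(s1 @ [c]) @ (flip c # s2) \<approx> s1 @ [] @ s2" using sim_context[OF sim_flip[of c], of s1 s2] by simp
    also have "s1 @ [] @ s2 \<approx> []"
    proof (rule less.hyps)
      show "length (s1 @ [] @ s2) < length s" by (simp add: Cons s')
      show "commutes c d" if "c \<in> set (s1 @ [] @ s2)" "d \<in> set (s1 @ [] @ s2)" for c d
        using less.prems(1)[of c d] that by (auto simp: Cons s')
      show "expo g (s1 @ [] @ s2) = 0" for g using less.prems(2)[of g] by (auto simp: Cons s' split: if_splits)
    qed
    finally show ?thesis by (simp add: Cons s')
  qed simp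
qed

lemma free_red_opposite: "free_red [(c, s), (c, \<not> s)] = []"
  by (simp add: free_red_def)

context
  fixes n :: int
begin

text \<open>
  The group is an HNN extension with stable letter \<open>\<beta>\<^sub>n\<^sub>-\<^sub>2\<close> which centralizes the generators of its link;
  \<open>route\<close> is the walk of a word in the Bass-Serre tree.
\<close>

definition link :: "(bool \<times> int) \<times> bool \<Rightarrow> bool" where
  "link c \<longleftrightarrow> comm (False, n - 2) (fst c)"

definition link_coset :: "((bool \<times> int) \<times> bool) list \<Rightarrow> ((bool \<times> int) \<times> bool) list set" where
  "link_coset g = {t. \<exists>h. (\<forall>c\<in>set h. link c) \<and> t \<approx> g @ h}"

text \<open>Only the stable letter crosses an edge. Read backwards, it is named by the coset at its
  end.\<close>

definition route_label :: "((bool \<times> int) \<times> bool) list \<Rightarrow> (bool \<times> int) \<times> bool \<Rightarrow> (((bool \<times> int) \<times> bool) list set \<times> bool) list" where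
  "route_label g c = (if fst c = (False, n - 2) then if snd c then [(link_coset g, True)] else [(link_coset (g @ [c]), False)] else [])"

fun route :: "((bool \<times> int) \<times> bool) list \<Rightarrow> ((bool \<times> int) \<times> bool) list \<Rightarrow> (((bool \<times> int) \<times> bool) list set \<times> bool) list" where
  "route g [] = []"
| "route g (c # s) = route_label g c @ route (g @ [c]) s"

lemma route_append: "route g (s @ t) = route g s @ route (g @ s) t"
  by (induction s arbitrary: g) simp_all

lemma link_coset_sim: "g \<approx> g' \<Longrightarrow> link_coset g = link_coset g'"
  unfolding link_coset_def using sim_trans sim_sym sim_append[OF _ sim_refl] by blast

lemma link_coset_link:
  assumes "link d"
  shows "link_coset (g @ [d]) = link_coset g"
proof (intro equalityI subsetI)
  fix t assume "t \<in> link_coset (g @ [d])"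
  then obtain h where "\<forall>c\<in>set h. link c" "t \<approx> g @ (d # h)" by (auto simp: link_coset_def)
  then show "t \<in> link_coset g" using assms unfolding link_coset_def by (intro CollectI exI[of _ "d # h"]) simp
next
  fix t assume "t \<in> link_coset g"
  then obtain h where h: "\<forall>c\<in>set h. link c" "t \<approx> g @ h" by (auto simp: link_coset_def)
  have "g @ [] @ h \<approx> g @ [d, flip d] @ h" by (rule sim_context) (rule sim_sym[OF sim_flip])
  then have "t \<approx> (g @ [d]) @ (flip d # h)" using sim_trans[OF h(2)] by simp
  then show "t \<in> link_coset (g @ [d])" using assms h(1) unfolding link_coset_def
    by (intro CollectI exI[of _ "flip d # h"]) (simp add: link_def)
qed

lemma link_coset_eqD: "link_coset g = link_coset g' \<Longrightarrow> \<exists>h. (\<forall>c\<in>set h. link c) \<and> g' \<approx> g @ h"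
proof -
  assume "link_coset g = link_coset g'"
  moreover have "g' \<in> link_coset g'" unfolding link_coset_def by (intro CollectI exI[of _ "[]"]) simp
  ultimately have "g' \<in> link_coset g" by simp
  then show ?thesis unfolding link_coset_def by (rule CollectD)
qed

lemma route_prefix: "g \<approx> g' \<Longrightarrow> route g s = route g' s"
proof (induction s arbitrary: g g')
  case (Cons c s)
  have "g @ [c] \<approx> g' @ [c]" by (rule sim_append[OF Cons.prems sim_refl])
  then show ?case using Cons link_coset_sim by (simp add: route_label_def)
qed simp

lemma route_rules:
  assumes "(l, r) \<in> commute_rules"
  shows "free_red (route g l) = free_red (route g r)"
proof -
  consider c where "l = [c, flip c]" "r = []" | c d where "l = [c, d]" "r = [d, c]" "comm (fst c) (fst d)"
    using assms unfolding commute_rules_def by blast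
  then show ?thesis
  proof cases
    case (1 c)
    have "g @ [c, flip c] @ [] \<approx> g @ [] @ []" by (rule sim_context) (rule sim_flip)
    then have "link_coset (g @ [c, flip c]) = link_coset g" using link_coset_sim by simp
    then show ?thesis using 1 by (auto simp: route_label_def free_red_opposite[of _ True, simplified] free_red_opposite[of _ False, simplified] free_red_def[of "[]"])
  next
    case (2 c d)
    have *: "route g [c, d] = route g [d, c]" if "comm (fst c) (fst d)" "fst c = (False, n - 2)" for c d
    proof -
      have d: "link d" "fst d \<noteq> (False, n - 2)" using that by (auto simp: link_def comm_def)
      have "g @ [d, c] @ [] \<approx> g @ [c, d] @ []" by (rule sim_context) (rule sim_comm[OF comm_sym[OF that(1)]])
      then have "link_coset (g @ [d, c]) = link_coset ((g @ [c]) @ [d])" using link_coset_sim by simp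
      then have "link_coset (g @ [d, c]) = link_coset (g @ [c])" using link_coset_link[OF d(1), of "g @ [c]"] by simp
      then show ?thesis using that d link_coset_link[OF d(1), of g] by (simp add: route_label_def)
    qed
    show ?thesis
    proof (cases "fst c = (False, n - 2) \<or> fst d = (False, n - 2)")
      case True
      then have "route g [c, d] = route g [d, c]" using *[OF 2(3)] *[OF comm_sym[OF 2(3)], symmetric] by blast
      then show ?thesis by (simp only: 2(1,2))
    next
      case False
      then show ?thesis using 2 by (simp add: route_label_def)
    qed
  qed
qed

lemma route_sim: "s \<approx> t \<Longrightarrow> free_red (route g s) = free_red (route g t)"
proof (rule sim_invariant[of "\<lambda>s. free_red (route g s)"])
  fix s t l r assume lr: "(l, r) \<in> commute_rules"
  have "g @ s @ l \<approx> g @ s @ r" using sim_context[OF sim_rule[OF lr], of "g @ s" "[]"] by simp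
  then have "route (g @ s @ l) t = route (g @ s @ r) t" by (rule route_prefix)
  then show "free_red (route g (s @ l @ t)) = free_red (route g (s @ r @ t))"
    using route_rules[OF lr, of "g @ s"] unfolding route_append by (intro free_red_append_cong) simp_all
qed

end

text \<open>The elements \<open>a\<^sub>k = \<alpha>\<^sub>k \<beta>\<^sub>k\<^sub>-\<^sub>2\<close> generate a copy of the kernel of the map from \<open>\<langle>x, y\<rangle>\<close> to \<open>\<int>\<close> sending \<open>x\<close> to 1 and \<open>y\<close> to \<open>-1\<close>.\<close>

fun img :: "int \<times> bool \<Rightarrow> ((bool \<times> int) \<times> bool) list" where
  "img (k, True) = [((True, k), True), ((False, k - 2), True)]"
| "img (k, False) = [((False, k - 2), False), ((True, k), False)]"

definition image :: "(int \<times> bool) list \<Rightarrow> ((bool \<times> int) \<times> bool) list" where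
  "image W = concat (map img W)"

lemma image_simps [simp]: "image [] = []" "image (c # W) = img c @ image W" "image (V @ W) = image V @ image W"
  by (simp_all add: image_def)

lemma img_flip: "winv (img c) = img (flip c)"
  by (cases c rule: img.cases) (simp_all add: winv_def)

lemma fst_img: "d \<in> set (img c) \<Longrightarrow> fst d = (True, fst c) \<or> fst d = (False, fst c - 2)"
  by (cases c rule: img.cases) auto

lemma fst_image: "d \<in> set (image W) \<Longrightarrow> \<exists>k\<in>fst ` set W. fst d = (True, k) \<or> fst d = (False, k - 2)"
proof -
  assume "d \<in> set (image W)"
  then obtain c where "c \<in> set W" "d \<in> set (img c)" by (auto simp: image_def)
  then show ?thesis using fst_img by blast
qed

lemma expo_image: "expo (True, m) (image W) = expo m W" "expo (False, m) (image W) = expo (m + 2) W"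
proof -
  have "expo (True, m) (img c) = expo m [c]" "expo (False, m) (img c) = expo (m + 2) [c]" for c
    by (cases c rule: img.cases; auto)+
  then show "expo (True, m) (image W) = expo m W" "expo (False, m) (image W) = expo (m + 2) W"
    by (induction W) auto
qed

lemma route_img_other: "fst c \<noteq> n \<Longrightarrow> route n g (img c) = []"
  by (cases c rule: img.cases) (auto simp: route_label_def)

lemma route_img: "route n g (img (n, True)) = [(link_coset n (g @ [((True, n), True)]), True)]"
  "route n g (img (n, False)) = [(link_coset n (g @ [((False, n - 2), False)]), False)]"
  by (auto simp: route_label_def)

lemma route_img_snd: "fst c = n \<Longrightarrow> route n g (img c) = [z] \<Longrightarrow> snd z = snd c"
  by (cases c; cases "snd c") (auto simp: route_img simp del: route.simps img.simps)

lemma route_first: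
  "route n g (image W) = y # b \<Longrightarrow> \<exists>U c V. W = U @ c # V \<and> n \<notin> fst ` set U \<and> fst c = n \<and> route n (g @ image U) (img c) = [y]"
proof (induction W arbitrary: g)
  case (Cons c W)
  show ?case
  proof (cases "fst c = n")
    case True
    then have "\<exists>z. route n g (img c) = [z]" using route_img by (cases c; cases "snd c") auto
    then have "route n (g @ image []) (img c) = [y]" using Cons.prems by (auto simp: route_append)
    then show ?thesis using True by (intro exI[of _ "[]"] exI[of _ c] exI[of _ W]) simp
  next
    case False
    then have "route n (g @ img c) (image W) = y # b" using Cons.prems by (simp add: route_append route_img_other)
    from Cons.IH[OF this] obtain U d V where "W = U @ d # V" "n \<notin> fst ` set U" "fst d = n"
      "route n ((g @ img c) @ image U) (img d) = [y]" by blast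
    then show ?thesis using False by (intro exI[of _ "c # U"] exI[of _ d] exI[of _ V]) auto
  qed
qed simp

lemma route_adjacent:
  "route n g (image W) = a @ x # y # b \<Longrightarrow> \<exists>W0 c U d V. W = W0 @ c # U @ d # V \<and> n \<notin> fst ` set U \<and> fst c = n \<and> fst d = n \<and>
     route n (g @ image W0) (img c) = [x] \<and> route n (g @ image (W0 @ c # U)) (img d) = [y]"
proof (induction W arbitrary: g a)
  case (Cons c W)
  have shift: ?case if "route n (g @ img c) (image W) = a' @ x # y # b" for a'
  proof -
    from Cons.IH[OF that] obtain W0 c' U d V where "W = W0 @ c' # U @ d # V" "n \<notin> fst ` set U" "fst c' = n" "fst d = n"
      "route n ((g @ img c) @ image W0) (img c') = [x]" "route n ((g @ img c) @ image (W0 @ c' # U)) (img d) = [y]" by blast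
    then show ?thesis by (intro exI[of _ "c # W0"] exI[of _ c'] exI[of _ U] exI[of _ d] exI[of _ V]) simp
  qed
  show ?case
  proof (cases "fst c = n")
    case False
    then have "route n (g @ img c) (image W) = a @ x # y # b" using Cons.prems by (simp add: route_append route_img_other)
    then show ?thesis by (rule shift)
  next
    case True
    then have "\<exists>z. route n g (img c) = [z]" using route_img by (cases c; cases "snd c") auto
    then obtain z where z: "route n g (img c) = [z]" by blast
    then have zW: "z # route n (g @ img c) (image W) = a @ x # y # b" using Cons.prems by (simp add: route_append)
    show ?thesis
    proof (cases a)
      case Nil
      then have "route n (g @ img c) (image W) = y # b" "z = x" using zW by auto
      from route_first[OF this(1)] obtain U d V where "W = U @ d # V" "n \<notin> fst ` set U" "fst d = n"
        "route n ((g @ img c) @ image U) (img d) = [y]" by blast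
      then show ?thesis using True z \<open>z = x\<close>
        by (intro exI[of _ "[]"] exI[of _ c] exI[of _ U] exI[of _ d] exI[of _ V]) simp
    next
      case (Cons z' a')
      then show ?thesis using zW shift by simp
    qed
  qed
qed simp

text \<open>Britton's lemma: the route of a trivial word is not reduced, so two crossings that
  cancel follow each other. Each of them comes from a letter with index n.\<close>

lemma pinch:
  assumes triv: "image W \<approx> []" and n: "n \<in> fst ` set W"
  obtains W0 s U V h where "W = W0 @ (n, s) # U @ (n, \<not> s) # V" "n \<notin> fst ` set U" "\<forall>c\<in>set h. link n c" "image U \<approx> h"
proof -
  have "free_red (route n [] (image W)) = []" using route_sim[OF triv, of n "[]"] by (simp add: free_red_def)
  moreover have "route n [] (image W) \<noteq> []"
  proof -
    obtain W0 c V where W: "W = W0 @ c # V" "fst c = n" using n by (metis imageE split_list)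
    have "route n (image W0) (img c) \<noteq> []" using W(2) route_img by (cases c; cases "snd c") auto
    then show ?thesis by (simp add: W(1) route_append)
  qed
  ultimately have "\<not> freely_reduced (route n [] (image W))" using free_red_reduced by force
  then obtain a x b where "route n [] (image W) = a @ [x, flip x] @ b" by (rule not_freely_reducedE)
  then obtain W0 c U d V where W: "W = W0 @ c # U @ d # V" "n \<notin> fst ` set U" "fst c = n" "fst d = n"
     "route n (image W0) (img c) = [x]" "route n (image (W0 @ c # U)) (img d) = [flip x]"
    using route_adjacent[of n "[]" W a x "flip x" b] by auto
  obtain s where c: "c = (n, s)" using W(3) by (cases c) auto
  have "snd x = s" "snd (flip x) = snd d" using route_img_snd[OF W(3,5)] route_img_snd[OF W(4,6)] c by simp_all
  then have d': "d = (n, \<not> s)" using W(4) by (cases d) auto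
  let ?a = "((True, n), True)" and ?v = "((False, n - 2), True)"
  have "\<exists>h. (\<forall>c\<in>set h. link n c) \<and> image U \<approx> h \<and> d = (n, \<not> s)"
  proof (cases s)
    case True
    have d: "d = (n, False)" using d' True by simp
    have eq: "link_coset n (image W0 @ [?a]) = link_coset n (image (W0 @ c # U) @ [flip ?v])"
      using W(5,6) route_img(1)[of n "image W0"] route_img(2)[of n "image (W0 @ c # U)"] by (cases x) (simp add: c True d del: route.simps img.simps image_simps)
    obtain h where h: "\<forall>c\<in>set h. link n c" "image (W0 @ c # U) @ [flip ?v] \<approx> (image W0 @ [?a]) @ h"
      using link_coset_eqD[OF eq] by blast
    then have "(image W0 @ [?a]) @ (?v # image U @ [flip ?v]) \<approx> (image W0 @ [?a]) @ h" by (simp add: c True)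
    then have 1: "?v # image U @ [flip ?v] \<approx> h" by (rule sim_cancel)
    have "[?v] @ (image U @ []) \<approx> [?v] @ (image U @ [flip ?v, ?v])"
      using sim_context[OF sim_sym[OF sim_flip'[of ?v]], of "?v # image U" "[]"] by simp
    also have "[?v] @ (image U @ [flip ?v, ?v]) \<approx> h @ [?v]" using sim_append[OF 1 sim_refl[of "[?v]"]] by simp
    also have "h @ [?v] \<approx> [?v] @ h"
      by (rule sim_commute_words) (use h(1) in \<open>auto simp: link_def intro: comm_sym\<close>)
    finally have "image U \<approx> h" using sim_cancel[of "[?v]"] by simp
    then show ?thesis using h(1) d True by blast
  next
    case False
    have d: "d = (n, True)" using d' False by simp
    have eq: "link_coset n (image W0 @ [flip ?v]) = link_coset n (image (W0 @ c # U) @ [?a])"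
      using W(5,6) route_img(2)[of n "image W0"] route_img(1)[of n "image (W0 @ c # U)"] by (cases x) (simp add: c False d del: route.simps img.simps image_simps)
    obtain h where h: "\<forall>c\<in>set h. link n c" "image (W0 @ c # U) @ [?a] \<approx> (image W0 @ [flip ?v]) @ h"
      using link_coset_eqD[OF eq] by blast
    then have "(image W0 @ [flip ?v]) @ (flip ?a # image U @ [?a]) \<approx> (image W0 @ [flip ?v]) @ h" by (simp add: c False)
    then have 1: "flip ?a # image U @ [?a] \<approx> h" by (rule sim_cancel)
    have "[flip ?a] @ image U \<approx> [flip ?a] @ (image U @ [?a, flip ?a])"
      using sim_context[OF sim_sym[OF sim_flip[of ?a]], of "flip ?a # image U" "[]"] by simp
    also have "[flip ?a] @ (image U @ [?a, flip ?a]) \<approx> h @ [flip ?a]" using sim_append[OF 1 sim_refl[of "[flip ?a]"]] by simp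
    also have "h @ [flip ?a] \<approx> [flip ?a] @ (?a # h @ [flip ?a])"
      using sim_context[OF sim_sym[OF sim_flip'[of ?a]], of "[]" "h @ [flip ?a]"] by simp
    finally have "image U \<approx> ?a # h @ [flip ?a]" by (rule sim_cancel)
    \<comment> \<open>The link of \<open>\<beta>\<^sub>n\<^sub>-\<^sub>2\<close> contains
      \<open>\<alpha>\<^sub>n\<close>, so conjugation by it does no harm.\<close>
    moreover have "\<forall>c\<in>set (?a # h @ [flip ?a]). link n c" using h(1) by (auto simp: link_def comm_def)
    ultimately show ?thesis using d False by blast
  qed
  then show ?thesis using W(1,2) c that by blast
qed

text \<open>The link of \<open>\<beta>\<^sub>n\<^sub>-\<^sub>2\<close> contains no \<alpha> with
  index at most n - 2. Let V cancel the exponent of n - 1 in U. Deleting those \<alpha> from the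
  image of U V changes nothing up to congruence and leaves letters that commute and have exponent
  0.\<close>

lemma pinch_content:
  assumes less: "\<And>k. k \<in> fst ` set U \<Longrightarrow> k < n" and h: "\<forall>c\<in>set h. link n c" "image U \<approx> h"
  shows "image (U @ replicate (nat \<bar>expo (n - 1) U\<bar>) (n - 1, expo (n - 1) U < 0)) \<approx> []"
proof -
  define V where "V = replicate (nat \<bar>expo (n - 1) U\<bar>) (n - 1, expo (n - 1) U < 0)"
  define keep where "keep d \<longleftrightarrow> \<not> (fst d \<and> snd d \<le> n - 2)" for d :: "bool \<times> int"
  have V: "fst c = n - 1" if "c \<in> set V" for c using that by (auto simp: V_def)
  have expoV: "expo (n - 1) V = - expo (n - 1) U"
  proof -
    have "expo m (replicate k (m, s)) = (if s then int k else - int k)" for m :: int and k s by (induction k) auto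
    then show ?thesis by (simp add: V_def)
  qed
  have sim: "image (U @ V) \<approx> h @ image V" using sim_append[OF h(2) sim_refl] by simp
  have "keep (fst c)" if "c \<in> set (h @ image V)" for c
    using that h(1) fst_image[of c V] by (auto simp: keep_def link_def comm_def split: if_splits dest!: V)
  then have "h @ image V = filter (\<lambda>c. keep (fst c)) (h @ image V)" by (intro filter_True[symmetric] ballI)
  also have "\<dots> \<approx> filter (\<lambda>c. keep (fst c)) (image (U @ V))" by (rule sim_filter[OF sim_sym[OF sim]])
  also have "\<dots> \<approx> []"
  proof (rule sim_abelian)
    have range: "\<exists>k<n. fst c = (True, k) \<or> fst c = (False, k - 2)" if "c \<in> set (image (U @ V))" for c
      using fst_image[OF that] less V by fastforce
    fix c d assume "c \<in> set (filter (\<lambda>c. keep (fst c)) (image (U @ V)))" "d \<in> set (filter (\<lambda>c. keep (fst c)) (image (U @ V)))"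
    then show "commutes c d" using range[of c] range[of d] by (auto simp: keep_def comm_def)
  next
    fix g
    \<comment> \<open>For m \<le> n - 2 the letter \<open>\<alpha>\<^sub>m\<close> occurs neither in
      \<open>h\<close> nor in the image of V. So the exponent of m vanishes, and with it that of the
      \<beta> paired with \<open>\<alpha>\<^sub>m\<close>.\<close>
    have zero: "expo m (U @ V) = 0" for m
    proof -
      consider "m = n - 1" | "m \<le> n - 2" | "m \<ge> n" by linarith
      then show ?thesis
      proof cases
        case 2
        have "expo (True, m) (h @ image V) = 0"
          using 2 h(1) fst_image[of _ V] V by (intro expo_notin) (fastforce simp: link_def comm_def)
        then show ?thesis using expo_sim[OF sim, of "(True, m)"] expo_image(1)[of m "U @ V"] by simp
      next
        case 3
        then show ?thesis using less V by (intro expo_notin) fastforce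
      qed (simp add: expoV)
    qed
    show "expo g (filter (\<lambda>c. keep (fst c)) (image (U @ V))) = 0"
      using zero expo_image[of "snd g" "U @ V"] unfolding expo_filter by (cases g; cases "fst g") auto
  qed
  finally show ?thesis using sim_trans[OF sim] by (simp add: V_def)
qed

section \<open>The kernel of the map to the integers\<close>

context xyyx
begin

text \<open>The a_n of the overview, with a_0 = b and a_1 = a.\<close>

definition gen :: "int \<Rightarrow> (gen \<times> bool) list set" where
  "gen n = x [^] n \<otimes> b \<otimes> inv (x [^] n)"

lemma gen_closed [simp]: "gen n \<in> carrier G"
  by (simp add: gen_def)

lemma gen_commute: "gen n \<otimes> gen (n + 1) = gen (n + 1) \<otimes> gen n"
proof -
  define u where "u = x [^] n"
  have u: "u \<in> carrier G" by (simp add: u_def)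
  have "x [^] (n + 1) = u \<otimes> x" using int_pow_mult[of x n 1] int_pow_1[of x] by (simp only: u_def closed)
  then have "gen (n + 1) = u \<otimes> (x \<otimes> b \<otimes> inv x) \<otimes> inv u" using u by (simp add: gen_def inv_mult_group m_assoc)
  also have "x \<otimes> b \<otimes> inv x = a" by (simp add: x_b m_assoc)
  finally have "gen (n + 1) = u \<otimes> a \<otimes> inv u" .
  moreover have "gen n = u \<otimes> b \<otimes> inv u" by (simp only: gen_def u_def)
  ultimately show ?thesis using conj_mult[OF u closed(2,3)] conj_mult[OF u closed(3,2)] a_b by simp
qed

fun ev1 :: "int \<times> bool \<Rightarrow> (gen \<times> bool) list set" where
  "ev1 (n, s) = (if s then gen n else inv (gen n))"

definition ev :: "(int \<times> bool) list \<Rightarrow> (gen \<times> bool) list set" where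
  "ev W = foldr (\<lambda>c g. ev1 c \<otimes> g) W \<one>"

lemma ev1_closed [simp]: "ev1 k \<in> carrier G"
  by (cases k) simp

lemma ev_simps [simp]: "ev [] = \<one>" "ev (k # W) = ev1 k \<otimes> ev W"
  by (simp_all add: ev_def)

lemma ev_closed [simp]: "ev W \<in> carrier G"
  by (induction W) simp_all

lemma ev_append: "ev (V @ W) = ev V \<otimes> ev W"
  by (induction V) (simp_all add: m_assoc)

lemma ev_centralizes:
  assumes "\<And>c. c \<in> set V \<Longrightarrow> fst c = n - 1"
  shows "ev V \<in> {z \<in> carrier G. z \<otimes> gen n = gen n \<otimes> z}"
proof -
  note Z = centralizer_subgroup[OF gen_closed[of n]]
  have g: "gen (n - 1) \<in> {z \<in> carrier G. z \<otimes> gen n = gen n \<otimes> z}" using gen_commute[of "n - 1"] by simp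
  have "ev1 c \<in> {z \<in> carrier G. z \<otimes> gen n = gen n \<otimes> z}" if "fst c = n - 1" for c
    using that g subgroup.m_inv_closed[OF Z g] by (cases c) (simp del: mem_Collect_eq)
  then have ev1: "ev1 c \<in> {z \<in> carrier G. z \<otimes> gen n = gen n \<otimes> z}" if "fst c = n - 1" for c using that .
  show ?thesis using assms
  proof (induction V)
    case Nil
    show ?case unfolding ev_simps by (rule subgroup.one_closed[OF Z])
  next
    case (Cons k V)
    show ?case unfolding ev_simps
      by (rule subgroup.m_closed[OF Z ev1 Cons.IH]) (use Cons.prems in simp_all)
  qed
qed

text \<open>Induction on the range of indices, then on the length. A pinch at the largest index n
  encloses a word U whose image is that of a power of a_(n-1). By the hypothesis for the smaller
  range U equals this power in the group, which commutes with a_n, so the enclosing letters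
  cancel.\<close>

lemma ev_image_trivial_bounded:
  assumes "\<And>c. c \<in> set W \<Longrightarrow> m \<le> fst c \<and> fst c < m + int N" "image W \<approx> []"
  shows "ev W = \<one>"
  using assms
proof (induction N arbitrary: W)
  case 0
  then have "W = []" by (cases W) fastforce+
  then show ?case by simp
next
  case (Suc N)
  define n where "n = m + int N"
  have below: "ev W = \<one>" if "\<And>c. c \<in> set W \<Longrightarrow> m \<le> fst c \<and> fst c < n" "image W \<approx> []" for W
    using Suc.IH that unfolding n_def by blast
  have "\<And>c. c \<in> set W \<Longrightarrow> m \<le> fst c \<and> fst c \<le> n" using Suc.prems(1) by (force simp: n_def)
  then show ?case using Suc.prems(2)
  proof (induction "length W" arbitrary: W rule: less_induct)
    case less
    show ?case
    proof (cases "n \<in> fst ` set W")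
      case False
      then have "m \<le> fst c \<and> fst c < n" if "c \<in> set W" for c using less.prems(1)[OF that] that by (metis image_eqI order_le_imp_less_or_eq)
      then show ?thesis using below less.prems(2) by blast
    next
      case True
      obtain W0 s U V h where W: "W = W0 @ (n, s) # U @ (n, \<not> s) # V" and nU: "n \<notin> fst ` set U"
        and h: "\<forall>c\<in>set h. link n c" "image U \<approx> h"
        by (rule pinch[OF less.prems(2) True])
      have U: "m \<le> fst c \<and> fst c < n" if "c \<in> set U" for c
        using less.prems(1)[of c] that nU W by (metis Un_iff image_eqI list.set_intros(2) order_le_imp_less_or_eq set_append)
      define K where "K = replicate (nat \<bar>expo (n - 1) U\<bar>) (n - 1, expo (n - 1) U < 0)"
      have K: "fst c = n - 1" if "c \<in> set K" for c using that by (auto simp: K_def)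
      have UK: "image (U @ K) \<approx> []" unfolding K_def by (rule pinch_content[OF _ h]) (use U in auto)
      have UKr: "m \<le> fst c \<and> fst c < n" if "c \<in> set (U @ K)" for c
      proof (cases "c \<in> set U")
        case False
        then have "c \<in> set K" using that by simp
        \<comment> \<open>\<open>K\<close> is non-empty only if n - 1 occurs in U, so it stays
          within the range of indices.\<close>
        then have "expo (n - 1) U \<noteq> 0" by (auto simp: K_def)
        then have "n - 1 \<in> fst ` set U" using expo_notin[of "n - 1" U] by argo
        then obtain k where k: "n - 1 = fst k" "k \<in> set U" by (rule imageE)
        then have "m \<le> n - 1" using U[OF k(2)] by simp
        then show ?thesis using K[OF \<open>c \<in> set K\<close>] by simp
      qed (rule U)
      have "ev (U @ K) = \<one>" by (rule below[OF UKr UK])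
      then have evU: "ev U = inv (ev K)" using inv_equality[of "ev U" "ev K"] by (simp add: ev_append)
      have "ev K \<in> {z \<in> carrier G. z \<otimes> gen n = gen n \<otimes> z}" by (rule ev_centralizes) (rule K)
      then have "inv (ev K) \<in> {z \<in> carrier G. z \<otimes> gen n = gen n \<otimes> z}"
        by (rule subgroup.m_inv_closed[OF centralizer_subgroup[OF gen_closed]])
      then have "gen n \<otimes> ev U = ev U \<otimes> gen n" by (simp add: evU)
      then have gZ: "gen n \<in> {z \<in> carrier G. z \<otimes> ev U = ev U \<otimes> z}" by simp
      have comm: "ev1 (n, s) \<otimes> ev U = ev U \<otimes> ev1 (n, s)"
      proof (cases s)
        case True
        then show ?thesis using gZ by simp
      next
        case False
        then show ?thesis using subgroup.m_inv_closed[OF centralizer_subgroup[OF ev_closed[of U]] gZ] by simp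
      qed
      have cancel: "ev1 (n, s) \<otimes> ev1 (n, \<not> s) = \<one>" by (cases s) simp_all
      have "ev1 (n, s) \<otimes> ev U \<otimes> ev1 (n, \<not> s) = ev U \<otimes> (ev1 (n, s) \<otimes> ev1 (n, \<not> s))"
        unfolding comm by (rule m_assoc) (rule ev_closed ev1_closed)+
      then have core: "ev1 (n, s) \<otimes> ev U \<otimes> ev1 (n, \<not> s) = ev U" unfolding cancel by (simp only: r_one ev_closed)
      have "ev W = ev W0 \<otimes> (ev1 (n, s) \<otimes> ev U \<otimes> ev1 (n, \<not> s)) \<otimes> ev V"
        unfolding W by (simp only: ev_append ev_simps m_assoc ev_closed ev1_closed m_closed)
      then have evW: "ev W = ev (W0 @ U @ V)" unfolding core by (simp add: ev_append m_assoc)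
      let ?k = "winv (image K)"
      have U_K: "image U \<approx> ?k"
      proof -
        have "image U @ [] \<approx> image U @ (image K @ ?k)" by (rule sim_append[OF sim_refl sim_sym[OF sim_winv]])
        also have "image U @ (image K @ ?k) \<approx> ?k" using sim_append[OF UK sim_refl[of ?k]] by simp
        finally show ?thesis by simp
      qed
      \<comment> \<open>The same cancellation on the images shows that the shorter word still has a
        trivial image.\<close>
      have "img (n, s) @ image U @ img (n, \<not> s) \<approx> (img (n, s) @ ?k) @ img (n, \<not> s)"
        using sim_context[OF U_K] by simp
      also have "(img (n, s) @ ?k) @ img (n, \<not> s) \<approx> (?k @ img (n, s)) @ img (n, \<not> s)"
      proof (rule sim_append[OF sim_commute_words sim_refl])
        fix c d assume c: "c \<in> set (img (n, s))" and "d \<in> set ?k"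
        then obtain d' where d': "d' \<in> set (image K)" "d = flip d'" by (auto simp: winv_def)
        obtain k where k: "k \<in> fst ` set K" "fst d' = (True, k) \<or> fst d' = (False, k - 2)" using fst_image[OF d'(1)] by blast
        have "k = n - 1" using k(1) K by auto
        then show "commutes c d" using fst_img[OF c] k(2) d'(2) by (auto simp: comm_def)
      qed
      also have "(?k @ img (n, s)) @ img (n, \<not> s) \<approx> ?k @ []"
        using sim_append[OF sim_refl[of ?k] sim_winv[of "img (n, s)"]] by (simp add: img_flip)
      also have "?k @ [] \<approx> image U" using sim_sym[OF U_K] by simp
      finally have "image W0 @ (img (n, s) @ image U @ img (n, \<not> s)) @ image V \<approx> image W0 @ image U @ image V"
        by (rule sim_context)
      then have "image W \<approx> image (W0 @ U @ V)" by (simp add: W)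
      then have triv: "image (W0 @ U @ V) \<approx> []" using sim_trans[OF sim_sym less.prems(2)] by simp
      have len: "length (W0 @ U @ V) < length W" by (simp add: W)
      have "ev (W0 @ U @ V) = \<one>"
        by (rule less.hyps[OF len _ triv], rule less.prems(1)) (auto simp: W)
      then show ?thesis using evW by simp
    qed
  qed
qed

theorem ev_image_trivial:
  assumes "image W \<approx> []"
  shows "ev W = \<one>"
proof -
  define m where "m = Min (insert 0 (fst ` set W))"
  define M where "M = Max (insert 0 (fst ` set W))"
  have "m \<le> fst c \<and> fst c < m + int (nat (M - m + 1))" if "c \<in> set W" for c
  proof -
    have "m \<le> fst c" "fst c \<le> M" using that by (auto simp: m_def M_def)
    then show ?thesis by simp
  qed
  then show ?thesis by (rule ev_image_trivial_bounded[OF _ assms])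
qed

end


section \<open>An embedding into a diagram group\<close>

text \<open>
  The letters 0, 4, 8 mark the left end, the middle and the right end of a word; between 0 and 4 there
  are letters 1, 2, 3 and between 4 and 8 letters 5, 6, 7.
\<close>

definition emb_rules :: "nat list rel" where
  "emb_rules = {([0], [0, 1]), ([1, 4], [4, 5]), ([5, 8], [8]),
    ([1], [2]), ([2], [3]), ([3], [1]), ([5], [6]), ([6], [7]), ([7], [5])}"

interpretation emb: base_point "{..8}" emb_rules "[0, 4, 8]"
  by unfold_locales (auto simp: semigroup_presentation_def nonempty_words_def emb_rules_def)

lemma emb_rulesI:
  "([0], [0, 1]) \<in> emb_rules" "([1, 4], [4, 5]) \<in> emb_rules" "([5, 8], [8]) \<in> emb_rules"
  "([1], [2]) \<in> emb_rules" "([2], [3]) \<in> emb_rules" "([3], [1]) \<in> emb_rules"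
  "([5], [6]) \<in> emb_rules" "([6], [7]) \<in> emb_rules" "([7], [5]) \<in> emb_rules"
  unfolding emb_rules_def by blast+

lemma emb_rel_cases:
  "(u, v) \<in> emb_rules \<or> (v, u) \<in> emb_rules \<Longrightarrow>
    u = [0] \<and> v = [0, 1] \<or> u = [0, 1] \<and> v = [0] \<or> u = [1, 4] \<and> v = [4, 5] \<or> u = [4, 5] \<and> v = [1, 4] \<or>
    u = [5, 8] \<and> v = [8] \<or> u = [8] \<and> v = [5, 8] \<or>
    u = [1] \<and> v = [2] \<or> u = [2] \<and> v = [1] \<or> u = [2] \<and> v = [3] \<or> u = [3] \<and> v = [2] \<or> u = [3] \<and> v = [1] \<or> u = [1] \<and> v = [3] \<or>
    u = [5] \<and> v = [6] \<or> u = [6] \<and> v = [5] \<or> u = [6] \<and> v = [7] \<or> u = [7] \<and> v = [6] \<or> u = [7] \<and> v = [5] \<or> u = [5] \<and> v = [7]"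
  unfolding emb_rules_def by auto

text \<open>A finite automaton for the words consisting of 0, letters among 1, 2, 3, then 4, letters
  among 5, 6, 7, and 8. State 3 accepts and state 4 is a sink.\<close>

fun delta :: "nat \<Rightarrow> nat \<Rightarrow> nat" where
  "delta s c = (if s = 0 \<and> c = 0 then 1 else if s = 1 \<and> 1 \<le> c \<and> c \<le> 3 then 1 else if s = 1 \<and> c = 4 then 2
     else if s = 2 \<and> 5 \<le> c \<and> c \<le> 7 then 2 else if s = 2 \<and> c = 8 then 3 else 4)"

declare delta.simps [simp del]

definition valid :: "nat list \<Rightarrow> bool" where
  "valid c \<longleftrightarrow> foldl delta 0 c = 3"

lemma delta_rel: "(u, v) \<in> emb_rules \<or> (v, u) \<in> emb_rules \<Longrightarrow> foldl delta s u = foldl delta s v"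
  by (drule emb_rel_cases, elim disjE conjE) (simp_all add: delta.simps)

lemma valid_path: "emb.path a s b \<Longrightarrow> valid a \<longleftrightarrow> valid b"
proof (induction s arbitrary: a)
  case (Cons e s)
  obtain p u v q where e: "e = (p, u, v, q)" by (cases e)
  have uv: "(u, v) \<in> emb_rules \<or> (v, u) \<in> emb_rules" "a = p @ u @ q" and path: "emb.path (p @ v @ q) s b"
    using Cons.prems by (auto simp: e)
  have "valid a \<longleftrightarrow> valid (p @ v @ q)" using delta_rel[OF uv(1)] by (simp add: valid_def uv(2))
  then show ?case using Cons.IH[OF path] by simp
qed simp

lemma foldl_delta_4: "foldl delta 4 c = 4"
  by (induction c) (simp_all add: delta.simps)

lemma foldl_delta_3: "foldl delta 3 c = 3 \<Longrightarrow> c = []"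
  by (cases c) (simp_all add: delta.simps foldl_delta_4)

lemma foldl_delta_pos: "s > 0 \<Longrightarrow> foldl delta s c > 0"
  by (induction c arbitrary: s) (simp_all add: delta.simps)

lemma foldl_delta_mono: "s \<ge> 2 \<Longrightarrow> foldl delta s c \<ge> 2"
  by (induction c arbitrary: s) (simp_all add: delta.simps)

definition move :: "nat list \<Rightarrow> nat list \<Rightarrow> int" where
  "move u v = (if u = [0] \<and> v = [0, 1] then 1 else if u = [0, 1] \<and> v = [0] then - 1 else 0)"

text \<open>\<open>k\<close> is the number of moves minus the position. The offsets 1 and 2 fit the
  relations: a letter right of 4 is at least two places behind a letter left of 4, so independent
  \<open>\<alpha>\<^sub>m\<close> and \<open>\<beta>\<^sub>n\<close> are recorded with n <
  m.\<close>

definition mark :: "nat list \<Rightarrow> nat list \<Rightarrow> int \<Rightarrow> ((bool \<times> int) \<times> bool) list" where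
  "mark u v k = (if u = [3] \<and> v = [1] then [((True, k + 1), True)] else if u = [1] \<and> v = [3] then [((True, k + 1), False)]
     else if u = [7] \<and> v = [5] then [((False, k + 2), True)] else if u = [5] \<and> v = [7] then [((False, k + 2), False)] else [])"

text \<open>
  \<open>L\<close> counts the applications of \<open>0 \<rightarrow> 01\<close>. The letters between 0 and 4 and those between 4 and 8
  are numbered from the right so that the numbers are invariant under these applications; a passage
  \<open>3 \<rightarrow> 1\<close> at the letter with number \<open>n\<close> is recorded as \<open>\<alpha>\<^sub>n\<close>, a passage \<open>7 \<rightarrow> 5\<close> as \<open>\<beta>\<^sub>n\<close>.
\<close>

fun record_marks :: "int \<Rightarrow> nat squier_edge list \<Rightarrow> ((bool \<times> int) \<times> bool) list" where
  "record_marks L [] = []"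
| "record_marks L ((p, u, v, q) # s) = mark u v (L - int (length p)) @ record_marks (L + move u v) s"

fun shift :: "nat squier_edge list \<Rightarrow> int" where
  "shift [] = 0"
| "shift ((p, u, v, q) # s) = move u v + shift s"

lemma shift_append: "shift (s @ t) = shift s + shift t"
  by (induction s rule: shift.induct) simp_all

lemma record_append: "record_marks L (s @ t) = record_marks L s @ record_marks (L + shift s) t"
  by (induction L s rule: record_marks.induct) (simp_all add: add.assoc)

text \<open>The right edge involves no move, and the left edge changes the length by exactly its
  move. So both edges keep their records, and these commute because they belong to different
  letters.\<close>

lemma record_exchange:
  assumes valid: "valid (p @ l @ z @ u @ q)"
    and lr: "(l, r) \<in> emb_rules \<or> (r, l) \<in> emb_rules" and uv: "(u, v) \<in> emb_rules \<or> (v, u) \<in> emb_rules"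
  shows "record_marks L [(p @ l @ z, u, v, q), (p, l, r, z @ v @ q)] \<approx> record_marks L [(p, l, r, z @ u @ q), (p @ r @ z, u, v, q)]"
proof -
  define s0 where "s0 = foldl delta 0 p"
  define s1 where "s1 = foldl delta s0 l"
  define s2 where "s2 = foldl delta s1 z"
  define s3 where "s3 = foldl delta s2 u"
  have s3: "foldl delta s3 q = 3" using valid by (simp add: valid_def s0_def s1_def s2_def s3_def)
  then have s3_4: "s3 \<noteq> 4" using foldl_delta_4[of q] by auto
  then have s2_4: "s2 \<noteq> 4" using foldl_delta_4[of u] by (auto simp: s3_def)
  then have s1_4: "s1 \<noteq> 4" using foldl_delta_4[of z] by (auto simp: s2_def)
  have u: "u \<noteq> []" and l: "l \<noteq> []" using emb_rel_cases[OF uv] emb_rel_cases[OF lr] by auto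
  have s1_3: "s1 \<noteq> 3"
  proof
    assume "s1 = 3"
    then have "foldl delta 3 (z @ u @ q) = 3" using s3 by (simp add: s2_def s3_def)
    then show False using foldl_delta_3[of "z @ u @ q"] u by simp
  qed
  have s1_pos: "s1 > 0"
  proof -
    obtain c l' where l': "l = c # l'" using l by (cases l) auto
    have "delta s0 c > 0" by (simp add: delta.simps)
    then show ?thesis using foldl_delta_pos by (simp add: s1_def l')
  qed
  then have s2_pos: "s2 > 0" unfolding s2_def by (rule foldl_delta_pos)
  have move_uv: "move u v = 0"
    using emb_rel_cases[OF uv] s3_4 s2_pos foldl_delta_4 by (auto simp: move_def s3_def delta.simps)
  \<comment> \<open>The relation 58 = 8 changes the length without being a move, but nothing stands
    to the right of 8, so it is not the left one of two edges.\<close>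
  have move_lr: "move l r = int (length r) - int (length l)"
    using emb_rel_cases[OF lr] s1_3 s1_4
    by (elim disjE conjE) (simp_all add: move_def s1_def delta.simps split: if_splits)
  have marks: "mark u v k = [] \<or> (\<exists>b. mark u v k = [((True, k + 1), b)] \<and> foldl delta s u \<in> {1, 4} \<and> (foldl delta s u = 1 \<longrightarrow> s = 1)) \<or>
      (\<exists>b. mark u v k = [((False, k + 2), b)] \<and> foldl delta s u \<in> {2, 4} \<and> (foldl delta s u = 2 \<longrightarrow> s = 2))" for u v k s
    by (auto simp: mark_def delta.simps)
  let ?k = "L - int (length p)" and ?k' = "L - int (length p) - int (length l) - int (length z)"
  have l1: "int (length l) > 0" using l by simp
  have comm: "commutes c d" if "c \<in> set (mark u v ?k')" "d \<in> set (mark l r ?k)" for c d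
  proof -
    from marks[of u v ?k' s2] that(1) consider "fst c = (True, ?k' + 1)" "s2 = 1" | "fst c = (False, ?k' + 2)" "s2 = 2"
      using s3_4 unfolding s3_def[symmetric] by force
    then show ?thesis
    proof cases
      case 1
      then have "\<not> s1 \<ge> 2" using foldl_delta_mono[of s1 z] by (auto simp: s2_def)
      then have "fst d = (True, ?k + 1)" using marks[of l r ?k s0] that(2) s1_4 unfolding s1_def[symmetric] by force
      then show ?thesis using 1 l1 by (simp add: comm_def)
    next
      case 2
      from marks[of l r ?k s0] that(2) consider "fst d = (True, ?k + 1)" "s1 = 1" | "fst d = (False, ?k + 2)"
        using s1_4 unfolding s1_def[symmetric] by force
      then show ?thesis
      proof cases
        case 1
        then have "z \<noteq> []" using 2(2) by (auto simp: s2_def)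
        then have "int (length z) > 0" by simp
        then have lt: "?k' + 2 < ?k + 1" using l1 by linarith
        then show ?thesis unfolding comm_def 1(1) 2(1) fst_conv snd_conv by simp
      next
        case b: 2
        then show ?thesis using 2 l1 by (simp add: comm_def)
      qed
    qed
  qed
  have "record_marks L [(p @ l @ z, u, v, q), (p, l, r, z @ v @ q)] = mark u v ?k' @ mark l r ?k"
    by (simp add: move_uv algebra_simps)
  moreover have "record_marks L [(p, l, r, z @ u @ q), (p @ r @ z, u, v, q)] = mark l r ?k @ mark u v ?k'"
    by (simp add: move_lr algebra_simps)
  ultimately show ?thesis using sim_commute_words[OF comm] by simp
qed

lemma record_inverse: "record_marks L [e, squier_inv e] \<approx> []"
proof -
  obtain p u v q where e: "e = (p, u, v, q)" by (cases e)
  have "mark u v k = [] \<and> mark v u (k + move u v) = [] \<or> (\<exists>c. mark u v k = [c] \<and> mark v u (k + move u v) = [flip c])" for k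
    by (auto simp: mark_def move_def)
  from this[of "L - int (length p)"] show ?thesis using sim_flip by (auto simp: e algebra_simps)
qed

lemma shift_inverse: "shift [e, squier_inv e] = 0"
  by (cases e) (auto simp: move_def)

lemma record_reduce1:
  assumes "reduce1 s t" "emb.path a s b" "valid a"
  shows "record_marks L s \<approx> record_marks L t \<and> shift s = shift t"
proof -
  obtain s1 x y rs s2 where r: "reduce2 x y rs" "s = s1 @ [x, y] @ s2" "t = s1 @ rs @ s2"
    using assms(1) unfolding reduce1_def by blast
  obtain c d where c: "emb.path a s1 c" "emb.path c [x, y] d" using assms(2) unfolding r emb.path_append by blast
  have "valid c" using valid_path[OF c(1)] assms(3) by simp
  have "record_marks (L + shift s1) [x, y] \<approx> record_marks (L + shift s1) rs \<and> shift [x, y] = shift rs" using r(1)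
  proof cases
    case deletion
    then show ?thesis using record_inverse shift_inverse by simp
  next
    case (exchange l r u v p z q)
    have "c = p @ l @ z @ u @ q" "(l, r) \<in> emb_rules \<or> (r, l) \<in> emb_rules" "(u, v) \<in> emb_rules \<or> (v, u) \<in> emb_rules"
      using c(2) exchange(1,2) by auto
    then show ?thesis using record_exchange[of p l z u q r v "L + shift s1"] \<open>valid c\<close> exchange(1-3) by simp
  qed
  then have E: "record_marks (L + shift s1) [x, y] \<approx> record_marks (L + shift s1) rs" and S: "shift [x, y] = shift rs" by simp_all
  have "record_marks L s1 @ record_marks (L + shift s1) [x, y] @ record_marks (L + shift s1 + shift rs) s2 \<approx>
      record_marks L s1 @ record_marks (L + shift s1) rs @ record_marks (L + shift s1 + shift rs) s2"
    by (rule sim_context[OF E])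
  then show ?thesis by (simp only: r record_append shift_append S)
qed

lemma record_reduces:
  assumes "reduce1\<^sup>*\<^sup>* s t" "emb.path a s b" "valid a"
  shows "record_marks L s \<approx> record_marks L t \<and> shift s = shift t"
  using assms(1)
proof (induction rule: rtranclp_induct)
  case (step t u)
  have "record_marks L t \<approx> record_marks L u \<and> shift t = shift u"
    using record_reduce1[OF step(2) emb.path_reduces[OF step(1) assms(2)] assms(3)] .
  then show ?case using step.IH sim_trans[of "record_marks L s" "record_marks L t" "record_marks L u"] by simp
qed simp

lemma record_dg_0:
  assumes "emb.path [0, 4, 8] s [0, 4, 8]" "dg s = 0"
  shows "record_marks 0 s \<approx> [] \<and> shift s = 0"
proof -
  have nil: "emb.path [0, 4, 8] [] [0, 4, 8]" "dg s = dg []" using assms(2) by (simp_all add: dg_Nil)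
  have "valid [0, 4, 8]" by (simp add: valid_def delta.simps)
  note red = record_reduces[OF _ _ this]
  obtain r where r: "reduce1\<^sup>*\<^sup>* s r" "reduce1\<^sup>*\<^sup>* [] r" by (rule emb.path_common_reduct[OF assms(1) nil])
  have "record_marks 0 s \<approx> record_marks 0 r" "shift s = shift r" "record_marks 0 [] \<approx> record_marks 0 r" "shift [] = shift r"
    using red[OF r(1) assms(1), of 0] red[OF r(2) nil(1), of 0] by blast+
  then show ?thesis using sim_trans[of "record_marks 0 s" "record_marks 0 r" "record_marks 0 []"] sim_sym[of "record_marks 0 []" "record_marks 0 r"] by simp
qed

section \<open>The images of the generators\<close>

definition pT :: "nat squier_edge list" where
  "pT = [([], [0], [0, 1], [4, 8]), ([0], [1, 4], [4, 5], [8]), ([0, 4], [5, 8], [8], [])]"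

definition pA :: "nat squier_edge list" where
  "pA = [([], [0], [0, 1], [4, 8]), ([0], [1], [2], [4, 8]), ([0], [2], [3], [4, 8]), ([0], [3], [1], [4, 8]), ([], [0, 1], [0], [4, 8])]"

definition pB :: "nat squier_edge list" where
  "pB = [([0, 4], [8], [5, 8], []), ([0, 4], [5], [6], [8]), ([0, 4], [6], [7], [8]), ([0, 4], [7], [5], [8]), ([0, 4], [5, 8], [8], [])]"

text \<open>\<open>pT\<close> lets a letter enter at 0, pass 4 and leave at 8; it represents x.
  \<open>pA\<close> and \<open>pB\<close> create a letter next to 0 or 8, take it round its cycle
  and remove it. The word for y is chosen such that xy becomes A T^-1 B T, the image of a.\<close>

fun gpath1 :: "gen \<times> bool \<Rightarrow> nat squier_edge list" where
  "gpath1 (X, s) = (if s then pT else path_inv pT)"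
| "gpath1 (Y, s) = (if s then path_inv pT @ pA @ path_inv pT @ pB @ pT else path_inv (path_inv pT @ pA @ path_inv pT @ pB @ pT))"

definition gpath :: "(gen \<times> bool) list \<Rightarrow> nat squier_edge list" where
  "gpath s = concat (map gpath1 s)"

lemma gpath_simps [simp]: "gpath [] = []" "gpath (k # s) = gpath1 k @ gpath s" "gpath (s @ t) = gpath s @ gpath t"
  by (simp_all add: gpath_def)

lemma pTAB: "emb.path [0, 4, 8] pT [0, 4, 8]" "emb.path [0, 4, 8] pA [0, 4, 8]" "emb.path [0, 4, 8] pB [0, 4, 8]"
  by (simp_all add: pT_def pA_def pB_def emb_rulesI del: One_nat_def)

lemma gpath1_path: "emb.path [0, 4, 8] (gpath1 k) [0, 4, 8]"
proof -
  have T: "emb.path [0, 4, 8] (path_inv pT) [0, 4, 8]" by (rule emb.path_path_inv[OF pTAB(1)])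
  have Y: "emb.path [0, 4, 8] (path_inv pT @ pA @ path_inv pT @ pB @ pT) [0, 4, 8]"
    unfolding emb.path_append using T pTAB by blast
  show ?thesis using T pTAB(1) Y emb.path_path_inv[OF Y] by (cases k rule: gpath1.cases) (simp_all only: gpath1.simps split: if_split, blast+)
qed

lemma gpath_path: "emb.path [0, 4, 8] (gpath s) [0, 4, 8]"
proof (induction s)
  case (Cons k s)
  then show ?case using gpath1_path[of k] emb.path_append by (simp del: gpath1.simps) blast
qed simp

text \<open>Reidemeister-Schreier rewriting: at height L the letter y is a_L followed by
  x^-1.\<close>

fun kernel_word :: "int \<Rightarrow> (gen \<times> bool) list \<Rightarrow> (int \<times> bool) list" where
  "kernel_word L [] = []"
| "kernel_word L ((X, s) # t) = kernel_word (if s then L + 1 else L - 1) t"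
| "kernel_word L ((Y, s) # t) = (if s then (L, True) # kernel_word (L - 1) t else (L + 1, False) # kernel_word (L + 1) t)"

fun height :: "(gen \<times> bool) list \<Rightarrow> int" where
  "height [] = 0"
| "height ((X, s) # t) = (if s then 1 else - 1) + height t"
| "height ((Y, s) # t) = (if s then - 1 else 1) + height t"

lemma record_gpath1:
  "record_marks L (gpath1 (X, s)) = []" "shift (gpath1 (X, s)) = (if s then 1 else - 1)"
  "record_marks L (gpath1 (Y, s)) = (if s then img (L, True) else img (L + 1, False))" "shift (gpath1 (Y, s)) = (if s then - 1 else 1)"
  by (simp_all add: pT_def pA_def pB_def mark_def move_def)

lemma record_gpath: "record_marks L (gpath s) = image (kernel_word L s) \<and> shift (gpath s) = height s"
  by (induction L s rule: kernel_word.induct) (auto simp: record_append shift_append record_gpath1 simp del: gpath1.simps)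

text \<open>With Z = T^-1 B T the relation says that A + Z, the image of a, commutes with its
  conjugate by T^-1. This amounts to four commutations, each an interchange of diagrams on disjoint
  factors after a conjugation.\<close>

lemma emb_relation: "dg (gpath [(X, True), (Y, True), (Y, True), (X, True)]) = dg (gpath [(Y, True), (X, True), (X, True), (Y, True)])"
proof -
  define \<theta> \<pi> \<kappa> \<zeta> \<eta> :: "nat diagram" where "\<theta> = dg [([], [0], [0, 1], [])]" and "\<pi> = dg [([], [1, 4], [4, 5], [])]"
    and "\<kappa> = dg [([], [5, 8], [8], [])]" and "\<zeta> = dg [([], [1], [2], []), ([], [2], [3], []), ([], [3], [1], [])]"
    and "\<eta> = dg [([], [5], [6], []), ([], [6], [7], []), ([], [7], [5], [])]"
  have mor: "emb.mor [0] \<theta> [0, 1]" "emb.mor [1, 4] \<pi> [4, 5]" "emb.mor [5, 8] \<kappa> [8]" "emb.mor [1] \<zeta> [1]" "emb.mor [5] \<eta> [5]"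
    unfolding \<theta>_def \<pi>_def \<kappa>_def \<zeta>_def \<eta>_def by (rule emb.mor_dg, simp add: emb_rulesI del: One_nat_def)+
  define \<alpha> where "\<alpha> = cnj \<theta> (lsh [0] \<zeta>)"
  define \<beta> where "\<beta> = cnj (- \<kappa>) (rsh [8] \<eta>)"
  \<comment> \<open>The loop \<alpha> performed between 0 and a letter 1 that stays, and below the
    loop \<beta> between a letter 5 that stays and 8. They turn out to be the conjugates of A by T
    and of B by T^-1.\<close>
  define \<alpha>' where "\<alpha>' = cnj \<theta> (rsh [1] \<alpha>)"
  define \<beta>' where "\<beta>' = cnj (- \<kappa>) (lsh [5] \<beta>)"
  have z: "emb.mor [0, 1] (lsh [0] \<zeta>) [0, 1]" using emb.mor_lsh[OF _ mor(4), of "[0]"] by simp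
  have e: "emb.mor [5, 8] (rsh [8] \<eta>) [5, 8]" using emb.mor_rsh[OF _ mor(5), of "[8]"] by simp
  have \<alpha>: "emb.mor [0] \<alpha> [0]" unfolding \<alpha>_def by (rule emb.mor_cnj[OF mor(1) z])
  have \<beta>: "emb.mor [8] \<beta> [8]" unfolding \<beta>_def by (rule emb.mor_cnj[OF emb.mor_minus[OF mor(3)] e])
  have \<alpha>': "emb.mor [0] \<alpha>' [0]" unfolding \<alpha>'_def
    by (rule emb.mor_cnj[OF mor(1)]) (use emb.mor_rsh[OF _ \<alpha>, of "[1]"] in simp)
  have \<beta>': "emb.mor [8] \<beta>' [8]" unfolding \<beta>'_def
    by (rule emb.mor_cnj[OF emb.mor_minus[OF mor(3)]]) (use emb.mor_lsh[OF _ \<beta>, of "[5]"] in simp)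
  have \<alpha>\<alpha>': "\<alpha>' + \<alpha> = \<alpha> + \<alpha>'"
    using iffD2[OF cnj_commute[of \<theta>] emb.interchange[OF \<alpha> mor(4)]] by (simp only: \<alpha>'_def \<alpha>_def[symmetric])
  have \<beta>\<beta>': "\<beta>' + \<beta> = \<beta> + \<beta>'"
    using iffD2[OF cnj_commute[of "- \<kappa>"] emb.interchange[OF mor(5) \<beta>, symmetric]] by (simp only: \<beta>'_def \<beta>_def[symmetric])
  have far: "rsh [4, 8] f + lsh [0, 4] g = lsh [0, 4] g + rsh [4, 8] f"
    if "emb.mor [0] f [0]" "emb.mor [8] g [8]" for f g
    using emb.interchange[OF that(1) emb.mor_lsh[OF _ that(2), of "[4]"]] by (simp add: lsh_lsh)
  define T A B where "T = dg pT" and "A = dg pA" and "B = dg pB"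
  have T: "T = rsh [4, 8] \<theta> + lsh [0] (rsh [8] \<pi>) + lsh [0, 4] \<kappa>"
    by (simp add: T_def pT_def \<theta>_def \<pi>_def \<kappa>_def lsh_dg rsh_dg dg_append[symmetric])
  have A: "A = rsh [4, 8] \<alpha>"
    unfolding \<alpha>_def cnj_def by (simp add: A_def pA_def \<theta>_def \<zeta>_def lsh_dg rsh_dg dg_append[symmetric] dg_path_inv[symmetric] del: add_uminus_conv_diff)
  have B: "B = lsh [0, 4] \<beta>"
    unfolding \<beta>_def cnj_def by (simp add: B_def pB_def \<kappa>_def \<eta>_def lsh_dg rsh_dg dg_append[symmetric] dg_path_inv[symmetric] del: add_uminus_conv_diff)
  \<comment> \<open>A works next to 0 only, so it slides through all of T except the creation of the
    letter 1.\<close>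
  have TA: "cnj T A = rsh [4, 8] \<alpha>'"
  proof -
    have 1: "lsh [0, 4] \<kappa> + A = rsh [4, 5, 8] \<alpha> + lsh [0, 4] \<kappa>"
      using emb.interchange[OF \<alpha> emb.mor_lsh[OF _ mor(3), of "[4]"]] by (simp add: A lsh_lsh)
    have 2: "lsh [0] (rsh [8] \<pi>) + rsh [4, 5, 8] \<alpha> = rsh [1, 4, 8] \<alpha> + lsh [0] (rsh [8] \<pi>)"
      using emb.interchange[OF \<alpha> emb.mor_rsh[OF _ mor(2), of "[8]"]] by simp
    have "T + A = rsh [4, 8] \<theta> + (lsh [0] (rsh [8] \<pi>) + (lsh [0, 4] \<kappa> + A))" by (simp add: T add.assoc)
    also have "\<dots> = rsh [4, 8] \<theta> + ((lsh [0] (rsh [8] \<pi>) + rsh [4, 5, 8] \<alpha>) + lsh [0, 4] \<kappa>)" unfolding 1 by (simp add: add.assoc)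
    also have "\<dots> = (rsh [4, 8] \<theta> + rsh [4, 8] (rsh [1] \<alpha>) + - rsh [4, 8] \<theta>) + T"
      unfolding 2 by (simp add: T add.assoc rsh_rsh del: add_uminus_conv_diff)
    finally show ?thesis unfolding cnj_eq_iff[of T A] \<alpha>'_def cnj_def
      by (simp add: cnj_def rsh_add rsh_minus add.assoc del: add_uminus_conv_diff)
  qed
  have TB: "cnj (- T) B = lsh [0, 4] \<beta>'"
  proof -
    have 1: "B + rsh [4, 8] \<theta> = rsh [4, 8] \<theta> + lsh [0, 1, 4] \<beta>"
      using emb.interchange[OF mor(1) emb.mor_lsh[OF _ \<beta>, of "[4]"]] by (simp add: B lsh_lsh)
    have 2: "lsh [0, 1, 4] \<beta> + lsh [0] (rsh [8] \<pi>) = lsh [0] (rsh [8] \<pi>) + lsh [0, 4, 5] \<beta>"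
      using arg_cong[OF emb.interchange[OF mor(2) \<beta>], of "lsh [0]"] by (simp add: lsh_lsh lsh_add)
    have "B + T = (B + rsh [4, 8] \<theta>) + lsh [0] (rsh [8] \<pi>) + lsh [0, 4] \<kappa>" by (simp add: T add.assoc)
    also have "\<dots> = rsh [4, 8] \<theta> + (lsh [0, 1, 4] \<beta> + lsh [0] (rsh [8] \<pi>)) + lsh [0, 4] \<kappa>" unfolding 1 by (simp add: add.assoc)
    also have "\<dots> = T + (- lsh [0, 4] \<kappa> + lsh [0, 4] (lsh [5] \<beta>) + lsh [0, 4] \<kappa>)"
      unfolding 2 by (simp add: T add.assoc lsh_lsh del: add_uminus_conv_diff)
    finally have "B + T = T + lsh [0, 4] \<beta>'" unfolding \<beta>'_def cnj_def
      by (simp add: lsh_add lsh_minus add.assoc del: add_uminus_conv_diff)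
    then have "cnj T (lsh [0, 4] \<beta>') = B" unfolding cnj_eq_iff by simp
    then have "cnj (- T) B = cnj (- T) (cnj T (lsh [0, 4] \<beta>'))" by simp
    then show ?thesis by (simp add: cnj_cnj)
  qed
  define Z where "Z = cnj (- T) B"
  have AA: "A + cnj (- T) A = cnj (- T) A + A"
  proof -
    have "cnj T A + A = A + cnj T A" unfolding TA unfolding A rsh_add[symmetric] \<alpha>\<alpha>' ..
    then have "cnj (- T) (cnj T A + A) = cnj (- T) (A + cnj T A)" by simp
    then show ?thesis by (simp add: cnj_add cnj_cnj)
  qed
  have ZZ: "Z + cnj (- T) Z = cnj (- T) Z + Z"
  proof -
    have "Z + B = B + Z" unfolding Z_def TB unfolding B lsh_add[symmetric] \<beta>\<beta>' ..
    then have "cnj (- T) (B + Z) = cnj (- T) (Z + B)" by simp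
    then show ?thesis by (simp only: cnj_add Z_def[symmetric])
  qed
  have AZ: "A + cnj (- T) Z = cnj (- T) Z + A"
  proof -
    have "cnj T A + Z = Z + cnj T A" unfolding Z_def TA TB by (rule far[OF \<alpha>' \<beta>'])
    then have "cnj (- T) (cnj T A + Z) = cnj (- T) (Z + cnj T A)" by simp
    then show ?thesis by (simp add: cnj_add cnj_cnj)
  qed
  have ZA: "Z + cnj (- T) A = cnj (- T) A + Z"
  proof -
    have "A + B = B + A" unfolding A B by (rule far[OF \<alpha> \<beta>])
    then have "cnj (- T) (B + A) = cnj (- T) (A + B)" by simp
    then show ?thesis by (simp only: cnj_add Z_def[symmetric])
  qed
  have comm: "(A + Z) + cnj (- T) (A + Z) = cnj (- T) (A + Z) + (A + Z)"
    unfolding cnj_add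
    by (rule commute_add[OF commute_add[OF AA ZA, symmetric] commute_add[OF AZ ZZ, symmetric], symmetric])
  have Y: "dg (gpath [(Y, True)]) = - T + (A + Z)"
    by (simp add: dg_append dg_path_inv T_def[symmetric] A_def[symmetric] B_def[symmetric] Z_def cnj_def add.assoc del: add_uminus_conv_diff)
  have X: "dg (gpath [(X, True)]) = T" by (simp add: T_def)
  have "dg (gpath [(X, True), (Y, True), (Y, True), (X, True)]) = T + (- T + (A + Z)) + (- T + (A + Z)) + T"
    using X Y by (simp add: dg_append add.assoc del: gpath1.simps add_uminus_conv_diff)
  also have "\<dots> = (A + Z) + cnj (- T) (A + Z)" by (simp add: cnj_def add.assoc del: add_uminus_conv_diff)
  also have "\<dots> = cnj (- T) (A + Z) + (A + Z)" by (rule comm)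
  also have "\<dots> = (- T + (A + Z)) + T + T + (- T + (A + Z))" by (simp add: cnj_def add.assoc del: add_uminus_conv_diff)
  also have "\<dots> = dg (gpath [(Y, True), (X, True), (X, True), (Y, True)])"
    using X Y by (simp add: dg_append add.assoc del: gpath1.simps add_uminus_conv_diff)
  finally show ?thesis .
qed

lemma dg_gpath_el: "el s = el t \<Longrightarrow> dg (gpath s) = dg (gpath t)"
proof (rule el_invariant[of "\<lambda>s. dg (gpath s)"])
  fix s t l r assume "(l, r) \<in> xyyx_rules"
  then have "dg (gpath l) = dg (gpath r)"
  proof (cases rule: xyyx_rules_cases)
    case 1
    then show ?thesis using emb_relation by simp
  next
    case (2 g b)
    then show ?thesis
      by (cases g; cases b) (simp_all add: dg_append dg_path_inv dg_Nil minus_add add.assoc del: add_uminus_conv_diff)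
  qed
  then show "dg (gpath (s @ l @ t)) = dg (gpath (s @ r @ t))" by (simp add: dg_append)
qed

section \<open>Injectivity of the embedding\<close>

context xyyx
begin

lemma el_kernel_word: "x [^] L \<otimes> el s = ev (kernel_word L s) \<otimes> x [^] (L + height s)"
proof (induction L s rule: kernel_word.induct)
  case (1 L)
  then show ?case by (simp add: el_Nil)
next
  case (2 L s t)
  have "x [^] L \<otimes> el [(X, s)] = x [^] (if s then L + 1 else L - 1)"
    using int_pow_mult[of x L 1] int_pow_mult[of x L "- 1"] int_pow_neg[of x 1] int_pow_1[of x] by (simp add: el_X inv_x[symmetric])
  moreover have "el ((X, s) # t) = el [(X, s)] \<otimes> el t" by (simp add: el_mult)
  ultimately have "x [^] L \<otimes> el ((X, s) # t) = x [^] (if s then L + 1 else L - 1) \<otimes> el t" by (simp add: m_assoc[symmetric])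
  then show ?case using 2 by (cases s) (simp_all add: algebra_simps)
next
  case (3 L s t)
  have pow1: "x [^] (K + 1) = x [^] K \<otimes> x" "x [^] (K - 1) = x [^] K \<otimes> inv x" for K :: int
    using int_pow_mult[of x K 1] int_pow_mult[of x K "- 1"] int_pow_neg[of x 1] int_pow_1[of x] by simp_all
  have y: "x [^] K \<otimes> el [(Y, True)] = gen K \<otimes> x [^] (K - 1)" for K
  proof -
    define u where "u = x [^] K"
    have u: "u \<in> carrier G" by (simp add: u_def)
    have "gen K \<otimes> x [^] (K - 1) = u \<otimes> (inv x \<otimes> a \<otimes> x) \<otimes> inv u \<otimes> (u \<otimes> inv x)"
      by (simp only: gen_def pow1 u_def b_conj)
    also have "\<dots> = u \<otimes> (inv x \<otimes> a) \<otimes> (x \<otimes> (inv u \<otimes> (u \<otimes> inv x)))" using u by (simp only: m_assoc m_closed closed inv_closed)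
    also have "inv u \<otimes> (u \<otimes> inv x) = inv x" using u by (simp add: m_assoc[symmetric])
    finally show ?thesis using u by (simp add: el_Y u_def[symmetric])
  qed
  have y': "x [^] L \<otimes> el [(Y, False)] = inv (gen (L + 1)) \<otimes> x [^] (L + 1)"
  proof -
    have "x [^] L = inv (gen (L + 1)) \<otimes> (x [^] (L + 1) \<otimes> el [(Y, True)])"
      using y[of "L + 1"] by (simp add: m_assoc[symmetric])
    then have "x [^] L \<otimes> el [(Y, False)] = inv (gen (L + 1)) \<otimes> (x [^] (L + 1) \<otimes> el [(Y, True)]) \<otimes> el [(Y, False)]"
      by (rule arg_cong)
    also have "\<dots> = inv (gen (L + 1)) \<otimes> (x [^] (L + 1) \<otimes> (el [(Y, True)] \<otimes> el [(Y, False)]))" by (simp add: m_assoc)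
    also have "el [(Y, True)] \<otimes> el [(Y, False)] = \<one>" using el_cancel[of "[]" Y True "[]"] by (simp add: el_mult el_Nil)
    finally show ?thesis by simp
  qed
  have split: "el ((Y, s) # t) = el [(Y, s)] \<otimes> el t" by (simp add: el_mult)
  show ?case
  proof (cases s)
    case True
    have "x [^] L \<otimes> el ((Y, s) # t) = gen L \<otimes> x [^] (L - 1) \<otimes> el t"
      unfolding split using y[of L] True by (simp add: m_assoc[symmetric])
    then show ?thesis using 3 True by (simp add: m_assoc algebra_simps)
  next
    case False
    have "x [^] L \<otimes> el ((Y, s) # t) = inv (gen (L + 1)) \<otimes> x [^] (L + 1) \<otimes> el t"
      unfolding split using y' False by (simp add: m_assoc[symmetric])
    then show ?thesis using 3 False by (simp add: m_assoc algebra_simps)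
  qed
qed

text \<open>A trivial diagram has height 0 and records a trivial word, which is the image of the
  rewritten word. So \<open>ev_image_trivial\<close> applies to the latter.\<close>

lemma dg_gpath_0: "dg (gpath s) = 0 \<Longrightarrow> el s = \<one>"
proof -
  assume "dg (gpath s) = 0"
  from record_dg_0[OF gpath_path this] have "image (kernel_word 0 s) \<approx> []" "height s = 0" using record_gpath by auto
  then show ?thesis using ev_image_trivial[of "kernel_word 0 s"] el_kernel_word[of 0 s] by simp
qed

definition embed :: "(gen \<times> bool) list set \<Rightarrow> nat squier_edge list set" where
  "embed g = emb.cls (gpath (SOME s. el s = g))"

lemma embed_el: "embed (el s) = emb.cls (gpath s)"
  unfolding embed_def emb.cls_eq_iff[OF gpath_path gpath_path] by (rule dg_gpath_el[OF el_some])

lemma embed_hom: "embed \<in> hom G (diagram_group_of {..8} emb_rules [0, 4, 8])"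
proof (rule homI)
  fix g h assume "g \<in> carrier G" "h \<in> carrier G"
  then obtain s t where st: "g = el s" "h = el t" by (auto simp: carrier_eq)
  show "embed g \<in> carrier (diagram_group_of {..8} emb_rules [0, 4, 8])"
    unfolding st embed_el emb.cls_carrier using gpath_path by blast
  show "embed (g \<otimes> h) = embed g \<otimes>\<^bsub>diagram_group_of {..8} emb_rules [0, 4, 8]\<^esub> embed h"
    unfolding st el_mult embed_el emb.cls_mult[OF gpath_path gpath_path] by simp
qed

lemma embed_inj: "inj_on embed (carrier G)"
proof (rule inj_onI)
  fix g h assume "g \<in> carrier G" "h \<in> carrier G" and eq: "embed g = embed h"
  then obtain s t where st: "g = el s" "h = el t" by (auto simp: carrier_eq)
  obtain t' where t': "inv h = el t'" using inv_closed[OF \<open>h \<in> carrier G\<close>] by (rule el_cases)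
  have "el (t @ t') = el []" unfolding el_mult[symmetric] st(2)[symmetric] t'[symmetric] el_Nil using \<open>h \<in> carrier G\<close> by simp
  then have "dg (gpath (s @ t')) = 0" using dg_gpath_el[of "t @ t'" "[]"] eq
    unfolding st(1,2) embed_el emb.cls_eq_iff[OF gpath_path gpath_path] by (simp add: dg_append dg_Nil)
  then have "g \<otimes> inv h = \<one>" using dg_gpath_0[of "s @ t'"] by (simp add: st(1) t' el_mult)
  then show "g = h" using inv_equality[of g "inv h"] \<open>g \<in> carrier G\<close> \<open>h \<in> carrier G\<close> by simp
qed

lemma embeds: "\<exists>(D :: nat squier_edge list set monoid) H. diagram_group TYPE(nat) D \<and> subgroup H D \<and> G \<cong> D\<lparr>carrier := H\<rparr>"
proof (intro exI conjI)
  let ?D = "diagram_group_of {..8} emb_rules [0, 4, 8]"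
  have pres: "semigroup_presentation {..8} emb_rules" "[0, 4, 8 :: nat] \<in> nonempty_words {..8}" by (rule emb.pres) (rule emb.w)
  have D: "group ?D" by (rule group_diagram_group_of[OF pres])
  have "id \<in> iso ?D ?D" by (simp add: iso_def hom_def)
  then have "?D \<cong> ?D" unfolding is_iso_def by blast
  then show "diagram_group TYPE(nat) ?D" unfolding diagram_group_def using pres D by blast
  interpret h: group_hom G ?D embed using D embed_hom by (simp add: group_hom_def group_hom_axioms_def group_axioms)
  show "subgroup (embed ` carrier G) ?D" by (rule h.img_is_subgroup)
  have "embed \<in> iso G (?D\<lparr>carrier := embed ` carrier G\<rparr>)"
    using embed_hom embed_inj by (auto simp: iso_def hom_def bij_betw_def)
  then show "G \<cong> ?D\<lparr>carrier := embed ` carrier G\<rparr>" by (auto simp: is_iso_def)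
qed

end

theorem theorem28:
  shows "(\<exists>(G :: nat squier_edge list set monoid) H.
            diagram_group TYPE(nat) G \<and> subgroup H G \<and> \<not> diagram_group TYPE('a) (G\<lparr>carrier := H\<rparr>))
       \<and> (\<exists>(G :: nat squier_edge list set monoid) H.
            diagram_group TYPE(nat) G \<and> subgroup H G \<and> xyyx_group \<cong> G\<lparr>carrier := H\<rparr>)
       \<and> \<not> diagram_group TYPE('a) xyyx_group"
proof (intro conjI)
  interpret xyyx xyyx_group by unfold_locales (rule refl)
  show "\<exists>(G :: nat squier_edge list set monoid) H. diagram_group TYPE(nat) G \<and> subgroup H G \<and> xyyx_group \<cong> G\<lparr>carrier := H\<rparr>"
    by (rule embeds)
  then obtain D :: "nat squier_edge list set monoid" and H
    where D: "diagram_group TYPE(nat) D" "subgroup H D" "xyyx_group \<cong> D\<lparr>carrier := H\<rparr>" by blast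
  show not: "\<not> diagram_group TYPE('a) xyyx_group" by (rule xyyx_not_diagram_group)
  \<comment> \<open>A realisation of the subgroup as a diagram group would be carried over to
    \<open>xyyx_group\<close> by the isomorphism.\<close>
  have "\<not> diagram_group TYPE('a) (D\<lparr>carrier := H\<rparr>)"
  proof
    assume "diagram_group TYPE('a) (D\<lparr>carrier := H\<rparr>)"
    then obtain A :: "'a set" and R w where ARw: "semigroup_presentation A R" "w \<in> nonempty_words A"
        "D\<lparr>carrier := H\<rparr> \<cong> diagram_group_of A R w"
      unfolding diagram_group_def by blast
    have "diagram_group TYPE('a) xyyx_group"
      unfolding diagram_group_def using group_axioms ARw(1,2) iso_trans[OF D(3) ARw(3)] by blast
    then show False using not by blast
  qed
  then show "\<exists>(G :: nat squier_edge list set monoid) H.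
      diagram_group TYPE(nat) G \<and> subgroup H G \<and> \<not> diagram_group TYPE('a) (G\<lparr>carrier := H\<rparr>)"
    using D(1,2) by blast
qed

end
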